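(* Let $n\ge1$, $0<p<\infty$ and $0<q\le\infty$ be such that $\min(1,p,q)>\frac{p}{p+1}$. Let $r=\max\{1,p\}$, let $r'$ be its conjugate exponent ($1/r'=1-1/r$), and let $w(t)=(1+\log_+(1/t))^{1/r'}$ for $t>0$. Then there is a constant $C>0$ such that $$\|fg\|_{F^{n/p,1/w}_{p,q}(\mathbb{R}^n)}\le C\|f\|_{F^{n/p}_{p,q}(\mathbb{R}^n)}\|g\|_{F^{n/p}_{p,q}(\mathbb{R}^n)}$$ for all $f,g\in F^{n/p}_{p,q}(\mathbb{R}^n)$.
   Context: Notation: $\log_+t=\max\{\log t,0\}$; $\widehat f(\xi)=\int_{\mathbb{R}^n} f(x)e^{-ix\xi}\,dx$; for a symbol $a$, $a(D)f$ is the inverse Fourier transform of $a(\xi)\widehat f(\xi)$. Let $\varphi_0$ be a nonnegative radially decreasing Schwartz function supported in $\{|\xi|\le3/2\}$, identically one on $\{|\xi|\le1\}$; $\varphi(\xi)=\varphi_0(\xi)-\varphi_0(2\xi)$, $\varphi_j(\xi)=\varphi(2^{-j}\xi)$, $j\ge1$. For $s\in\mathbb{R}$, a weight $w:(0,\infty)\to(0,\infty)$ (here a power of $1+\log_+(1/t)$), $0<p<\infty$, $0<q\le\infty$, the space $F^{s,w}_{p,q}(\mathbb{R}^n)$ is the set of tempered distributions $f$ with $\|f\|_{F^{s,w}_{p,q}}=\big\|\big(\sum_{j\ge0}2^{jsq}w(2^{-j})^q|\varphi_j(D)f|^q\big)^{1/q}\big\|_{L^p}<\infty$ (usual modification if $q=\infty$),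 and $F^s_{p,q}:=F^{s,1}_{p,q}$ (weight $w\equiv1$). Elements of $F^{n/p}_{p,q}(\mathbb{R}^n)$, $0<p<\infty$, are functions of local bounded mean oscillation, and $fg$ is the pointwise product, regarded as a tempered distribution. *)

theory Defs
  imports "HOL-Analysis.Analysis"
begin

text \<open>
  The space \<open>\<real>\<^sup>n\<close> is a type \<open>'a :: euclidean_space\<close> with \<open>n = DIM('a)\<close>, which is at least 1.
\<close>

subsection \<open>Schwartz functions and tempered distributions\<close>

text \<open>
  A list of basis vectors plays the role of a multi-index: \<open>partials [b\<^sub>1, \<dots>, b\<^sub>k] f\<close> is
  \<open>\<partial>\<^bsub>b\<^sub>1\<^esub> \<dots> \<partial>\<^bsub>b\<^sub>k\<^esub> f\<close>.
\<close>

fun partials :: "'a::euclidean_space list \<Rightarrow> ('a \<Rightarrow> complex) \<Rightarrow> 'a \<Rightarrow> complex" where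
  "partials [] f = f"
| "partials (b # bs) f = (\<lambda>x. frechet_derivative (partials bs f) (at x) b)"

definition schwartz :: "('a::euclidean_space \<Rightarrow> complex) set" where
  "schwartz = {f. \<forall>bs \<in> lists Basis.
     (\<forall>x. partials bs f differentiable (at x)) \<and>
     (\<forall>N::nat. bounded (range (\<lambda>x. (1 + norm x) ^ N * norm (partials bs f x))))}"

definition schwartz_norm :: "nat \<Rightarrow> ('a::euclidean_space \<Rightarrow> complex) \<Rightarrow> real" where
  "schwartz_norm N f =
     (\<Sum>bs | bs \<in> lists Basis \<and> length bs \<le> N. SUP x. (1 + norm x) ^ N * norm (partials bs f x))"

text \<open>
  A tempered distribution is a continuous linear functional on \<^const>\<open>schwartz\<close>. It is represented
  by a function on all of \<open>'a \<Rightarrow> complex\<close>, of which only the values on \<^const>\<open>schwartz\<close> matter.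
\<close>

type_synonym 'a distribution = "('a \<Rightarrow> complex) \<Rightarrow> complex"

definition tempered :: "'a::euclidean_space distribution \<Rightarrow> bool" where
  "tempered u \<longleftrightarrow>
     (\<forall>f \<in> schwartz. \<forall>g \<in> schwartz. u (\<lambda>x. f x + g x) = u f + u g) \<and>
     (\<forall>c. \<forall>f \<in> schwartz. u (\<lambda>x. c * f x) = c * u f) \<and>
     (\<exists>N C. \<forall>f \<in> schwartz. norm (u f) \<le> C * schwartz_norm N f)"

text \<open>
  The tempered distribution \<open>u\<close> is (given by) the function \<open>f\<close>. Such an \<open>f\<close> is locally integrable and
  determined by \<open>u\<close> up to a null set.
\<close>

definition is_function :: "'a::euclidean_space distribution \<Rightarrow> ('a \<Rightarrow> complex) \<Rightarrow> bool" where
  "is_function u f \<longleftrightarrow> tempered u \<and> f \<in> borel_measurable borel \<and>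
     (\<forall>\<psi> \<in> schwartz. integrable lborel (\<lambda>x. f x * \<psi> x) \<and> u \<psi> = (LINT x|lborel. f x * \<psi> x))"

text \<open>
  The tempered distribution \<open>h\<close> is the pointwise product of \<open>u\<close> and \<open>v\<close>, which are functions. Since the
  representing functions are unique up to null sets, the choice of \<open>f\<close> and \<open>g\<close> does not matter.
\<close>

definition is_pointwise_product ::
    "'a::euclidean_space distribution \<Rightarrow> 'a distribution \<Rightarrow> 'a distribution \<Rightarrow> bool" where
  "is_pointwise_product u v h \<longleftrightarrow>
     (\<exists>f g. is_function u f \<and> is_function v g \<and> is_function h (\<lambda>x. f x * g x))"


subsection \<open>Fourier transform and Fourier multipliers\<close>

definition fourier :: "('a::euclidean_space \<Rightarrow> complex) \<Rightarrow> 'a \<Rightarrow> complex" where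
  "fourier f \<xi> = (LINT x|lborel. f x * exp (- \<i> * complex_of_real (x \<bullet> \<xi>)))"

definition inv_fourier :: "('a::euclidean_space \<Rightarrow> complex) \<Rightarrow> 'a \<Rightarrow> complex" where
  "inv_fourier f x =
     (LINT \<xi>|lborel. f \<xi> * exp (\<i> * complex_of_real (x \<bullet> \<xi>))) / complex_of_real ((2 * pi) ^ DIM('a))"

definition fourier_dist :: "'a::euclidean_space distribution \<Rightarrow> 'a distribution" where
  "fourier_dist u = (\<lambda>\<psi>. u (fourier \<psi>))"

definition inv_fourier_dist :: "'a::euclidean_space distribution \<Rightarrow> 'a distribution" where
  "inv_fourier_dist u = (\<lambda>\<psi>. u (inv_fourier \<psi>))"

definition times_dist :: "('a \<Rightarrow> complex) \<Rightarrow> 'a::euclidean_space distribution \<Rightarrow> 'a distribution" where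
  "times_dist a u = (\<lambda>\<psi>. u (\<lambda>\<xi>. a \<xi> * \<psi> \<xi>))"

text \<open>The distribution \<open>a(D) u\<close>.\<close>

definition multiplier :: "('a \<Rightarrow> complex) \<Rightarrow> 'a::euclidean_space distribution \<Rightarrow> 'a distribution" where
  "multiplier a u = inv_fourier_dist (times_dist a (fourier_dist u))"

text \<open>
  For a compactly supported smooth symbol \<open>a\<close> and tempered \<open>u\<close>, the distribution \<open>a(D) u\<close> is a smooth
  function of polynomial growth (Paley-Wiener-Schwartz); this is that function, singled out in its
  almost-everywhere class by continuity.
\<close>

definition multiplier_fun ::
    "('a \<Rightarrow> complex) \<Rightarrow> 'a::euclidean_space distribution \<Rightarrow> 'a \<Rightarrow> complex" where
  "multiplier_fun a u = (THE h. continuous_on UNIV h \<and> is_function (multiplier a u) h)"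


subsection \<open>Triebel-Lizorkin spaces\<close>

text \<open>The second conjunct says that \<open>\<phi>\<close> is radial and decreasing in \<^term>\<open>norm \<xi>\<close>.\<close>

definition lp_generator :: "('a::euclidean_space \<Rightarrow> real) \<Rightarrow> bool" where
  "lp_generator \<phi> \<longleftrightarrow>
     (\<forall>\<xi>. 0 \<le> \<phi> \<xi>) \<and>
     (\<forall>\<xi> \<eta>. norm \<xi> \<le> norm \<eta> \<longrightarrow> \<phi> \<eta> \<le> \<phi> \<xi>) \<and>
     (\<lambda>\<xi>. complex_of_real (\<phi> \<xi>)) \<in> schwartz \<and>
     closure {\<xi>. \<phi> \<xi> \<noteq> 0} \<subseteq> {\<xi>. norm \<xi> \<le> 3/2} \<and>
     (\<forall>\<xi>. norm \<xi> \<le> 1 \<longrightarrow> \<phi> \<xi> = 1)"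

text \<open>The functions \<open>\<phi>\<^sub>j\<close>, \<open>j \<ge> 0\<close>, built from \<open>\<phi>\<^sub>0 = \<phi>\<close>.\<close>

definition lp_symbol :: "('a::euclidean_space \<Rightarrow> real) \<Rightarrow> nat \<Rightarrow> 'a \<Rightarrow> complex" where
  "lp_symbol \<phi> j \<xi> = complex_of_real
     (if j = 0 then \<phi> \<xi>
      else let \<eta> = (1 / 2 ^ j) *\<^sub>R \<xi> in \<phi> \<eta> - \<phi> (2 *\<^sub>R \<eta>))"

text \<open>Powers of extended nonnegative numbers, for an exponent \<open>a > 0\<close>.\<close>

definition epowr :: "ennreal \<Rightarrow> real \<Rightarrow> ennreal" where
  "epowr x a = (if x = \<infinity> then \<infinity> else ennreal (enn2real x powr a))"

definition lq_norm :: "ennreal \<Rightarrow> (nat \<Rightarrow> ennreal) \<Rightarrow> ennreal" where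
  "lq_norm q c =
     (if q = \<infinity> then (SUP j. c j)
      else epowr (\<Sum>j. epowr (c j) (enn2real q)) (1 / enn2real q))"

definition Lp_norm :: "real \<Rightarrow> ('a::euclidean_space \<Rightarrow> ennreal) \<Rightarrow> ennreal" where
  "Lp_norm p F = epowr (\<integral>\<^sup>+ x. epowr (F x) p \<partial>lborel) (1 / p)"

text \<open>
  The (quasi-)norm of \<open>F\<^bsup>s,w\<^esup>\<^bsub>p,q\<^esub>\<close>, with value \<open>\<infinity>\<close> outside of the space. The weight \<open>w\<close> is only
  relevant on \<open>(0, \<infinity>)\<close>.
\<close>

definition F_norm ::
    "('a::euclidean_space \<Rightarrow> real) \<Rightarrow> real \<Rightarrow> (real \<Rightarrow> real) \<Rightarrow> real \<Rightarrow> ennreal \<Rightarrow>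
     'a distribution \<Rightarrow> ennreal" where
  "F_norm \<phi> s w p q u =
     Lp_norm p (\<lambda>x. lq_norm q (\<lambda>j. ennreal
       (2 powr (real j * s) * w (2 powr (- real j)) * norm (multiplier_fun (lp_symbol \<phi> j) u x))))"

definition F_space ::
    "('a::euclidean_space \<Rightarrow> real) \<Rightarrow> real \<Rightarrow> (real \<Rightarrow> real) \<Rightarrow> real \<Rightarrow> ennreal \<Rightarrow>
     'a distribution set" where
  "F_space \<phi> s w p q = {u. tempered u \<and> F_norm \<phi> s w p q u < \<infinity>}"

definition log_plus :: "real \<Rightarrow> real" where
  "log_plus t = max (ln t) 0"

end

(*
  Write S_j f for the low-pass truncations of f and f_j = S_j f - S_(j-1) f. Peetre's maximal inequality and
  integration over dyadic annuli around x give sum_j |f_j(x)|^p <= C ||f||^p at every point x (the critical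
  smoothness n/p makes the volume of the annuli match), hence |S_j f(x)| <= C (1 + j)^(1/r') ||f|| by the
  power mean inequality. The product is the telescoping sum of
  h_j = S_j f S_j g - S_(j-1) f S_(j-1) g, and |h_j| <= C (1 + j)^(1/r') (||g|| |f_j| + ||f|| |g_j|).
  The spectrum of h_j lies in a ball of radius 3 2^j, so phi_k(D)(fg) only sees j >= k - 3, and Peetre's
  inequality bounds phi_k(D) h_j by 2^((j-k)(a-n)) times the L^eta average of h_j at scale 2^(-j), where
  n/eta < a < n + n/p. The geometric loss is beaten by the factor 2^(-(j-k)n/p), the logarithmic weights are
  comparable up to 1 + |j - k|, and the vector-valued inequality for the averages in
  L^(p/eta)(l^(q/eta)) finishes the proof.
*)
theory Submission
  imports Defs "HOL-Probability.Probability"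
begin

subsection \<open>Integration on Euclidean space\<close>

text \<open>The hypothesis on p and q makes room for one auxiliary exponent \<open>\<eta>\<close>.
  Splitting a function into its powers \<open>\<eta>\<close> and 1 - \<open>\<eta>\<close> requires
  \<open>\<eta>\<close> \<le> 1; bounding averages of \<open>\<eta>\<close>-th powers in
  L^(p/\<open>\<eta>\<close>)(l^(q/\<open>\<eta>\<close>)) by the maximal method requires
  \<open>\<eta>\<close> < p and \<open>\<eta>\<close> < q; and the range n/\<open>\<eta>\<close> < a
  < n + n/p, whose lower end makes the averaging kernel integrable and whose upper end lets
  smoothness win over the convolution loss, is nonempty exactly for \<open>\<eta>\<close> > p/(p+1).
  The logarithm has a single source: at a point only the l^p norm of the pieces is controlled, while
  a truncation is their plain sum over j + 1 terms. For p \<le> 1 this costs nothing, in agreement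
  with 1/r' = 0. Products of truncations have spectrum in balls rather than annuli, so infinitely
  many of them meet each frequency band. Spectral localisation is encoded by reproducing identities
  for kernels, which a tempered distribution respects because it commutes with integrals of
  translates.\<close>

lemma nn_integral_lborel_affine:
  fixes f :: "'a::euclidean_space \<Rightarrow> ennreal"
  assumes [measurable]: "f \<in> borel_measurable borel" and "c \<noteq> 0"
  shows "(\<integral>\<^sup>+x. f x \<partial>lborel) = ennreal (\<bar>c\<bar> ^ DIM('a)) * (\<integral>\<^sup>+x. f (t + c *\<^sub>R x) \<partial>lborel)"
  by (subst lborel_affine[OF assms(2), of t])
     (simp add: nn_integral_density nn_integral_distr nn_integral_cmult)

lemma nn_integral_lborel_reflect:
  fixes f :: "'a::euclidean_space \<Rightarrow> ennreal"
  assumes "f \<in> borel_measurable borel"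
  shows "(\<integral>\<^sup>+y. f (x - y) \<partial>lborel) = (\<integral>\<^sup>+y. f y \<partial>lborel)"
  using nn_integral_lborel_affine[OF assms, of "-1" x] by simp

lemma has_bochner_integral_lborel_affine:
  fixes f :: "'a::euclidean_space \<Rightarrow> complex"
  assumes [measurable]: "f \<in> borel_measurable borel" and "c \<noteq> 0"
  shows "integrable lborel (\<lambda>x. f (t + c *\<^sub>R x)) \<longleftrightarrow> integrable lborel f"
    and "(LINT x|lborel. f x) = (\<bar>c\<bar> ^ DIM('a)) *\<^sub>R (LINT x|lborel. f (t + c *\<^sub>R x))"
proof -
  let ?D = "distr lborel borel (\<lambda>x. t + c *\<^sub>R x) :: 'a measure"
  let ?M = "density ?D (\<lambda>_. ennreal (\<bar>c\<bar> ^ DIM('a)))"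
  have eq: "(lborel :: 'a measure) = ?M" using lborel_affine[OF assms(2), of t] by simp
  have f: "f \<in> borel_measurable ?D" by simp
  have "integrable lborel f \<longleftrightarrow> integrable ?M f"
    by (rule arg_cong[OF eq, of "\<lambda>M. integrable M f"])
  also have "\<dots> \<longleftrightarrow> integrable ?D (\<lambda>x. (\<bar>c\<bar> ^ DIM('a)) *\<^sub>R f x)"
    by (rule integrable_density[OF f]) auto
  also have "\<dots> \<longleftrightarrow> integrable ?D f"
  proof
    assume "integrable ?D (\<lambda>x. (\<bar>c\<bar> ^ DIM('a)) *\<^sub>R f x)"
    then have *: "integrable ?D (\<lambda>x. inverse (\<bar>c\<bar> ^ DIM('a)) *\<^sub>R ((\<bar>c\<bar> ^ DIM('a)) *\<^sub>R f x))"
      by (rule integrable_scaleR_right)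
    have "(\<lambda>x. inverse (\<bar>c\<bar> ^ DIM('a)) *\<^sub>R ((\<bar>c\<bar> ^ DIM('a)) *\<^sub>R f x)) = f"
      using assms(2) by (simp add: fun_eq_iff)
    with * show "integrable ?D f" by (simp only:)
  qed (intro integrable_scaleR_right)
  also have "\<dots> \<longleftrightarrow> integrable lborel (\<lambda>x. f (t + c *\<^sub>R x))"
    by (rule integrable_distr_eq) auto
  finally show "integrable lborel (\<lambda>x. f (t + c *\<^sub>R x)) \<longleftrightarrow> integrable lborel f" ..
  have "integral\<^sup>L lborel f = integral\<^sup>L ?M f"
    by (rule arg_cong[OF eq, of "\<lambda>M. integral\<^sup>L M f"])
  also have "\<dots> = integral\<^sup>L ?D (\<lambda>x. (\<bar>c\<bar> ^ DIM('a)) *\<^sub>R f x)"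
    by (rule integral_density[OF f]) auto
  also have "\<dots> = (\<bar>c\<bar> ^ DIM('a)) *\<^sub>R integral\<^sup>L ?D f" by (rule integral_scaleR_right)
  also have "integral\<^sup>L ?D f = (LINT x|lborel. f (t + c *\<^sub>R x))"
    by (rule integral_distr) auto
  finally show "(LINT x|lborel. f x) = (\<bar>c\<bar> ^ DIM('a)) *\<^sub>R (LINT x|lborel. f (t + c *\<^sub>R x))" .
qed

lemma integral_lborel_reflect:
  fixes f :: "'a::euclidean_space \<Rightarrow> complex"
  assumes "f \<in> borel_measurable borel"
  shows "(LINT y|lborel. f (x - y)) = (LINT y|lborel. f y)"
    "integrable lborel (\<lambda>y. f (x - y)) \<longleftrightarrow> integrable lborel f"
  using has_bochner_integral_lborel_affine[OF assms, of "-1" x] by simp_all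

text \<open>The standard majorant of an L^1-normalised kernel at scale 2^-j: the prefactor
  compensates the dilation, and \<open>b\<close> is the decay in excess of the dimension, so that b
  > 0 gives integrability uniformly in \<open>j\<close>.\<close>

definition kern :: "real \<Rightarrow> nat \<Rightarrow> 'a::euclidean_space \<Rightarrow> real" where
  "kern b j z = 2 ^ (j * DIM('a)) * (1 + 2 ^ j * norm z) powr (- (real DIM('a) + b))"

lemma kern_nonneg: "0 \<le> kern b j z"
  by (simp add: kern_def)

lemma kern_minus: "kern b j (x - y) = kern b j (y - x)"
  by (simp add: kern_def norm_minus_commute)

lemma borel_measurable_kern [measurable]: "kern b j \<in> borel_measurable borel"
  unfolding kern_def by measurable

text \<open>Every point lies in a smallest ball of radius 2^i / 2^j. There the decay is of order
  (2^i)^-(n+b): the part (2^i)^-n normalises the indicator of the ball, and (2^-b)^i is left as a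
  summable coefficient. The same series serves the integral of the kernel and the comparison with
  ball averages.\<close>

lemma kern_le_shells:
  fixes z :: "'a::euclidean_space"
  assumes b: "0 < b"
  shows "ennreal (kern b j z) \<le> (\<Sum>i. ennreal (2 powr (real DIM('a) + b) * (2 powr (- b)) ^ i) *
      (ennreal ((2 ^ j / 2 ^ i) ^ DIM('a)) * indicator (cball 0 (2 ^ i / 2 ^ j)) z))"
    (is "_ \<le> suminf ?s")
proof -
  let ?n = "real DIM('a)"
  let ?t = "2 ^ j * norm z"
  have ex: "\<exists>i. ?t \<le> 2 ^ i"
    using real_arch_pow[of 2 ?t] by (auto intro: less_imp_le)
  define i where "i = (LEAST i. ?t \<le> 2 ^ i)"
  have i: "?t \<le> 2 ^ i" using LeastI_ex[OF ex] by (simp add: i_def)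
  \<comment> \<open>Minimality of \<open>i\<close>: the previous power of 2 is below
    \<open>?t\<close>; for i = 0 the summand 1 does the work.\<close>
  have low: "(2::real) ^ i \<le> 2 * (1 + ?t)"
  proof (cases i)
    case 0 then show ?thesis by (simp add: add_increasing2)
  next
    case (Suc k)
    then have "\<not> ?t \<le> 2 ^ k" using not_less_Least[of k "\<lambda>i. ?t \<le> 2 ^ i"] by (simp add: i_def)
    with Suc show ?thesis by simp
  qed
  have "(1 + ?t) powr (- (?n + b)) \<le> (2 ^ i / 2) powr (- (?n + b))"
    using low b by (intro powr_mono2') (auto simp: field_simps add_pos_nonneg)
  also have "\<dots> = 2 powr (?n + b) * (2 powr (- b)) ^ i * (1 / 2 ^ i) ^ DIM('a)"
  proof -
    have 1: "(2::real) ^ i / 2 = 2 powr (real i - 1)" by (simp add: powr_diff powr_realpow)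
    have 2: "((2::real) powr (- b)) ^ i = 2 powr (real i * (- b))" by (simp add: powr_power)
    have "((1::real) / 2 ^ i) ^ DIM('a) = (2 powr (- real i)) ^ DIM('a)"
      by (simp add: powr_minus_divide powr_realpow)
    also have "\<dots> = 2 powr (real DIM('a) * (- real i))" by (simp add: powr_power)
    finally have 3: "((1::real) / 2 ^ i) ^ DIM('a) = 2 powr (real DIM('a) * (- real i))" .
    show ?thesis unfolding 1 2 3 powr_powr powr_add[symmetric]
      by (intro arg_cong2[where f="(powr)"] refl) (simp add: algebra_simps)
  qed
  finally have "kern b j z \<le> 2 ^ (j * DIM('a)) * (2 powr (?n + b) * (2 powr (- b)) ^ i * (1 / 2 ^ i) ^ DIM('a))"
    unfolding kern_def by (intro mult_left_mono) auto
  also have "\<dots> = 2 powr (?n + b) * (2 powr (- b)) ^ i * (2 ^ j / 2 ^ i) ^ DIM('a)"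
    by (simp add: power_divide power_mult)
  finally have "ennreal (kern b j z) \<le> ?s i"
    using i by (simp add: ennreal_mult'[symmetric] mult_ac field_simps indicator_def)
  also have "\<dots> \<le> suminf ?s"
    using sum_le_suminf[of ?s "{i}"] by simp
  finally show ?thesis .
qed

text \<open>
  Only an upper bound for the integral of \<open>kern b j\<close>, obtained by summing over dyadic shells.
\<close>

definition kern_mass :: "'a::euclidean_space itself \<Rightarrow> real \<Rightarrow> real" where
  "kern_mass _ b = 2 powr (real DIM('a) + b) * unit_ball_vol (DIM('a)) / (1 - 2 powr (- b))"

lemma kern_mass_nonneg: "0 < b \<Longrightarrow> 0 \<le> kern_mass TYPE('a::euclidean_space) b"
  by (auto simp: kern_mass_def powr_minus field_simps intro!: divide_nonneg_nonneg)

lemma nn_integral_suminf_indicator: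
  assumes "\<And>i. A i \<in> sets M"
  shows "(\<integral>\<^sup>+z. (\<Sum>i. c i * (e i * indicator (A i) z)) \<partial>M) = (\<Sum>i. c i * (e i * emeasure M (A i)))"
proof -
  have "(\<integral>\<^sup>+z. (\<Sum>i. c i * (e i * indicator (A i) z)) \<partial>M)
      = (\<Sum>i. \<integral>\<^sup>+z. c i * (e i * indicator (A i) z) \<partial>M)"
    using assms by (intro nn_integral_suminf borel_measurable_times_ennreal borel_measurable_const
        borel_measurable_indicator)
  also have "\<dots> = (\<Sum>i. c i * (e i * emeasure M (A i)))"
    using assms by (simp add: nn_integral_cmult)
  finally show ?thesis .
qed

text \<open>The volume of each ball cancels its normalising factor, which leaves a geometric series
  that does not depend on the scale \<open>j\<close>.\<close>

lemma nn_integral_kern_le: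
  assumes b: "0 < b"
  shows "(\<integral>\<^sup>+z. ennreal (kern b j (z::'a::euclidean_space)) \<partial>lborel) \<le> ennreal (kern_mass TYPE('a) b)"
proof -
  let ?n = "DIM('a)"
  have "(\<integral>\<^sup>+z. ennreal (kern b j (z::'a)) \<partial>lborel)
     \<le> (\<integral>\<^sup>+z. (\<Sum>i. ennreal (2 powr (real ?n + b) * (2 powr (- b)) ^ i) *
      (ennreal ((2 ^ j / 2 ^ i) ^ ?n) * indicator (cball 0 (2 ^ i / 2 ^ j)) (z::'a))) \<partial>lborel)"
    by (intro nn_integral_mono kern_le_shells b)
  also have "\<dots> = (\<Sum>i. ennreal (2 powr (real ?n + b) * (2 powr (- b)) ^ i) *
      (ennreal ((2 ^ j / 2 ^ i) ^ ?n) * emeasure lborel (cball (0::'a) (2 ^ i / 2 ^ j))))"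
    by (rule nn_integral_suminf_indicator) simp
  also have "\<dots> = (\<Sum>i. ennreal (2 powr (real ?n + b) * unit_ball_vol ?n * (2 powr (- b)) ^ i))"
  proof (intro arg_cong[where f=suminf] ext)
    fix i
    have *: "(2 ^ j / 2 ^ i) ^ ?n * (2 ^ i / 2 ^ j :: real) ^ ?n = 1"
      unfolding power_mult_distrib[symmetric] by simp
    have "ennreal ((2 ^ j / 2 ^ i) ^ ?n) * emeasure lborel (cball (0::'a) (2 ^ i / 2 ^ j))
       = ennreal ((2 ^ j / 2 ^ i) ^ ?n * (unit_ball_vol ?n * (2 ^ i / 2 ^ j) ^ ?n))"
      by (subst emeasure_cball) (auto simp: ennreal_mult')
    also have "(2 ^ j / 2 ^ i) ^ ?n * (unit_ball_vol ?n * (2 ^ i / 2 ^ j) ^ ?n) = unit_ball_vol ?n"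
      using * by (metis mult.left_commute mult.right_neutral)
    finally show "ennreal (2 powr (real ?n + b) * (2 powr (- b)) ^ i) *
      (ennreal ((2 ^ j / 2 ^ i) ^ ?n) * emeasure lborel (cball (0::'a) (2 ^ i / 2 ^ j)))
      = ennreal (2 powr (real ?n + b) * unit_ball_vol ?n * (2 powr (- b)) ^ i)"
      by (simp add: ennreal_mult'[symmetric] mult_ac)
  qed
  also have "\<dots> = ennreal (\<Sum>i. 2 powr (real ?n + b) * unit_ball_vol ?n * (2 powr (- b)) ^ i)"
    using b by (intro suminf_ennreal2) (auto intro!: summable_mult summable_geometric simp: powr_less_one)
  also have "(\<Sum>i. 2 powr (real ?n + b) * unit_ball_vol ?n * (2 powr (- b)) ^ i) = kern_mass TYPE('a) b"
    using b by (subst suminf_mult) (auto simp: suminf_geometric powr_less_one kern_mass_def intro!: summable_geometric)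
  finally show ?thesis .
qed

subsection \<open>Rapidly decaying functions\<close>

text \<open>The decay half of the Schwartz condition without smoothness, meant for functions that
  are only integrated against and not differentiated.\<close>

definition rapid :: "('a::real_normed_vector \<Rightarrow> 'b::real_normed_vector) \<Rightarrow> bool" where
  "rapid f \<longleftrightarrow> (\<forall>N::nat. \<exists>C. \<forall>x. (1 + norm x) ^ N * norm (f x) \<le> C)"

lemma rapidE:
  assumes "rapid f"
  obtains C where "C > 0" "\<And>x. (1 + norm x) ^ N * norm (f x) \<le> C"
proof -
  obtain C where "\<And>x. (1 + norm x) ^ N * norm (f x) \<le> C" using assms unfolding rapid_def by blast
  then have "\<And>x. (1 + norm x) ^ N * norm (f x) \<le> max C 1" by (meson max.coboundedI1)
  then show thesis by (intro that[of "max C 1"]) auto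
qed

text \<open>A factor of polynomial growth only costs \<open>m\<close> powers of the weight.\<close>

lemma rapid_dom:
  assumes "rapid f" "\<And>x. norm (g x) \<le> A * (1 + norm x) ^ m * norm (f x)"
  shows "rapid g"
  unfolding rapid_def
proof
  fix N
  obtain C where C: "\<And>x. (1 + norm x) ^ (N + m) * norm (f x) \<le> C"
    using assms(1) unfolding rapid_def by blast
  have "(1 + norm x) ^ N * norm (g x) \<le> \<bar>A\<bar> * C" for x
  proof -
    have "(1 + norm x) ^ N * norm (g x) \<le> (1 + norm x) ^ N * (A * (1 + norm x) ^ m * norm (f x))"
      by (intro mult_left_mono assms) simp
    also have "\<dots> = A * ((1 + norm x) ^ (N + m) * norm (f x))"
      by (simp add: power_add)
    also have "\<dots> \<le> \<bar>A\<bar> * ((1 + norm x) ^ (N + m) * norm (f x))"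
      by (intro mult_right_mono) auto
    also have "\<dots> \<le> \<bar>A\<bar> * C" by (intro mult_left_mono C) simp
    finally show ?thesis .
  qed
  then show "\<exists>C. \<forall>x. (1 + norm x) ^ N * norm (g x) \<le> C" by blast
qed

lemma rapid_add:
  assumes "rapid f" "rapid g" shows "rapid (\<lambda>x. f x + g x)"
  unfolding rapid_def
proof
  fix N
  obtain C where C: "\<And>x. (1 + norm x) ^ N * norm (f x) \<le> C"
    using assms(1) unfolding rapid_def by blast
  obtain D where D: "\<And>x. (1 + norm x) ^ N * norm (g x) \<le> D"
    using assms(2) unfolding rapid_def by blast
  have "(1 + norm x) ^ N * norm (f x + g x) \<le> C + D" for x
  proof -
    have "(1 + norm x) ^ N * norm (f x + g x) \<le> (1 + norm x) ^ N * (norm (f x) + norm (g x))"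
      by (intro mult_left_mono norm_triangle_ineq) auto
    also have "\<dots> \<le> C + D" using C[of x] D[of x] by (simp add: distrib_left)
    finally show ?thesis .
  qed
  then show "\<exists>C. \<forall>x. (1 + norm x) ^ N * norm (f x + g x) \<le> C" by blast
qed

text \<open>The multiplicative form of the triangle inequality: a polynomial weight moves from one
  point to another at the cost of the weight of their difference.\<close>

lemma one_plus_norm_triangle: "1 + norm (x::'a::real_normed_vector) \<le> (1 + norm y) * (1 + norm (x - y))"
proof -
  have "norm x \<le> norm y + norm (x - y)" using norm_triangle_ineq[of y "x - y"] by simp
  moreover have "0 \<le> norm y * norm (x - y)" by (rule mult_nonneg_nonneg) auto
  ultimately show ?thesis unfolding distrib_left distrib_right by linarith
qed

lemma one_plus_norm_power_triangle:
  "(1 + norm (x::'a::real_normed_vector)) ^ N \<le> (1 + norm y) ^ N * (1 + norm (x - y)) ^ N"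
  unfolding power_mult_distrib[symmetric] by (intro power_mono one_plus_norm_triangle) simp

text \<open>The integrand is \<open>kern 1 0\<close>, whose integral is already bounded.\<close>

lemma integrable_inverse_power:
  "integrable lborel (\<lambda>x::'a::euclidean_space. 1 / (1 + norm x) ^ (DIM('a) + 1))"
proof (rule integrableI_nonneg)
  have "(\<integral>\<^sup>+x. ennreal (1 / (1 + norm (x::'a)) ^ (DIM('a) + 1)) \<partial>lborel) = (\<integral>\<^sup>+x. ennreal (kern 1 0 (x::'a)) \<partial>lborel)"
  proof (intro nn_integral_cong arg_cong[where f=ennreal])
    fix x :: 'a
    have "0 < 1 + norm x" by (simp add: add_pos_nonneg)
    then have "(1 + norm x) powr (- (real DIM('a) + 1)) = 1 / (1 + norm x) ^ (DIM('a) + 1)"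
      using powr_realpow[of "1 + norm x" "DIM('a) + 1"] powr_minus_divide[of "1 + norm x" "real DIM('a) + 1"]
      by (simp add: add.commute)
    then show "1 / (1 + norm x) ^ (DIM('a) + 1) = kern 1 0 x" by (simp add: kern_def)
  qed
  also have "\<dots> < \<infinity>" using nn_integral_kern_le[of 1 0, where 'a='a] by (simp add: le_less_trans)
  finally show "(\<integral>\<^sup>+x. ennreal (1 / (1 + norm (x::'a)) ^ (DIM('a) + 1)) \<partial>lborel) < \<infinity>" .
qed auto

lemma integrable_rapid:
  fixes f :: "'a::euclidean_space \<Rightarrow> 'b::{banach, second_countable_topology}"
  assumes "rapid f" and [measurable]: "f \<in> borel_measurable borel"
  shows "integrable lborel f"
proof -
  obtain C where C: "\<And>x. (1 + norm x) ^ (DIM('a) + 1) * norm (f x) \<le> C"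
    using assms(1) unfolding rapid_def by blast
  show ?thesis
  proof (rule Bochner_Integration.integrable_bound)
    show "integrable lborel (\<lambda>x::'a. C * (1 / (1 + norm x) ^ (DIM('a) + 1)))"
      by (intro integrable_mult_right integrable_inverse_power)
    have "norm (f x) \<le> norm (C * (1 / (1 + norm x) ^ (DIM('a) + 1)))" for x
    proof -
      have "norm (f x) \<le> C / (1 + norm x) ^ (DIM('a) + 1)"
        using C[of x] zero_less_power[of "1 + norm x" "DIM('a) + 1"]
        by (subst pos_le_divide_eq) (auto simp: mult.commute add_pos_nonneg)
      also have "\<dots> \<le> norm (C * (1 / (1 + norm x) ^ (DIM('a) + 1)))"
        using abs_ge_self[of "C / (1 + norm x) ^ (DIM('a) + 1)"] by (simp only: real_norm_def times_divide_eq_right mult_1_right)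
      finally show ?thesis .
    qed
    then show "AE x in lborel. norm (f x) \<le> norm (C * (1 / (1 + norm x) ^ (DIM('a) + 1)))" by simp
  qed auto
qed

text \<open>Dominated convergence for difference quotients: one integrable \<open>L\<close> controls
  the derivative and the increments within distance 1 of \<open>s0\<close>, hence
  \<open>2 * L\<close> dominates the error quotients. The form with a full derivative serves both a
  parameter in space and a real translation parameter.\<close>

lemma has_derivative_integral_dominated:
  fixes f :: "'b \<Rightarrow> 'a::euclidean_space \<Rightarrow> complex"
  assumes int: "\<And>s. integrable M (\<lambda>y. f y s)"
    and der: "\<And>y. (f y has_derivative D y) (at s0)"
    and Dm: "\<And>v. (\<lambda>y. D y v) \<in> borel_measurable M"
    and L: "integrable M L" and DL: "\<And>y v. norm (D y v) \<le> L y * norm v"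
    and lip: "\<And>y s. norm (s - s0) \<le> 1 \<Longrightarrow> norm (f y s - f y s0) \<le> L y * norm (s - s0)"
  shows "((\<lambda>s. LINT y|M. f y s) has_derivative (\<lambda>v. LINT y|M. D y v)) (at s0)"
proof -
  have Dlin: "linear (D y)" for y using der[of y] by (simp add: has_derivative_def bounded_linear.linear)
  have Dint: "integrable M (\<lambda>y. D y v)" for v
  proof (rule Bochner_Integration.integrable_bound)
    show "integrable M (\<lambda>y. L y * norm v)" using L by simp
    have "norm (D y v) \<le> norm (L y * norm v)" for y
      using DL[of y v] abs_ge_self[of "L y * norm v"] unfolding real_norm_def by linarith
    then show "AE y in M. norm (D y v) \<le> norm (L y * norm v)" by simp
  qed (rule Dm)
  have lin: "bounded_linear (\<lambda>v. LINT y|M. D y v)"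
    unfolding linear_conv_bounded_linear[symmetric]
    by (rule linearI)
       (simp_all add: linear_add[OF Dlin] linear_scale[OF Dlin] Dint)
  have "((\<lambda>s. norm ((LINT y|M. f y s) - (LINT y|M. f y s0) - (LINT y|M. D y (s - s0))) / norm (s - s0)) \<longlongrightarrow> 0) (at s0)"
    unfolding tendsto_at_iff_sequentially comp_def
  proof (intro allI impI)
    fix X :: "nat \<Rightarrow> 'a" assume X0: "\<forall>i. X i \<in> UNIV - {s0}" and X: "X \<longlonglongrightarrow> s0"
    from X have "eventually (\<lambda>i. dist (X i) s0 < 1) sequentially" by (rule tendstoD) simp
    then obtain k where k': "\<And>i. i \<ge> k \<Longrightarrow> dist (X i) s0 < 1"
      unfolding eventually_sequentially by blast
    have k: "norm (X i - s0) \<le> 1" if "i \<ge> k" for i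
      using k'[OF that] by (simp add: dist_norm)
    \<comment> \<open>Dropping the first \<open>k\<close> terms puts the whole sequence into the
      unit ball around \<open>s0\<close>, where \<open>lip\<close> applies.\<close>
    define Y where "Y = (\<lambda>i. X (i + k))"
    have Y: "Y \<longlonglongrightarrow> s0" "\<And>i. Y i \<noteq> s0" "\<And>i. norm (Y i - s0) \<le> 1"
      using LIMSEQ_ignore_initial_segment[OF X, of k] X0 k by (auto simp: Y_def)
    let ?R = "\<lambda>i y. norm (f y (Y i) - f y s0 - D y (Y i - s0)) / norm (Y i - s0)"
    have lim: "(\<lambda>i. LINT y|M. ?R i y) \<longlonglongrightarrow> (LINT y|M. (0::real))"
    proof (rule integral_dominated_convergence)
      show "(\<lambda>y. ?R i y) \<in> borel_measurable M" for i
        using int Dint by (intro borel_measurable_divide borel_measurable_norm borel_measurable_diff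
            borel_measurable_integrable borel_measurable_const) auto
      show "integrable M (\<lambda>y. 2 * L y)" using L by simp
      show "AE y in M. (\<lambda>i. ?R i y) \<longlonglongrightarrow> 0"
      proof (rule AE_I2)
        fix y
        have "((\<lambda>s. norm (f y s - f y s0 - D y (s - s0)) / norm (s - s0)) \<longlongrightarrow> 0) (at s0)"
          using der[of y] by (simp add: has_derivative_iff_norm)
        then show "(\<lambda>i. ?R i y) \<longlonglongrightarrow> 0"
          unfolding tendsto_at_iff_sequentially comp_def using Y by auto
      qed
      show "AE y in M. norm (?R i y) \<le> 2 * L y" for i
      proof (rule AE_I2)
        fix y
        have "norm (f y (Y i) - f y s0 - D y (Y i - s0)) \<le> norm (f y (Y i) - f y s0) + norm (D y (Y i - s0))"
          by (rule norm_triangle_ineq4)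
        also have "\<dots> \<le> 2 * L y * norm (Y i - s0)"
          using lip[OF Y(3), of y i] DL[of y "Y i - s0"] by simp
        finally show "norm (?R i y) \<le> 2 * L y" using Y(2)[of i] by (simp add: divide_le_eq)
      qed
    qed simp
    have "norm (norm ((LINT y|M. f y (Y i)) - (LINT y|M. f y s0) - (LINT y|M. D y (Y i - s0))) / norm (Y i - s0))
       \<le> (LINT y|M. ?R i y)" for i
    proof -
      have "(LINT y|M. f y (Y i)) - (LINT y|M. f y s0) - (LINT y|M. D y (Y i - s0))
         = (LINT y|M. f y (Y i) - f y s0 - D y (Y i - s0))"
        by (simp add: int Dint)
      then show ?thesis
        using integral_norm_bound[of M "\<lambda>y. f y (Y i) - f y s0 - D y (Y i - s0)"] 
        by (simp add: divide_right_mono)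
    qed
    then have "(\<lambda>i. norm ((LINT y|M. f y (Y i)) - (LINT y|M. f y s0) - (LINT y|M. D y (Y i - s0))) / norm (Y i - s0)) \<longlonglongrightarrow> 0"
      using lim by (intro Lim_null_comparison[OF _ lim[simplified]]) auto
    then show "(\<lambda>i. norm ((LINT y|M. f y (X i)) - (LINT y|M. f y s0) - (LINT y|M. D y (X i - s0))) / norm (X i - s0)) \<longlonglongrightarrow> 0"
      unfolding Y_def by (rule LIMSEQ_offset)
  qed
  then show ?thesis using lin by (simp add: has_derivative_iff_norm)
qed

subsection \<open>Schwartz functions\<close>

definition pd :: "'a::euclidean_space \<Rightarrow> ('a \<Rightarrow> complex) \<Rightarrow> 'a \<Rightarrow> complex" where
  "pd b f = (\<lambda>x. frechet_derivative f (at x) b)"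

lemma partials_Cons: "partials (b # bs) f = pd b (partials bs f)"
  by (simp add: pd_def)

text \<open>\<open>partials\<close> recurses on the outermost derivative; peeling off the innermost
  one instead shows that derivatives of Schwartz functions are Schwartz.\<close>

lemma partials_snoc: "partials (bs @ [b]) f = partials bs (pd b f)"
  by (induction bs) (simp_all add: pd_def)

lemma rapid_iff_bounded: "rapid f \<longleftrightarrow> (\<forall>N. bounded (range (\<lambda>x. (1 + norm x) ^ N * norm (f x))))"
proof -
  have "bounded (range (\<lambda>x. (1 + norm x) ^ N * norm (f x))) \<longleftrightarrow> (\<exists>C. \<forall>x. (1 + norm x) ^ N * norm (f x) \<le> C)" for N
    unfolding bounded_iff by simp
  then show ?thesis unfolding rapid_def by simp
qed

lemma schwartzD:
  assumes "f \<in> schwartz"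
  shows "rapid f" "f differentiable (at x)" "(f has_derivative frechet_derivative f (at x)) (at x)"
    "b \<in> Basis \<Longrightarrow> pd b f \<in> schwartz" "bs \<in> lists Basis \<Longrightarrow> partials bs f \<in> schwartz"
proof -
  have *: "(\<forall>x. partials bs f differentiable (at x)) \<and> rapid (partials bs f)" if "bs \<in> lists Basis" for bs
    using assms that unfolding schwartz_def rapid_iff_bounded by blast
  from *[of "[]"] show "rapid f" "f differentiable (at x)" by auto
  then show "(f has_derivative frechet_derivative f (at x)) (at x)"
    by (simp add: frechet_derivative_works)
  have pdS: "pd b f \<in> schwartz" if f: "f \<in> schwartz" and b: "b \<in> Basis" for f :: "'a \<Rightarrow> complex" and b
  proof -
    have "(\<forall>x. partials bs (pd b f) differentiable (at x)) \<and> rapid (partials bs (pd b f))" if "bs \<in> lists Basis" for bs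
    proof -
      have "bs @ [b] \<in> lists Basis" using that b by auto
      with f show ?thesis unfolding schwartz_def rapid_iff_bounded partials_snoc[symmetric] by blast
    qed
    then show ?thesis unfolding schwartz_def rapid_iff_bounded by blast
  qed
  then show "b \<in> Basis \<Longrightarrow> pd b f \<in> schwartz" using assms by blast
  show "bs \<in> lists Basis \<Longrightarrow> partials bs f \<in> schwartz"
    by (induction bs) (use assms pdS in \<open>auto simp: pd_def[symmetric]\<close>)
qed

text \<open>The place where derivatives of members of \<open>X\<close> may land in the coinduction
  below, for instance the two terms of the Leibniz rule.\<close>

inductive addclos :: "(('a::euclidean_space \<Rightarrow> complex) \<Rightarrow> bool) \<Rightarrow> ('a \<Rightarrow> complex) \<Rightarrow> bool" for X where
  base: "X f \<Longrightarrow> addclos X f"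
| sch: "f \<in> schwartz \<Longrightarrow> addclos X f"
| add: "addclos X f \<Longrightarrow> addclos X g \<Longrightarrow> addclos X (\<lambda>x. f x + g x)"

text \<open>Being Schwartz is a greatest fixed point: decay, and the same again for all first
  partial derivatives. So it suffices to exhibit a class of decaying functions whose derivatives
  return to the class up to sums and known Schwartz functions; formulas for higher derivatives never
  appear.\<close>

lemma schwartz_coinduct:
  assumes "X f"
    and X: "\<And>f. X f \<Longrightarrow> rapid f \<and> (\<exists>D. (\<forall>x. (f has_derivative D x) (at x)) \<and> (\<forall>b\<in>Basis. addclos X (\<lambda>x. D x b)))"
  shows "f \<in> schwartz"
proof -
  \<comment> \<open>Decay and differentiability pass to sums, so the closure inherits the hypothesis
    on \<open>X\<close>.\<close>
  have clos: "rapid f \<and> (\<exists>D. (\<forall>x. (f has_derivative D x) (at x)) \<and> (\<forall>b\<in>Basis. addclos X (\<lambda>x. D x b)))"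
    if "addclos X f" for f
    using that
  proof (induction)
    case (base f) then show ?case by (rule X)
  next
    case (sch f)
    then show ?case
      by (intro conjI exI[of _ "\<lambda>x. frechet_derivative f (at x)"])
         (auto intro!: addclos.sch schwartzD schwartzD(4)[unfolded pd_def])
  next
    case (add f g)
    then obtain D E where D: "\<forall>x. (f has_derivative D x) (at x)" "\<forall>b\<in>Basis. addclos X (\<lambda>x. D x b)"
      and E: "\<forall>x. (g has_derivative E x) (at x)" "\<forall>b\<in>Basis. addclos X (\<lambda>x. E x b)" by blast
    have "\<forall>x. ((\<lambda>x. f x + g x) has_derivative (\<lambda>v. D x v + E x v)) (at x)"
      using D E by (auto intro: has_derivative_add)
    moreover have "\<forall>b\<in>Basis. addclos X (\<lambda>x. D x b + E x b)" using D E by (auto intro: addclos.add)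
    ultimately have "\<exists>DD. (\<forall>x. ((\<lambda>x. f x + g x) has_derivative DD x) (at x)) \<and> (\<forall>b\<in>Basis. addclos X (\<lambda>x. DD x b))"
      by (intro exI[of _ "\<lambda>x v. D x v + E x v"] conjI)
    with add show ?case by (auto intro: rapid_add)
  qed
  have step: "addclos X (pd b f) \<and> rapid f \<and> (\<forall>x. f differentiable (at x))" if "addclos X f" "b \<in> Basis" for f b
  proof -
    from clos[OF that(1)] that(2) obtain D where D: "\<forall>x. (f has_derivative D x) (at x)" "addclos X (\<lambda>x. D x b)" "rapid f"
      by blast
    have "pd b f = (\<lambda>x. D x b)"
      using D(1) frechet_derivative_at unfolding pd_def by metis
    with D show ?thesis unfolding differentiable_def by auto
  qed
  have "addclos X (partials bs f)" if "bs \<in> lists Basis" for bs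
    using that by (induction bs) (use assms(1) step in \<open>auto simp: pd_def[symmetric] intro: addclos.base\<close>)
  then have "(\<forall>x. partials bs f differentiable (at x)) \<and> rapid (partials bs f)" if "bs \<in> lists Basis" for bs
    using that step SOME_Basis by blast
  then show ?thesis unfolding schwartz_def rapid_iff_bounded by blast
qed

lemma schwartz_continuous: "f \<in> schwartz \<Longrightarrow> continuous_on A f"
  by (meson continuous_at_imp_continuous_on differentiable_imp_continuous_within schwartzD(2))

lemma schwartz_measurable: "f \<in> schwartz \<Longrightarrow> f \<in> borel_measurable borel"
  by (intro borel_measurable_continuous_onI schwartz_continuous)

lemma schwartz_integrable: "f \<in> schwartz \<Longrightarrow> integrable lborel f"
  by (intro integrable_rapid schwartzD schwartz_measurable)

lemma schwartz_add:
  fixes f g :: "'a::euclidean_space \<Rightarrow> complex"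
  assumes "f \<in> schwartz" "g \<in> schwartz" shows "(\<lambda>x. f x + g x) \<in> schwartz"
proof (rule schwartz_coinduct[where X="\<lambda>h. \<exists>f\<in>schwartz. \<exists>g\<in>schwartz. h = (\<lambda>x. f x + g x)"])
  let ?X = "\<lambda>h. \<exists>f\<in>schwartz. \<exists>g\<in>schwartz. h = (\<lambda>x::'a. f x + g x)"
  fix h assume "?X h"
  then obtain f g where f: "f \<in> schwartz" and g: "g \<in> schwartz" and h: "h = (\<lambda>x. f x + g x)" by blast
  have "rapid h" unfolding h by (intro rapid_add schwartzD f g)
  moreover have "\<forall>x. (h has_derivative (\<lambda>v. frechet_derivative f (at x) v + frechet_derivative g (at x) v)) (at x)"
    unfolding h by (intro allI has_derivative_add schwartzD f g)
  moreover have "\<forall>b\<in>(Basis::'a set). addclos ?X (\<lambda>x. frechet_derivative f (at x) b + frechet_derivative g (at x) b)"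
    using schwartzD(4)[OF f] schwartzD(4)[OF g] unfolding pd_def by (intro ballI addclos.add addclos.sch)
  ultimately show "rapid h \<and> (\<exists>D. (\<forall>x. (h has_derivative D x) (at x)) \<and> (\<forall>b\<in>(Basis::'a set). addclos ?X (\<lambda>x. D x b)))"
    by (intro conjI exI[of _ "\<lambda>x v. frechet_derivative f (at x) v + frechet_derivative g (at x) v"])
qed (use assms in blast)

lemma schwartz_cmult:
  fixes f :: "'a::euclidean_space \<Rightarrow> complex"
  assumes "f \<in> schwartz" shows "(\<lambda>x. c * f x) \<in> schwartz"
proof (rule schwartz_coinduct[where X="\<lambda>h. \<exists>f\<in>schwartz. h = (\<lambda>x. c * f x)"])
  fix h :: "'a \<Rightarrow> complex" assume "\<exists>f\<in>schwartz. h = (\<lambda>x. c * f x)"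
  then obtain f where f: "f \<in> schwartz" and h: "h = (\<lambda>x. c * f x)" by blast
  have "rapid h" using rapid_dom[OF schwartzD(1)[OF f], of h "norm c" 0] by (simp add: h norm_mult)
  moreover have "\<forall>x. (h has_derivative (\<lambda>v. c * frechet_derivative f (at x) v)) (at x)"
    using schwartzD(3)[OF f] by (auto simp: h intro: has_derivative_mult_right)
  moreover have "\<forall>b\<in>Basis. addclos (\<lambda>h. \<exists>f\<in>schwartz. h = (\<lambda>x. c * f x)) (\<lambda>x. c * frechet_derivative f (at x) b)"
  proof
    fix b :: 'a assume b: "b \<in> Basis"
    show "addclos (\<lambda>h. \<exists>f\<in>schwartz. h = (\<lambda>x. c * f x)) (\<lambda>x. c * frechet_derivative f (at x) b)"
      by (rule addclos.base, rule bexI[of _ "pd b f"]) (simp_all add: pd_def schwartzD(4)[OF f b, unfolded pd_def])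
  qed
  ultimately show "rapid h \<and> (\<exists>D. (\<forall>x. (h has_derivative D x) (at x)) \<and>
      (\<forall>b\<in>Basis. addclos (\<lambda>h. \<exists>f\<in>schwartz. h = (\<lambda>x. c * f x)) (\<lambda>x. D x b)))"
    by (intro conjI exI[of _ "\<lambda>x v. c * frechet_derivative f (at x) v"])
qed (use assms in blast)

lemma schwartz_diff: "f \<in> schwartz \<Longrightarrow> g \<in> schwartz \<Longrightarrow> (\<lambda>x. f x - g x) \<in> schwartz"
  using schwartz_add[OF _ schwartz_cmult[of g "-1"], of f] by simp

lemma schwartz_zero: "(\<lambda>x. 0) \<in> schwartz"
proof (rule schwartz_coinduct[where X="\<lambda>h. h = (\<lambda>x. 0)"])
  fix h :: "'a \<Rightarrow> complex" assume h: "h = (\<lambda>x. 0)"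
  have "rapid h" unfolding rapid_def h by (auto intro!: exI[of _ 0])
  moreover have "\<forall>x. (h has_derivative (\<lambda>v. 0)) (at x)" by (simp add: h)
  moreover have "\<forall>b\<in>(Basis::'a set). addclos (\<lambda>h. h = (\<lambda>x. 0)) (\<lambda>x. 0)" by (simp add: addclos.base)
  ultimately show "rapid h \<and> (\<exists>D. (\<forall>x. (h has_derivative D x) (at x)) \<and> (\<forall>b\<in>Basis. addclos (\<lambda>h. h = (\<lambda>x. 0)) (\<lambda>x. D x b)))"
    by (intro conjI exI[of _ "\<lambda>x v. 0"])
qed simp

lemma schwartz_sum: "(\<And>i. i \<in> I \<Longrightarrow> f i \<in> schwartz) \<Longrightarrow> (\<lambda>x. \<Sum>i\<in>I. f i x) \<in> schwartz"
  by (induction I rule: infinite_finite_induct) (simp_all add: schwartz_zero schwartz_add)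

lemma schwartz_mult:
  fixes f g :: "'a::euclidean_space \<Rightarrow> complex"
  assumes "f \<in> schwartz" "g \<in> schwartz" shows "(\<lambda>x. f x * g x) \<in> schwartz"
proof (rule schwartz_coinduct[where X="\<lambda>h. \<exists>f\<in>schwartz. \<exists>g\<in>schwartz. h = (\<lambda>x. f x * g x)"])
  let ?X = "\<lambda>h. \<exists>f\<in>schwartz. \<exists>g\<in>schwartz. h = (\<lambda>x::'a. f x * g x)"
  fix h assume "?X h"
  then obtain f g where f: "f \<in> schwartz" and g: "g \<in> schwartz" and h: "h = (\<lambda>x. f x * g x)" by blast
  obtain C where C: "\<And>x. norm (g x) \<le> C" using rapidE[OF schwartzD(1)[OF g], of 0] by auto
  have "norm (h x) \<le> C * (1 + norm x) ^ 0 * norm (f x)" for x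
    using mult_left_mono[OF C[of x], of "norm (f x)"] by (simp add: h norm_mult mult.commute)
  then have "rapid h" by (rule rapid_dom[OF schwartzD(1)[OF f]])
  moreover have "\<forall>x. (h has_derivative (\<lambda>v. f x * frechet_derivative g (at x) v + frechet_derivative f (at x) v * g x)) (at x)"
    using has_derivative_mult[OF schwartzD(3)[OF f] schwartzD(3)[OF g]] by (simp add: h)
  moreover have "\<forall>b\<in>Basis. addclos ?X (\<lambda>x. f x * frechet_derivative g (at x) b + frechet_derivative f (at x) b * g x)"
  proof
    fix b :: 'a assume b: "b \<in> Basis"
    have "?X (\<lambda>x. f x * pd b g x)" "?X (\<lambda>x. pd b f x * g x)"
      using f g schwartzD(4)[OF f b] schwartzD(4)[OF g b] by blast+
    then show "addclos ?X (\<lambda>x. f x * frechet_derivative g (at x) b + frechet_derivative f (at x) b * g x)"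
      unfolding pd_def by (intro addclos.add addclos.base)
  qed
  ultimately show "rapid h \<and> (\<exists>D. (\<forall>x. (h has_derivative D x) (at x)) \<and> (\<forall>b\<in>Basis. addclos ?X (\<lambda>x. D x b)))"
    by (intro conjI exI[of _ "\<lambda>x v. f x * frechet_derivative g (at x) v + frechet_derivative f (at x) v * g x"])
qed (use assms in blast)

lemma schwartz_coord:
  fixes f :: "'a::euclidean_space \<Rightarrow> complex"
  assumes "f \<in> schwartz" shows "(\<lambda>x. complex_of_real (x \<bullet> b) * f x) \<in> schwartz"
proof (rule schwartz_coinduct[where X="\<lambda>h. \<exists>f\<in>schwartz. h = (\<lambda>x. complex_of_real (x \<bullet> b) * f x)"])
  let ?X = "\<lambda>h. \<exists>f\<in>schwartz. h = (\<lambda>x::'a. complex_of_real (x \<bullet> b) * f x)"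
  fix h assume "?X h"
  then obtain f where f: "f \<in> schwartz" and h: "h = (\<lambda>x. complex_of_real (x \<bullet> b) * f x)" by blast
  have "norm (h x) \<le> norm b * (1 + norm x) ^ 1 * norm (f x)" for x
  proof -
    have "\<bar>x \<bullet> b\<bar> \<le> norm b * (1 + norm x)"
      by (rule order_trans[OF Cauchy_Schwarz_ineq2]) (simp add: distrib_left mult.commute)
    then show ?thesis using mult_right_mono[of _ _ "norm (f x)"] by (simp add: h norm_mult)
  qed
  then have "rapid h" by (rule rapid_dom[OF schwartzD(1)[OF f]])
  moreover have "\<forall>x. (h has_derivative (\<lambda>v. complex_of_real (x \<bullet> b) * frechet_derivative f (at x) v + complex_of_real (v \<bullet> b) * f x)) (at x)"
    unfolding h by (intro allI has_derivative_mult schwartzD(3)[OF f]) (auto intro!: derivative_eq_intros)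
  moreover have "\<forall>c\<in>Basis. addclos ?X (\<lambda>x. complex_of_real (x \<bullet> b) * frechet_derivative f (at x) c + complex_of_real (c \<bullet> b) * f x)"
  proof
    fix c :: 'a assume c: "c \<in> Basis"
    have "?X (\<lambda>x. complex_of_real (x \<bullet> b) * pd c f x)"
      using schwartzD(4)[OF f c] by blast
    then show "addclos ?X (\<lambda>x. complex_of_real (x \<bullet> b) * frechet_derivative f (at x) c + complex_of_real (c \<bullet> b) * f x)"
      unfolding pd_def by (intro addclos.add addclos.sch[OF schwartz_cmult[OF f]] addclos.base)
  qed
  ultimately show "rapid h \<and> (\<exists>D. (\<forall>x. (h has_derivative D x) (at x)) \<and> (\<forall>b\<in>Basis. addclos ?X (\<lambda>x. D x b)))"
    by (intro conjI exI[of _ "\<lambda>x v. complex_of_real (x \<bullet> b) * frechet_derivative f (at x) v + complex_of_real (v \<bullet> b) * f x"])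
qed (use assms in blast)

lemma schwartz_affine:
  fixes f :: "'a::euclidean_space \<Rightarrow> complex"
  assumes "f \<in> schwartz" and c: "c \<noteq> 0" shows "(\<lambda>x. f (t + c *\<^sub>R x)) \<in> schwartz"
proof (rule schwartz_coinduct[where X="\<lambda>h. \<exists>f\<in>schwartz. h = (\<lambda>x. f (t + c *\<^sub>R x))"])
  let ?X = "\<lambda>h. \<exists>f\<in>schwartz. h = (\<lambda>x::'a. f (t + c *\<^sub>R x))"
  fix h assume "?X h"
  then obtain f where f: "f \<in> schwartz" and h: "h = (\<lambda>x. f (t + c *\<^sub>R x))" by blast
  have "rapid h"
    unfolding rapid_def
  proof
    fix N
    obtain C where C: "\<And>x. (1 + norm x) ^ N * norm (f x) \<le> C"
      using schwartzD(1)[OF f] unfolding rapid_def by blast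
    \<comment> \<open>From |x| \<le> (|t + c x| + |t|) / |c|, arranged as a product so that N-th
      powers can be taken factor by factor.\<close>
    define A where "A = (1 + 1 / \<bar>c\<bar>) * (1 + norm t)"
    have "(1 + norm x) ^ N * norm (h x) \<le> A ^ N * C" for x
    proof -
      have "norm x = norm ((t + c *\<^sub>R x) - t) / \<bar>c\<bar>" using c by simp
      also have "\<dots> \<le> (norm (t + c *\<^sub>R x) + norm t) / \<bar>c\<bar>"
        by (intro divide_right_mono norm_triangle_ineq4) simp
      finally have 1: "norm x \<le> (norm (t + c *\<^sub>R x) + norm t) * (1 / \<bar>c\<bar>)" by simp
      define u where "u = norm (t + c *\<^sub>R x)"
      define w where "w = norm t"
      define k where "k = 1 / \<bar>c\<bar>"
      have nn: "u \<ge> 0" "w \<ge> 0" "k \<ge> 0" by (auto simp: u_def w_def k_def)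
      have "1 + norm x \<le> 1 + (u + w) * k" using 1 by (simp add: u_def w_def k_def)
      also have "\<dots> \<le> (1 + k) * (1 + w) * (1 + u)"
        using nn by (simp add: algebra_simps add_nonneg_nonneg)
      finally have "1 + norm x \<le> A * (1 + u)" by (simp add: A_def k_def w_def)
      then have "(1 + norm x) ^ N \<le> (A * (1 + u)) ^ N" by (intro power_mono) auto
      then have "(1 + norm x) ^ N * norm (h x) \<le> A ^ N * ((1 + u) ^ N * norm (h x))"
        using mult_right_mono[OF _ norm_ge_zero[of "h x"]] by (simp add: power_mult_distrib mult.assoc[symmetric])
      also have "\<dots> \<le> A ^ N * C"
        using C[of "t + c *\<^sub>R x"] by (intro mult_left_mono) (auto simp: A_def h u_def)
      finally show ?thesis .
    qed
    then show "\<exists>C. \<forall>x. (1 + norm x) ^ N * norm (h x) \<le> C" by blast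
  qed
  moreover have D: "\<forall>x. (h has_derivative (\<lambda>v. frechet_derivative f (at (t + c *\<^sub>R x)) (c *\<^sub>R v))) (at x)"
    unfolding h by (intro allI has_derivative_compose[of "\<lambda>x. t + c *\<^sub>R x" "\<lambda>v. c *\<^sub>R v" _ _ f] schwartzD(3)[OF f])
      (auto intro!: derivative_eq_intros)
  moreover have "\<forall>b\<in>Basis. addclos ?X (\<lambda>x. frechet_derivative f (at (t + c *\<^sub>R x)) (c *\<^sub>R b))"
  proof
    fix b :: 'a assume b: "b \<in> Basis"
    \<comment> \<open>The factor \<open>c\<close> of the chain rule is absorbed into the Schwartz
      function, so that the derivative is again an affine pullback.\<close>
    have "frechet_derivative f (at z) (c *\<^sub>R b) = complex_of_real c * pd b f z" for z
      using linear_scale[OF has_derivative_linear[OF schwartzD(3)[OF f]]] by (simp add: pd_def scaleR_conv_of_real)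
    then have "(\<lambda>x. frechet_derivative f (at (t + c *\<^sub>R x)) (c *\<^sub>R b)) = (\<lambda>x. (\<lambda>z. complex_of_real c * pd b f z) (t + c *\<^sub>R x))"
      by simp
    then show "addclos ?X (\<lambda>x. frechet_derivative f (at (t + c *\<^sub>R x)) (c *\<^sub>R b))"
      by (rule addclos.base[where X="?X", OF bexI[OF _ schwartz_cmult[OF schwartzD(4)[OF f b], of "complex_of_real c"]]])
  qed
  ultimately show "rapid h \<and> (\<exists>D. (\<forall>x. (h has_derivative D x) (at x)) \<and> (\<forall>b\<in>Basis. addclos ?X (\<lambda>x. D x b)))"
    by (intro conjI exI[of _ "\<lambda>x v. frechet_derivative f (at (t + c *\<^sub>R x)) (c *\<^sub>R v)"])
qed (use assms in blast)

lemma schwartz_reflect: "f \<in> schwartz \<Longrightarrow> (\<lambda>s. f (t - s)) \<in> schwartz"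
  using schwartz_affine[of f "-1" t] by simp

lemma frechet_derivative_expansion:
  assumes "f \<in> schwartz"
  shows "frechet_derivative f (at x) v = (\<Sum>b\<in>Basis. complex_of_real (v \<bullet> b) * pd b f x)"
proof -
  interpret linear "frechet_derivative f (at x)"
    by (rule has_derivative_linear[OF schwartzD(3)[OF assms]])
  have "frechet_derivative f (at x) v = frechet_derivative f (at x) (\<Sum>b\<in>Basis. (v \<bullet> b) *\<^sub>R b)"
    by (simp add: euclidean_representation)
  then show ?thesis by (simp add: sum scale pd_def scaleR_conv_of_real)
qed

lemma schwartz_deriv_decay:
  assumes f: "f \<in> schwartz"
  obtains C where "C > 0" "\<And>x v. (1 + norm x) ^ N * norm (frechet_derivative f (at x) v) \<le> C * norm v"
proof -
  have "\<forall>b\<in>Basis. \<exists>C. \<forall>x. (1 + norm x) ^ N * norm (pd b f x) \<le> C"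
    using schwartzD(1)[OF schwartzD(4)[OF f]] unfolding rapid_def by blast
  then obtain C where C: "\<And>b x. b \<in> Basis \<Longrightarrow> (1 + norm x) ^ N * norm (pd b f x) \<le> C b"
    by (metis (no_types))
  have C0: "C b \<ge> 0" if "b \<in> Basis" for b
    using C[OF that, of 0] by (auto intro: order_trans[OF norm_ge_zero])
  have "(1 + norm x) ^ N * norm (frechet_derivative f (at x) v) \<le> (1 + (\<Sum>b\<in>Basis. C b)) * norm v" for x v
  proof -
    have "(1 + norm x) ^ N * norm (frechet_derivative f (at x) v)
        \<le> (1 + norm x) ^ N * (\<Sum>b\<in>Basis. norm v * norm (pd b f x))"
      unfolding frechet_derivative_expansion[OF f]
      by (intro mult_left_mono sum_norm_le) (auto simp: norm_mult Basis_le_norm intro!: mult_right_mono)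
    also have "\<dots> = (\<Sum>b\<in>Basis. (1 + norm x) ^ N * norm (pd b f x)) * norm v"
      by (simp add: sum_distrib_left sum_distrib_right mult_ac)
    also have "\<dots> \<le> (\<Sum>b\<in>Basis. C b) * norm v"
      by (intro mult_right_mono sum_mono C) auto
    also have "\<dots> \<le> (1 + (\<Sum>b\<in>Basis. C b)) * norm v" by (simp add: distrib_right)
    finally show ?thesis .
  qed
  moreover have "1 + (\<Sum>b\<in>Basis. C b) > 0" using C0 by (simp add: add_pos_nonneg sum_nonneg)
  ultimately show thesis by (rule that[rotated])
qed

text \<open>The mean value inequality on the segment from x - s to y - s. Its points t satisfy |t +
  s| \<le> R, so the weight in \<open>s\<close> is traded for the decay of the derivative at t, at
  the cost of (1 + R)^N.\<close>

lemma schwartz_weighted_lipschitz: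
  assumes f: "f \<in> schwartz"
  obtains C where "C > 0"
    "\<And>x y s R. norm x \<le> R \<Longrightarrow> norm y \<le> R \<Longrightarrow>
        (1 + norm s) ^ N * norm (f (x - s) - f (y - s)) \<le> C * (1 + R) ^ N * norm (x - y)"
proof -
  obtain C where C: "C > 0" "\<And>x v. (1 + norm x) ^ N * norm (frechet_derivative f (at x) v) \<le> C * norm v"
    using schwartz_deriv_decay[OF f, of N] by blast
  have "(1 + norm s) ^ N * norm (f (x - s) - f (y - s)) \<le> C * (1 + R) ^ N * norm (x - y)"
    if R: "norm x \<le> R" "norm y \<le> R" for x y s R
  proof -
    let ?B = "C * (1 + R) ^ N / (1 + norm s) ^ N"
    have R0: "0 \<le> R" using R(1) norm_ge_zero[of x] by linarith
    have p: "0 < (1 + norm s) ^ N" by (intro zero_less_power) (simp add: add_pos_nonneg)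
    have "norm (f (x - s) - f (y - s)) \<le> ?B * norm ((x - s) - (y - s))"
    proof (rule differentiable_bound[where S="closed_segment (x - s) (y - s)" and f=f
          and f'="\<lambda>t. frechet_derivative f (at t)" and B="?B" and x="x - s" and y="y - s"])
      fix t assume t: "t \<in> closed_segment (x - s) (y - s)"
      show "(f has_derivative frechet_derivative f (at t)) (at t within closed_segment (x - s) (y - s))"
        by (rule has_derivative_at_withinI[OF schwartzD(3)[OF f]])
      have "t + s \<in> closed_segment x y"
        using t by (auto simp: in_segment algebra_simps)
      then have tR: "norm (t + s) \<le> R"
        using segment_bound_lemma R convex_cball[of 0 R] closed_segment_subset[of x "cball 0 R" y] by auto
      show "onorm (frechet_derivative f (at t)) \<le> ?B"
      proof (rule onorm_le)
        fix v
        have "(1 + norm s) ^ N \<le> (1 + R) ^ N * (1 + norm t) ^ N"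
        proof -
          have "(1 + norm s) ^ N \<le> (1 + norm (t + s)) ^ N * (1 + norm (s - (t + s))) ^ N"
            by (rule one_plus_norm_power_triangle)
          also have "\<dots> \<le> (1 + R) ^ N * (1 + norm t) ^ N"
            using tR R0 by (intro mult_mono power_mono) auto
          finally show ?thesis .
        qed
        then have "(1 + norm s) ^ N * norm (frechet_derivative f (at t) v)
           \<le> (1 + R) ^ N * ((1 + norm t) ^ N * norm (frechet_derivative f (at t) v))"
          using mult_right_mono[OF _ norm_ge_zero[of "frechet_derivative f (at t) v"]] by (simp add: mult.assoc[symmetric])
        also have "\<dots> \<le> (1 + R) ^ N * (C * norm v)"
          using R0 by (intro mult_left_mono C) auto
        finally show "norm (frechet_derivative f (at t) v) \<le> ?B * norm v"
          using p by (simp add: pos_le_divide_eq mult_ac)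
      qed
    qed auto
    then show ?thesis using p by (simp add: pos_le_divide_eq mult_ac)
  qed
  with C(1) show thesis by (rule that)
qed

subsection \<open>Superpositions of translates and tempered distributions\<close>

lemma schwartz_lipschitz:
  assumes f: "f \<in> schwartz"
  obtains C where "C > 0" "\<And>x y. norm (f x - f y) \<le> C * norm (x - y)"
proof -
  obtain C where C: "C > 0" "\<And>x y s R. norm x \<le> R \<Longrightarrow> norm y \<le> R \<Longrightarrow>
        (1 + norm s) ^ 0 * norm (f (x - s) - f (y - s)) \<le> C * (1 + R) ^ 0 * norm (x - y)"
    using schwartz_weighted_lipschitz[OF f, of 0] by blast
  have "norm (f x - f y) \<le> C * norm (x - y)" for x y
    using C(2)[of x "max (norm x) (norm y)" y 0] by simp
  with C(1) show thesis by (rule that)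
qed

text \<open>
  For \<open>F y = y\<close> this is a convolution; for simple \<open>F\<close> it is a finite combination of translates, on which a
  distribution acts termwise. Approximating the identity by simple functions thus moves a distribution
  under the integral sign.
\<close>

definition superpos :: "('a::euclidean_space \<Rightarrow> complex) \<Rightarrow> ('a \<Rightarrow> 'a) \<Rightarrow> ('a \<Rightarrow> complex) \<Rightarrow> 'a \<Rightarrow> complex" where
  "superpos \<psi> F K = (\<lambda>s. LINT y|lborel. \<psi> y * K (F y - s))"

text \<open>The bound \<open>2 * norm y\<close> is what the approximation of the identity by simple
  functions provides; it turns weights in \<open>F y\<close> into weights in \<open>y\<close>,
  uniformly in \<open>F\<close>.\<close>

definition admissible :: "('a::euclidean_space \<Rightarrow> complex) \<Rightarrow> ('a \<Rightarrow> 'a) \<Rightarrow> bool" where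
  "admissible \<psi> F \<longleftrightarrow> \<psi> \<in> borel_measurable borel \<and> rapid \<psi> \<and> F \<in> borel_measurable borel \<and>
     (\<forall>y. norm (F y) \<le> 2 * norm y)"

lemma rapid_integrable_weight:
  fixes \<psi> :: "'a::euclidean_space \<Rightarrow> complex"
  assumes "rapid \<psi>" "\<psi> \<in> borel_measurable borel" "g \<in> borel_measurable borel"
    and "\<And>y. norm (g y) \<le> A * (1 + norm y) ^ m"
  shows "integrable lborel (\<lambda>y. \<psi> y * g y)" "integrable lborel (\<lambda>y. norm (\<psi> y) * norm (g y))"
proof -
  have "rapid (\<lambda>y. \<psi> y * g y)"
    using mult_left_mono[OF assms(4) norm_ge_zero]
    by (intro rapid_dom[OF assms(1), of _ A m]) (simp add: norm_mult mult_ac)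
  then show *: "integrable lborel (\<lambda>y. \<psi> y * g y)"
    by (rule integrable_rapid) (use assms in measurable)
  show "integrable lborel (\<lambda>y. norm (\<psi> y) * norm (g y))"
    using integrable_norm[OF *] by (simp add: norm_mult)
qed

lemma admissible_integrable:
  assumes "admissible \<psi> F" "K \<in> schwartz"
  shows "integrable lborel (\<lambda>y. \<psi> y * K (F y - s))"
proof -
  have [measurable]: "K \<in> borel_measurable borel" "F \<in> borel_measurable borel"
    using assms schwartz_measurable by (auto simp: admissible_def)
  obtain C where "\<And>x. norm (K x) \<le> C" using rapidE[OF schwartzD(1)[OF assms(2)], of 0] by auto
  then show ?thesis
    using assms(1) by (intro rapid_integrable_weight(1)[of _ _ C 0]) (auto simp: admissible_def)
qed

lemma superpos_has_derivative:
  assumes adm: "admissible \<psi> F" and K: "K \<in> schwartz"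
  shows "(superpos \<psi> F K has_derivative (\<lambda>v. LINT y|lborel. \<psi> y * frechet_derivative K (at (F y - s)) (- v))) (at s)"
  unfolding superpos_def
proof -
  have [measurable]: "F \<in> borel_measurable borel" "\<psi> \<in> borel_measurable borel"
    using adm by (auto simp: admissible_def)
  obtain C where C: "C > 0" "\<And>x y. norm (K x - K y) \<le> C * norm (x - y)"
    using schwartz_lipschitz[OF K] by blast
  obtain C' where C': "C' > 0" "\<And>x v. (1 + norm x) ^ 0 * norm (frechet_derivative K (at x) v) \<le> C' * norm v"
    using schwartz_deriv_decay[OF K, of 0] by blast
  show "((\<lambda>s. LINT y|lborel. \<psi> y * K (F y - s)) has_derivative
     (\<lambda>v. LINT y|lborel. \<psi> y * frechet_derivative K (at (F y - s)) (- v))) (at s)"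
  proof (rule has_derivative_integral_dominated[where L="\<lambda>y. max C C' * norm (\<psi> y)"])
    show "integrable lborel (\<lambda>y. \<psi> y * K (F y - s))" for s
      by (rule admissible_integrable[OF adm K])
    show "((\<lambda>s. \<psi> y * K (F y - s)) has_derivative (\<lambda>v. \<psi> y * frechet_derivative K (at (F y - s)) (- v))) (at s)" for y
      by (intro has_derivative_mult_right has_derivative_compose[of "\<lambda>s. F y - s" "\<lambda>v. - v" _ _ K] schwartzD(3) K)
         (auto intro!: derivative_eq_intros)
    show "(\<lambda>y. \<psi> y * frechet_derivative K (at (F y - s)) (- v)) \<in> borel_measurable lborel" for v
    proof -
      have [measurable]: "pd b K \<in> borel_measurable borel" if "b \<in> Basis" for b
        using schwartzD(4)[OF K that] by (rule schwartz_measurable)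
      show ?thesis unfolding frechet_derivative_expansion[OF K] by measurable
    qed
    show "integrable lborel (\<lambda>y. max C C' * norm (\<psi> y))"
      using adm by (intro integrable_mult_right integrable_norm integrable_rapid) (auto simp: admissible_def)
    show "norm (\<psi> y * frechet_derivative K (at (F y - s)) (- v)) \<le> max C C' * norm (\<psi> y) * norm v" for y v
    proof -
      have "norm (frechet_derivative K (at (F y - s)) (- v)) \<le> C' * norm v" using C'(2)[of "F y - s" "- v"] by simp
      also have "\<dots> \<le> max C C' * norm v" by (intro mult_right_mono) auto
      finally have "norm (\<psi> y) * norm (frechet_derivative K (at (F y - s)) (- v)) \<le> norm (\<psi> y) * (max C C' * norm v)"
        by (intro mult_left_mono) auto
      then show ?thesis by (simp add: norm_mult mult_ac)
    qed
    show "norm (\<psi> y * K (F y - s') - \<psi> y * K (F y - s)) \<le> max C C' * norm (\<psi> y) * norm (s' - s)" for y s'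
    proof -
      have "norm (K (F y - s') - K (F y - s)) \<le> C * norm (s' - s)"
        using C(2)[of "F y - s'" "F y - s"] by (simp add: norm_minus_commute)
      also have "\<dots> \<le> max C C' * norm (s' - s)" by (intro mult_right_mono) auto
      finally have "norm (\<psi> y) * norm (K (F y - s') - K (F y - s)) \<le> norm (\<psi> y) * (max C C' * norm (s' - s))"
        by (intro mult_left_mono) auto
      then show ?thesis by (simp add: norm_mult mult_ac right_diff_distrib[symmetric])
    qed
  qed
qed

lemma pd_eqI: "(\<And>x. (f has_derivative D x) (at x)) \<Longrightarrow> pd b f = (\<lambda>x. D x b)"
  unfolding pd_def using frechet_derivative_at by metis

lemma frechet_derivative_minus_Basis:
  "K \<in> schwartz \<Longrightarrow> frechet_derivative K (at x) (- b) = - pd b K x"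
  using linear_neg[OF has_derivative_linear[OF schwartzD(3)]] by (simp add: pd_def)

text \<open>A derivative in \<open>s\<close> falls on \<open>K\<close> alone, with sign -1;
  superpositions are thus closed under differentiation with \<open>\<psi>\<close> and
  \<open>F\<close> fixed.\<close>

lemma pd_superpos:
  assumes "admissible \<psi> F" "K \<in> schwartz"
  shows "pd b (superpos \<psi> F K) = superpos \<psi> F (\<lambda>x. (-1) * pd b K x)"
proof -
  have "pd b (superpos \<psi> F K) = (\<lambda>s. LINT y|lborel. \<psi> y * frechet_derivative K (at (F y - s)) (- b))"
    by (rule pd_eqI[OF superpos_has_derivative[OF assms]])
  then show ?thesis unfolding superpos_def frechet_derivative_minus_Basis[OF assms(2)] by simp
qed

text \<open>The weight at \<open>s\<close> splits into a weight at \<open>F y\<close>, absorbed by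
  the decay of \<open>\<psi>\<close>, and one at \<open>F y - s\<close>, absorbed by the decay of
  \<open>K\<close>.\<close>

lemma superpos_rapid:
  assumes adm: "admissible \<psi> F" and K: "K \<in> schwartz"
  shows "rapid (superpos \<psi> F K)"
  unfolding rapid_def
proof
  fix N
  have [measurable]: "F \<in> borel_measurable borel" "\<psi> \<in> borel_measurable borel" "K \<in> borel_measurable borel"
    using adm schwartz_measurable[OF K] by (auto simp: admissible_def)
  obtain C where C: "C > 0" "\<And>x. (1 + norm x) ^ N * norm (K x) \<le> C"
    using rapidE[OF schwartzD(1)[OF K], of N] by blast
  have int: "integrable lborel (\<lambda>y. norm (\<psi> y) * norm (complex_of_real ((1 + 2 * norm y) ^ N)))"
  proof (rule rapid_integrable_weight(2))
    show "norm (complex_of_real ((1 + 2 * norm y) ^ N)) \<le> 2 ^ N * (1 + norm y) ^ N" for y :: 'a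
      unfolding power_mult_distrib[symmetric] norm_of_real by (auto intro!: power_mono simp: power_abs)
  qed (use adm in \<open>auto simp: admissible_def\<close>)
  let ?I = "LINT y|lborel. norm (\<psi> y) * norm (complex_of_real ((1 + 2 * norm y) ^ N)) * C"
  have "(1 + norm s) ^ N * norm (superpos \<psi> F K s) \<le> ?I" for s
  proof -
    have "(1 + norm s) ^ N * norm (superpos \<psi> F K s) = norm (LINT y|lborel. complex_of_real ((1 + norm s) ^ N) * (\<psi> y * K (F y - s)))"
      by (simp add: superpos_def norm_mult norm_power del: of_real_power)
    also have "\<dots> \<le> ?I"
    proof (rule order_trans[OF integral_norm_bound integral_mono])
      show "integrable lborel (\<lambda>y. norm (complex_of_real ((1 + norm s) ^ N) * (\<psi> y * K (F y - s))))"
        by (intro integrable_norm integrable_mult_right admissible_integrable adm K)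
      show "integrable lborel (\<lambda>y. norm (\<psi> y) * norm (complex_of_real ((1 + 2 * norm y) ^ N)) * C)"
        by (intro integrable_mult_left int)
      fix y
      have "(1 + norm s) ^ N * norm (K (F y - s)) \<le> ((1 + norm (F y)) ^ N * (1 + norm (s - F y)) ^ N) * norm (K (F y - s))"
        by (intro mult_right_mono one_plus_norm_power_triangle) auto
      also have "\<dots> = (1 + norm (F y)) ^ N * ((1 + norm (F y - s)) ^ N * norm (K (F y - s)))"
        by (simp add: norm_minus_commute)
      also have "\<dots> \<le> (1 + 2 * norm y) ^ N * C"
        using adm by (intro mult_mono power_mono C) (auto simp: admissible_def)
      finally have "norm (\<psi> y) * ((1 + norm s) ^ N * norm (K (F y - s))) \<le> norm (\<psi> y) * ((1 + 2 * norm y) ^ N * C)"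
        by (intro mult_left_mono) auto
      then show "norm (complex_of_real ((1 + norm s) ^ N) * (\<psi> y * K (F y - s))) \<le> norm (\<psi> y) * norm (complex_of_real ((1 + 2 * norm y) ^ N)) * C"
        unfolding norm_mult norm_of_real by (simp add: mult_ac power_abs)
    qed
    finally show ?thesis .
  qed
  then show "\<exists>C. \<forall>s. (1 + norm s) ^ N * norm (superpos \<psi> F K s) \<le> C" by blast
qed

lemma superpos_schwartz:
  fixes K :: "'a::euclidean_space \<Rightarrow> complex"
  assumes adm: "admissible \<psi> F" and K: "K \<in> schwartz"
  shows "superpos \<psi> F K \<in> schwartz"
proof (rule schwartz_coinduct[where X="\<lambda>h. \<exists>K\<in>schwartz. h = superpos \<psi> F K"])
  fix h :: "'a \<Rightarrow> complex" assume "\<exists>K\<in>schwartz. h = superpos \<psi> F K"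
  then obtain K where K: "K \<in> schwartz" and h: "h = superpos \<psi> F K" by blast
  let ?D = "\<lambda>s v. LINT y|lborel. \<psi> y * frechet_derivative K (at (F y - s)) (- v)"
  have D: "(h has_derivative ?D s) (at s)" for s
    unfolding h by (rule superpos_has_derivative[OF adm K])
  have "addclos (\<lambda>h. \<exists>K\<in>schwartz. h = superpos \<psi> F K) (\<lambda>s. ?D s b)" if b: "b \<in> Basis" for b
  proof (rule addclos.base)
    have "(\<lambda>s. ?D s b) = pd b h" by (rule pd_eqI[OF D, symmetric])
    then show "\<exists>K\<in>schwartz. (\<lambda>s. ?D s b) = superpos \<psi> F K"
      using pd_superpos[OF adm K] schwartz_cmult[OF schwartzD(4)[OF K b]] by (metis h)
  qed
  with D superpos_rapid[OF adm K] show "rapid h \<and> (\<exists>D. (\<forall>x. (h has_derivative D x) (at x)) \<and>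
     (\<forall>b\<in>Basis. addclos (\<lambda>h. \<exists>K\<in>schwartz. h = superpos \<psi> F K) (\<lambda>x. D x b)))"
    unfolding h by (intro conjI exI[of _ ?D]) auto
qed (use K in blast)

text \<open>The point is the order of the quantifiers: one \<open>K'\<close> serves all
  \<open>\<psi>\<close> and \<open>F\<close>, which makes the constant of the difference estimate
  below uniform.\<close>

lemma partials_superpos:
  fixes K :: "'a::euclidean_space \<Rightarrow> complex"
  assumes K: "K \<in> schwartz" and bs: "bs \<in> lists Basis"
  obtains K' where "K' \<in> schwartz" "\<And>\<psi> F. admissible \<psi> F \<Longrightarrow> partials bs (superpos \<psi> F K) = superpos \<psi> F K'"
proof -
  have "\<exists>K'\<in>schwartz. \<forall>\<psi> F. admissible \<psi> F \<longrightarrow> partials bs (superpos \<psi> F K) = superpos \<psi> F K'"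
    using bs
  proof (induction bs)
    case Nil
    then show ?case using K by auto
  next
    case (Cons b bs)
    then obtain K' where K': "K' \<in> schwartz" "\<And>\<psi> F. admissible \<psi> F \<Longrightarrow> partials bs (superpos \<psi> F K) = superpos \<psi> F K'"
      by auto
    show ?case
      using pd_superpos[OF _ K'(1)] K' schwartz_cmult[OF schwartzD(4)[OF K'(1) Cons.hyps(1)], of "-1"]
      unfolding partials_Cons by (metis (no_types, lifting))
  qed
  then show thesis using that by blast
qed

section \<open>Seminorm estimates for translates and superpositions, and the action of a tempered
  distribution on them\<close>

lemma pd_reflect:
  assumes "K \<in> schwartz"
  shows "pd b (\<lambda>s. K (y - s)) = (\<lambda>s. (-1) * pd b K (y - s))"
proof -
  have "((\<lambda>s. K (y - s)) has_derivative (\<lambda>v. frechet_derivative K (at (y - s)) (- v))) (at s)" for s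
    by (intro has_derivative_compose[of "\<lambda>s. y - s" "\<lambda>v. - v" _ _ K] schwartzD(3) assms)
       (auto intro!: derivative_eq_intros)
  from pd_eqI[OF this] show ?thesis by (simp add: frechet_derivative_minus_Basis[OF assms])
qed

lemma partials_reflect:
  fixes K :: "'a::euclidean_space \<Rightarrow> complex"
  assumes K: "K \<in> schwartz" and bs: "bs \<in> lists Basis"
  obtains K' where "K' \<in> schwartz" "\<And>y. partials bs (\<lambda>s. K (y - s)) = (\<lambda>s. K' (y - s))"
proof -
  have "\<exists>K'\<in>schwartz. \<forall>y. partials bs (\<lambda>s. K (y - s)) = (\<lambda>s. K' (y - s))"
    using bs
  proof (induction bs)
    case Nil
    then show ?case using K by auto
  next
    case (Cons b bs)
    then obtain K' where K': "K' \<in> schwartz" "\<And>y. partials bs (\<lambda>s. K (y - s)) = (\<lambda>s. K' (y - s))"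
      by auto
    have "partials (b # bs) (\<lambda>s. K (y - s)) = (\<lambda>s. (\<lambda>x. (-1) * pd b K' x) (y - s))" for y
      unfolding partials_Cons K'(2) pd_reflect[OF K'(1)] ..
    then show ?case by (intro bexI[OF _ schwartz_cmult[OF schwartzD(4)[OF K'(1) Cons.hyps(1)], of "-1"]] allI)
  qed
  then show thesis using that by blast
qed

lemma partials_diff:
  assumes "f \<in> schwartz" "g \<in> schwartz" "bs \<in> lists Basis"
  shows "partials bs (\<lambda>x. f x - g x) = (\<lambda>x. partials bs f x - partials bs g x)"
  using assms(3)
proof (induction bs)
  case (Cons b bs)
  have S: "partials bs f \<in> schwartz" "partials bs g \<in> schwartz"
    using schwartzD(5)[OF assms(1)] schwartzD(5)[OF assms(2)] Cons by auto
  have "pd b (\<lambda>x. partials bs f x - partials bs g x) = (\<lambda>x. frechet_derivative (partials bs f) (at x) b - frechet_derivative (partials bs g) (at x) b)"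
    by (rule pd_eqI[OF has_derivative_diff[OF schwartzD(3)[OF S(1)] schwartzD(3)[OF S(2)]]])
  with Cons show ?case unfolding partials_Cons by (simp add: pd_def)
qed simp

lemma finite_multiindices: "finite {bs. bs \<in> lists (Basis::'a::euclidean_space set) \<and> length bs \<le> N}"
  using finite_lists_length_le[of "Basis::'a set" N] by (simp add: lists_eq_set)

lemma schwartz_norm_le:
  fixes f :: "'a::euclidean_space \<Rightarrow> complex"
  assumes "\<And>bs x. bs \<in> lists Basis \<Longrightarrow> length bs \<le> N \<Longrightarrow> (1 + norm x) ^ N * norm (partials bs f x) \<le> B bs"
  shows "schwartz_norm N f \<le> (\<Sum>bs | bs \<in> lists (Basis::'a set) \<and> length bs \<le> N. B bs)"
  unfolding schwartz_norm_def using assms by (intro sum_mono cSUP_least) auto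

lemma temperedD:
  assumes "tempered u"
  shows "f \<in> schwartz \<Longrightarrow> g \<in> schwartz \<Longrightarrow> u (\<lambda>x. f x + g x) = u f + u g"
    "f \<in> schwartz \<Longrightarrow> u (\<lambda>x. c * f x) = c * u f"
    "f \<in> schwartz \<Longrightarrow> g \<in> schwartz \<Longrightarrow> u (\<lambda>x. f x - g x) = u f - u g"
proof -
  show 1: "f \<in> schwartz \<Longrightarrow> g \<in> schwartz \<Longrightarrow> u (\<lambda>x. f x + g x) = u f + u g" for f g
    using assms unfolding tempered_def by blast
  show 2: "f \<in> schwartz \<Longrightarrow> u (\<lambda>x. c * f x) = c * u f" for f c
    using assms unfolding tempered_def by blast
  show "f \<in> schwartz \<Longrightarrow> g \<in> schwartz \<Longrightarrow> u (\<lambda>x. f x - g x) = u f - u g"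
    using 1[OF _ schwartz_cmult[of g "-1"], of f] 2[of g "-1"] by simp
qed

lemma tempered_zero: "tempered u \<Longrightarrow> u (\<lambda>x. 0) = 0"
  using temperedD(2)[OF _ schwartz_zero, of u 0] by simp

lemma tempered_sum:
  assumes "tempered u" "\<And>i. i \<in> I \<Longrightarrow> f i \<in> schwartz"
  shows "u (\<lambda>x. \<Sum>i\<in>I. c i * f i x) = (\<Sum>i\<in>I. c i * u (f i))"
  using assms(2)
proof (induction I rule: infinite_finite_induct)
  case (insert i I)
  then have "u (\<lambda>x. c i * f i x + (\<Sum>i\<in>I. c i * f i x)) = u (\<lambda>x. c i * f i x) + u (\<lambda>x. \<Sum>i\<in>I. c i * f i x)"
    by (intro temperedD(1) assms(1) schwartz_cmult schwartz_sum) auto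
  with insert show ?case by (simp add: temperedD(2)[OF assms(1)])
qed (simp_all add: tempered_zero[OF assms(1)])

lemma tempered_bound:
  assumes "tempered u"
  obtains N C where "C > 0" "\<And>f. f \<in> schwartz \<Longrightarrow> norm (u f) \<le> C * schwartz_norm N f"
proof -
  obtain N C where C: "\<And>f. f \<in> schwartz \<Longrightarrow> norm (u f) \<le> C * schwartz_norm N f"
    using assms unfolding tempered_def by blast
  have "norm (u f) \<le> max C 1 * schwartz_norm N f" if f: "f \<in> schwartz" for f
  proof -
    have "0 \<le> schwartz_norm N f"
      unfolding schwartz_norm_def
    proof (intro sum_nonneg)
      fix bs :: "'a list" assume "bs \<in> {bs. bs \<in> lists Basis \<and> length bs \<le> N}"
      then have "rapid (partials bs f)" using schwartzD(1)[OF schwartzD(5)[OF f]] by blast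
      then obtain B where "\<And>x. (1 + norm x) ^ N * norm (partials bs f x) \<le> B"
        unfolding rapid_def by blast
      then have "(1 + norm 0) ^ N * norm (partials bs f 0) \<le> (SUP x. (1 + norm x) ^ N * norm (partials bs f x))"
        using cSUP_upper[of "0::'a" UNIV "\<lambda>x. (1 + norm x) ^ N * norm (partials bs f x)", OF _ bdd_aboveI2[of _ _ B]] by simp
      then show "0 \<le> (SUP x. (1 + norm x) ^ N * norm (partials bs f x))"
        by (rule order_trans[rotated]) auto
    qed
    then have "C * schwartz_norm N f \<le> max C 1 * schwartz_norm N f" by (intro mult_right_mono) auto
    with C[OF f] show ?thesis by linarith
  qed
  then show thesis by (intro that[of "max C 1" N]) auto
qed

text \<open>The weighted Lipschitz bound for \<open>K\<close>, integrated against
  \<open>\<psi>\<close>. The constant depends on \<open>K\<close> and \<open>N\<close> only. With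
  \<open>\<psi>\<close> fixed this allows simple maps to tend to the identity; with a contracting
  family of kernels as \<open>\<psi>\<close> it yields the convergence of low-pass
  truncations.\<close>

lemma superpos_diff_bound:
  fixes K :: "'a::euclidean_space \<Rightarrow> complex"
  assumes K: "K \<in> schwartz"
  obtains C where "C > 0" "\<And>\<psi> F G. admissible \<psi> F \<Longrightarrow> admissible \<psi> G \<Longrightarrow>
     schwartz_norm N (\<lambda>s. superpos \<psi> F K s - superpos \<psi> G K s)
       \<le> C * (LINT y|lborel. norm (\<psi> y) * ((1 + 2 * norm y) ^ N * norm (F y - G y)))"
proof -
  let ?I = "\<lambda>\<psi> F G. LINT y|lborel. norm (\<psi> y) * ((1 + 2 * norm y) ^ N * norm (F y - G y))"
  have I0: "0 \<le> ?I \<psi> F G" for \<psi> :: "'a \<Rightarrow> complex" and F G :: "'a \<Rightarrow> 'a" by (intro integral_nonneg_AE) auto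
  have "\<exists>C. \<forall>\<psi> F G s. admissible \<psi> F \<longrightarrow> admissible \<psi> G \<longrightarrow>
      (1 + norm s) ^ N * norm (partials bs (\<lambda>s. superpos \<psi> F K s - superpos \<psi> G K s) s) \<le> C * ?I \<psi> F G"
    if bs: "bs \<in> lists Basis" for bs
  proof -
    obtain K' where K': "K' \<in> schwartz" "\<And>\<psi> F. admissible \<psi> F \<Longrightarrow> partials bs (superpos \<psi> F K) = superpos \<psi> F K'"
      using partials_superpos[OF K bs] by blast
    obtain C where C: "C > 0" "\<And>x y s R. norm x \<le> R \<Longrightarrow> norm y \<le> R \<Longrightarrow>
        (1 + norm s) ^ N * norm (K' (x - s) - K' (y - s)) \<le> C * (1 + R) ^ N * norm (x - y)"
      using schwartz_weighted_lipschitz[OF K'(1), of N] by blast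
    have "(1 + norm s) ^ N * norm (partials bs (\<lambda>s. superpos \<psi> F K s - superpos \<psi> G K s) s) \<le> C * ?I \<psi> F G"
      if F: "admissible \<psi> F" and G: "admissible \<psi> G" for \<psi> F G s
    proof -
      have [measurable]: "F \<in> borel_measurable borel" "G \<in> borel_measurable borel" "\<psi> \<in> borel_measurable borel"
        using F G by (auto simp: admissible_def)
      have iK: "integrable lborel (\<lambda>y. \<psi> y * K' (F y - s))" "integrable lborel (\<lambda>y. \<psi> y * K' (G y - s))"
        by (intro admissible_integrable F G K')+
      have int: "integrable lborel (\<lambda>y. norm (\<psi> y) * norm (complex_of_real ((1 + 2 * norm y) ^ N * norm (F y - G y))))"
      proof (rule rapid_integrable_weight(2))
        fix y
        have "norm (F y - G y) \<le> norm (F y) + norm (G y)" by (rule norm_triangle_ineq4)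
        also have "\<dots> \<le> 4 * (1 + norm y)" using F G unfolding admissible_def by (smt (verit) norm_ge_zero)
        finally have *: "norm (F y - G y) \<le> 4 * (1 + norm y)" .
        have "(1 + 2 * norm y) ^ N * norm (F y - G y) \<le> (2 * (1 + norm y)) ^ N * (4 * (1 + norm y))"
          by (intro mult_mono power_mono *) auto
        also have "\<dots> = (2 ^ N * 4) * (1 + norm y) ^ (N + 1)"
          unfolding power_mult_distrib power_add power_one_right by (simp only: mult_ac)
        finally show "norm (complex_of_real ((1 + 2 * norm y) ^ N * norm (F y - G y))) \<le> (2 ^ N * 4) * (1 + norm y) ^ (N + 1)"
          unfolding norm_of_real by (simp only: abs_mult power_abs abs_of_nonneg add_nonneg_nonneg norm_ge_zero mult_nonneg_nonneg zero_le_one zero_le_numeral zero_le_power)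
      qed (use F in \<open>auto simp: admissible_def\<close>)
      then have int: "integrable lborel (\<lambda>y. norm (\<psi> y) * ((1 + 2 * norm y) ^ N * norm (F y - G y)))"
        unfolding norm_of_real by (simp add: abs_mult power_abs)
      have "partials bs (\<lambda>s. superpos \<psi> F K s - superpos \<psi> G K s) s = superpos \<psi> F K' s - superpos \<psi> G K' s"
        using partials_diff[OF superpos_schwartz[OF F K] superpos_schwartz[OF G K] bs] K'(2)[OF F] K'(2)[OF G] by simp
      also have "\<dots> = (LINT y|lborel. \<psi> y * (K' (F y - s) - K' (G y - s)))"
        unfolding superpos_def by (simp add: Bochner_Integration.integral_diff[OF iK, symmetric] right_diff_distrib)
      finally have "(1 + norm s) ^ N * norm (partials bs (\<lambda>s. superpos \<psi> F K s - superpos \<psi> G K s) s)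
          = (1 + norm s) ^ N * norm (LINT y|lborel. \<psi> y * (K' (F y - s) - K' (G y - s)))" by simp
      also have "\<dots> \<le> (1 + norm s) ^ N * (LINT y|lborel. norm (\<psi> y * (K' (F y - s) - K' (G y - s))))"
        by (intro mult_left_mono integral_norm_bound) auto
      also have "\<dots> = (LINT y|lborel. (1 + norm s) ^ N * norm (\<psi> y * (K' (F y - s) - K' (G y - s))))"
        by simp
      also have "\<dots> \<le> (LINT y|lborel. C * (norm (\<psi> y) * ((1 + 2 * norm y) ^ N * norm (F y - G y))))"
      proof (rule integral_mono)
        show "integrable lborel (\<lambda>y. (1 + norm s) ^ N * norm (\<psi> y * (K' (F y - s) - K' (G y - s))))"
          using Bochner_Integration.integrable_diff[OF iK] by (simp add: right_diff_distrib)
        show "integrable lborel (\<lambda>y. C * (norm (\<psi> y) * ((1 + 2 * norm y) ^ N * norm (F y - G y))))"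
          by (intro integrable_mult_right int)
        fix y
        have "norm (F y) \<le> 2 * norm y" "norm (G y) \<le> 2 * norm y" using F G by (auto simp: admissible_def)
        from mult_left_mono[OF C(2)[OF this, of s] norm_ge_zero[of "\<psi> y"]]
        show "(1 + norm s) ^ N * norm (\<psi> y * (K' (F y - s) - K' (G y - s))) \<le> C * (norm (\<psi> y) * ((1 + 2 * norm y) ^ N * norm (F y - G y)))"
          by (simp add: norm_mult mult_ac)
      qed
      also have "\<dots> = C * ?I \<psi> F G" by simp
      finally show ?thesis .
    qed
    then show ?thesis by blast
  qed
  then have "\<forall>bs\<in>lists Basis. \<exists>C. \<forall>\<psi> F G s. admissible \<psi> F \<longrightarrow> admissible \<psi> G \<longrightarrow>
      (1 + norm s) ^ N * norm (partials bs (\<lambda>s. superpos \<psi> F K s - superpos \<psi> G K s) s) \<le> C * ?I \<psi> F G"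
    by (rule ballI)
  from bchoice[OF this] obtain C where C: "\<And>bs \<psi> F G s. bs \<in> lists Basis \<Longrightarrow> admissible \<psi> F \<Longrightarrow> admissible \<psi> G \<Longrightarrow>
      (1 + norm s) ^ N * norm (partials bs (\<lambda>s. superpos \<psi> F K s - superpos \<psi> G K s) s) \<le> C bs * ?I \<psi> F G"
    by blast
  define B where "B = (\<Sum>bs | bs \<in> lists (Basis::'a set) \<and> length bs \<le> N. C bs)"
  have "schwartz_norm N (\<lambda>s. superpos \<psi> F K s - superpos \<psi> G K s) \<le> (\<bar>B\<bar> + 1) * ?I \<psi> F G"
    if F: "admissible \<psi> F" and G: "admissible \<psi> G" for \<psi> F G
  proof -
    have "schwartz_norm N (\<lambda>s. superpos \<psi> F K s - superpos \<psi> G K s)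
      \<le> (\<Sum>bs | bs \<in> lists (Basis::'a set) \<and> length bs \<le> N. C bs * ?I \<psi> F G)"
      by (rule schwartz_norm_le[where B="\<lambda>bs. C bs * ?I \<psi> F G"]) (rule C[OF _ F G])
    also have "\<dots> = B * ?I \<psi> F G" by (simp add: B_def sum_distrib_right)
    also have "\<dots> \<le> (\<bar>B\<bar> + 1) * ?I \<psi> F G" by (intro mult_right_mono I0) auto
    finally show ?thesis .
  qed
  then show thesis by (intro that[of "\<bar>B\<bar> + 1"]) auto
qed


text \<open>Schwartz seminorms of the translates grow polynomially and depend on the translation in
  a locally Lipschitz way, and \<open>u\<close> is controlled by one such seminorm.\<close>

lemma tempered_translate:
  fixes K :: "'a::euclidean_space \<Rightarrow> complex"
  assumes u: "tempered u" and K: "K \<in> schwartz"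
  shows "continuous_on UNIV (\<lambda>y. u (\<lambda>s. K (y - s)))"
    and "\<exists>C m. C > 0 \<and> (\<forall>y. norm (u (\<lambda>s. K (y - s))) \<le> C * (1 + norm y) ^ m)"
proof -
  obtain N C where C: "C > 0" "\<And>f. f \<in> schwartz \<Longrightarrow> norm (u f) \<le> C * schwartz_norm N f"
    using tempered_bound[OF u] by blast
  let ?S = "{bs. bs \<in> lists (Basis::'a set) \<and> length bs \<le> N}"
  have "\<exists>B. \<forall>x y s. (1 + norm s) ^ N * norm (partials bs (\<lambda>s. K (x - s)) s) \<le> B * (1 + norm x) ^ N \<and>
      (1 + norm s) ^ N * norm (partials bs (\<lambda>s. K (x - s) - K (y - s)) s)
         \<le> B * ((1 + max (norm x) (norm y)) ^ N * norm (x - y))"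
    if bs: "bs \<in> lists Basis" for bs
  proof -
    obtain K' where K': "K' \<in> schwartz" "\<And>y. partials bs (\<lambda>s. K (y - s)) = (\<lambda>s. K' (y - s))"
      using partials_reflect[OF K bs] by blast
    obtain A where A: "A > 0" "\<And>x. (1 + norm x) ^ N * norm (K' x) \<le> A"
      using rapidE[OF schwartzD(1)[OF K'(1)], of N] by blast
    obtain B where B: "B > 0" "\<And>x y s R. norm x \<le> R \<Longrightarrow> norm y \<le> R \<Longrightarrow>
        (1 + norm s) ^ N * norm (K' (x - s) - K' (y - s)) \<le> B * (1 + R) ^ N * norm (x - y)"
      using schwartz_weighted_lipschitz[OF K'(1), of N] by blast
    have 1: "(1 + norm s) ^ N * norm (K' (x - s)) \<le> max A B * (1 + norm x) ^ N" for x s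
    proof -
      have "(1 + norm s) ^ N * norm (K' (x - s)) \<le> ((1 + norm x) ^ N * (1 + norm (s - x)) ^ N) * norm (K' (x - s))"
        by (intro mult_right_mono one_plus_norm_power_triangle) auto
      also have "\<dots> = (1 + norm x) ^ N * ((1 + norm (x - s)) ^ N * norm (K' (x - s)))"
        by (simp add: norm_minus_commute)
      also have "\<dots> \<le> (1 + norm x) ^ N * max A B"
        using A(2)[of "x - s"] by (intro mult_left_mono) auto
      finally show ?thesis by (simp only: mult.commute)
    qed
    have 2: "(1 + norm s) ^ N * norm (K' (x - s) - K' (y - s)) \<le> max A B * ((1 + max (norm x) (norm y)) ^ N * norm (x - y))" for x y s
    proof -
      have "(1 + norm s) ^ N * norm (K' (x - s) - K' (y - s)) \<le> B * ((1 + max (norm x) (norm y)) ^ N * norm (x - y))"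
        using B(2)[of x "max (norm x) (norm y)" y s] by (simp add: mult.assoc)
      also have "\<dots> \<le> max A B * ((1 + max (norm x) (norm y)) ^ N * norm (x - y))"
        by (intro mult_right_mono mult_nonneg_nonneg zero_le_power) (auto simp: le_max_iff_disj add_nonneg_nonneg)
      finally show ?thesis .
    qed
    have 3: "partials bs (\<lambda>s. K (x - s) - K (y - s)) s = K' (x - s) - K' (y - s)" for x y s
      using partials_diff[OF schwartz_reflect[OF K] schwartz_reflect[OF K] bs, of x y] by (simp add: K'(2))
    show ?thesis unfolding 3 unfolding K'(2) using 1 2 by blast
  qed
  then have "\<forall>bs\<in>lists Basis. \<exists>B. \<forall>x y s. (1 + norm s) ^ N * norm (partials bs (\<lambda>s. K (x - s)) s) \<le> B * (1 + norm x) ^ N \<and>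
      (1 + norm s) ^ N * norm (partials bs (\<lambda>s. K (x - s) - K (y - s)) s)
         \<le> B * ((1 + max (norm x) (norm y)) ^ N * norm (x - y))"
    by (rule ballI)
  from bchoice[OF this] obtain B where B:
    "\<And>bs x s. bs \<in> lists Basis \<Longrightarrow> (1 + norm s) ^ N * norm (partials bs (\<lambda>s. K (x - s)) s) \<le> B bs * (1 + norm x) ^ N"
    "\<And>bs x y s. bs \<in> lists Basis \<Longrightarrow> (1 + norm s) ^ N * norm (partials bs (\<lambda>s. K (x - s) - K (y - s)) s)
         \<le> B bs * ((1 + max (norm x) (norm y)) ^ N * norm (x - y))"
    by blast
  let ?B = "\<bar>\<Sum>bs\<in>?S. B bs\<bar> + 1"
  have bd: "norm (u (\<lambda>s. K (x - s))) \<le> (C * ?B) * (1 + norm x) ^ N" for x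
  proof -
    have "norm (u (\<lambda>s. K (x - s))) \<le> C * schwartz_norm N (\<lambda>s. K (x - s))"
      by (rule C(2)[OF schwartz_reflect[OF K]])
    also have "schwartz_norm N (\<lambda>s. K (x - s)) \<le> (\<Sum>bs\<in>?S. B bs * (1 + norm x) ^ N)"
      by (rule schwartz_norm_le) (rule B(1))
    also have "\<dots> = (\<Sum>bs\<in>?S. B bs) * (1 + norm x) ^ N" by (simp add: sum_distrib_right)
    also have "\<dots> \<le> ?B * (1 + norm x) ^ N" by (intro mult_right_mono) auto
    finally show ?thesis using C(1) by (simp add: mult.assoc)
  qed
  have "C * ?B > 0" using C(1) by (intro mult_pos_pos) auto
  with bd show "\<exists>C m. C > 0 \<and> (\<forall>y. norm (u (\<lambda>s. K (y - s))) \<le> C * (1 + norm y) ^ m)" by blast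
  have lip: "norm (u (\<lambda>s. K (x - s)) - u (\<lambda>s. K (y - s))) \<le> (C * ?B) * ((1 + max (norm x) (norm y)) ^ N * norm (x - y))" for x y
  proof -
    have "norm (u (\<lambda>s. K (x - s)) - u (\<lambda>s. K (y - s))) = norm (u (\<lambda>s. K (x - s) - K (y - s)))"
      by (simp add: temperedD(3)[OF u schwartz_reflect[OF K] schwartz_reflect[OF K]])
    also have "\<dots> \<le> C * schwartz_norm N (\<lambda>s. K (x - s) - K (y - s))"
      by (rule C(2)[OF schwartz_diff[OF schwartz_reflect[OF K] schwartz_reflect[OF K]]])
    also have "schwartz_norm N (\<lambda>s. K (x - s) - K (y - s)) \<le> (\<Sum>bs\<in>?S. B bs * ((1 + max (norm x) (norm y)) ^ N * norm (x - y)))"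
      by (rule schwartz_norm_le) (rule B(2))
    also have "\<dots> = (\<Sum>bs\<in>?S. B bs) * ((1 + max (norm x) (norm y)) ^ N * norm (x - y))" by (simp add: sum_distrib_right)
    also have "\<dots> \<le> ?B * ((1 + max (norm x) (norm y)) ^ N * norm (x - y))"
      by (intro mult_right_mono mult_nonneg_nonneg zero_le_power) (auto simp: le_max_iff_disj add_nonneg_nonneg)
    finally show ?thesis using C(1) by (simp add: mult.assoc)
  qed
  have "isCont (\<lambda>y. u (\<lambda>s. K (y - s))) y" for y
  proof -
    have "((\<lambda>x. (C * ?B) * ((1 + max (norm x) (norm y)) ^ N * norm (x - y))) \<longlongrightarrow>
        (C * ?B) * ((1 + max (norm y) (norm y)) ^ N * norm (y - y))) (at y)"
      by (intro tendsto_intros)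
    then have "((\<lambda>x. (C * ?B) * ((1 + max (norm x) (norm y)) ^ N * norm (x - y))) \<longlongrightarrow> 0) (at y)" by simp
    then have "((\<lambda>x. u (\<lambda>s. K (x - s)) - u (\<lambda>s. K (y - s))) \<longlongrightarrow> 0) (at y)"
      by (rule Lim_null_comparison[rotated]) (intro always_eventually allI lip)
    then show ?thesis unfolding isCont_def by (rule LIM_zero_cancel)
  qed
  then show "continuous_on UNIV (\<lambda>y. u (\<lambda>s. K (y - s)))" by (simp add: continuous_at_imp_continuous_on)
qed

text \<open>Used in both directions: to write a superposition as a finite combination of translates,
  and to reassemble the sum into an integral after a distribution has acted termwise.\<close>

lemma integral_simple_compose:
  fixes \<psi> :: "'a::euclidean_space \<Rightarrow> complex"
  assumes F: "simple_function lborel F" and \<psi>: "integrable lborel \<psi>"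
  shows "(LINT y|lborel. \<psi> y * g (F y)) = (\<Sum>z\<in>range F. (LINT y|lborel. indicator (F -` {z}) y *\<^sub>R \<psi> y) * g z)"
proof -
  have fin: "finite (range F)" using simple_functionD(1)[OF F] by simp
  have sets: "F -` {z} \<in> sets lborel" for z using simple_functionD(2)[OF F, of "{z}"] by simp
  have int: "integrable lborel (\<lambda>y. indicator (F -` {z}) y *\<^sub>R \<psi> y)" for z
    by (rule integrable_mult_indicator[OF sets \<psi>])
  have "\<psi> y * g (F y) = (\<Sum>z\<in>range F. (indicator (F -` {z}) y *\<^sub>R \<psi> y) * g z)" for y
  proof -
    have "(\<Sum>z\<in>range F. (indicator (F -` {z}) y *\<^sub>R \<psi> y) * g z) = (\<Sum>z\<in>range F. if F y = z then \<psi> y * g z else 0)"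
      by (intro sum.cong) (auto simp: indicator_def)
    then show ?thesis using fin by (simp add: sum.delta')
  qed
  then have "(LINT y|lborel. \<psi> y * g (F y)) = (LINT y|lborel. (\<Sum>z\<in>range F. (indicator (F -` {z}) y *\<^sub>R \<psi> y) * g z))"
    by simp
  also have "\<dots> = (\<Sum>z\<in>range F. LINT y|lborel. (indicator (F -` {z}) y *\<^sub>R \<psi> y) * g z)"
    by (intro Bochner_Integration.integral_sum integrable_mult_left int)
  finally show ?thesis by (simp only: integral_mult_left_zero)
qed

text \<open>For simple maps both sides agree by linearity. As these tend to the identity, the left
  side converges by \<open>superpos_diff_bound\<close> and continuity of \<open>u\<close>, the right
  side by dominated convergence, since the translates have polynomial growth under \<open>u\<close>.
  Of \<open>\<psi>\<close> only decay is used, so it may itself contain a smeared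
  distribution.\<close>

theorem tempered_exchange:
  fixes K :: "'a::euclidean_space \<Rightarrow> complex"
  assumes u: "tempered u" and K: "K \<in> schwartz" and \<psi>: "rapid \<psi>" and [measurable]: "\<psi> \<in> borel_measurable borel"
  shows "u (\<lambda>s. LINT y|lborel. \<psi> y * K (y - s)) = (LINT y|lborel. \<psi> y * u (\<lambda>s. K (y - s)))"
    and "integrable lborel (\<lambda>y. \<psi> y * u (\<lambda>s. K (y - s)))"
proof -
  define h where "h = (\<lambda>y. u (\<lambda>s. K (y - s)))"
  have hc: "continuous_on UNIV h" unfolding h_def by (rule tempered_translate(1)[OF u K])
  then have [measurable]: "h \<in> borel_measurable borel" by (rule borel_measurable_continuous_onI)
  obtain A m where A: "A > 0" "\<And>y. norm (h y) \<le> A * (1 + norm y) ^ m"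
    using tempered_translate(2)[OF u K] unfolding h_def by blast
  have "integrable lborel (\<lambda>y. \<psi> y * h y)"
    using rapid_integrable_weight(1)[OF \<psi> _ _ A(2)] by simp
  then show "integrable lborel (\<lambda>y. \<psi> y * u (\<lambda>s. K (y - s)))" by (simp add: h_def)
  \<comment> \<open>Simple maps tending to the identity, with exactly the bound that
    \<open>admissible\<close> asks for.\<close>
  obtain F where F: "\<And>i. simple_function lborel (F i)" "\<And>x. (\<lambda>i. F i x) \<longlonglongrightarrow> (x::'a)"
      "\<And>i x. norm (F i x) \<le> 2 * norm x"
    using borel_measurable_implies_sequence_metric[of "\<lambda>x::'a. x" lborel 0] by (auto simp: dist_norm)
  have Fm[measurable]: "F i \<in> borel_measurable borel" for i
    using borel_measurable_simple_function[OF F(1)[of i]] by simp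
  have admF: "admissible \<psi> (F i)" for i using \<psi> F(3) by (simp add: admissible_def)
  have adm: "admissible \<psi> (\<lambda>y. y)" using \<psi> by (simp add: admissible_def)
  have \<psi>i: "integrable lborel \<psi>" using \<psi> by (intro integrable_rapid) simp_all
  have uF: "u (superpos \<psi> (F i) K) = (LINT y|lborel. \<psi> y * h (F i y))" for i
  proof -
    define c where "c z = (LINT y|lborel. indicator (F i -` {z}) y *\<^sub>R \<psi> y)" for z
    have "superpos \<psi> (F i) K = (\<lambda>s. \<Sum>z\<in>range (F i). c z * K (z - s))"
      unfolding superpos_def c_def
    proof
      fix s
      show "(LINT y|lborel. \<psi> y * K (F i y - s)) = (\<Sum>z\<in>range (F i). (LINT y|lborel. indicator (F i -` {z}) y *\<^sub>R \<psi> y) * K (z - s))"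
        by (rule integral_simple_compose[OF F(1) \<psi>i, where g="\<lambda>z. K (z - s)"])
    qed
    then have "u (superpos \<psi> (F i) K) = (\<Sum>z\<in>range (F i). c z * h z)"
      by (simp only: tempered_sum[OF u schwartz_reflect[OF K]] h_def)
    also have "\<dots> = (LINT y|lborel. \<psi> y * h (F i y))"
      unfolding c_def by (rule integral_simple_compose[OF F(1) \<psi>i, symmetric])
    finally show ?thesis .
  qed
  obtain N C where C: "C > 0" "\<And>f. f \<in> schwartz \<Longrightarrow> norm (u f) \<le> C * schwartz_norm N f"
    using tempered_bound[OF u] by blast
  obtain B where B: "B > 0" "\<And>\<psi> F G. admissible \<psi> F \<Longrightarrow> admissible \<psi> G \<Longrightarrow>
     schwartz_norm N (\<lambda>s. superpos \<psi> F K s - superpos \<psi> G K s)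
       \<le> B * (LINT y|lborel. norm (\<psi> y) * ((1 + 2 * norm y) ^ N * norm (F y - G y)))"
    using superpos_diff_bound[OF K, of N] by blast
  have "(\<lambda>i. LINT y|lborel. norm (\<psi> y) * ((1 + 2 * norm y) ^ N * norm (F i y - y))) \<longlonglongrightarrow> (LINT y|(lborel::'a measure). 0)"
  proof (rule integral_dominated_convergence)
    show "integrable lborel (\<lambda>y. norm (\<psi> y) * norm ((1 + 2 * norm y) ^ N * (3 * norm y)))"
    proof -
      have "integrable lborel (\<lambda>y. norm (\<psi> y) * norm (complex_of_real ((1 + 2 * norm y) ^ N * (3 * norm y))))"
      proof (rule rapid_integrable_weight(2)[OF \<psi>])
        fix y :: 'a
        have "(1 + 2 * norm y) ^ N * (3 * norm y) \<le> (2 * (1 + norm y)) ^ N * (3 * (1 + norm y))"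
          by (intro mult_mono power_mono) auto
        also have "\<dots> = (2 ^ N * 3) * (1 + norm y) ^ (N + 1)"
          unfolding power_mult_distrib power_add power_one_right by (simp only: mult_ac)
        finally show "norm (complex_of_real ((1 + 2 * norm y) ^ N * (3 * norm y))) \<le> (2 ^ N * 3) * (1 + norm y) ^ (N + 1)"
          unfolding norm_of_real by (simp only: abs_mult power_abs abs_of_nonneg add_nonneg_nonneg norm_ge_zero mult_nonneg_nonneg zero_le_one zero_le_numeral zero_le_power)
      qed measurable
      then show ?thesis unfolding norm_of_real by simp
    qed
    show "AE y in lborel. (\<lambda>i. norm (\<psi> y) * ((1 + 2 * norm y) ^ N * norm (F i y - y))) \<longlonglongrightarrow> 0"
    proof (rule AE_I2)
      fix y
      have "(\<lambda>i. norm (\<psi> y) * ((1 + 2 * norm y) ^ N * norm (F i y - y))) \<longlonglongrightarrow> norm (\<psi> y) * ((1 + 2 * norm y) ^ N * norm (y - y))"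
        by (intro tendsto_intros F(2))
      then show "(\<lambda>i. norm (\<psi> y) * ((1 + 2 * norm y) ^ N * norm (F i y - y))) \<longlonglongrightarrow> 0" by simp
    qed
    show "AE y in lborel. norm (norm (\<psi> y) * ((1 + 2 * norm y) ^ N * norm (F i y - y))) \<le> norm (\<psi> y) * norm ((1 + 2 * norm y) ^ N * (3 * norm y))" for i
    proof (rule AE_I2)
      fix y
      have "norm (F i y - y) \<le> 3 * norm y" using norm_triangle_ineq4[of "F i y" y] F(3)[of i y] by linarith
      then show "norm (norm (\<psi> y) * ((1 + 2 * norm y) ^ N * norm (F i y - y))) \<le> norm (\<psi> y) * norm ((1 + 2 * norm y) ^ N * (3 * norm y))"
        by (auto simp: abs_mult intro!: mult_left_mono)
    qed
  qed measurable
  then have lim0: "(\<lambda>i. C * (B * (LINT y|lborel. norm (\<psi> y) * ((1 + 2 * norm y) ^ N * norm (F i y - y))))) \<longlonglongrightarrow> 0"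
    by (intro tendsto_mult_right_zero) simp
  have "norm (u (superpos \<psi> (F i) K) - u (superpos \<psi> (\<lambda>y. y) K))
      \<le> C * (B * (LINT y|lborel. norm (\<psi> y) * ((1 + 2 * norm y) ^ N * norm (F i y - y))))" for i
  proof -
    note S = superpos_schwartz[OF admF K, of i] superpos_schwartz[OF adm K]
    have "norm (u (superpos \<psi> (F i) K) - u (superpos \<psi> (\<lambda>y. y) K))
       \<le> C * schwartz_norm N (\<lambda>s. superpos \<psi> (F i) K s - superpos \<psi> (\<lambda>y. y) K s)"
      using C(2)[OF schwartz_diff[OF S]] by (simp add: temperedD(3)[OF u S])
    also have "\<dots> \<le> C * (B * (LINT y|lborel. norm (\<psi> y) * ((1 + 2 * norm y) ^ N * norm (F i y - y))))"
      using C(1) by (intro mult_left_mono B(2) admF adm) auto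
    finally show ?thesis .
  qed
  then have "(\<lambda>i. u (superpos \<psi> (F i) K) - u (superpos \<psi> (\<lambda>y. y) K)) \<longlonglongrightarrow> 0"
    by (intro Lim_null_comparison[OF _ lim0] always_eventually allI)
  then have 1: "(\<lambda>i. u (superpos \<psi> (F i) K)) \<longlonglongrightarrow> u (superpos \<psi> (\<lambda>y. y) K)" by (rule LIM_zero_cancel)
  have 2: "(\<lambda>i. LINT y|lborel. \<psi> y * h (F i y)) \<longlonglongrightarrow> (LINT y|lborel. \<psi> y * h y)"
  proof (rule integral_dominated_convergence)
    show "integrable lborel (\<lambda>y. norm (\<psi> y) * norm (complex_of_real (A * (1 + 2 * norm y) ^ m)))"
    proof (rule rapid_integrable_weight(2)[OF \<psi>])
      fix y :: 'a
      have "A * (1 + 2 * norm y) ^ m \<le> A * (2 * (1 + norm y)) ^ m"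
        using A(1) by (intro mult_left_mono power_mono) auto
      also have "\<dots> = (A * 2 ^ m) * (1 + norm y) ^ m"
        unfolding power_mult_distrib by (simp only: mult_ac)
      finally show "norm (complex_of_real (A * (1 + 2 * norm y) ^ m)) \<le> (A * 2 ^ m) * (1 + norm y) ^ m"
        using A(1) unfolding norm_of_real by (simp add: abs_mult power_abs)
    qed measurable
    show "AE y in lborel. (\<lambda>i. \<psi> y * h (F i y)) \<longlonglongrightarrow> \<psi> y * h y"
    proof (rule AE_I2)
      fix y
      have "isCont h y" using hc by (simp add: continuous_on_eq_continuous_at)
      then show "(\<lambda>i. \<psi> y * h (F i y)) \<longlonglongrightarrow> \<psi> y * h y"
        by (intro tendsto_mult tendsto_const isCont_tendsto_compose[of y h] F(2))
    qed
    show "AE y in lborel. norm (\<psi> y * h (F i y)) \<le> norm (\<psi> y) * norm (complex_of_real (A * (1 + 2 * norm y) ^ m))" for i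
    proof (rule AE_I2)
      fix y
      have "norm (h (F i y)) \<le> A * (1 + norm (F i y)) ^ m" by (rule A(2))
      also have "\<dots> \<le> A * (1 + 2 * norm y) ^ m"
        using A(1) F(3) by (intro mult_left_mono power_mono) auto
      also have "\<dots> \<le> norm (complex_of_real (A * (1 + 2 * norm y) ^ m))" unfolding norm_of_real by (rule abs_ge_self)
      finally show "norm (\<psi> y * h (F i y)) \<le> norm (\<psi> y) * norm (complex_of_real (A * (1 + 2 * norm y) ^ m))"
        unfolding norm_mult by (intro mult_left_mono) auto
    qed
  qed measurable
  have "u (superpos \<psi> (\<lambda>y. y) K) = (LINT y|lborel. \<psi> y * h y)"
    using LIMSEQ_unique[OF 1[unfolded uF] 2] .
  then show "u (\<lambda>s. LINT y|lborel. \<psi> y * K (y - s)) = (LINT y|lborel. \<psi> y * u (\<lambda>s. K (y - s)))"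
    by (simp add: superpos_def h_def)
qed

subsection \<open>The Fourier transform\<close>

abbreviation expi :: "real \<Rightarrow> complex" where "expi t \<equiv> exp (\<i> * complex_of_real t)"

lemma norm_expi: "norm (expi t) = 1"
  by (rule norm_exp_i_times)

lemma expi_add: "expi (s + t) = expi s * expi t"
  by (simp add: distrib_left exp_add)

lemma expi_lipschitz: "norm (expi s - expi t) \<le> \<bar>s - t\<bar>"
proof -
  have "norm (expi (s - t) - 1) \<le> \<bar>s - t\<bar>"
    using iexp_approx1[of "s - t" 0] by simp
  moreover have "expi s - expi t = expi t * (expi (s - t) - 1)"
    using expi_add[of t "s - t"] by (simp add: right_diff_distrib)
  ultimately show ?thesis by (simp add: norm_mult)
qed

lemma has_derivative_expi:
  assumes "(g has_derivative g') (at x)"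
  shows "((\<lambda>x. expi (g x)) has_derivative (\<lambda>v. \<i> * complex_of_real (g' v) * expi (g x))) (at x)"
proof -
  have "((\<lambda>x. \<i> * complex_of_real (g x)) has_derivative (\<lambda>v. \<i> * complex_of_real (g' v))) (at x)"
    by (intro has_derivative_mult_right has_derivative_of_real assms)
  moreover have "(exp has_derivative (\<lambda>h. exp z * h)) (at z)" for z :: complex
    using DERIV_exp[of z] by (simp add: has_field_derivative_def)
  ultimately have "((\<lambda>x. expi (g x)) has_derivative (\<lambda>v. expi (g x) * (\<i> * complex_of_real (g' v)))) (at x)"
    by (rule has_derivative_compose)
  then show ?thesis by (simp add: mult.commute)
qed

lemma borel_measurable_expi [measurable]: "(\<lambda>x. expi (f x)) \<in> borel_measurable M" if [measurable]: "f \<in> borel_measurable M"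
  by measurable

text \<open>The unnormalised inverse transform. \<open>fourier\<close> and
  \<open>inv_fourier\<close> differ from it by a reflection and a constant, so regularity is proved
  only once.\<close>

definition ift :: "('a::euclidean_space \<Rightarrow> complex) \<Rightarrow> 'a \<Rightarrow> complex" where
  "ift a x = (LINT \<xi>|lborel. a \<xi> * expi (x \<bullet> \<xi>))"

lemma inv_fourier_ift: "inv_fourier a = (\<lambda>x. inverse (complex_of_real ((2 * pi) ^ DIM('a))) * ift a (x::'a::euclidean_space))"
  by (simp add: inv_fourier_def ift_def fun_eq_iff field_simps)

lemma fourier_ift: "fourier a \<xi> = ift a (- \<xi>)"
  by (simp add: fourier_def ift_def inner_commute)

lemma ift_integrable:
  assumes "integrable lborel a"
  shows "integrable lborel (\<lambda>\<xi>. a \<xi> * expi (x \<bullet> \<xi>))"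
proof (rule Bochner_Integration.integrable_bound[OF assms])
  have [measurable]: "a \<in> borel_measurable borel" using assms by (simp add: borel_measurable_integrable[of lborel a, simplified])
  show "(\<lambda>\<xi>. a \<xi> * expi (x \<bullet> \<xi>)) \<in> borel_measurable lborel" by measurable
qed (simp add: norm_mult norm_expi)

lemma norm_ift_le: "norm (ift a x) \<le> (LINT \<xi>|lborel. norm (a \<xi>))"
  unfolding ift_def by (rule order_trans[OF integral_norm_bound]) (simp add: norm_mult norm_expi)

lemma ift_has_derivative:
  assumes a: "a \<in> schwartz"
  shows "(ift a has_derivative (\<lambda>v. LINT \<xi>|lborel. a \<xi> * (\<i> * complex_of_real (v \<bullet> \<xi>) * expi (x \<bullet> \<xi>)))) (at x)"
  unfolding ift_def
proof (rule has_derivative_integral_dominated[where L="\<lambda>\<xi>. norm (a \<xi>) * norm \<xi>"])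
  have [measurable]: "a \<in> borel_measurable borel" by (rule schwartz_measurable[OF a])
  show "integrable lborel (\<lambda>y. a y * expi (s \<bullet> y))" for s
    by (rule ift_integrable[OF schwartz_integrable[OF a]])
  show "((\<lambda>s. a y * expi (s \<bullet> y)) has_derivative (\<lambda>v. a y * (\<i> * complex_of_real (v \<bullet> y) * expi (x \<bullet> y)))) (at x)" for y
    by (intro has_derivative_mult_right has_derivative_expi has_derivative_inner_left has_derivative_ident)
  show "(\<lambda>y. a y * (\<i> * complex_of_real (v \<bullet> y) * expi (x \<bullet> y))) \<in> borel_measurable lborel" for v
    by measurable
  have "integrable lborel (\<lambda>\<xi>. norm (a \<xi>) * norm (complex_of_real (norm \<xi>)))"
    by (rule rapid_integrable_weight(2)[OF schwartzD(1)[OF a], where A=1 and m=1]) auto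
  then show "integrable lborel (\<lambda>\<xi>. norm (a \<xi>) * norm \<xi>)" by simp
  show "norm (a y * (\<i> * complex_of_real (v \<bullet> y) * expi (x \<bullet> y))) \<le> norm (a y) * norm y * norm v" for y v
    using mult_left_mono[OF Cauchy_Schwarz_ineq2[of v y] norm_ge_zero[of "a y"]]
    by (simp add: norm_mult norm_expi mult_ac)
  show "norm (a y * expi (s \<bullet> y) - a y * expi (x \<bullet> y)) \<le> norm (a y) * norm y * norm (s - x)" for y s
  proof -
    have "norm (expi (s \<bullet> y) - expi (x \<bullet> y)) \<le> \<bar>(s - x) \<bullet> y\<bar>"
      using expi_lipschitz[of "s \<bullet> y" "x \<bullet> y"] by (simp add: inner_diff_left)
    also have "\<dots> \<le> norm y * norm (s - x)" using Cauchy_Schwarz_ineq2[of "s - x" y] by (simp add: mult.commute)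
    finally have "norm (a y) * norm (expi (s \<bullet> y) - expi (x \<bullet> y)) \<le> norm (a y) * (norm y * norm (s - x))"
      by (rule mult_left_mono) simp
    then show ?thesis by (simp add: right_diff_distrib[symmetric] norm_mult mult_ac)
  qed
qed

lemma pd_ift:
  assumes "a \<in> schwartz"
  shows "pd b (ift a) = ift (\<lambda>\<xi>. \<i> * (complex_of_real (\<xi> \<bullet> b) * a \<xi>))"
  unfolding pd_eqI[OF ift_has_derivative[OF assms]] unfolding ift_def
  by (simp add: inner_commute mult_ac)

text \<open>Integration by parts without boundary terms: the identity for the transform of a
  translate in direction \<open>b\<close> is differentiated at h = 0 on both sides.\<close>

lemma ift_pd:
  fixes a :: "'a::euclidean_space \<Rightarrow> complex"
  assumes a: "a \<in> schwartz" and b: "b \<in> Basis"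
  shows "ift (pd b a) x = - \<i> * complex_of_real (x \<bullet> b) * ift a x"
proof -
  have [measurable]: "a \<in> borel_measurable borel" "pd b a \<in> borel_measurable borel"
    by (intro schwartz_measurable a schwartzD(4) b)+
  have trans: "(LINT \<xi>|lborel. a (\<xi> + h *\<^sub>R b) * expi (x \<bullet> \<xi>)) = expi (- h * (x \<bullet> b)) * ift a x" for h
  proof -
    have "expi (- h * (x \<bullet> b)) * ift a x = (LINT \<xi>|lborel. a \<xi> * (expi (- h * (x \<bullet> b)) * expi (x \<bullet> \<xi>)))"
      unfolding ift_def by (simp add: mult.left_commute flip: integral_mult_right_zero)
    also have "\<dots> = (LINT \<xi>|lborel. a \<xi> * expi (x \<bullet> (\<xi> - h *\<^sub>R b)))"
      by (simp add: inner_diff_right expi_add[symmetric] distrib_left[symmetric] of_real_add[symmetric]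
          del: of_real_add of_real_mult of_real_minus of_real_diff)
    also have "\<dots> = (LINT \<xi>|lborel. a (\<xi> + h *\<^sub>R b) * expi (x \<bullet> \<xi>))"
      by (subst has_bochner_integral_lborel_affine(2)[where c=1 and t="h *\<^sub>R b"]) (auto simp: add.commute)
    finally show ?thesis ..
  qed
  let ?N = "DIM('a) + 1"
  obtain C where C: "C > 0" "\<And>x y s R. norm x \<le> R \<Longrightarrow> norm y \<le> R \<Longrightarrow>
        (1 + norm s) ^ ?N * norm (a (x - s) - a (y - s)) \<le> C * (1 + R) ^ ?N * norm (x - y)"
    using schwartz_weighted_lipschitz[OF a, of ?N] by blast
  obtain C' where C': "C' > 0" "\<And>x v. (1 + norm x) ^ ?N * norm (frechet_derivative a (at x) v) \<le> C' * norm v"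
    using schwartz_deriv_decay[OF a, of ?N] by blast
  \<comment> \<open>A single majorant must cover the derivative, through \<open>C'\<close>, and the
    increments with |h| \<le> 1, where the radius R = 1 produces the power of 2.\<close>
  define A where "A = max (C * 2 ^ ?N) C'"
  let ?L = "\<lambda>\<xi>::'a. A * (1 / (1 + norm \<xi>) ^ ?N)"
  have L: "r \<le> ?L \<xi> * k" if "(1 + norm \<xi>) ^ ?N * r \<le> A * k" for r k \<xi>
  proof -
    have "0 < (1 + norm \<xi>) ^ ?N" by (intro zero_less_power) (simp add: add_pos_nonneg)
    then show ?thesis using that by (simp add: pos_le_divide_eq mult_ac)
  qed
  have 1: "((\<lambda>h. LINT \<xi>|lborel. a (\<xi> + h *\<^sub>R b) * expi (x \<bullet> \<xi>)) has_derivative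
     (\<lambda>k. LINT \<xi>|lborel. (complex_of_real k * pd b a \<xi>) * expi (x \<bullet> \<xi>))) (at (0::real))"
  proof (rule has_derivative_integral_dominated[where L="?L"])
    have "integrable lborel (\<lambda>\<xi>. a (h *\<^sub>R b + 1 *\<^sub>R \<xi>))" for h
      by (subst has_bochner_integral_lborel_affine(1)) (auto simp: schwartz_integrable[OF a])
    then have "integrable lborel (\<lambda>\<xi>. a (\<xi> + h *\<^sub>R b))" for h
      by (simp add: add.commute)
    then show "integrable lborel (\<lambda>\<xi>. a (\<xi> + h *\<^sub>R b) * expi (x \<bullet> \<xi>))" for h
      by (rule ift_integrable)
    show "((\<lambda>h. a (\<xi> + h *\<^sub>R b) * expi (x \<bullet> \<xi>)) has_derivative (\<lambda>k. (complex_of_real k * pd b a \<xi>) * expi (x \<bullet> \<xi>))) (at 0)" for \<xi>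
    proof -
      have "((\<lambda>h. a (\<xi> + h *\<^sub>R b)) has_derivative (\<lambda>k. frechet_derivative a (at (\<xi> + 0 *\<^sub>R b)) (k *\<^sub>R b))) (at 0)"
        by (intro has_derivative_compose[of "\<lambda>h. \<xi> + h *\<^sub>R b" "\<lambda>k. k *\<^sub>R b" _ _ a] schwartzD(3) a)
           (auto intro!: derivative_eq_intros)
      moreover have "frechet_derivative a (at \<xi>) (k *\<^sub>R b) = complex_of_real k * pd b a \<xi>" for k
        using linear_scale[OF has_derivative_linear[OF schwartzD(3)[OF a]]] by (simp add: pd_def scaleR_conv_of_real)
      ultimately show ?thesis by (intro has_derivative_mult_left) simp
    qed
    show "(\<lambda>\<xi>. (complex_of_real k * pd b a \<xi>) * expi (x \<bullet> \<xi>)) \<in> borel_measurable lborel" for k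
      by measurable
    show "integrable lborel ?L" by (intro integrable_mult_right integrable_inverse_power)
    show "norm (complex_of_real k * pd b a \<xi> * expi (x \<bullet> \<xi>)) \<le> ?L \<xi> * norm k" for \<xi> k
    proof (rule L)
      have "(1 + norm \<xi>) ^ ?N * norm (pd b a \<xi>) \<le> A"
        using C'(2)[of \<xi> b] b unfolding pd_def A_def by (simp add: norm_Basis)
      from mult_right_mono[OF this norm_ge_zero[of k]]
      show "(1 + norm \<xi>) ^ ?N * norm (complex_of_real k * pd b a \<xi> * expi (x \<bullet> \<xi>)) \<le> A * norm k"
        by (simp add: norm_mult norm_expi mult_ac)
    qed
    show "norm (a (\<xi> + h *\<^sub>R b) * expi (x \<bullet> \<xi>) - a (\<xi> + 0 *\<^sub>R b) * expi (x \<bullet> \<xi>)) \<le> ?L \<xi> * norm (h - 0)" if "norm (h - 0) \<le> 1" for \<xi> h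
    proof (rule L)
      have "(1 + norm \<xi>) ^ ?N * norm (a (\<xi> + h *\<^sub>R b) - a \<xi>) \<le> C * 2 ^ ?N * \<bar>h\<bar>"
        using C(2)[of "h *\<^sub>R b" 1 0 "- \<xi>"] b that by (simp add: norm_Basis add.commute)
      also have "\<dots> \<le> A * \<bar>h\<bar>" unfolding A_def by (intro mult_right_mono) auto
      finally show "(1 + norm \<xi>) ^ ?N * norm (a (\<xi> + h *\<^sub>R b) * expi (x \<bullet> \<xi>) - a (\<xi> + 0 *\<^sub>R b) * expi (x \<bullet> \<xi>)) \<le> A * norm (h - 0)"
        by (simp add: left_diff_distrib[symmetric] norm_mult norm_expi)
    qed
  qed
  have 2: "((\<lambda>h. expi (- h * (x \<bullet> b)) * ift a x) has_derivative (\<lambda>k. (- \<i> * complex_of_real k * complex_of_real (x \<bullet> b)) * ift a x)) (at 0)"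
  proof -
    have "((\<lambda>h. - h * (x \<bullet> b)) has_derivative (\<lambda>k. - k * (x \<bullet> b))) (at (0::real))"
      by (auto intro!: derivative_eq_intros)
    from has_derivative_mult_left[OF has_derivative_expi[OF this], of "ift a x"] show ?thesis by (simp add: mult.assoc)
  qed
  have "(\<lambda>k. LINT \<xi>|lborel. (complex_of_real k * pd b a \<xi>) * expi (x \<bullet> \<xi>)) = (\<lambda>k. (- \<i> * complex_of_real k * complex_of_real (x \<bullet> b)) * ift a x)"
    using has_derivative_unique[OF 1[unfolded trans] 2] .
  from fun_cong[OF this, of 1] show ?thesis by (simp add: ift_def)
qed

text \<open>Induction on the power of the weight, for all Schwartz functions at once: a further
  factor |x| is at most the sum of the |x . b|, and each of these becomes a derivative of
  \<open>a\<close>.\<close>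

lemma ift_rapid:
  fixes a :: "'a::euclidean_space \<Rightarrow> complex"
  assumes "a \<in> schwartz"
  shows "rapid (ift a)"
proof -
  have "\<forall>a\<in>schwartz. \<exists>C. \<forall>x::'a. (1 + norm x) ^ N * norm (ift a x) \<le> C" for N
  proof (induction N)
    case 0
    then show ?case using norm_ift_le by auto
  next
    case (Suc N)
    show ?case
    proof
      fix a :: "'a \<Rightarrow> complex" assume a: "a \<in> schwartz"
      obtain C where C: "\<And>x. (1 + norm x) ^ N * norm (ift a x) \<le> C" using Suc a by blast
      have "\<forall>b\<in>Basis. \<exists>C. \<forall>x. (1 + norm x) ^ N * norm (ift (pd b a) x) \<le> C"
        using Suc schwartzD(4)[OF a] by blast
      from bchoice[OF this] obtain D where D: "\<And>b x. b \<in> Basis \<Longrightarrow> (1 + norm x) ^ N * norm (ift (pd b a) x) \<le> D b"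
        by blast
      have "(1 + norm x) ^ Suc N * norm (ift a x) \<le> C + (\<Sum>b\<in>Basis. D b)" for x
      proof -
        have "(1 + norm x) ^ Suc N * norm (ift a x) = (1 + norm x) ^ N * norm (ift a x) + (1 + norm x) ^ N * (norm x * norm (ift a x))"
          by (simp add: algebra_simps)
        also have "norm x * norm (ift a x) \<le> (\<Sum>b\<in>Basis. \<bar>x \<bullet> b\<bar>) * norm (ift a x)"
          by (intro mult_right_mono norm_le_l1) auto
        also have "\<dots> = (\<Sum>b\<in>Basis. norm (ift (pd b a) x))"
          unfolding sum_distrib_right by (intro sum.cong refl) (simp add: ift_pd[OF a] norm_mult)
        finally have "(1 + norm x) ^ Suc N * norm (ift a x) \<le> (1 + norm x) ^ N * norm (ift a x) + (1 + norm x) ^ N * (\<Sum>b\<in>Basis. norm (ift (pd b a) x))"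
          by (simp add: mult_left_mono)
        also have "\<dots> \<le> C + (\<Sum>b\<in>Basis. D b)"
          unfolding sum_distrib_left by (intro add_mono C sum_mono D)
        finally show ?thesis .
      qed
      then show "\<exists>C. \<forall>x. (1 + norm x) ^ Suc N * norm (ift a x) \<le> C" by blast
    qed
  qed
  with assms show ?thesis unfolding rapid_def by blast
qed

lemma ift_schwartz:
  fixes a :: "'a::euclidean_space \<Rightarrow> complex"
  assumes "a \<in> schwartz"
  shows "ift a \<in> schwartz"
proof (rule schwartz_coinduct[where X="\<lambda>h. \<exists>a\<in>schwartz. h = ift a"])
  fix h :: "'a \<Rightarrow> complex" assume "\<exists>a\<in>schwartz. h = ift a"
  then obtain a where a: "a \<in> schwartz" and h: "h = ift a" by blast
  let ?D = "\<lambda>x v. LINT \<xi>|lborel. a \<xi> * (\<i> * complex_of_real (v \<bullet> \<xi>) * expi (x \<bullet> \<xi>))"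
  have D: "(h has_derivative ?D s) (at s)" for s
    unfolding h by (rule ift_has_derivative[OF a])
  have "addclos (\<lambda>h. \<exists>a\<in>schwartz. h = ift a) (\<lambda>s. ?D s b)" for b
  proof (rule addclos.base)
    have "(\<lambda>s. ?D s b) = pd b h" by (rule pd_eqI[OF D, symmetric])
    then show "\<exists>K\<in>schwartz. (\<lambda>s. ?D s b) = ift K"
      using pd_ift[OF a, of b] schwartz_cmult[OF schwartz_coord[OF a, of b], of \<i>] unfolding h by metis
  qed
  with D ift_rapid[OF a] show "rapid h \<and> (\<exists>D. (\<forall>x. (h has_derivative D x) (at x)) \<and>
     (\<forall>b\<in>Basis. addclos (\<lambda>h. \<exists>a\<in>schwartz. h = ift a) (\<lambda>x. D x b)))"
    unfolding h by (intro conjI exI[of _ ?D]) auto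
qed (use assms in blast)

lemma inv_fourier_schwartz: "a \<in> schwartz \<Longrightarrow> inv_fourier a \<in> schwartz"
  unfolding inv_fourier_ift by (intro schwartz_cmult ift_schwartz)

lemma inv_fourier_diff:
  assumes "f \<in> schwartz" "g \<in> schwartz"
  shows "inv_fourier (\<lambda>\<xi>::'a::euclidean_space. f \<xi> - g \<xi>) = (\<lambda>x. inv_fourier f x - inv_fourier g x)"
  unfolding inv_fourier_ift ift_def
  using ift_integrable[OF schwartz_integrable[OF assms(1)]] ift_integrable[OF schwartz_integrable[OF assms(2)]]
  by (simp add: left_diff_distrib right_diff_distrib)

text \<open>Boundedness of \<open>k\<close> keeps f(x) g(y) k(x, y) integrable on the product space;
  in the applications \<open>k\<close> is an exponential.\<close>

lemma fubini_bounded_kernel: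
  fixes f :: "'a::euclidean_space \<Rightarrow> complex" and g :: "'b::euclidean_space \<Rightarrow> complex"
  assumes f: "integrable lborel f" and g: "integrable lborel g"
    and km[measurable]: "case_prod k \<in> borel_measurable (borel \<Otimes>\<^sub>M borel)" and k: "\<And>x y. norm (k x y) \<le> 1"
  shows "(LINT x|lborel. f x * (LINT y|lborel. g y * k x y)) = (LINT y|lborel. g y * (LINT x|lborel. f x * k x y))"
proof -
  have [measurable]: "f \<in> borel_measurable borel" "g \<in> borel_measurable borel"
    using borel_measurable_integrable[OF f] borel_measurable_integrable[OF g] by simp_all
  have gi: "integrable lborel (\<lambda>y. g y * k x y)" for x
    by (rule Bochner_Integration.integrable_bound[OF g]) (auto simp: norm_mult intro!: mult_right_le_one_le k)
  have gx: "integrable lborel (\<lambda>y. norm (g y * k x y))" for x using gi by (rule integrable_norm)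
  have *: "integrable (lborel \<Otimes>\<^sub>M lborel) (case_prod (\<lambda>x y. f x * (g y * k x y)))"
  proof (rule lborel_pair.Fubini_integrable)
    show "case_prod (\<lambda>x y. f x * (g y * k x y)) \<in> borel_measurable (lborel \<Otimes>\<^sub>M lborel)"
      by measurable
    show "AE x in lborel. integrable lborel (\<lambda>y. case (x, y) of (x, y) \<Rightarrow> f x * (g y * k x y))"
      using gi by simp
    show "integrable lborel (\<lambda>x. LINT y|lborel. norm (case (x, y) of (x, y) \<Rightarrow> f x * (g y * k x y)))"
    proof (rule Bochner_Integration.integrable_bound)
      show "integrable lborel (\<lambda>x. norm (f x) * (LINT y|lborel. norm (g y)))"
        using f by simp
      show "AE x in lborel. norm (LINT y|lborel. norm (case (x, y) of (x, y) \<Rightarrow> f x * (g y * k x y))) \<le> norm (norm (f x) * (LINT y|lborel. norm (g y)))"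
      proof (rule AE_I2)
        fix x
        have "(LINT y|lborel. norm (g y * k x y)) \<le> (LINT y|lborel. norm (g y))"
          using g gx by (intro integral_mono) (auto simp: norm_mult intro!: mult_right_le_one_le k)
        from mult_left_mono[OF this norm_ge_zero[of "f x"]]
        have "(LINT y|lborel. norm (f x * (g y * k x y))) \<le> norm (f x) * (LINT y|lborel. norm (g y))"
          by (simp add: norm_mult[of "f x"])
        then show "norm (LINT y|lborel. norm (case (x, y) of (x, y) \<Rightarrow> f x * (g y * k x y))) \<le> norm (norm (f x) * (LINT y|lborel. norm (g y)))"
          by (simp add: abs_mult)
      qed
    qed measurable
  qed
  have "(LINT x|lborel. f x * (LINT y|lborel. g y * k x y)) = (LINT x|lborel. LINT y|lborel. f x * (g y * k x y))"
    by simp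
  also have "\<dots> = (LINT y|lborel. LINT x|lborel. f x * (g y * k x y))"
    by (rule lborel_pair.Fubini_integral[OF *, symmetric])
  also have "\<dots> = (LINT y|lborel. LINT x|lborel. g y * (f x * k x y))"
    by (simp only: mult.left_commute)
  finally show ?thesis by simp
qed


subsection \<open>Fourier inversion\<close>

text \<open>A probability density, built as a product so that its transform reduces to the
  characteristic function of the normal distribution in each coordinate.\<close>

definition gauss :: "'a::euclidean_space \<Rightarrow> real" where
  "gauss x = (\<Prod>b\<in>Basis. std_normal_density (x \<bullet> b))"

lemma std_normal_fourier:
  "integrable lborel (\<lambda>t. complex_of_real (std_normal_density t) * expi (t * r))"
  "(LINT t|lborel. complex_of_real (std_normal_density t) * expi (t * r)) = complex_of_real (exp (- (r\<^sup>2) / 2))"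
proof -
  show "integrable lborel (\<lambda>t. complex_of_real (std_normal_density t) * expi (t * r))"
    by (rule Bochner_Integration.integrable_bound[where f=std_normal_density])
       (auto simp: norm_mult norm_expi intro!: integrable_std_normal_moment[of 0, simplified])
  have "complex_of_real (exp (- (r\<^sup>2) / 2)) = char std_normal_distribution r"
    by (simp add: char_std_normal_distribution)
  also have "\<dots> = (LINT t|lborel. std_normal_density t *\<^sub>R expi (r * t))"
    unfolding char_def by (subst integral_density) (auto simp: normal_density_nonneg)
  finally show "(LINT t|lborel. complex_of_real (std_normal_density t) * expi (t * r)) = complex_of_real (exp (- (r\<^sup>2) / 2))"
    by (simp add: scaleR_conv_of_real mult.commute)
qed

lemma expi_sum: "finite A \<Longrightarrow> expi (\<Sum>b\<in>A. h b) = (\<Prod>b\<in>A. expi (h b))"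
  by (simp add: sum_distrib_left exp_sum)

lemma norm_power2_sum: "(norm (x::'a::euclidean_space))\<^sup>2 = (\<Sum>b\<in>Basis. (x \<bullet> b)\<^sup>2)"
  unfolding power2_norm_eq_inner by (subst euclidean_inner) (simp add: power2_eq_square)

lemma gauss_fourier:
  fixes s :: "'a::euclidean_space"
  shows "integrable lborel (\<lambda>x. complex_of_real (gauss x) * expi (x \<bullet> s))"
    "(LINT x|lborel. complex_of_real (gauss x) * expi (x \<bullet> s)) = complex_of_real (exp (- ((norm s)\<^sup>2) / 2))"
proof -
  interpret product_sigma_finite "\<lambda>_::'a. lborel :: real measure" ..
  let ?T = "\<lambda>f. \<Sum>b\<in>Basis. f b *\<^sub>R (b::'a)"
  let ?P = "\<Pi>\<^sub>M b\<in>(Basis::'a set). (lborel :: real measure)"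
  let ?g = "\<lambda>b t. complex_of_real (std_normal_density t) * expi (t * (s \<bullet> b))"
  have gm: "(\<lambda>x. complex_of_real (gauss x) * expi (x \<bullet> s)) \<in> borel_measurable borel"
    unfolding gauss_def by measurable
  have Tm: "?T \<in> measurable ?P borel" by measurable
  have eq: "complex_of_real (gauss (?T f)) * expi (?T f \<bullet> s) = (\<Prod>b\<in>Basis. ?g b (f b))" for f
  proof -
    have "?T f \<bullet> s = (\<Sum>b\<in>Basis. f b * (s \<bullet> b))"
      by (simp add: inner_commute[of _ s] inner_sum_right)
    then have "expi (?T f \<bullet> s) = (\<Prod>b\<in>Basis. expi (f b * (s \<bullet> b)))"
      by (simp only: expi_sum finite_Basis)
    then show ?thesis
      unfolding gauss_def of_real_prod by (simp add: inner_sum_left_Basis prod.distrib)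
  qed
  have "integrable ?P (\<lambda>f. \<Prod>b\<in>Basis. ?g b (f b))"
    by (intro product_integrable_prod std_normal_fourier) auto
  then show "integrable lborel (\<lambda>x. complex_of_real (gauss x) * expi (x \<bullet> s))"
    by (subst lborel_eq, subst integrable_distr_eq[OF Tm gm]) (simp only: eq)
  have "(LINT x|lborel. complex_of_real (gauss x) * expi (x \<bullet> s)) = (LINT f|?P. (\<Prod>b\<in>Basis. ?g b (f b)))"
    by (subst lborel_eq, subst integral_distr[OF Tm gm]) (simp only: eq)
  also have "\<dots> = (\<Prod>b\<in>Basis. complex_of_real (exp (- ((s \<bullet> b)\<^sup>2) / 2)))"
    by (subst product_integral_prod) (rule finite_Basis std_normal_fourier(1) | simp only: std_normal_fourier(2))+
  also have "\<dots> = complex_of_real (exp (- ((norm s)\<^sup>2) / 2))"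
    unfolding of_real_prod[symmetric] exp_sum[OF finite_Basis, symmetric]
    by (simp add: sum_negf sum_divide_distrib[symmetric] norm_power2_sum)
  finally show "(LINT x|lborel. complex_of_real (gauss x) * expi (x \<bullet> s)) = complex_of_real (exp (- ((norm s)\<^sup>2) / 2))" .
qed

text \<open>The Gaussian is a constant multiple of its own transform, so that the transform of a
  dilated Gaussian can again be expressed by \<open>gauss\<close>.\<close>

lemma gauss_eq: "gauss (x::'a::euclidean_space) = gauss (0::'a) * exp (- ((norm x)\<^sup>2) / 2)"
proof -
  have "gauss x = (\<Prod>b\<in>(Basis::'a set). std_normal_density 0 * exp (- ((x \<bullet> b)\<^sup>2) / 2))"
    unfolding gauss_def by (intro prod.cong) (auto simp: normal_density_def)
  also have "\<dots> = gauss (0::'a) * exp (\<Sum>b\<in>(Basis::'a set). - ((x \<bullet> b)\<^sup>2) / 2)"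
    by (simp add: prod.distrib exp_sum gauss_def)
  also have "(\<Sum>b\<in>(Basis::'a set). - ((x \<bullet> b)\<^sup>2) / 2) = - ((norm x)\<^sup>2) / 2"
    by (simp add: sum_negf sum_divide_distrib[symmetric] norm_power2_sum)
  finally show ?thesis .
qed

text \<open>The second identity is what cancels the factor (2 pi)^n of the inverse transform in the
  inversion formula.\<close>

lemma gauss_0: "gauss (0::'a::euclidean_space) > 0" "(gauss (0::'a))\<^sup>2 * (2 * pi) ^ DIM('a) = 1"
proof -
  have 1: "gauss (0::'a) = (1 / sqrt (2 * pi)) ^ DIM('a)"
    by (simp add: gauss_def normal_density_def)
  then show "gauss (0::'a) > 0" by simp
  show "(gauss (0::'a))\<^sup>2 * (2 * pi) ^ DIM('a) = 1"
  proof -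
    have "(1 / sqrt (2 * pi))\<^sup>2 * (2 * pi) = 1" by (simp add: power_divide)
    then have "((1 / sqrt (2 * pi))\<^sup>2 * (2 * pi)) ^ DIM('a) = 1" by simp
    then show ?thesis unfolding 1 by (simp only: power_mult_distrib power_mult[symmetric] mult.commute[of 2])
  qed
qed

lemma gauss_bounds: "0 \<le> gauss x" "gauss (x::'a::euclidean_space) \<le> gauss (0::'a)"
  using gauss_0(1)[where 'a='a] by (subst gauss_eq, simp)+

lemma borel_measurable_gauss [measurable]: "gauss \<in> borel_measurable borel"
  unfolding gauss_def[abs_def] by measurable

lemma gauss_integral: "integrable lborel (\<lambda>x::'a::euclidean_space. complex_of_real (gauss x))"
  "(LINT x|lborel. complex_of_real (gauss (x::'a))) = 1"
  using gauss_fourier[of "0::'a"] by simp_all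

lemma gauss_continuous: "continuous_on A gauss"
  unfolding gauss_def[abs_def] normal_density_def by (intro continuous_intros) auto

lemma gauss_scaled_fourier:
  fixes s :: "'a::euclidean_space"
  assumes e: "e > 0"
  shows "integrable lborel (\<lambda>x. complex_of_real (gauss (e *\<^sub>R x)) * expi (x \<bullet> s))"
   "(LINT x|lborel. complex_of_real (gauss (e *\<^sub>R x)) * expi (x \<bullet> s))
     = complex_of_real (inverse (e ^ DIM('a)) * (gauss ((1 / e) *\<^sub>R s) / gauss (0::'a)))"
proof -
  let ?F = "\<lambda>x. complex_of_real (gauss x) * expi (x \<bullet> ((1 / e) *\<^sub>R s))"
  have Fm: "?F \<in> borel_measurable borel" by measurable
  have eq: "?F (0 + e *\<^sub>R x) = complex_of_real (gauss (e *\<^sub>R x)) * expi (x \<bullet> s)" for x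
    using e by simp
  show "integrable lborel (\<lambda>x. complex_of_real (gauss (e *\<^sub>R x)) * expi (x \<bullet> s))"
    using has_bochner_integral_lborel_affine(1)[OF Fm, of e 0] e gauss_fourier(1)[of "(1 / e) *\<^sub>R s"] unfolding eq by simp
  have "complex_of_real (exp (- ((norm ((1 / e) *\<^sub>R s))\<^sup>2) / 2)) = e ^ DIM('a) *\<^sub>R (LINT x|lborel. complex_of_real (gauss (e *\<^sub>R x)) * expi (x \<bullet> s))"
    using has_bochner_integral_lborel_affine(2)[OF Fm, of e 0] e unfolding eq gauss_fourier(2) by simp
  moreover have "exp (- ((norm ((1 / e) *\<^sub>R s))\<^sup>2) / 2) = gauss ((1 / e) *\<^sub>R s) / gauss (0::'a)"
    using gauss_eq[of "(1 / e) *\<^sub>R s"] gauss_0(1)[where 'a='a] by simp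
  ultimately have *: "complex_of_real (e ^ DIM('a)) * (LINT x|lborel. complex_of_real (gauss (e *\<^sub>R x)) * expi (x \<bullet> s)) = complex_of_real (gauss ((1 / e) *\<^sub>R s) / gauss (0::'a))"
    by (simp only: scaleR_conv_of_real)
  have "(LINT x|lborel. complex_of_real (gauss (e *\<^sub>R x)) * expi (x \<bullet> s))
     = complex_of_real (inverse (e ^ DIM('a))) * (complex_of_real (e ^ DIM('a)) * (LINT x|lborel. complex_of_real (gauss (e *\<^sub>R x)) * expi (x \<bullet> s)))"
    using e by simp
  then show "(LINT x|lborel. complex_of_real (gauss (e *\<^sub>R x)) * expi (x \<bullet> s))
     = complex_of_real (inverse (e ^ DIM('a)) * (gauss ((1 / e) *\<^sub>R s) / gauss (0::'a)))"
    unfolding * by (simp only: of_real_mult)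
qed

text \<open>The integral defining the transform is damped by a widening Gaussian. Removing the
  damping gives one limit (\<open>1\<close>); Fubini turns the damped integral into a narrowing
  Gaussian average of \<open>a\<close> around \<open>\<zeta>\<close> (\<open>2\<close>), whose limit
  follows from continuity of \<open>a\<close> (\<open>3\<close>).\<close>

theorem fourier_inversion:
  fixes a :: "'a::euclidean_space \<Rightarrow> complex"
  assumes a: "a \<in> schwartz"
  shows "fourier (inv_fourier a) \<zeta> = a \<zeta>"
proof -
  define e where "e m = 1 / real (Suc m)" for m
  have e0: "e m > 0" for m by (simp add: e_def)
  have elim: "e \<longlonglongrightarrow> 0" unfolding e_def by (rule LIMSEQ_Suc[OF lim_1_over_n])
  let ?c = "complex_of_real ((2 * pi) ^ DIM('a))"
  let ?g0 = "complex_of_real (gauss (0::'a))"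
  let ?I = "\<lambda>m. LINT x|lborel. inv_fourier a x * (complex_of_real (gauss (e m *\<^sub>R x)) * expi (- (x \<bullet> \<zeta>)))"
  note ms[measurable] = schwartz_measurable[OF a] schwartz_measurable[OF inv_fourier_schwartz[OF a]]
  have ii: "integrable lborel (inv_fourier a)" by (rule schwartz_integrable[OF inv_fourier_schwartz[OF a]])
  have 1: "?I \<longlonglongrightarrow> (LINT x|lborel. inv_fourier a x * (?g0 * expi (- (x \<bullet> \<zeta>))))"
  proof (rule integral_dominated_convergence)
    show "integrable lborel (\<lambda>x. norm (inv_fourier a x) * gauss (0::'a))"
      using ii by simp
    show "AE x in lborel. (\<lambda>m. inv_fourier a x * (complex_of_real (gauss (e m *\<^sub>R x)) * expi (- (x \<bullet> \<zeta>)))) \<longlonglongrightarrow> inv_fourier a x * (?g0 * expi (- (x \<bullet> \<zeta>)))"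
    proof (rule AE_I2)
      fix x :: 'a
      have "(\<lambda>m. e m *\<^sub>R x) \<longlonglongrightarrow> 0 *\<^sub>R x" by (intro tendsto_intros elim)
      then have "(\<lambda>m. gauss (e m *\<^sub>R x)) \<longlonglongrightarrow> gauss (0 *\<^sub>R x)"
        by (rule continuous_on_tendsto_compose[OF gauss_continuous[of UNIV]]) auto
      then show "(\<lambda>m. inv_fourier a x * (complex_of_real (gauss (e m *\<^sub>R x)) * expi (- (x \<bullet> \<zeta>)))) \<longlonglongrightarrow> inv_fourier a x * (?g0 * expi (- (x \<bullet> \<zeta>)))"
        by (intro tendsto_intros) simp
    qed
    show "AE x in lborel. norm (inv_fourier a x * (complex_of_real (gauss (e m *\<^sub>R x)) * expi (- (x \<bullet> \<zeta>)))) \<le> norm (inv_fourier a x) * gauss (0::'a)" for m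
    proof (rule AE_I2)
      fix x
      show "norm (inv_fourier a x * (complex_of_real (gauss (e m *\<^sub>R x)) * expi (- (x \<bullet> \<zeta>)))) \<le> norm (inv_fourier a x) * gauss (0::'a)"
        using mult_left_mono[OF gauss_bounds(2)[of "e m *\<^sub>R x"] norm_ge_zero[of "inv_fourier a x"]] gauss_bounds(1)[of "e m *\<^sub>R x"]
        by (simp only: norm_mult norm_expi norm_of_real abs_of_nonneg mult_1_right)
    qed
  qed measurable
  have 2: "?I m = inverse ?c * (LINT t|lborel. a (\<zeta> + e m *\<^sub>R t) * (complex_of_real (gauss t) / ?g0))" for m
  proof -
    let ?f = "\<lambda>x. complex_of_real (gauss (e m *\<^sub>R x)) * expi (- (x \<bullet> \<zeta>))"
    have fi: "integrable lborel ?f"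
      using gauss_scaled_fourier(1)[OF e0[of m], of "- \<zeta>"] by (simp add: inner_minus_right)
    have "?I m = inverse ?c * (LINT x|lborel. ?f x * (LINT \<xi>|lborel. a \<xi> * expi (x \<bullet> \<xi>)))"
      unfolding inv_fourier_ift ift_def by (simp add: mult_ac flip: integral_mult_right_zero)
    also have "(LINT x|lborel. ?f x * (LINT \<xi>|lborel. a \<xi> * expi (x \<bullet> \<xi>))) = (LINT \<xi>|lborel. a \<xi> * (LINT x|lborel. ?f x * expi (x \<bullet> \<xi>)))"
      by (rule fubini_bounded_kernel[OF fi schwartz_integrable[OF a]]) (auto simp: norm_expi)
    also have "(\<lambda>\<xi>. LINT x|lborel. ?f x * expi (x \<bullet> \<xi>)) = (\<lambda>\<xi>. LINT x|lborel. complex_of_real (gauss (e m *\<^sub>R x)) * expi (x \<bullet> (\<xi> - \<zeta>)))"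
      by (simp add: inner_diff_right expi_add[of "- _", simplified] mult.assoc flip: exp_add distrib_left)
    also have "\<dots> = (\<lambda>\<xi>. complex_of_real (inverse (e m ^ DIM('a)) * (gauss ((1 / e m) *\<^sub>R (\<xi> - \<zeta>)) / gauss (0::'a))))"
      by (rule ext) (rule gauss_scaled_fourier(2)[OF e0])
    also have "(LINT \<xi>|lborel. a \<xi> * complex_of_real (inverse (e m ^ DIM('a)) * (gauss ((1 / e m) *\<^sub>R (\<xi> - \<zeta>)) / gauss (0::'a))))
       = \<bar>e m\<bar> ^ DIM('a) *\<^sub>R (LINT t|lborel. a (\<zeta> + e m *\<^sub>R t) * complex_of_real (inverse (e m ^ DIM('a)) * (gauss ((1 / e m) *\<^sub>R ((\<zeta> + e m *\<^sub>R t) - \<zeta>)) / gauss (0::'a))))"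
      using e0[of m] by (intro has_bochner_integral_lborel_affine(2)) auto
    also have "\<dots> = (LINT t|lborel. a (\<zeta> + e m *\<^sub>R t) * (complex_of_real (gauss t) / ?g0))"
      using e0[of m] unfolding integral_scaleR_right[symmetric]
      by (intro Bochner_Integration.integral_cong refl) (simp add: scaleR_conv_of_real)
    finally show ?thesis .
  qed
  have 3: "(\<lambda>m. LINT t|lborel. a (\<zeta> + e m *\<^sub>R t) * (complex_of_real (gauss t) / ?g0)) \<longlonglongrightarrow> (LINT t|lborel. a \<zeta> * (complex_of_real (gauss (t::'a)) / ?g0))"
  proof -
    obtain C where C: "\<And>x. norm (a x) \<le> C" using rapidE[OF schwartzD(1)[OF a], of 0] by auto
    show ?thesis
    proof (rule integral_dominated_convergence)
      show "integrable lborel (\<lambda>t. C * norm (complex_of_real (gauss (t::'a)) / ?g0))"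
        by (intro integrable_mult_right integrable_norm integrable_divide gauss_integral)
      show "AE t in lborel. (\<lambda>m. a (\<zeta> + e m *\<^sub>R t) * (complex_of_real (gauss t) / ?g0)) \<longlonglongrightarrow> a \<zeta> * (complex_of_real (gauss t) / ?g0)"
      proof (rule AE_I2)
        fix t :: 'a
        have "(\<lambda>m. \<zeta> + e m *\<^sub>R t) \<longlonglongrightarrow> \<zeta> + 0 *\<^sub>R t" by (intro tendsto_intros elim)
        then have "(\<lambda>m. a (\<zeta> + e m *\<^sub>R t)) \<longlonglongrightarrow> a (\<zeta> + 0 *\<^sub>R t)"
          by (rule continuous_on_tendsto_compose[OF schwartz_continuous[OF a, of UNIV]]) auto
        then show "(\<lambda>m. a (\<zeta> + e m *\<^sub>R t) * (complex_of_real (gauss t) / ?g0)) \<longlonglongrightarrow> a \<zeta> * (complex_of_real (gauss t) / ?g0)"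
          by (intro tendsto_mult tendsto_const) simp
      qed
      show "AE t in lborel. norm (a (\<zeta> + e m *\<^sub>R t) * (complex_of_real (gauss t) / ?g0)) \<le> C * norm (complex_of_real (gauss t) / ?g0)" for m
        by (intro AE_I2) (unfold norm_mult, intro mult_right_mono C norm_ge_zero)
    qed measurable
  qed
  have "?I \<longlonglongrightarrow> inverse ?c * (LINT t|lborel. a \<zeta> * (complex_of_real (gauss (t::'a)) / ?g0))"
    unfolding 2 by (intro tendsto_intros 3)
  from LIMSEQ_unique[OF 1 this]
  have "(LINT x|lborel. inv_fourier a x * (?g0 * expi (- (x \<bullet> \<zeta>)))) = inverse ?c * (LINT t|lborel. a \<zeta> * (complex_of_real (gauss (t::'a)) / ?g0))" .
  also have "(LINT x|lborel. inv_fourier a x * (?g0 * expi (- (x \<bullet> \<zeta>)))) = ?g0 * fourier (inv_fourier a) \<zeta>"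
    unfolding fourier_def by (simp add: mult.left_commute flip: integral_mult_right_zero)
  also have "(LINT t|lborel. a \<zeta> * (complex_of_real (gauss (t::'a)) / ?g0)) = a \<zeta> / ?g0"
    by (simp only: integral_mult_right_zero integral_divide_zero gauss_integral) simp
  finally have *: "?g0 * fourier (inv_fourier a) \<zeta> = inverse ?c * (a \<zeta> / ?g0)" .
  have g: "?g0 \<noteq> 0" using gauss_0(1)[where 'a='a] by simp
  have "?g0 * ?g0 * ?c = 1"
    using gauss_0(2)[where 'a='a] unfolding power2_eq_square of_real_mult[symmetric] by (simp only: of_real_1)
  then have "a \<zeta> = ?g0 * ?g0 * ?c * a \<zeta>" by simp
  also have "\<dots> = ?g0 * ?g0 * ?c * (?c * ?g0 * ?g0 * fourier (inv_fourier a) \<zeta>)"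
    using * g by (simp add: field_simps)
  also have "\<dots> = (?g0 * ?g0 * ?c) * (?g0 * ?g0 * ?c) * fourier (inv_fourier a) \<zeta>" by (simp only: mult_ac)
  also have "\<dots> = fourier (inv_fourier a) \<zeta>" unfolding \<open>?g0 * ?g0 * ?c = 1\<close> by simp
  finally show ?thesis ..
qed


subsection \<open>Convolution identities\<close>

text \<open>The multiplier is defined by duality, and this is the function on which the original
  distribution is evaluated. Its form shows that a(D) is convolution with
  \<open>inv_fourier a\<close>.\<close>

lemma fourier_mult_inv_fourier:
  fixes a \<psi> :: "'a::euclidean_space \<Rightarrow> complex"
  assumes a: "a \<in> schwartz" and \<psi>: "\<psi> \<in> schwartz"
  shows "fourier (\<lambda>\<xi>. a \<xi> * inv_fourier \<psi> \<xi>) = (\<lambda>y. LINT x|lborel. \<psi> x * inv_fourier a (x - y))"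
proof
  fix y
  let ?c = "complex_of_real ((2 * pi) ^ DIM('a))"
  have "fourier (\<lambda>\<xi>. a \<xi> * inv_fourier \<psi> \<xi>) y
     = inverse ?c * (LINT \<xi>|lborel. (a \<xi> * expi ((- y) \<bullet> \<xi>)) * (LINT x|lborel. \<psi> x * expi (\<xi> \<bullet> x)))"
    unfolding fourier_ift inv_fourier_ift unfolding ift_def by (simp add: mult_ac flip: integral_mult_right_zero)
  also have "(LINT \<xi>|lborel. (a \<xi> * expi ((- y) \<bullet> \<xi>)) * (LINT x|lborel. \<psi> x * expi (\<xi> \<bullet> x)))
     = (LINT x|lborel. \<psi> x * (LINT \<xi>|lborel. (a \<xi> * expi ((- y) \<bullet> \<xi>)) * expi (\<xi> \<bullet> x)))"
    by (intro fubini_bounded_kernel ift_integrable schwartz_integrable a \<psi>) (auto simp: norm_expi)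
  also have "(\<lambda>x. LINT \<xi>|lborel. (a \<xi> * expi ((- y) \<bullet> \<xi>)) * expi (\<xi> \<bullet> x)) = (\<lambda>x. ift a (x - y))"
  proof
    fix x
    have "(a \<xi> * expi ((- y) \<bullet> \<xi>)) * expi (\<xi> \<bullet> x) = a \<xi> * expi ((x - y) \<bullet> \<xi>)" for \<xi>
      using expi_add[of "(- y) \<bullet> \<xi>" "\<xi> \<bullet> x"] by (simp add: inner_diff_left inner_commute[of \<xi> x])
    then show "(LINT \<xi>|lborel. (a \<xi> * expi ((- y) \<bullet> \<xi>)) * expi (\<xi> \<bullet> x)) = ift a (x - y)"
      unfolding ift_def by (simp only:)
  qed
  finally show "fourier (\<lambda>\<xi>. a \<xi> * inv_fourier \<psi> \<xi>) y = (LINT x|lborel. \<psi> x * inv_fourier a (x - y))"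
    unfolding inv_fourier_ift by (simp add: mult_ac flip: integral_mult_right_zero)
qed

text \<open>Exponentials are eigenfunctions of the convolution with \<open>inv_fourier c\<close>,
  and Fourier inversion identifies the eigenvalue.\<close>

lemma inv_fourier_fourier_at:
  fixes c :: "'a::euclidean_space \<Rightarrow> complex"
  assumes c: "c \<in> schwartz"
  shows "(LINT y|lborel. inv_fourier c (x - y) * expi (y \<bullet> \<zeta>)) = expi (x \<bullet> \<zeta>) * c \<zeta>"
proof -
  note [measurable] = schwartz_measurable[OF inv_fourier_schwartz[OF c]]
  have "(LINT y|lborel. inv_fourier c (x - y) * expi (y \<bullet> \<zeta>)) = (LINT y|lborel. inv_fourier c y * expi ((x - y) \<bullet> \<zeta>))"
    using integral_lborel_reflect(1)[of "\<lambda>y. inv_fourier c y * expi ((x - y) \<bullet> \<zeta>)" x] by simp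
  also have "\<dots> = (LINT y|lborel. expi (x \<bullet> \<zeta>) * (inv_fourier c y * expi (- (y \<bullet> \<zeta>))))"
  proof (intro Bochner_Integration.integral_cong refl)
    fix y
    show "inv_fourier c y * expi ((x - y) \<bullet> \<zeta>) = expi (x \<bullet> \<zeta>) * (inv_fourier c y * expi (- (y \<bullet> \<zeta>)))"
      using expi_add[of "x \<bullet> \<zeta>" "- (y \<bullet> \<zeta>)"] by (simp add: inner_diff_left)
  qed
  also have "\<dots> = expi (x \<bullet> \<zeta>) * fourier (inv_fourier c) \<zeta>"
    by (simp add: fourier_def)
  finally show ?thesis by (simp only: fourier_inversion[OF c])
qed

text \<open>
  On the Fourier side the multiplier \<open>c(D)\<close> acts on a product of exponentials \<open>\<xi>, \<eta>\<close> as the factor \<open>c(\<xi> + \<eta>)\<close>;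
  in this form the spectral support of a product is never mentioned.
\<close>

lemma triple_convolution:
  fixes a b c :: "'a::euclidean_space \<Rightarrow> complex"
  assumes a: "a \<in> schwartz" and b: "b \<in> schwartz" and c: "c \<in> schwartz"
    and l: "\<And>\<xi> \<eta>. c (\<xi> + \<eta>) * (a \<xi> * b \<eta>) = l * (a \<xi> * b \<eta>)"
  shows "(LINT y|lborel. inv_fourier c (x - y) * inv_fourier b (y - t) * inv_fourier a (y - s))
     = l * inv_fourier b (x - t) * inv_fourier a (x - s)"
proof -
  let ?n = "inverse (complex_of_real ((2 * pi) ^ DIM('a)))"
  have Sx: "(\<lambda>y. inv_fourier c (x - y)) \<in> schwartz" by (intro schwartz_reflect inv_fourier_schwartz c)
  have Sb: "(\<lambda>y. inv_fourier b (y - t)) \<in> schwartz"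
    using schwartz_affine[OF inv_fourier_schwartz[OF b], of 1 "- t"] by simp
  have shift: "ift f (y - s) = (LINT \<xi>|lborel. (f \<xi> * expi ((- s) \<bullet> \<xi>)) * expi (y \<bullet> \<xi>))" for f and y s :: 'a
    unfolding ift_def
  proof (intro Bochner_Integration.integral_cong refl)
    fix \<xi>
    show "f \<xi> * expi ((y - s) \<bullet> \<xi>) = (f \<xi> * expi ((- s) \<bullet> \<xi>)) * expi (y \<bullet> \<xi>)"
      using expi_add[of "(- s) \<bullet> \<xi>" "y \<bullet> \<xi>"] by (simp add: inner_diff_left)
  qed
  \<comment> \<open>\<open>G\<close> collects everything except \<open>a\<close>. Expanding
    \<open>b\<close> into exponentials makes \<open>c\<close> appear at the sum of the two
    frequencies, the form in which the hypothesis \<open>l\<close> applies.\<close>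
  define G where "G \<xi> = (LINT y|lborel. (inv_fourier c (x - y) * inv_fourier b (y - t)) * expi (y \<bullet> \<xi>))" for \<xi>
  have G: "G \<xi> = ?n * (LINT \<eta>|lborel. (b \<eta> * expi ((- t) \<bullet> \<eta>)) * (expi (x \<bullet> (\<xi> + \<eta>)) * c (\<xi> + \<eta>)))" for \<xi>
  proof -
    have "G \<xi> = ?n * (LINT y|lborel. (inv_fourier c (x - y) * expi (\<xi> \<bullet> y)) * (LINT \<eta>|lborel. (b \<eta> * expi ((- t) \<bullet> \<eta>)) * expi (y \<bullet> \<eta>)))"
      unfolding G_def inv_fourier_ift[of b] unfolding shift[of b]
      by (simp add: mult_ac inner_commute flip: integral_mult_right_zero)
    also have "(LINT y|lborel. (inv_fourier c (x - y) * expi (\<xi> \<bullet> y)) * (LINT \<eta>|lborel. (b \<eta> * expi ((- t) \<bullet> \<eta>)) * expi (y \<bullet> \<eta>)))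
       = (LINT \<eta>|lborel. (b \<eta> * expi ((- t) \<bullet> \<eta>)) * (LINT y|lborel. (inv_fourier c (x - y) * expi (\<xi> \<bullet> y)) * expi (y \<bullet> \<eta>)))"
      by (intro fubini_bounded_kernel ift_integrable schwartz_integrable b Sx) (auto simp: norm_expi)
    also have "(\<lambda>\<eta>. LINT y|lborel. (inv_fourier c (x - y) * expi (\<xi> \<bullet> y)) * expi (y \<bullet> \<eta>)) = (\<lambda>\<eta>. expi (x \<bullet> (\<xi> + \<eta>)) * c (\<xi> + \<eta>))"
    proof
      fix \<eta>
      have "(inv_fourier c (x - y) * expi (\<xi> \<bullet> y)) * expi (y \<bullet> \<eta>) = inv_fourier c (x - y) * expi (y \<bullet> (\<xi> + \<eta>))" for y
        using expi_add[of "y \<bullet> \<xi>" "y \<bullet> \<eta>"] by (simp add: inner_add_right inner_commute[of \<xi>])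
      then show "(LINT y|lborel. (inv_fourier c (x - y) * expi (\<xi> \<bullet> y)) * expi (y \<bullet> \<eta>)) = expi (x \<bullet> (\<xi> + \<eta>)) * c (\<xi> + \<eta>)"
        by (simp only: inv_fourier_fourier_at[OF c])
    qed
    finally show ?thesis .
  qed
  have aG: "a \<xi> * G \<xi> = l * inv_fourier b (x - t) * (a \<xi> * expi (x \<bullet> \<xi>))" for \<xi>
  proof -
    have "a \<xi> * G \<xi> = ?n * (LINT \<eta>|lborel. a \<xi> * ((b \<eta> * expi ((- t) \<bullet> \<eta>)) * (expi (x \<bullet> (\<xi> + \<eta>)) * c (\<xi> + \<eta>))))"
      unfolding G by (simp add: mult_ac flip: integral_mult_right_zero)
    also have "(\<lambda>\<eta>. a \<xi> * ((b \<eta> * expi ((- t) \<bullet> \<eta>)) * (expi (x \<bullet> (\<xi> + \<eta>)) * c (\<xi> + \<eta>))))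
        = (\<lambda>\<eta>. (l * a \<xi> * expi (x \<bullet> \<xi>)) * ((b \<eta> * expi ((- t) \<bullet> \<eta>)) * expi (x \<bullet> \<eta>)))"
    proof
      fix \<eta>
      have "a \<xi> * ((b \<eta> * expi ((- t) \<bullet> \<eta>)) * (expi (x \<bullet> (\<xi> + \<eta>)) * c (\<xi> + \<eta>)))
        = (c (\<xi> + \<eta>) * (a \<xi> * b \<eta>)) * (expi ((- t) \<bullet> \<eta>) * expi (x \<bullet> (\<xi> + \<eta>)))" by (simp only: mult_ac)
      also have "\<dots> = (l * (a \<xi> * b \<eta>)) * (expi ((- t) \<bullet> \<eta>) * (expi (x \<bullet> \<xi>) * expi (x \<bullet> \<eta>)))"
        unfolding l inner_add_right expi_add ..
      finally show "a \<xi> * ((b \<eta> * expi ((- t) \<bullet> \<eta>)) * (expi (x \<bullet> (\<xi> + \<eta>)) * c (\<xi> + \<eta>)))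
        = (l * a \<xi> * expi (x \<bullet> \<xi>)) * ((b \<eta> * expi ((- t) \<bullet> \<eta>)) * expi (x \<bullet> \<eta>))" by (simp only: mult_ac)
    qed
    also have "?n * (LINT \<eta>|lborel. (l * a \<xi> * expi (x \<bullet> \<xi>)) * ((b \<eta> * expi ((- t) \<bullet> \<eta>)) * expi (x \<bullet> \<eta>)))
       = (l * a \<xi> * expi (x \<bullet> \<xi>)) * (?n * ift b (x - t))"
      unfolding shift[of b] by (subst integral_mult_right_zero) (rule mult.left_commute)
    finally show ?thesis unfolding inv_fourier_ift[of b] by (simp only: mult_ac)
  qed
  have "(LINT y|lborel. inv_fourier c (x - y) * inv_fourier b (y - t) * inv_fourier a (y - s))
     = ?n * (LINT y|lborel. (inv_fourier c (x - y) * inv_fourier b (y - t)) * (LINT \<xi>|lborel. (a \<xi> * expi ((- s) \<bullet> \<xi>)) * expi (y \<bullet> \<xi>)))"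
    unfolding inv_fourier_ift[of a] unfolding shift[of a]
    by (simp only: mult.left_commute[of _ ?n] integral_mult_right_zero)
  also have "(LINT y|lborel. (inv_fourier c (x - y) * inv_fourier b (y - t)) * (LINT \<xi>|lborel. (a \<xi> * expi ((- s) \<bullet> \<xi>)) * expi (y \<bullet> \<xi>)))
     = (LINT \<xi>|lborel. (a \<xi> * expi ((- s) \<bullet> \<xi>)) * G \<xi>)"
    unfolding G_def by (intro fubini_bounded_kernel ift_integrable schwartz_integrable a schwartz_mult Sx Sb) (auto simp: norm_expi)
  also have "\<dots> = (LINT \<xi>|lborel. (l * inv_fourier b (x - t)) * ((a \<xi> * expi ((- s) \<bullet> \<xi>)) * expi (x \<bullet> \<xi>)))"
  proof (intro Bochner_Integration.integral_cong refl)
    fix \<xi>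
    have "(a \<xi> * expi ((- s) \<bullet> \<xi>)) * G \<xi> = expi ((- s) \<bullet> \<xi>) * (a \<xi> * G \<xi>)" by (simp only: mult_ac)
    then show "(a \<xi> * expi ((- s) \<bullet> \<xi>)) * G \<xi> = (l * inv_fourier b (x - t)) * ((a \<xi> * expi ((- s) \<bullet> \<xi>)) * expi (x \<bullet> \<xi>))"
      unfolding aG by (simp only: mult_ac)
  qed
  also have "\<dots> = (l * inv_fourier b (x - t)) * ift a (x - s)"
    unfolding shift[of a] by (simp only: integral_mult_right_zero)
  finally show ?thesis unfolding inv_fourier_ift[of a] by (simp only: mult_ac)
qed

subsection \<open>Functions as tempered distributions\<close>

lemma schwartz_norm_ge:
  fixes \<psi> :: "'a::euclidean_space \<Rightarrow> complex"
  assumes \<psi>: "\<psi> \<in> schwartz"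
  shows "(1 + norm x) ^ N * norm (\<psi> x) \<le> schwartz_norm N \<psi>"
proof -
  have bdd: "(1 + norm x) ^ N * norm (partials bs \<psi> x) \<le> (SUP x. (1 + norm x) ^ N * norm (partials bs \<psi> x))"
    if bs: "bs \<in> lists Basis" for bs and x :: 'a
  proof -
    obtain B where "\<And>x. (1 + norm x) ^ N * norm (partials bs \<psi> x) \<le> B"
      using schwartzD(1)[OF schwartzD(5)[OF \<psi> bs]] unfolding rapid_def by blast
    then have "bdd_above (range (\<lambda>x. (1 + norm x) ^ N * norm (partials bs \<psi> x)))"
      by (intro bdd_aboveI2[of _ _ B])
    from cSUP_upper[OF UNIV_I this, of x] show ?thesis by simp
  qed
  have "(1 + norm x) ^ N * norm (partials [] \<psi> x) \<le> (SUP x. (1 + norm x) ^ N * norm (partials [] \<psi> x))"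
    by (rule bdd) simp
  also have "\<dots> \<le> schwartz_norm N \<psi>"
    unfolding schwartz_norm_def
  proof (rule member_le_sum[OF _ _ finite_multiindices])
    fix bs :: "'a list" assume "bs \<in> {bs. bs \<in> lists Basis \<and> length bs \<le> N} - {[]}"
    then have bs: "bs \<in> lists Basis" by blast
    have "0 \<le> (1 + norm (0::'a)) ^ N * norm (partials bs \<psi> 0)" by simp
    also have "\<dots> \<le> (SUP x. (1 + norm x) ^ N * norm (partials bs \<psi> x))" by (rule bdd[OF bs])
    finally show "0 \<le> (SUP x. (1 + norm x) ^ N * norm (partials bs \<psi> x))" .
  qed simp
  finally show ?thesis by simp
qed

text \<open>Integrability against some polynomial weight bounds the functional by the Schwartz norm
  of the same order, hence makes it tempered.\<close>

lemma is_functionI: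
  fixes h :: "'a::euclidean_space \<Rightarrow> complex"
  assumes hm[measurable]: "h \<in> borel_measurable borel" and int: "integrable lborel (\<lambda>x. norm (h x) / (1 + norm x) ^ N)"
    and v: "\<And>\<psi>. \<psi> \<in> schwartz \<Longrightarrow> v \<psi> = (LINT x|lborel. h x * \<psi> x)"
  shows "is_function v h"
proof -
  let ?A = "LINT x|lborel. norm (h x) / (1 + norm x) ^ N"
  have bd: "norm (h x * \<psi> x) \<le> norm (h x) / (1 + norm x) ^ N * schwartz_norm N \<psi>" if \<psi>: "\<psi> \<in> schwartz" for \<psi> x
  proof -
    have "1 + norm x \<noteq> 0" using norm_ge_zero[of x] by linarith
    then have "norm (h x * \<psi> x) = norm (h x) / (1 + norm x) ^ N * ((1 + norm x) ^ N * norm (\<psi> x))"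
      by (simp add: norm_mult)
    also have "\<dots> \<le> norm (h x) / (1 + norm x) ^ N * schwartz_norm N \<psi>"
      by (intro mult_left_mono schwartz_norm_ge \<psi>) auto
    finally show ?thesis .
  qed
  have ih: "integrable lborel (\<lambda>x. h x * \<psi> x)" if \<psi>: "\<psi> \<in> schwartz" for \<psi>
  proof (rule Bochner_Integration.integrable_bound)
    have [measurable]: "\<psi> \<in> borel_measurable borel" by (rule schwartz_measurable[OF \<psi>])
    show "integrable lborel (\<lambda>x. norm (h x) / (1 + norm x) ^ N * schwartz_norm N \<psi>)"
      by (intro integrable_mult_left int)
    show "(\<lambda>x. h x * \<psi> x) \<in> borel_measurable lborel" by measurable
    show "AE x in lborel. norm (h x * \<psi> x) \<le> norm (norm (h x) / (1 + norm x) ^ N * schwartz_norm N \<psi>)"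
      using order_trans[OF bd[OF \<psi>] abs_ge_self] by simp
  qed
  have "norm (v \<psi>) \<le> ?A * schwartz_norm N \<psi>" if \<psi>: "\<psi> \<in> schwartz" for \<psi>
  proof -
    have "norm (v \<psi>) \<le> (LINT x|lborel. norm (h x * \<psi> x))"
      unfolding v[OF \<psi>] by (rule integral_norm_bound)
    also have "\<dots> \<le> (LINT x|lborel. norm (h x) / (1 + norm x) ^ N * schwartz_norm N \<psi>)"
      by (intro integral_mono integrable_norm ih \<psi> integrable_mult_left int bd)
    finally show ?thesis by (simp only: integral_mult_left_zero)
  qed
  then have "tempered v"
    unfolding tempered_def
    by (auto simp: v schwartz_add schwartz_cmult ih distrib_left mult.left_commute)
  then show ?thesis unfolding is_function_def using v ih hm by blast
qed

lemma integrable_poly_growth: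
  fixes h :: "'a::euclidean_space \<Rightarrow> complex"
  assumes hm[measurable]: "h \<in> borel_measurable borel" and h: "\<And>x. norm (h x) \<le> C * (1 + norm x) ^ m"
  shows "integrable lborel (\<lambda>x. norm (h x) / (1 + norm x) ^ (m + (DIM('a) + 1)))"
proof (rule Bochner_Integration.integrable_bound)
  show "integrable lborel (\<lambda>x::'a. C * (1 / (1 + norm x) ^ (DIM('a) + 1)))"
    by (intro integrable_mult_right integrable_inverse_power)
  have "norm (h x) / (1 + norm x) ^ (m + (DIM('a) + 1)) \<le> C * (1 / (1 + norm x) ^ (DIM('a) + 1))" for x
  proof -
    have p: "0 < (1 + norm x) ^ k" for k by (intro zero_less_power) (simp add: add_pos_nonneg)
    have "norm (h x) / (1 + norm x) ^ (m + (DIM('a) + 1)) \<le> C * (1 + norm x) ^ m / (1 + norm x) ^ (m + (DIM('a) + 1))"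
      by (intro divide_right_mono h) (simp add: less_imp_le[OF p])
    also have "\<dots> = C * (1 / (1 + norm x) ^ (DIM('a) + 1))"
      using less_imp_neq[OF p[of m]] unfolding power_add[of _ m] by simp
    finally show ?thesis .
  qed
  then show "AE x in lborel. norm (norm (h x) / (1 + norm x) ^ (m + (DIM('a) + 1))) \<le> norm (C * (1 / (1 + norm x) ^ (DIM('a) + 1)))"
    by (intro AE_I2 order_trans[OF _ abs_ge_self[of "C * _", folded real_norm_def]]) (simp add: abs_of_nonneg)
qed measurable

text \<open>The generator doubles as a bump function: dilated by 2 / e it is 1 on the ball of radius
  e / 2 and, since its support has radius below 2, it vanishes off the ball of radius e. There the
  difference of two representatives stays close to a nonzero value, so it cannot integrate to 0
  against the bump.\<close>

lemma is_function_continuous_unique: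
  fixes h1 h2 :: "'a::euclidean_space \<Rightarrow> complex"
  assumes \<phi>: "lp_generator (\<phi> :: 'a \<Rightarrow> real)" and c: "continuous_on UNIV h1" "continuous_on UNIV h2"
    and f: "is_function v h1" "is_function v h2"
  shows "h1 = h2"
proof (rule ccontr)
  assume "h1 \<noteq> h2"
  then obtain x0 where x0: "h1 x0 - h2 x0 \<noteq> 0" by (auto simp: fun_eq_iff)
  define d where "d x = h1 x - h2 x" for x
  have dc: "continuous_on UNIV d" unfolding d_def[abs_def] by (intro continuous_intros c)
  have d0: "norm (d x0) > 0" using x0 by (simp add: d_def)
  from dc have "continuous (at x0) d" by (simp add: continuous_on_eq_continuous_at)
  then obtain e where e: "e > 0" "\<And>x. dist x x0 < e \<Longrightarrow> dist (d x) (d x0) < norm (d x0) / 2"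
    unfolding continuous_at_eps_delta using d0 by (metis half_gt_zero)
  define \<psi> :: "'a \<Rightarrow> complex" where "\<psi> x = complex_of_real (\<phi> ((- (2 / e) *\<^sub>R x0) + (2 / e) *\<^sub>R x))" for x
  have \<phi>S: "(\<lambda>\<xi>. complex_of_real (\<phi> \<xi>)) \<in> schwartz" using \<phi> by (simp add: lp_generator_def)
  have \<psi>S: "\<psi> \<in> schwartz" unfolding \<psi>_def using e(1) by (intro schwartz_affine[OF \<phi>S]) auto
  have norm_eq: "norm ((- (2 / e) *\<^sub>R x0) + (2 / e) *\<^sub>R x) = (2 / e) * dist x x0" for x
  proof -
    have "(- (2 / e) *\<^sub>R x0) + (2 / e) *\<^sub>R x = (2 / e) *\<^sub>R (x - x0)" by (simp add: algebra_simps)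
    then show ?thesis using e(1) by (simp add: dist_norm)
  qed
  have supp: "\<psi> x = 0" if "\<not> dist x x0 < e" for x
  proof -
    have "norm ((- (2 / e) *\<^sub>R x0) + (2 / e) *\<^sub>R x) \<ge> 2"
      unfolding norm_eq using that e(1) by (simp add: field_simps)
    then have "(- (2 / e) *\<^sub>R x0) + (2 / e) *\<^sub>R x \<notin> closure {\<xi>. \<phi> \<xi> \<noteq> 0}" using \<phi> by (auto simp: lp_generator_def)
    then show ?thesis using closure_subset[of "{\<xi>. \<phi> \<xi> \<noteq> 0}"] by (auto simp: \<psi>_def)
  qed
  have one: "\<psi> x = 1" if "x \<in> cball x0 (e / 2)" for x
  proof -
    have "norm ((- (2 / e) *\<^sub>R x0) + (2 / e) *\<^sub>R x) \<le> 1"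
      unfolding norm_eq using that e(1) by (simp add: field_simps dist_commute)
    then show ?thesis using \<phi> by (simp add: \<psi>_def lp_generator_def)
  qed
  have nn: "\<psi> x = complex_of_real (norm (\<psi> x))" for x
    using \<phi> by (simp add: \<psi>_def lp_generator_def)
  have \<psi>i: "integrable lborel \<psi>" by (rule schwartz_integrable[OF \<psi>S])
  have pos: "(LINT x|lborel. norm (\<psi> x)) > 0"
  proof -
    have "0 < measure lborel (cball x0 (e / 2))"
      using e(1) content_cball_pos[of "e / 2" x0] by simp
    also have "measure lborel (cball x0 (e / 2)) = (LINT x|lborel. indicator (cball x0 (e / 2)) x)"
      by simp
    also have "\<dots> \<le> (LINT x|lborel. norm (\<psi> x))"
    proof (rule integral_mono)
      show "integrable lborel (indicator (cball x0 (e / 2)) :: 'a \<Rightarrow> real)"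
        using emeasure_lborel_cball_finite[of x0 "e / 2"] by (intro integrable_real_indicator) simp_all
      show "indicator (cball x0 (e / 2)) x \<le> norm (\<psi> x)" for x
        by (cases "x \<in> cball x0 (e / 2)") (simp_all add: one del: mem_cball)
    qed (use \<psi>i in simp)
    finally show ?thesis .
  qed
  have i1: "integrable lborel (\<lambda>x. h1 x * \<psi> x)" and v1: "v \<psi> = (LINT x|lborel. h1 x * \<psi> x)"
    using f(1) \<psi>S unfolding is_function_def by blast+
  have i2: "integrable lborel (\<lambda>x. h2 x * \<psi> x)" and v2: "v \<psi> = (LINT x|lborel. h2 x * \<psi> x)"
    using f(2) \<psi>S unfolding is_function_def by blast+
  have eq: "(LINT x|lborel. h1 x * \<psi> x) = (LINT x|lborel. h2 x * \<psi> x)" using v1 v2 by simp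
  have di: "integrable lborel (\<lambda>x. d x * \<psi> x)" and dz: "(LINT x|lborel. d x * \<psi> x) = 0"
    using Bochner_Integration.integrable_diff[OF i1 i2] Bochner_Integration.integral_diff[OF i1 i2] eq
    by (simp_all add: d_def left_diff_distrib)
  have ci: "integrable lborel (\<lambda>x. d x0 * \<psi> x)" using \<psi>i by simp
  have "norm (d x0) * (LINT x|lborel. norm (\<psi> x)) = norm (LINT x|lborel. d x0 * \<psi> x)"
  proof -
    have "(LINT x|lborel. \<psi> x) = (LINT x|lborel. complex_of_real (norm (\<psi> x)))" using nn by (intro Bochner_Integration.integral_cong refl)
    also have "\<dots> = complex_of_real (LINT x|lborel. norm (\<psi> x))" by (rule integral_complex_of_real)
    finally show ?thesis using pos by (simp add: norm_mult)
  qed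
  also have "(LINT x|lborel. d x0 * \<psi> x) = (LINT x|lborel. d x0 * \<psi> x - d x * \<psi> x)"
    by (simp add: Bochner_Integration.integral_diff[OF ci di] dz)
  also have "norm \<dots> \<le> (LINT x|lborel. norm (d x0) / 2 * norm (\<psi> x))"
  proof (rule order_trans[OF integral_norm_bound integral_mono])
    show "integrable lborel (\<lambda>x. norm (d x0 * \<psi> x - d x * \<psi> x))" using ci di by (intro integrable_norm Bochner_Integration.integrable_diff)
    show "integrable lborel (\<lambda>x. norm (d x0) / 2 * norm (\<psi> x))" using \<psi>i by (intro integrable_mult_right integrable_norm)
    fix x
    show "norm (d x0 * \<psi> x - d x * \<psi> x) \<le> norm (d x0) / 2 * norm (\<psi> x)"
    proof (cases "dist x x0 < e")
      case True
      have "norm (d x0 - d x) \<le> norm (d x0) / 2" using e(2)[OF True] by (simp add: dist_norm norm_minus_commute)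
      then show ?thesis unfolding left_diff_distrib[symmetric] norm_mult by (intro mult_right_mono) auto
    qed (simp add: supp)
  qed
  finally have "norm (d x0) * (LINT x|lborel. norm (\<psi> x)) \<le> norm (d x0) / 2 * (LINT x|lborel. norm (\<psi> x))"
    by (simp only: integral_mult_right_zero)
  with mult_pos_pos[OF d0 pos] show False by (simp only: times_divide_eq_left)
qed

subsection \<open>Convolving a tempered distribution with a Schwartz function\<close>

text \<open>The convolution of \<open>u\<close> with \<open>K\<close>; for tempered \<open>u\<close>
  and Schwartz \<open>K\<close> a continuous function of polynomial growth.\<close>

definition smear :: "'a::euclidean_space distribution \<Rightarrow> ('a \<Rightarrow> complex) \<Rightarrow> 'a \<Rightarrow> complex" where
  "smear u K x = u (\<lambda>s. K (x - s))"

lemma smear_continuous: "tempered u \<Longrightarrow> K \<in> schwartz \<Longrightarrow> continuous_on A (smear u K)"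
  using tempered_translate(1)[of u K] continuous_on_subset unfolding smear_def[abs_def] by blast

lemma smear_measurable: "tempered u \<Longrightarrow> K \<in> schwartz \<Longrightarrow> smear u K \<in> borel_measurable borel"
  by (intro borel_measurable_continuous_onI smear_continuous)

lemma smear_growth:
  assumes "tempered u" "K \<in> schwartz"
  obtains C m where "C > 0" "\<And>y. norm (smear u K y) \<le> C * (1 + norm y) ^ m"
  using tempered_translate(2)[OF assms] unfolding smear_def by blast

lemma smear_exchange:
  assumes "tempered u" "K \<in> schwartz" "rapid \<psi>" "\<psi> \<in> borel_measurable borel"
  shows "u (\<lambda>s. LINT y|lborel. \<psi> y * K (y - s)) = (LINT y|lborel. \<psi> y * smear u K y)"
    "integrable lborel (\<lambda>y. \<psi> y * smear u K y)"
  using tempered_exchange[OF assms] by (simp_all add: smear_def)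

text \<open>Evaluates the definite description once and for all: the convolution is a continuous
  representative, and continuous representatives are unique. From here on multipliers are
  convolutions.\<close>

lemma multiplier_fun_eq:
  fixes a :: "'a::euclidean_space \<Rightarrow> complex"
  assumes \<phi>: "lp_generator (\<phi> :: 'a \<Rightarrow> real)" and u: "tempered u" and a: "a \<in> schwartz"
  shows "multiplier_fun a u = smear u (inv_fourier a)"
proof -
  have K: "inv_fourier a \<in> schwartz" by (rule inv_fourier_schwartz[OF a])
  obtain C m where C: "\<And>y. norm (smear u (inv_fourier a) y) \<le> C * (1 + norm y) ^ m"
    using smear_growth[OF u K] by blast
  have "multiplier a u \<psi> = (LINT x|lborel. smear u (inv_fourier a) x * \<psi> x)" if \<psi>: "\<psi> \<in> schwartz" for \<psi>
  proof -
    have "multiplier a u \<psi> = u (fourier (\<lambda>\<xi>. a \<xi> * inv_fourier \<psi> \<xi>))"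
      by (simp add: multiplier_def inv_fourier_dist_def times_dist_def fourier_dist_def)
    also have "\<dots> = (LINT x|lborel. \<psi> x * smear u (inv_fourier a) x)"
      unfolding fourier_mult_inv_fourier[OF a \<psi>]
      by (rule smear_exchange[OF u K schwartzD(1)[OF \<psi>] schwartz_measurable[OF \<psi>]])
    finally show ?thesis by (simp only: mult.commute)
  qed
  then have f: "is_function (multiplier a u) (smear u (inv_fourier a))"
    by (intro is_functionI[OF smear_measurable[OF u K] integrable_poly_growth[OF smear_measurable[OF u K] C]])
  show ?thesis
    unfolding multiplier_fun_def
  proof (rule the_equality)
    show "continuous_on UNIV (smear u (inv_fourier a)) \<and> is_function (multiplier a u) (smear u (inv_fourier a))"
      using f smear_continuous[OF u K] by blast
    fix h assume "continuous_on UNIV h \<and> is_function (multiplier a u) h"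
    then show "h = smear u (inv_fourier a)"
      using is_function_continuous_unique[OF \<phi> _ smear_continuous[OF u K] _ f] by blast
  qed
qed

text \<open>The counterpart of \<open>triple_convolution\<close> for a single factor, by the same
  expansion into exponentials.\<close>

lemma double_convolution:
  fixes a c :: "'a::euclidean_space \<Rightarrow> complex"
  assumes a: "a \<in> schwartz" and c: "c \<in> schwartz" and l: "\<And>\<xi>. c \<xi> * a \<xi> = l * a \<xi>"
  shows "(LINT y|lborel. inv_fourier c (x - y) * inv_fourier a (y - s)) = l * inv_fourier a (x - s)"
proof -
  let ?n = "inverse (complex_of_real ((2 * pi) ^ DIM('a)))"
  have shift: "ift a (y - s) = (LINT \<xi>|lborel. (a \<xi> * expi ((- s) \<bullet> \<xi>)) * expi (y \<bullet> \<xi>))" for y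
    unfolding ift_def
  proof (intro Bochner_Integration.integral_cong refl)
    fix \<xi>
    show "a \<xi> * expi ((y - s) \<bullet> \<xi>) = (a \<xi> * expi ((- s) \<bullet> \<xi>)) * expi (y \<bullet> \<xi>)"
      using expi_add[of "(- s) \<bullet> \<xi>" "y \<bullet> \<xi>"] by (simp add: inner_diff_left)
  qed
  have Sx: "(\<lambda>y. inv_fourier c (x - y)) \<in> schwartz" by (intro schwartz_reflect inv_fourier_schwartz c)
  have "(LINT y|lborel. inv_fourier c (x - y) * inv_fourier a (y - s))
     = ?n * (LINT y|lborel. inv_fourier c (x - y) * (LINT \<xi>|lborel. (a \<xi> * expi ((- s) \<bullet> \<xi>)) * expi (y \<bullet> \<xi>)))"
    unfolding inv_fourier_ift[of a] unfolding shift
    by (simp only: mult.left_commute[of _ ?n] integral_mult_right_zero)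
  also have "(LINT y|lborel. inv_fourier c (x - y) * (LINT \<xi>|lborel. (a \<xi> * expi ((- s) \<bullet> \<xi>)) * expi (y \<bullet> \<xi>)))
     = (LINT \<xi>|lborel. (a \<xi> * expi ((- s) \<bullet> \<xi>)) * (LINT y|lborel. inv_fourier c (x - y) * expi (y \<bullet> \<xi>)))"
    by (intro fubini_bounded_kernel ift_integrable schwartz_integrable a Sx) (auto simp: norm_expi)
  also have "\<dots> = (LINT \<xi>|lborel. l * ((a \<xi> * expi ((- s) \<bullet> \<xi>)) * expi (x \<bullet> \<xi>)))"
  proof (intro Bochner_Integration.integral_cong refl)
    fix \<xi>
    have "(a \<xi> * expi ((- s) \<bullet> \<xi>)) * (LINT y|lborel. inv_fourier c (x - y) * expi (y \<bullet> \<xi>)) = (c \<xi> * a \<xi>) * (expi ((- s) \<bullet> \<xi>) * expi (x \<bullet> \<xi>))"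
      unfolding inv_fourier_fourier_at[OF c] by (simp only: mult_ac)
    then show "(a \<xi> * expi ((- s) \<bullet> \<xi>)) * (LINT y|lborel. inv_fourier c (x - y) * expi (y \<bullet> \<xi>)) = l * ((a \<xi> * expi ((- s) \<bullet> \<xi>)) * expi (x \<bullet> \<xi>))"
      unfolding l by (simp only: mult_ac)
  qed
  also have "\<dots> = l * ift a (x - s)"
    unfolding shift[of x] by (simp only: integral_mult_right_zero)
  finally show ?thesis unfolding inv_fourier_ift[of a] by (simp only: mult_ac)
qed

lemma convolve_smear:
  fixes a c :: "'a::euclidean_space \<Rightarrow> complex"
  assumes u: "tempered u" and a: "a \<in> schwartz" and c: "c \<in> schwartz" and l: "\<And>\<xi>. c \<xi> * a \<xi> = l * a \<xi>"
  shows "(LINT y|lborel. inv_fourier c (x - y) * smear u (inv_fourier a) y) = l * smear u (inv_fourier a) x"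
proof -
  have S: "(\<lambda>y. inv_fourier c (x - y)) \<in> schwartz" by (intro schwartz_reflect inv_fourier_schwartz c)
  have "(LINT y|lborel. inv_fourier c (x - y) * smear u (inv_fourier a) y)
     = u (\<lambda>s. LINT y|lborel. inv_fourier c (x - y) * inv_fourier a (y - s))"
    by (rule smear_exchange(1)[OF u inv_fourier_schwartz[OF a] schwartzD(1)[OF S] schwartz_measurable[OF S], symmetric])
  also have "\<dots> = l * smear u (inv_fourier a) x"
    unfolding double_convolution[OF a c l] smear_def
    by (rule temperedD(2)[OF u schwartz_reflect[OF inv_fourier_schwartz[OF a]]])
  finally show ?thesis .
qed

text \<open>The two distributions leave the integral one after the other. For \<open>v\<close> the
  kernel of \<open>a\<close> belongs to the test function; for \<open>u\<close> the role of the test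
  function is played by \<open>?\<psi>\<close>, which contains the smeared \<open>v\<close> and is
  only shown to decay rapidly.\<close>

lemma convolve_smear_product:
  fixes a b c :: "'a::euclidean_space \<Rightarrow> complex"
  assumes u: "tempered u" and v: "tempered v" and a: "a \<in> schwartz" and b: "b \<in> schwartz" and c: "c \<in> schwartz"
    and l: "\<And>\<xi> \<eta>. c (\<xi> + \<eta>) * (a \<xi> * b \<eta>) = l * (a \<xi> * b \<eta>)"
  shows "(LINT y|lborel. inv_fourier c (x - y) * (smear u (inv_fourier a) y * smear v (inv_fourier b) y))
     = l * (smear u (inv_fourier a) x * smear v (inv_fourier b) x)"
    and "integrable lborel (\<lambda>y. inv_fourier c (x - y) * (smear u (inv_fourier a) y * smear v (inv_fourier b) y))"
proof -
  note KS = inv_fourier_schwartz[OF a] inv_fourier_schwartz[OF b] inv_fourier_schwartz[OF c]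
  have S: "(\<lambda>y. inv_fourier c (x - y)) \<in> schwartz" by (intro schwartz_reflect KS)
  obtain A m where A: "A > 0" "\<And>y. norm (smear v (inv_fourier b) y) \<le> A * (1 + norm y) ^ m"
    using smear_growth[OF v KS(2)] by blast
  let ?\<psi> = "\<lambda>y. inv_fourier c (x - y) * smear v (inv_fourier b) y"
  have r: "rapid ?\<psi>"
  proof (rule rapid_dom[OF schwartzD(1)[OF S], of _ A m])
    fix y
    show "norm (?\<psi> y) \<le> A * (1 + norm y) ^ m * norm (inv_fourier c (x - y))"
      using mult_left_mono[OF A(2)[of y] norm_ge_zero[of "inv_fourier c (x - y)"]]
      by (simp add: norm_mult mult_ac)
  qed
  have m: "?\<psi> \<in> borel_measurable borel"
    by (intro borel_measurable_times smear_measurable v KS schwartz_measurable S)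
  have S': "(\<lambda>y. inv_fourier c (x - y) * inv_fourier a (y - s)) \<in> schwartz" for s
    using schwartz_mult[OF S schwartz_affine[OF KS(1), of 1 "- s"]] by simp
  have inner: "(LINT y|lborel. ?\<psi> y * inv_fourier a (y - s)) = (l * smear v (inv_fourier b) x) * inv_fourier a (x - s)" for s
  proof -
    have "(LINT y|lborel. ?\<psi> y * inv_fourier a (y - s)) = (LINT y|lborel. (inv_fourier c (x - y) * inv_fourier a (y - s)) * smear v (inv_fourier b) y)"
      by (simp only: mult_ac)
    also have "\<dots> = v (\<lambda>t. LINT y|lborel. (inv_fourier c (x - y) * inv_fourier a (y - s)) * inv_fourier b (y - t))"
      by (rule smear_exchange(1)[OF v KS(2) schwartzD(1)[OF S'] schwartz_measurable[OF S'], symmetric])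
    also have "(\<lambda>t. LINT y|lborel. (inv_fourier c (x - y) * inv_fourier a (y - s)) * inv_fourier b (y - t))
       = (\<lambda>t. (l * inv_fourier a (x - s)) * inv_fourier b (x - t))"
    proof
      fix t
      show "(LINT y|lborel. (inv_fourier c (x - y) * inv_fourier a (y - s)) * inv_fourier b (y - t)) = (l * inv_fourier a (x - s)) * inv_fourier b (x - t)"
        using triple_convolution[OF a b c l, where x=x and t=t and s=s] by (simp only: mult_ac)
    qed
    also have "v (\<lambda>t. (l * inv_fourier a (x - s)) * inv_fourier b (x - t)) = (l * inv_fourier a (x - s)) * smear v (inv_fourier b) x"
      unfolding smear_def by (rule temperedD(2)[OF v schwartz_reflect[OF KS(2)]])
    finally show ?thesis by (simp only: mult_ac)
  qed
  have "(LINT y|lborel. ?\<psi> y * smear u (inv_fourier a) y) = u (\<lambda>s. LINT y|lborel. ?\<psi> y * inv_fourier a (y - s))"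
    by (rule smear_exchange(1)[OF u KS(1) r m, symmetric])
  also have "\<dots> = (l * smear v (inv_fourier b) x) * smear u (inv_fourier a) x"
    unfolding inner unfolding smear_def[of u] by (rule temperedD(2)[OF u schwartz_reflect[OF KS(1)]])
  finally show "(LINT y|lborel. inv_fourier c (x - y) * (smear u (inv_fourier a) y * smear v (inv_fourier b) y))
     = l * (smear u (inv_fourier a) x * smear v (inv_fourier b) x)"
    by (simp only: mult_ac)
  show "integrable lborel (\<lambda>y. inv_fourier c (x - y) * (smear u (inv_fourier a) y * smear v (inv_fourier b) y))"
    using smear_exchange(2)[OF u KS(1) r m] by (simp only: mult_ac)
qed

subsection \<open>Powers of extended nonnegative reals\<close>

lemma epowr_ennreal: "0 \<le> r \<Longrightarrow> epowr (ennreal r) a = ennreal (r powr a)"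
  by (simp add: epowr_def)

lemma epowr_top [simp]: "epowr \<top> a = \<top>"
  by (simp add: epowr_def)

lemma epowr_0 [simp]: "epowr 0 a = 0"
  by (simp add: epowr_def)

lemma epowr_one [simp]: "epowr x 1 = x"
  by (cases x) (simp_all add: epowr_ennreal)

lemma epowr_mono: "0 \<le> a \<Longrightarrow> x \<le> y \<Longrightarrow> epowr x a \<le> epowr y a"
  by (cases x; cases y) (auto simp: epowr_ennreal powr_mono2 top_unique)

lemma epowr_epowr: "epowr (epowr x a) b = epowr x (a * b)"
  by (cases x) (simp_all add: epowr_ennreal powr_powr)

lemma epowr_mult:
  assumes "0 < a" shows "epowr (x * y) a = epowr x a * epowr y a"
proof (cases "x = \<top> \<or> y = \<top>")
  case True
  have pos: "epowr z a = 0 \<longleftrightarrow> z = 0" for z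
    using assms by (cases z) (auto simp: epowr_ennreal)
  from True show ?thesis
    by (cases "x = 0"; cases "y = 0") (auto simp: ennreal_top_mult ennreal_mult_top pos)
next
  case False
  then show ?thesis by (cases x; cases y) (simp_all add: epowr_ennreal ennreal_mult[symmetric] powr_mult)
qed

lemma epowr_add: "0 < a \<Longrightarrow> 0 < b \<Longrightarrow> epowr x a * epowr x b = epowr x (a + b)"
  by (cases x) (simp_all add: epowr_ennreal ennreal_mult[symmetric] powr_add)

lemma epowr_less_top_iff: "epowr x a < \<top> \<longleftrightarrow> x < \<top>"
  by (cases x) (auto simp: epowr_ennreal)

lemma borel_measurable_epowr [measurable]:
  assumes [measurable]: "f \<in> borel_measurable M"
  shows "(\<lambda>x. epowr (f x) a) \<in> borel_measurable M"
  unfolding epowr_def by measurable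

lemma epowr_add_le:
  assumes "0 < a" shows "epowr (x + y) a \<le> ennreal (2 powr a) * (epowr x a + epowr y a)"
proof -
  have "epowr (x + y) a \<le> epowr (2 * max x y) a"
    using assms by (intro epowr_mono) (auto simp: mult_2 intro!: add_mono)
  also have "\<dots> = ennreal (2 powr a) * epowr (max x y) a"
    using assms epowr_ennreal[of 2 a] by (simp add: epowr_mult)
  also have "epowr (max x y) a \<le> epowr x a + epowr y a"
    by (cases "x \<le> y") (auto simp: max_def add_increasing add_increasing2)
  finally show ?thesis by (simp add: mult_left_mono)
qed

lemma epowr_cmult: "0 \<le> c \<Longrightarrow> 0 < a \<Longrightarrow> epowr (ennreal c * x) a = ennreal (c powr a) * epowr x a"
  by (simp add: epowr_mult epowr_ennreal)

subsection \<open>Averaging operators\<close>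

definition avg :: "real \<Rightarrow> nat \<Rightarrow> ('a::euclidean_space \<Rightarrow> ennreal) \<Rightarrow> 'a \<Rightarrow> ennreal" where
  "avg b j F x = (\<integral>\<^sup>+y. ennreal (kern b j (x - y)) * F y \<partial>lborel)"

text \<open>A maximal function of Hardy-Littlewood type over the scales 2^-j, j \<ge> 0, with
  polynomially decaying kernels in place of indicators of balls.\<close>

definition maxavg :: "real \<Rightarrow> ('a::euclidean_space \<Rightarrow> ennreal) \<Rightarrow> 'a \<Rightarrow> ennreal" where
  "maxavg b F x = (SUP j. avg b j F x)"

lemma borel_measurable_avg [measurable]:
  assumes [measurable]: "F \<in> borel_measurable borel"
  shows "avg b j F \<in> borel_measurable borel"
  unfolding avg_def[abs_def] by measurable

lemma borel_measurable_maxavg [measurable]: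
  assumes [measurable]: "F \<in> borel_measurable borel"
  shows "maxavg b F \<in> borel_measurable borel"
  unfolding maxavg_def[abs_def] by measurable

lemma avg_le_maxavg: "avg b j F x \<le> maxavg b F x"
  unfolding maxavg_def by (rule SUP_upper) simp

lemma avg_mono: "(\<And>y. F y \<le> G y) \<Longrightarrow> avg b j F x \<le> avg b j G x"
  unfolding avg_def by (intro nn_integral_mono mult_left_mono) auto

lemma avg_add:
  assumes [measurable]: "F \<in> borel_measurable borel" "G \<in> borel_measurable borel"
  shows "avg b j (\<lambda>y. F y + G y) x = avg b j F x + avg b j G x"
  unfolding avg_def by (simp add: distrib_left nn_integral_add)

lemma avg_cmult:
  assumes [measurable]: "F \<in> borel_measurable borel"
  shows "avg b j (\<lambda>y. c * F y) x = c * avg b j F x"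
  unfolding avg_def by (simp add: mult.left_commute[of _ c] nn_integral_cmult)

lemma avg_const_le:
  fixes x :: "'a::euclidean_space"
  assumes "0 < b"
  shows "avg b j (\<lambda>y. c) x \<le> ennreal (kern_mass TYPE('a) b) * c"
proof -
  have "avg b j (\<lambda>y. c) x = (\<integral>\<^sup>+y. ennreal (kern b j (x - y)) \<partial>lborel) * c"
    unfolding avg_def by (simp add: nn_integral_multc)
  also have "(\<integral>\<^sup>+y. ennreal (kern b j (x - y)) \<partial>lborel) = (\<integral>\<^sup>+y. ennreal (kern b j (y::'a)) \<partial>lborel)"
    by (rule nn_integral_lborel_reflect) measurable
  also have "\<dots> \<le> ennreal (kern_mass TYPE('a) b)" by (rule nn_integral_kern_le[OF assms])
  finally show ?thesis by (simp add: mult_right_mono)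
qed

lemma avg_selfadjoint:
  fixes F G :: "'a::euclidean_space \<Rightarrow> ennreal"
  assumes [measurable]: "F \<in> borel_measurable borel" "G \<in> borel_measurable borel"
  shows "(\<integral>\<^sup>+x. avg b j F x * G x \<partial>lborel) = (\<integral>\<^sup>+x. F x * avg b j G x \<partial>lborel)"
proof -
  have "(\<integral>\<^sup>+x. avg b j F x * G x \<partial>lborel) = (\<integral>\<^sup>+x. \<integral>\<^sup>+y. ennreal (kern b j (x - y)) * F y * G x \<partial>lborel \<partial>lborel)"
    unfolding avg_def by (simp add: nn_integral_multc)
  also have "\<dots> = (\<integral>\<^sup>+y. \<integral>\<^sup>+x. ennreal (kern b j (x - y)) * F y * G x \<partial>lborel \<partial>lborel)"
    by (rule lborel_pair.Fubini') measurable
  also have "\<dots> = (\<integral>\<^sup>+y. \<integral>\<^sup>+x. F y * (ennreal (kern b j (y - x)) * G x) \<partial>lborel \<partial>lborel)"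
    by (intro nn_integral_cong) (simp add: kern_minus[of b j] mult_ac)
  also have "\<dots> = (\<integral>\<^sup>+x. F x * avg b j G x \<partial>lborel)"
    unfolding avg_def by (simp add: nn_integral_cmult)
  finally show ?thesis .
qed

text \<open>By self-adjointness the average is moved onto the constant function 1.\<close>

lemma nn_integral_avg_le:
  fixes F :: "'a::euclidean_space \<Rightarrow> ennreal"
  assumes b: "0 < b" and [measurable]: "F \<in> borel_measurable borel"
  shows "(\<integral>\<^sup>+x. avg b j F x \<partial>lborel) \<le> ennreal (kern_mass TYPE('a) b) * (\<integral>\<^sup>+x. F x \<partial>lborel)"
proof -
  have "(\<integral>\<^sup>+x. avg b j F x \<partial>lborel) = (\<integral>\<^sup>+x. F x * avg b j (\<lambda>y. 1) x \<partial>lborel)"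
    using avg_selfadjoint[of F "\<lambda>x. 1"] by simp
  also have "\<dots> \<le> (\<integral>\<^sup>+x. F x * ennreal (kern_mass TYPE('a) b) \<partial>lborel)"
    using avg_const_le[OF b, of j 1] by (intro nn_integral_mono mult_left_mono) auto
  also have "\<dots> = ennreal (kern_mass TYPE('a) b) * (\<integral>\<^sup>+x. F x \<partial>lborel)"
    by (simp add: nn_integral_multc mult.commute)
  finally show ?thesis .
qed

text \<open>Below the level \<open>l\<close> the first summand suffices, above it the second.
  Averaging or summing this inequality and choosing \<open>l\<close> afterwards replaces the
  inequalities of Jensen and Hoelder.\<close>

lemma ennreal_le_lambda_powr:
  assumes "l > 0" "s \<ge> 1"
  shows "z \<le> ennreal l + ennreal (l powr (1 - s)) * epowr z s"
proof (cases z)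
  case top
  then show ?thesis using assms by (simp add: ennreal_mult_top)
next
  case (real r)
  show ?thesis
  proof (cases "r \<le> l")
    case True
    then show ?thesis using real by (simp add: add_increasing2 ennreal_leI)
  next
    case False
    then have "r = r powr (1 - s) * r powr s" using assms by (simp add: powr_add[symmetric])
    also have "\<dots> \<le> l powr (1 - s) * r powr s"
      using False assms by (intro mult_right_mono powr_mono2') auto
    finally have "z \<le> ennreal (l powr (1 - s)) * epowr z s"
      using real by (simp add: epowr_ennreal ennreal_mult[symmetric] ennreal_leI)
    then show ?thesis by (simp add: add_increasing)
  qed
qed

lemma avg_jensen:
  fixes F :: "'a::euclidean_space \<Rightarrow> ennreal"
  assumes b: "0 < b" and s: "s \<ge> 1" and [measurable]: "F \<in> borel_measurable borel"
  shows "epowr (avg b j F x) s \<le> ennreal ((kern_mass TYPE('a) b + 1) powr s) * avg b j (\<lambda>y. epowr (F y) s) x"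
    (is "_ \<le> ennreal ?C * ?V")
proof (rule ennreal_le_epsilon)
  let ?m = "kern_mass TYPE('a) b"
  have m: "?m \<ge> 0" by (rule kern_mass_nonneg[OF b])
  have C: "?C > 0" using m by simp
  fix e :: real assume fin: "ennreal ?C * ?V < top" and e: "0 < e"
  have "?V < top" using fin C by (auto simp: ennreal_mult_less_top)
  then obtain v where v: "?V = ennreal v" "v \<ge> 0" by (cases ?V) auto
  \<comment> \<open>The extra \<open>e / ?C\<close> keeps the level positive even if v = 0, and is
    where the \<open>e\<close> of the claim goes.\<close>
  define \<mu> where "\<mu> = v + e / ?C"
  have \<mu>: "\<mu> > 0" "v \<le> \<mu>" using v e C by (auto simp: \<mu>_def intro!: add_nonneg_pos)
  define l where "l = \<mu> powr (1 / s)"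
  have l: "l > 0" "l powr s = \<mu>" using \<mu> s by (auto simp: l_def powr_powr)
  have "avg b j F x \<le> avg b j (\<lambda>y. ennreal l + ennreal (l powr (1 - s)) * epowr (F y) s) x"
    by (intro avg_mono ennreal_le_lambda_powr l s)
  also have "\<dots> = avg b j (\<lambda>y. ennreal l) x + ennreal (l powr (1 - s)) * ?V"
    by (subst avg_add) (auto simp: avg_cmult)
  also have "\<dots> \<le> ennreal ?m * ennreal l + ennreal (l powr (1 - s)) * ennreal (l powr s)"
    using \<mu>(2) by (intro add_mono avg_const_le b mult_left_mono) (auto simp: v l intro: ennreal_leI)
  also have "\<dots> = ennreal ((?m + 1) * l)"
  proof -
    have "l powr (1 - s) * l powr s = l" using l(1) by (simp only: powr_add[symmetric]) simp
    then show ?thesis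
      using l(1) m by (simp only: ennreal_mult[symmetric] powr_ge_zero less_imp_le ennreal_plus[symmetric] mult_nonneg_nonneg)
        (simp add: distrib_right)
  qed
  finally have "epowr (avg b j F x) s \<le> epowr (ennreal ((?m + 1) * l)) s"
    using s by (intro epowr_mono) auto
  also have "\<dots> = ennreal (?C * \<mu>)"
    using m l by (simp add: epowr_ennreal powr_mult)
  also have "\<dots> = ennreal ?C * ?V + ennreal e"
    using v C e by (simp add: \<mu>_def distrib_left ennreal_mult ennreal_plus)
  finally show "epowr (avg b j F x) s \<le> ennreal ?C * ?V + ennreal e" .
qed

subsection \<open>The maximal inequality\<close>

text \<open>The sum of the coefficients in \<open>kern_le_shells\<close>, that is
  \<open>kern_mass\<close> without the volume of the unit ball.\<close>

definition shell_mass :: "'a::euclidean_space itself \<Rightarrow> real \<Rightarrow> real" where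
  "shell_mass _ b = 2 powr (real DIM('a) + b) / (1 - 2 powr (- b))"

lemma shell_mass_pos: "0 < b \<Longrightarrow> 0 < shell_mass TYPE('a::euclidean_space) b"
  by (auto simp: shell_mass_def powr_less_one intro!: divide_pos_pos)

lemma nn_integral_suminf_indicator_mult:
  assumes [measurable]: "\<And>i. A i \<in> sets M" "F \<in> borel_measurable M"
  shows "(\<integral>\<^sup>+y. (\<Sum>i. c i * (e i * (indicator (A i) y * F y))) \<partial>M) = (\<Sum>i. c i * (e i * (\<integral>\<^sup>+y. indicator (A i) y * F y \<partial>M)))"
proof -
  have "(\<integral>\<^sup>+y. (\<Sum>i. c i * (e i * (indicator (A i) y * F y))) \<partial>M)
      = (\<Sum>i. \<integral>\<^sup>+y. c i * (e i * (indicator (A i) y * F y)) \<partial>M)"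
    by (rule nn_integral_suminf) measurable
  also have "\<dots> = (\<Sum>i. c i * (e i * (\<integral>\<^sup>+y. indicator (A i) y * F y \<partial>M)))"
    by (simp add: nn_integral_cmult)
  finally show ?thesis .
qed

text \<open>The kernel is dominated by a series of normalised ball indicators, so ball averages
  control \<open>avg\<close> at all scales at once. Read contrapositively, a large value of
  \<open>maxavg\<close> at a point yields a ball around it with a large average.\<close>

lemma avg_le_of_ball_averages:
  fixes F :: "'a::euclidean_space \<Rightarrow> ennreal"
  assumes b: "0 < b" and [measurable]: "F \<in> borel_measurable borel" and t: "t \<ge> 0"
    and ball: "\<And>r. r > 0 \<Longrightarrow> (\<integral>\<^sup>+y. indicator (cball x r) y * F y \<partial>lborel) \<le> ennreal (t * r ^ DIM('a))"
  shows "avg b j F x \<le> ennreal (shell_mass TYPE('a) b * t)"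
proof -
  let ?n = "DIM('a)"
  let ?c = "\<lambda>i. 2 powr (real ?n + b) * (2 powr (- b)) ^ i"
  let ?e = "\<lambda>i. ((2::real) ^ j / 2 ^ i) ^ ?n"
  let ?r = "\<lambda>i. (2::real) ^ i / 2 ^ j"
  have "avg b j F x \<le> (\<integral>\<^sup>+y. (\<Sum>i. ennreal (?c i) * (ennreal (?e i) * (indicator (cball x (?r i)) y * F y))) \<partial>lborel)"
    unfolding avg_def
  proof (rule nn_integral_mono)
    fix y
    have ind: "indicator (cball 0 (?r i)) (x - y) = (indicator (cball x (?r i)) y :: ennreal)" for i
      by (simp add: indicator_def dist_norm norm_minus_commute)
    have "ennreal (kern b j (x - y)) * F y \<le> (\<Sum>i. ennreal (?c i) * (ennreal (?e i) * indicator (cball 0 (?r i)) (x - y))) * F y"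
      by (intro mult_right_mono kern_le_shells b) simp
    also have "\<dots> = (\<Sum>i. ennreal (?c i) * (ennreal (?e i) * (indicator (cball x (?r i)) y * F y)))"
      unfolding ind by (simp add: ennreal_suminf_multc[symmetric] mult.assoc)
    finally show "ennreal (kern b j (x - y)) * F y \<le> (\<Sum>i. ennreal (?c i) * (ennreal (?e i) * (indicator (cball x (?r i)) y * F y)))" .
  qed
  also have "\<dots> = (\<Sum>i. ennreal (?c i) * (ennreal (?e i) * (\<integral>\<^sup>+y. indicator (cball x (?r i)) y * F y \<partial>lborel)))"
    by (rule nn_integral_suminf_indicator_mult) simp_all
  also have "\<dots> \<le> (\<Sum>i. ennreal (?c i * t))"
  proof (intro suminf_le summableI)
    fix i
    have *: "?e i * (?r i) ^ ?n = 1" unfolding power_mult_distrib[symmetric] by simp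
    have "ennreal (?e i) * (\<integral>\<^sup>+y. indicator (cball x (?r i)) y * F y \<partial>lborel) \<le> ennreal (?e i) * ennreal (t * (?r i) ^ ?n)"
      by (intro mult_left_mono ball) auto
    also have "\<dots> = ennreal (t * (?e i * (?r i) ^ ?n))"
    proof -
      have "ennreal (?e i) * ennreal (t * (?r i) ^ ?n) = ennreal (?e i * (t * (?r i) ^ ?n))"
        by (rule ennreal_mult'[symmetric]) simp
      also have "?e i * (t * (?r i) ^ ?n) = t * (?e i * (?r i) ^ ?n)" by (rule mult.left_commute)
      finally show ?thesis .
    qed
    finally have "ennreal (?e i) * (\<integral>\<^sup>+y. indicator (cball x (?r i)) y * F y \<partial>lborel) \<le> ennreal t"
      unfolding * by simp
    from mult_left_mono[OF this, of "ennreal (?c i)"]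
    show "ennreal (?c i) * (ennreal (?e i) * (\<integral>\<^sup>+y. indicator (cball x (?r i)) y * F y \<partial>lborel)) \<le> ennreal (?c i * t)"
      by (simp add: ennreal_mult')
  qed
  also have "\<dots> = ennreal (\<Sum>i. ?c i * t)"
    using b t by (intro suminf_ennreal2) (auto intro!: summable_mult2 summable_mult summable_geometric simp: powr_less_one)
  also have "(\<Sum>i. ?c i * t) = shell_mass TYPE('a) b * t"
  proof -
    have "(\<lambda>i. (2 powr (- b)) ^ i) sums (1 / (1 - 2 powr (- b)))"
      using b by (intro geometric_sums) (auto simp: powr_less_one)
    from sums_mult2[OF sums_mult[OF this, of "2 powr (real ?n + b)"], of t]
    show ?thesis by (simp add: sums_iff shell_mass_def)
  qed
  finally show ?thesis .
qed

text \<open>The factor 5^n is the enlargement of the balls in Vitali's covering lemma.\<close>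

definition weak_const :: "'a::euclidean_space itself \<Rightarrow> real \<Rightarrow> real" where
  "weak_const _ b = 5 ^ DIM('a) * unit_ball_vol DIM('a) * shell_mass TYPE('a) b"

lemma weak_const_pos: "0 < b \<Longrightarrow> 0 < weak_const TYPE('a::euclidean_space) b"
  by (auto simp: weak_const_def shell_mass_pos intro!: mult_pos_pos)

text \<open>The countable index set is transported to the naturals, with empty sets in the gaps, so
  that subadditivity applies on one side and additivity over disjoint sequences on the
  other.\<close>

lemma emeasure_countable_cover_le:
  assumes C: "countable C" and A: "\<And>i. i \<in> C \<Longrightarrow> A i \<in> sets M" and B: "\<And>i. i \<in> C \<Longrightarrow> B i \<in> sets N"
    and disj: "disjoint_family_on B C" and le: "\<And>i. i \<in> C \<Longrightarrow> emeasure M (A i) \<le> c * emeasure N (B i)"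
  shows "emeasure M (\<Union>i\<in>C. A i) \<le> c * emeasure N (\<Union>i\<in>C. B i)"
proof -
  define D where "D = to_nat_on C ` C"
  define A' where "A' n = (if n \<in> D then A (from_nat_into C n) else {})" for n
  define B' where "B' n = (if n \<in> D then B (from_nat_into C n) else {})" for n
  have D: "from_nat_into C n \<in> C" "to_nat_on C (from_nat_into C n) = n" if "n \<in> D" for n
    using that C by (auto simp: D_def)
  have UA: "(\<Union>i\<in>C. A i) = (\<Union>n. A' n)" and UB: "(\<Union>i\<in>C. B i) = (\<Union>n. B' n)"
    using D(1) C by (auto simp: A'_def B'_def D_def split: if_splits)
  have sA: "range A' \<subseteq> sets M" and sB: "range B' \<subseteq> sets N"
    using A B D(1) by (auto simp: A'_def B'_def)
  have "disjoint_family B'"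
    using disj D unfolding disjoint_family_on_def B'_def by (auto, metis IntI empty_iff)
  have "emeasure M (\<Union>n. A' n) \<le> (\<Sum>n. emeasure M (A' n))"
    by (rule emeasure_subadditive_countably[OF sA])
  also have "\<dots> \<le> (\<Sum>n. c * emeasure N (B' n))"
    using le D(1) by (intro suminf_le summableI) (auto simp: A'_def B'_def)
  also have "\<dots> = c * (\<Sum>n. emeasure N (B' n))" by simp
  also have "(\<Sum>n. emeasure N (B' n)) = emeasure N (\<Union>n. B' n)"
    by (rule suminf_emeasure[OF sB \<open>disjoint_family B'\<close>])
  finally show ?thesis unfolding UA UB .
qed

text \<open>Each point of the level set has a ball of radius r on which the mass of \<open>F\<close>
  exceeds k r^n. Vitali's lemma selects disjoint balls whose fivefold enlargements still cover;
  their total mass is at most the integral of \<open>F\<close>.\<close>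

lemma maxavg_weak:
  fixes F :: "'a::euclidean_space \<Rightarrow> ennreal"
  assumes b: "0 < b" and [measurable]: "F \<in> borel_measurable borel" and t: "t > 0"
  shows "emeasure lborel {x. ennreal t < maxavg b F x} \<le> ennreal (weak_const TYPE('a) b / t) * (\<integral>\<^sup>+x. F x \<partial>lborel)"
proof (cases "(\<integral>\<^sup>+x. F x \<partial>lborel) = \<top>")
  case True
  then show ?thesis using weak_const_pos[OF b, where 'a='a] t by (simp add: ennreal_mult_top)
next
  case False
  then obtain I where I: "(\<integral>\<^sup>+x. F x \<partial>lborel) = ennreal I" "I \<ge> 0" by (cases "\<integral>\<^sup>+x. F x \<partial>lborel") auto
  let ?n = "DIM('a)"
  let ?S = "{x. ennreal t < maxavg b F x}"
  define k where "k = t / shell_mass TYPE('a) b"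
  have sm: "shell_mass TYPE('a) b > 0" by (rule shell_mass_pos[OF b])
  have k: "k > 0" using t sm by (simp add: k_def)
  define \<nu> where "\<nu> = density lborel F"
  have \<nu>: "emeasure \<nu> A = (\<integral>\<^sup>+y. indicator A y * F y \<partial>lborel)" if "A \<in> sets borel" for A
    unfolding \<nu>_def using that by (subst emeasure_density) (auto simp: mult.commute)
  have \<nu>sets[simp, measurable_cong]: "sets \<nu> = sets borel" by (simp add: \<nu>_def)
  have "\<exists>r>0. ennreal (k * r ^ ?n) < emeasure \<nu> (cball x r)" if x: "x \<in> ?S" for x
  proof (rule ccontr)
    assume "\<not> (\<exists>r>0. ennreal (k * r ^ ?n) < emeasure \<nu> (cball x r))"
    then have "avg b j F x \<le> ennreal (shell_mass TYPE('a) b * k)" for j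
      using k by (intro avg_le_of_ball_averages b) (auto simp: \<nu> not_less[symmetric])
    then have "maxavg b F x \<le> ennreal (shell_mass TYPE('a) b * k)" unfolding maxavg_def by (intro SUP_least)
    also have "\<dots> = ennreal t" using sm by (simp add: k_def)
    finally show False using x by simp
  qed
  then have "\<forall>x\<in>?S. \<exists>r. r > 0 \<and> ennreal (k * r ^ ?n) < emeasure \<nu> (cball x r)" by (intro ballI)
  from bchoice[OF this] obtain r where r: "\<And>x. x \<in> ?S \<Longrightarrow> r x > 0" "\<And>x. x \<in> ?S \<Longrightarrow> ennreal (k * r x ^ ?n) < emeasure \<nu> (cball x (r x))"
    by blast
  \<comment> \<open>The covering lemma needs bounded radii; they are bounded because k r^n cannot
    exceed the total mass \<open>I\<close>.\<close>
  have rB: "0 < r x \<and> r x \<le> max 1 (I / k)" if x: "x \<in> ?S" for x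
  proof -
    have "ennreal (k * r x ^ ?n) \<le> emeasure \<nu> (cball x (r x))" using r(2)[OF x] by simp
    also have "\<dots> \<le> emeasure \<nu> UNIV" by (intro emeasure_mono) auto
    also have "\<dots> = ennreal I" by (simp add: \<nu> I(1))
    finally have "ennreal (k * r x ^ ?n) \<le> ennreal I" .
    then have "k * r x ^ ?n \<le> I" using I(2) by (simp add: ennreal_le_iff)
    then have rn: "r x ^ ?n \<le> I / k" using k by (simp add: field_simps)
    have "r x \<le> max 1 (r x ^ ?n)"
    proof (cases "r x \<le> 1")
      case False
      then have "r x ^ 1 \<le> r x ^ ?n" by (intro power_increasing) auto
      then show ?thesis by simp
    qed simp
    with rn r(1)[OF x] show ?thesis by simp
  qed
  have "?S \<subseteq> (\<Union>i\<in>?S. cball i (r i))" using r(1) by (force intro: less_imp_le)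
  then obtain C where C: "countable C" "C \<subseteq> ?S"
     "pairwise (\<lambda>i j. disjnt (cball i (r i)) (cball j (r j))) C"
     "?S \<subseteq> (\<Union>i\<in>C. cball i (5 * r i))"
    by (rule Vitali_covering_lemma_cballs[where a="\<lambda>x. x" and r=r and K="?S" and B="max 1 (I / k)", OF _ rB])
  have "emeasure lborel ?S \<le> emeasure lborel (\<Union>i\<in>C. cball i (5 * r i))"
    using C by (intro emeasure_mono sets.countable_UN') auto
  also have "\<dots> \<le> ennreal (weak_const TYPE('a) b / t) * emeasure \<nu> (\<Union>i\<in>C. cball i (r i))"
  proof (rule emeasure_countable_cover_le[OF C(1)])
    show "disjoint_family_on (\<lambda>i. cball i (r i)) C"
      using C(3) unfolding disjoint_family_on_def pairwise_def disjnt_def by blast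
    fix i assume "i \<in> C"
    then have i: "i \<in> ?S" using C(2) by blast
    have "emeasure lborel (cball i (5 * r i)) = ennreal (unit_ball_vol ?n * (5 * r i) ^ ?n)"
      using r(1)[OF i] by (intro emeasure_cball) auto
    also have "unit_ball_vol ?n * (5 * r i) ^ ?n = weak_const TYPE('a) b / t * (k * r i ^ ?n)"
      using sm t by (simp add: weak_const_def k_def power_mult_distrib)
    also have "ennreal \<dots> = ennreal (weak_const TYPE('a) b / t) * ennreal (k * r i ^ ?n)"
      using weak_const_pos[OF b, where 'a='a] t by (intro ennreal_mult') auto
    also have "\<dots> \<le> ennreal (weak_const TYPE('a) b / t) * emeasure \<nu> (cball i (r i))"
      using r(2)[OF i] by (intro mult_left_mono) auto
    finally show "emeasure lborel (cball i (5 * r i)) \<le> ennreal (weak_const TYPE('a) b / t) * emeasure \<nu> (cball i (r i))" .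
  qed auto
  also have "emeasure \<nu> (\<Union>i\<in>C. cball i (r i)) \<le> emeasure \<nu> UNIV"
    by (intro emeasure_mono) auto
  also have "emeasure \<nu> UNIV = (\<integral>\<^sup>+x. F x \<partial>lborel)" by (simp add: \<nu>)
  finally show ?thesis by (simp add: mult_left_mono)
qed

lemma nn_integral_powr_layer:
  assumes "p > 0" "y \<ge> 0"
  shows "(\<integral>\<^sup>+t. ennreal (t powr (p - 1)) * indicator {0..y} t \<partial>lborel) = ennreal (y powr p / p)"
proof -
  have "((\<lambda>t. t powr (p - 1)) has_integral (y powr p / p)) {0..y}"
    using has_integral_powr_from_0[of "p - 1" y] assms by simp
  then have "((\<lambda>t. if t \<in> {0..y} then t powr (p - 1) else 0) has_integral (y powr p / p)) UNIV"
    by (simp only: has_integral_restrict_UNIV)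
  then have "(\<integral>\<^sup>+t. ennreal (if t \<in> {0..y} then t powr (p - 1) else 0) \<partial>lborel) = ennreal (y powr p / p)"
    by (intro nn_integral_has_integral_lborel) auto
  moreover have "ennreal (if t \<in> {0..y} then t powr (p - 1) else 0) = ennreal (t powr (p - 1)) * indicator {0..y} t" for t
    by (auto simp: indicator_def)
  ultimately show ?thesis by simp
qed

lemma ennreal_eq_topI:
  fixes x :: ennreal
  assumes "\<And>n::nat. of_nat n \<le> x" shows "x = \<top>"
proof (rule ccontr)
  assume "x \<noteq> \<top>"
  then obtain n where "x < of_nat n" using ennreal_Ex_less_of_nat[of x] by (auto simp: less_top)
  with assms[of n] show False by simp
qed

text \<open>The layer-cake representation of a power. The case y = \<infinity> follows from the
  finite one by exhaustion.\<close>

lemma epowr_le_layer: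
  assumes p: "p > 0"
  shows "epowr y p \<le> (\<integral>\<^sup>+t. ennreal (p * t powr (p - 1)) * indicator {t. 0 < t \<and> ennreal t < y} t \<partial>lborel)"
proof -
  have fin: "ennreal (r powr p) \<le> (\<integral>\<^sup>+t. ennreal (p * t powr (p - 1)) * indicator {t. 0 < t \<and> ennreal t < y} t \<partial>lborel)"
    if r: "r \<ge> 0" "ennreal r \<le> y" for r
  proof -
    have "ennreal (r powr p) = ennreal p * (\<integral>\<^sup>+t. ennreal (t powr (p - 1)) * indicator {0..r} t \<partial>lborel)"
      using p r by (subst nn_integral_powr_layer) (auto simp: ennreal_mult'[symmetric])
    also have "\<dots> = (\<integral>\<^sup>+t. ennreal (p * t powr (p - 1)) * indicator {0..r} t \<partial>lborel)"
      using p by (subst nn_integral_cmult[symmetric]) (auto simp: ennreal_mult' mult.assoc)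
    also have "\<dots> \<le> (\<integral>\<^sup>+t. ennreal (p * t powr (p - 1)) * indicator {t. 0 < t \<and> ennreal t < y} t \<partial>lborel)"
    proof (rule nn_integral_mono_AE)
      have ne: "AE t in lborel. t \<noteq> 0" "AE t in lborel. t \<noteq> r" by (rule AE_lborel_singleton)+
      show "AE t in lborel. ennreal (p * t powr (p - 1)) * indicator {0..r} t \<le> ennreal (p * t powr (p - 1)) * indicator {t. 0 < t \<and> ennreal t < y} t"
        using ne
      proof eventually_elim
        case (elim t)
        show ?case
        proof (cases "t \<in> {0..r}")
          case True
          with elim have "0 < t" "t < r" by auto
          then have "ennreal t < ennreal r" by (simp add: ennreal_less_iff)
          then have "ennreal t < y" using r(2) by (rule less_le_trans)
          with True \<open>0 < t\<close> show ?thesis by simp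
        qed simp
      qed
    qed
    finally show ?thesis .
  qed
  show ?thesis
  proof (cases y)
    case (real r)
    then show ?thesis using fin[of r] by (simp add: epowr_ennreal)
  next
    case top
    let ?I = "\<integral>\<^sup>+t. ennreal (p * t powr (p - 1)) * indicator {t. 0 < t \<and> ennreal t < y} t \<partial>lborel"
    have "of_nat n \<le> ?I" for n
    proof -
      have "ennreal ((real n powr (1 / p)) powr p) \<le> ?I" by (rule fin) (auto simp: top)
      then show ?thesis using p by (simp add: powr_powr ennreal_of_nat_eq_real_of_nat)
    qed
    then have "?I = \<top>" by (rule ennreal_eq_topI)
    then show ?thesis by simp
  qed
qed

text \<open>The inner integral in the interpolation argument: a value \<open>z\<close> survives the
  truncation exactly at the levels \<open>t\<close> below c z.\<close>

lemma layer_integral_le: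
  assumes p: "p > 0" and c: "c > 0"
  shows "z * (\<integral>\<^sup>+t. ennreal (t powr (p - 1)) * indicator {t. 0 < t \<and> ennreal t < ennreal c * z} t \<partial>lborel)
     \<le> ennreal (c powr p / p) * epowr z (p + 1)"
proof (cases z)
  case top
  have "ennreal (c powr p / p) \<noteq> 0" using p c by simp
  then show ?thesis unfolding top epowr_top by (simp only: ennreal_mult_top top_greatest if_False)
next
  case (real r)
  have "(\<integral>\<^sup>+t. ennreal (t powr (p - 1)) * indicator {t. 0 < t \<and> ennreal t < ennreal c * z} t \<partial>lborel)
     \<le> (\<integral>\<^sup>+t. ennreal (t powr (p - 1)) * indicator {0..c * r} t \<partial>lborel)"
  proof (rule nn_integral_mono)
    fix t
    have cz: "ennreal c * z = ennreal (c * r)" using real c by (simp add: ennreal_mult')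
    have "indicator {t. 0 < t \<and> ennreal t < ennreal c * z} t \<le> (indicator {0..c * r} t :: ennreal)"
      unfolding cz by (auto simp: indicator_def ennreal_less_iff)
    then show "ennreal (t powr (p - 1)) * indicator {t. 0 < t \<and> ennreal t < ennreal c * z} t \<le> ennreal (t powr (p - 1)) * indicator {0..c * r} t"
      by (rule mult_left_mono) simp
  qed
  also have "\<dots> = ennreal ((c * r) powr p / p)"
    using p c real by (intro nn_integral_powr_layer) auto
  finally have "z * (\<integral>\<^sup>+t. ennreal (t powr (p - 1)) * indicator {t. 0 < t \<and> ennreal t < ennreal c * z} t \<partial>lborel)
      \<le> ennreal r * ennreal ((c * r) powr p / p)"
    using real by (simp add: mult_left_mono)
  also have "\<dots> = ennreal (c powr p / p) * epowr z (p + 1)"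
    using real c p by (simp add: epowr_ennreal ennreal_mult'[symmetric] powr_mult powr_add mult_ac)
  finally show ?thesis .
qed

text \<open>Marcinkiewicz interpolation between the weak bound and the trivial bound for bounded
  functions: at level t only the part of \<open>F\<close> above t / (2 m) matters, since the rest
  has averages of at most t / 2.\<close>

theorem maxavg_strong:
  assumes b: "0 < b" and s: "s > 1"
  obtains C where "C > 0" "\<And>F :: 'a::euclidean_space \<Rightarrow> ennreal. F \<in> borel_measurable borel \<Longrightarrow>
     (\<integral>\<^sup>+x. epowr (maxavg b F x) s \<partial>lborel) \<le> ennreal C * (\<integral>\<^sup>+x. epowr (F x) s \<partial>lborel)"
proof -
  \<comment> \<open>\<open>kern_mass\<close> is only known to be nonnegative; the summand 1 makes
    \<open>m\<close> a positive divisor.\<close>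
  define m where "m = kern_mass TYPE('a) b + 1"
  have m: "m > 0" using kern_mass_nonneg[OF b, where 'a='a] by (simp add: m_def)
  define W where "W = 2 * weak_const TYPE('a) b"
  have W: "W > 0" using weak_const_pos[OF b, where 'a='a] by (simp add: W_def)
  have weak: "emeasure lborel {x. ennreal t < maxavg b F x} \<le> ennreal (W / t) * (\<integral>\<^sup>+x. F x * indicator {x. ennreal t < ennreal (2 * m) * F x} x \<partial>lborel)"
    if Fm[measurable]: "F \<in> borel_measurable borel" and t: "t > 0" for F :: "'a \<Rightarrow> ennreal" and t
  proof -
    let ?A = "{x. ennreal t < ennreal (2 * m) * F x}"
    define G where "G x = F x * indicator ?A x" for x
    have [measurable]: "G \<in> borel_measurable borel" unfolding G_def by measurable
    have FG: "F x \<le> ennreal (t / (2 * m)) + G x" for x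
    proof (cases "x \<in> ?A")
      case False
      then have "ennreal (2 * m) * F x \<le> ennreal t" by (simp add: not_less)
      then have "F x \<le> ennreal (t / (2 * m))"
        using m t by (cases "F x") (auto simp: ennreal_mult'[symmetric] ennreal_mult_top top_unique ennreal_le_iff field_simps)
      then show ?thesis by (simp add: add_increasing2)
    qed (simp add: G_def)
    have "{x. ennreal t < maxavg b F x} \<subseteq> {x. ennreal (t / 2) < maxavg b G x}"
    proof safe
      fix x assume "ennreal t < maxavg b F x"
      then obtain j where j: "ennreal t < avg b j F x" unfolding maxavg_def by (auto simp: less_SUP_iff)
      also have "avg b j F x \<le> avg b j (\<lambda>y. ennreal (t / (2 * m))) x + avg b j G x"
        by (subst avg_add[symmetric]) (auto intro: avg_mono FG)
      also have "avg b j (\<lambda>y. ennreal (t / (2 * m))) x \<le> ennreal (m - 1) * ennreal (t / (2 * m))"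
        using avg_const_le[OF b] by (simp add: m_def)
      also have "\<dots> \<le> ennreal m * ennreal (t / (2 * m))"
        by (intro mult_right_mono ennreal_leI) auto
      also have "\<dots> = ennreal (t / 2)" using m by (simp add: ennreal_mult'[symmetric])
      finally have "ennreal t < ennreal (t / 2) + avg b j G x" by (simp add: add_right_mono)
      also have "avg b j G x \<le> maxavg b G x" by (rule avg_le_maxavg)
      finally have *: "ennreal t < ennreal (t / 2) + maxavg b G x" by (simp add: add_left_mono)
      show "ennreal (t / 2) < maxavg b G x"
      proof (rule ccontr)
        assume "\<not> ennreal (t / 2) < maxavg b G x"
        then have "ennreal (t / 2) + maxavg b G x \<le> ennreal (t / 2) + ennreal (t / 2)" by (intro add_left_mono) simp
        also have "\<dots> = ennreal t" using t by (simp add: ennreal_plus[symmetric] del: ennreal_plus)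
        finally show False using * by simp
      qed
    qed
    then have "emeasure lborel {x. ennreal t < maxavg b F x} \<le> emeasure lborel {x. ennreal (t / 2) < maxavg b G x}"
      by (intro emeasure_mono) measurable
    also have "\<dots> \<le> ennreal (weak_const TYPE('a) b / (t / 2)) * (\<integral>\<^sup>+x. G x \<partial>lborel)"
      using t by (intro maxavg_weak b) auto
    finally show ?thesis by (simp add: W_def G_def mult.commute)
  qed
  define C where "C = s * W * ((2 * m) powr (s - 1) / (s - 1))"
  have C: "C > 0" using s W m by (simp add: C_def)
  moreover have "(\<integral>\<^sup>+x. epowr (maxavg b F x) s \<partial>lborel) \<le> ennreal C * (\<integral>\<^sup>+x. epowr (F x) s \<partial>lborel)"
    if Fm[measurable]: "F \<in> borel_measurable borel" for F :: "'a \<Rightarrow> ennreal"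
  proof -
    have "(\<integral>\<^sup>+x. epowr (maxavg b F x) s \<partial>lborel)
      \<le> (\<integral>\<^sup>+x. \<integral>\<^sup>+t. ennreal (s * t powr (s - 1)) * indicator {t. 0 < t \<and> ennreal t < maxavg b F x} t \<partial>lborel \<partial>lborel)"
      using s by (intro nn_integral_mono epowr_le_layer) auto
    also have "\<dots> = (\<integral>\<^sup>+t. \<integral>\<^sup>+x. ennreal (s * t powr (s - 1)) * indicator {t. 0 < t \<and> ennreal t < maxavg b F x} t \<partial>lborel \<partial>lborel)"
      by (rule lborel_pair.Fubini') measurable
    also have "\<dots> \<le> (\<integral>\<^sup>+t. \<integral>\<^sup>+x. ennreal (s * W) * (F x * (ennreal (t powr (s - 2)) * indicator {t. 0 < t \<and> ennreal t < ennreal (2 * m) * F x} t)) \<partial>lborel \<partial>lborel)"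
    proof (rule nn_integral_mono)
      fix t :: real
      show "(\<integral>\<^sup>+x. ennreal (s * t powr (s - 1)) * indicator {t. 0 < t \<and> ennreal t < maxavg b F x} t \<partial>lborel)
        \<le> (\<integral>\<^sup>+x. ennreal (s * W) * (F x * (ennreal (t powr (s - 2)) * indicator {t. 0 < t \<and> ennreal t < ennreal (2 * m) * F x} t)) \<partial>lborel)"
      proof (cases "t > 0")
        case True
        have "(\<integral>\<^sup>+x. ennreal (s * t powr (s - 1)) * indicator {t. 0 < t \<and> ennreal t < maxavg b F x} t \<partial>lborel)
            = (\<integral>\<^sup>+x. ennreal (s * t powr (s - 1)) * indicator {x. ennreal t < maxavg b F x} x \<partial>lborel)"
          using True by (intro nn_integral_cong) (simp add: indicator_def)
        also have "\<dots> = ennreal (s * t powr (s - 1)) * emeasure lborel {x. ennreal t < maxavg b F x}"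
          by (subst nn_integral_cmult_indicator) auto
        also have "\<dots> \<le> ennreal (s * t powr (s - 1)) * (ennreal (W / t) * (\<integral>\<^sup>+x. F x * indicator {x. ennreal t < ennreal (2 * m) * F x} x \<partial>lborel))"
          by (intro mult_left_mono weak True) auto
        also have "\<dots> = ennreal (s * t powr (s - 1) * (W / t)) * (\<integral>\<^sup>+x. F x * indicator {x. ennreal t < ennreal (2 * m) * F x} x \<partial>lborel)"
        proof -
          have "ennreal (s * t powr (s - 1)) * ennreal (W / t) = ennreal (s * t powr (s - 1) * (W / t))"
            using s by (intro ennreal_mult'[symmetric]) simp
          then show ?thesis by (simp only: mult.assoc[symmetric])
        qed
        also have "s * t powr (s - 1) * (W / t) = s * W * t powr (s - 2)"
        proof -
          have "t powr (s - 1) = t powr (s - 2) * t" using True powr_add[of t "s - 2" 1] by simp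
          then show ?thesis using True by simp
        qed
        also have "ennreal (s * W * t powr (s - 2)) * (\<integral>\<^sup>+x. F x * indicator {x. ennreal t < ennreal (2 * m) * F x} x \<partial>lborel)
          = (\<integral>\<^sup>+x. ennreal (s * W * t powr (s - 2)) * (F x * indicator {x. ennreal t < ennreal (2 * m) * F x} x) \<partial>lborel)"
          by (rule nn_integral_cmult[symmetric]) measurable
        also have "\<dots> = (\<integral>\<^sup>+x. ennreal (s * W) * (F x * (ennreal (t powr (s - 2)) * indicator {t. 0 < t \<and> ennreal t < ennreal (2 * m) * F x} t)) \<partial>lborel)"
          using True s W by (intro nn_integral_cong) (simp add: indicator_def ennreal_mult' mult_ac)
        finally show ?thesis .
      qed simp
    qed
    also have "\<dots> = (\<integral>\<^sup>+x. \<integral>\<^sup>+t. ennreal (s * W) * (F x * (ennreal (t powr (s - 2)) * indicator {t. 0 < t \<and> ennreal t < ennreal (2 * m) * F x} t)) \<partial>lborel \<partial>lborel)"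
      by (rule lborel_pair.Fubini'[symmetric]) measurable
    also have "\<dots> = (\<integral>\<^sup>+x. ennreal (s * W) * (F x * (\<integral>\<^sup>+t. ennreal (t powr (s - 2)) * indicator {t. 0 < t \<and> ennreal t < ennreal (2 * m) * F x} t \<partial>lborel)) \<partial>lborel)"
      by (simp add: nn_integral_cmult)
    also have "\<dots> \<le> (\<integral>\<^sup>+x. ennreal (s * W) * (ennreal ((2 * m) powr (s - 1) / (s - 1)) * epowr (F x) s) \<partial>lborel)"
      using layer_integral_le[of "s - 1" "2 * m"] s m by (intro nn_integral_mono mult_left_mono) (auto simp: algebra_simps)
    also have "\<dots> = (\<integral>\<^sup>+x. ennreal C * epowr (F x) s \<partial>lborel)"
    proof -
      have "ennreal C = ennreal (s * W) * ennreal ((2 * m) powr (s - 1) / (s - 1))"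
        unfolding C_def using s W by (intro ennreal_mult') simp
      then show ?thesis by (simp only: mult.assoc)
    qed
    also have "\<dots> = ennreal C * (\<integral>\<^sup>+x. epowr (F x) s \<partial>lborel)"
      by (rule nn_integral_cmult) measurable
    finally show ?thesis .
  qed
  ultimately show thesis by (rule that)
qed


subsection \<open>The vector-valued inequality\<close>

text \<open>Young's inequality with a parameter, proved by comparing \<open>y\<close> with (K
  x)^(\<sigma> - 1). A large \<open>K\<close> makes the coefficient of the dual power small enough
  to be absorbed.\<close>

lemma mult_le_epowr_split:
  assumes K: "K > 0" and \<sigma>: "\<sigma> > 1"
  shows "x * y \<le> ennreal (K powr (\<sigma> - 1)) * epowr x \<sigma> + ennreal (1 / K) * epowr y (\<sigma> / (\<sigma> - 1))"
proof (cases "y \<le> epowr (ennreal K * x) (\<sigma> - 1)")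
  case True
  have "x * y \<le> x * (ennreal (K powr (\<sigma> - 1)) * epowr x (\<sigma> - 1))"
    using True K \<sigma> by (intro mult_left_mono) (auto simp: epowr_cmult)
  also have "\<dots> = ennreal (K powr (\<sigma> - 1)) * (epowr x 1 * epowr x (\<sigma> - 1))" by (simp add: mult_ac)
  also have "\<dots> = ennreal (K powr (\<sigma> - 1)) * epowr x \<sigma>" using \<sigma> by (subst epowr_add) auto
  finally show ?thesis by (rule order_trans) simp
next
  case False
  define k where "k = 1 / (\<sigma> - 1)"
  have k: "k > 0" "(\<sigma> - 1) * k = 1" "1 + k = \<sigma> / (\<sigma> - 1)" using \<sigma> by (auto simp: k_def field_simps)
  from False have "epowr (epowr (ennreal K * x) (\<sigma> - 1)) k \<le> epowr y k"
    using k by (intro epowr_mono) auto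
  then have "ennreal K * x \<le> epowr y k" by (simp add: epowr_epowr k)
  then have "ennreal (1 / K) * (ennreal K * x) \<le> ennreal (1 / K) * epowr y k" by (rule mult_left_mono) simp
  then have "x \<le> ennreal (1 / K) * epowr y k"
    using K by (simp add: mult.assoc[symmetric] ennreal_mult'[symmetric])
  then have "x * y \<le> (ennreal (1 / K) * epowr y k) * epowr y 1" by (simp add: mult_right_mono)
  also have "\<dots> = ennreal (1 / K) * epowr y (\<sigma> / (\<sigma> - 1))"
    using k by (simp add: mult.assoc epowr_add[of k 1] add.commute del: epowr_one)
  finally show ?thesis by (rule order_trans) simp
qed

lemma epowr_interpolate:
  assumes "0 < \<theta>" "\<theta> < 1"
  shows "epowr u (1 - \<theta>) * epowr v \<theta> \<le> u + v"
proof -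
  have "epowr u (1 - \<theta>) * epowr v \<theta> \<le> epowr (max u v) (1 - \<theta>) * epowr (max u v) \<theta>"
    using assms by (intro mult_mono epowr_mono) auto
  also have "\<dots> = max u v" using assms by (simp add: epowr_add)
  also have "\<dots> \<le> u + v" by (cases "u \<le> v") (auto simp: max_def)
  finally show ?thesis .
qed

lemma nn_integral_avg_epowr_le:
  fixes F :: "'a::euclidean_space \<Rightarrow> ennreal"
  assumes b: "0 < b" and s: "s \<ge> 1" and Fm[measurable]: "F \<in> borel_measurable borel"
  shows "(\<integral>\<^sup>+x. epowr (avg b j F x) s \<partial>lborel)
    \<le> ennreal ((kern_mass TYPE('a) b + 1) powr s * kern_mass TYPE('a) b) * (\<integral>\<^sup>+x. epowr (F x) s \<partial>lborel)"
proof -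
  have "(\<integral>\<^sup>+x. epowr (avg b j F x) s \<partial>lborel)
     \<le> (\<integral>\<^sup>+x. ennreal ((kern_mass TYPE('a) b + 1) powr s) * avg b j (\<lambda>y. epowr (F y) s) x \<partial>lborel)"
    by (intro nn_integral_mono avg_jensen b s Fm)
  also have "\<dots> = ennreal ((kern_mass TYPE('a) b + 1) powr s) * (\<integral>\<^sup>+x. avg b j (\<lambda>y. epowr (F y) s) x \<partial>lborel)"
    by (rule nn_integral_cmult) measurable
  also have "\<dots> \<le> ennreal ((kern_mass TYPE('a) b + 1) powr s) * (ennreal (kern_mass TYPE('a) b) * (\<integral>\<^sup>+x. epowr (F x) s \<partial>lborel))"
    by (intro mult_left_mono nn_integral_avg_le b) auto
  finally show ?thesis by (simp add: ennreal_mult' mult.assoc)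
qed

text \<open>
  By self-adjointness the sum is tested against its own power of order \<open>\<sigma> - 1\<close>, whose averages are all below one
  maximal function in the dual exponent. The truncation makes the quantity that is absorbed finite.
\<close>

lemma avg_sum_strong:
  assumes b: "0 < b" and \<sigma>: "\<sigma> > 1"
  obtains C where "C > 0" "\<And>X :: nat \<Rightarrow> 'a::euclidean_space \<Rightarrow> ennreal. (\<And>j. X j \<in> borel_measurable borel) \<Longrightarrow>
     (\<integral>\<^sup>+x. epowr (\<Sum>j. avg b j (X j) x) \<sigma> \<partial>lborel) \<le> ennreal C * (\<integral>\<^sup>+x. epowr (\<Sum>j. X j x) \<sigma> \<partial>lborel)"
proof -
  define \<sigma>' where "\<sigma>' = \<sigma> / (\<sigma> - 1)"
  have \<sigma>': "\<sigma>' > 1" "(\<sigma> - 1) * \<sigma>' = \<sigma>" using \<sigma> by (auto simp: \<sigma>'_def field_simps)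
  obtain D where D: "D > 0" "\<And>F :: 'a \<Rightarrow> ennreal. F \<in> borel_measurable borel \<Longrightarrow>
     (\<integral>\<^sup>+x. epowr (maxavg b F x) \<sigma>' \<partial>lborel) \<le> ennreal D * (\<integral>\<^sup>+x. epowr (F x) \<sigma>' \<partial>lborel)"
    using maxavg_strong[OF b \<sigma>'(1), where 'a='a] by blast
  \<comment> \<open>Gives the maximal-function term the factor D / K = 1 / 2.\<close>
  define K where "K = 2 * D"
  have K: "K > 0" using D by (simp add: K_def)
  define A where "A = K powr (\<sigma> - 1)"
  have A: "A > 0" using K by (simp add: A_def)
  have "(\<integral>\<^sup>+x. epowr (\<Sum>j. avg b j (X j) x) \<sigma> \<partial>lborel) \<le> ennreal (2 * A) * (\<integral>\<^sup>+x. epowr (\<Sum>j. X j x) \<sigma> \<partial>lborel)"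
    if Xm[measurable]: "\<And>j. X j \<in> borel_measurable borel" for X :: "nat \<Rightarrow> 'a \<Rightarrow> ennreal"
  proof -
    define N where "N x = (\<Sum>j. avg b j (X j) x)" for x
    define R where "R x = (\<Sum>j. X j x)" for x
    have [measurable]: "N \<in> borel_measurable borel" "R \<in> borel_measurable borel"
      unfolding N_def[abs_def] R_def[abs_def] by measurable
    let ?IR = "\<integral>\<^sup>+x. epowr (R x) \<sigma> \<partial>lborel"
    define Nm where "Nm m x = min (N x) (of_nat m) * indicator (ball 0 (real m)) x" for m x
    have [measurable]: "Nm m \<in> borel_measurable borel" for m
      unfolding Nm_def[abs_def] by (intro borel_measurable_times_ennreal borel_measurable_indicator) simp_all
    have bound: "(\<integral>\<^sup>+x. epowr (Nm m x) \<sigma> \<partial>lborel) \<le> ennreal (2 * A) * ?IR" for m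
    proof -
      let ?I = "\<integral>\<^sup>+x. epowr (Nm m x) \<sigma> \<partial>lborel"
      define g where "g x = epowr (Nm m x) (\<sigma> - 1)" for x
      have [measurable]: "g \<in> borel_measurable borel" unfolding g_def[abs_def] by measurable
      have fin: "?I < \<top>"
      proof -
        have "?I \<le> (\<integral>\<^sup>+x. epowr (of_nat m) \<sigma> * indicator (ball (0::'a) (real m)) x \<partial>lborel)"
          using \<sigma> by (intro nn_integral_mono) (auto simp: Nm_def indicator_def intro!: epowr_mono)
        also have "\<dots> = epowr (of_nat m) \<sigma> * emeasure lborel (ball (0::'a) (real m))"
          by (rule nn_integral_cmult_indicator) simp
        also have "\<dots> < \<top>"
          using emeasure_lborel_ball_finite[of "0::'a" "real m"] by (simp add: ennreal_mult_less_top epowr_less_top_iff ennreal_of_nat_eq_real_of_nat)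
        finally show ?thesis .
      qed
      have "?I \<le> (\<integral>\<^sup>+x. N x * g x \<partial>lborel)"
      proof (rule nn_integral_mono)
        fix x
        have "epowr (Nm m x) \<sigma> = epowr (Nm m x) 1 * g x"
          using \<sigma> unfolding g_def by (subst epowr_add) auto
        also have "\<dots> \<le> N x * g x" by (intro mult_right_mono) (auto simp: Nm_def indicator_def)
        finally show "epowr (Nm m x) \<sigma> \<le> N x * g x" .
      qed
      also have "\<dots> = (\<Sum>j. \<integral>\<^sup>+x. avg b j (X j) x * g x \<partial>lborel)"
        unfolding N_def by (simp only: ennreal_suminf_multc[symmetric]) (rule nn_integral_suminf, measurable)
      also have "\<dots> = (\<Sum>j. \<integral>\<^sup>+x. X j x * avg b j g x \<partial>lborel)"
        by (subst avg_selfadjoint) auto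
      also have "\<dots> \<le> (\<Sum>j. \<integral>\<^sup>+x. X j x * maxavg b g x \<partial>lborel)"
        by (intro suminf_le summableI nn_integral_mono mult_left_mono avg_le_maxavg) auto
      also have "\<dots> = (\<integral>\<^sup>+x. R x * maxavg b g x \<partial>lborel)"
        unfolding R_def by (simp only: ennreal_suminf_multc[symmetric]) (rule nn_integral_suminf[symmetric], measurable)
      also have "\<dots> \<le> (\<integral>\<^sup>+x. ennreal A * epowr (R x) \<sigma> + ennreal (1 / K) * epowr (maxavg b g x) \<sigma>' \<partial>lborel)"
        unfolding A_def \<sigma>'_def by (intro nn_integral_mono mult_le_epowr_split K \<sigma>)
      also have "\<dots> = ennreal A * ?IR + ennreal (1 / K) * (\<integral>\<^sup>+x. epowr (maxavg b g x) \<sigma>' \<partial>lborel)"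
        by (subst nn_integral_add) (auto simp: nn_integral_cmult)
      also have "\<dots> \<le> ennreal A * ?IR + ennreal (1 / K) * (ennreal D * (\<integral>\<^sup>+x. epowr (g x) \<sigma>' \<partial>lborel))"
        by (intro add_left_mono mult_left_mono D) auto
      \<comment> \<open>The loop closes: (\<sigma> - 1) \<sigma>' = \<sigma> brings back the
        integral that is being estimated.\<close>
      also have "(\<lambda>x. epowr (g x) \<sigma>') = (\<lambda>x. epowr (Nm m x) \<sigma>)"
        unfolding g_def epowr_epowr \<sigma>' ..
      also have "ennreal (1 / K) * (ennreal D * ?I) = ennreal (1 / 2) * ?I"
        using D by (simp add: K_def mult.assoc[symmetric] ennreal_mult'[symmetric])
      finally have le: "?I \<le> ennreal A * ?IR + ennreal (1 / 2) * ?I" .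
      obtain i where i: "?I = ennreal i" "i \<ge> 0" using fin by (cases ?I) auto
      show ?thesis
      proof (cases "?IR")
        case (real k)
        have ir: "?IR = ennreal k" using real by simp
        have "ennreal A * ennreal k + ennreal (1 / 2) * ennreal i = ennreal (A * k) + ennreal (1 / 2 * i)"
          using A by (intro arg_cong2[where f="(+)"] ennreal_mult'[symmetric]) auto
        also have "\<dots> = ennreal (A * k + 1 / 2 * i)" using A real i(2) by (intro ennreal_plus[symmetric]) auto
        finally have "ennreal i \<le> ennreal (A * k + 1 / 2 * i)"
          using le unfolding i(1) ir by (simp only:)
        then have "i \<le> A * k + 1 / 2 * i" using A real i by (subst (asm) ennreal_le_iff) auto
        then have "i \<le> 2 * A * k" by simp
        then show ?thesis using A real unfolding i(1) by (simp add: ennreal_mult'[symmetric] ennreal_leI)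
      next
        case top
        then show ?thesis using A by (simp add: ennreal_mult_top)
      qed
    qed
    have inc: "incseq (\<lambda>m x. epowr (Nm m x) \<sigma>)"
    proof (rule incseq_SucI, rule le_funI)
      fix m and x :: 'a
      have "indicator (ball 0 (real m)) x \<le> (indicator (ball 0 (real (Suc m))) x :: ennreal)"
        by (auto simp: indicator_def)
      then have "Nm m x \<le> Nm (Suc m) x"
        unfolding Nm_def by (intro mult_mono min.mono) auto
      then show "epowr (Nm m x) \<sigma> \<le> epowr (Nm (Suc m) x) \<sigma>" using \<sigma> by (intro epowr_mono) auto
    qed
    have "epowr (N x) \<sigma> \<le> (SUP m. epowr (Nm m x) \<sigma>)" for x
    proof -
      obtain m0 where m0: "norm x < real m0" using reals_Archimedean2 by blast
      show ?thesis
      proof (cases "N x")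
        case (real n)
        obtain m1 where m1: "n < real m1" using reals_Archimedean2 by blast
        have "N x \<le> of_nat (max m0 m1)"
        proof -
          have "N x = ennreal n" using real by simp
          then show ?thesis using m1 unfolding ennreal_of_nat_eq_real_of_nat by (simp add: ennreal_leI)
        qed
        moreover have "x \<in> ball 0 (real (max m0 m1))" using m0 by simp
        ultimately have "Nm (max m0 m1) x = N x"
          unfolding Nm_def by (simp add: min_absorb1 del: of_nat_max mem_ball mem_ball_0)
        then show ?thesis by (metis SUP_upper UNIV_I)
      next
        case top
        have "of_nat k \<le> (SUP m. epowr (Nm m x) \<sigma>)" for k
        proof -
          \<comment> \<open>The successor makes the base at least 1, so that raising it to the power
            \<sigma> does not decrease it.\<close>
          have "real (Suc k) powr 1 \<le> real (Suc (max m0 k)) powr \<sigma>"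
            using \<sigma> by (intro order_trans[OF powr_mono2 powr_mono]) auto
          then have "of_nat k \<le> ennreal (real (Suc (max m0 k)) powr \<sigma>)"
            unfolding ennreal_of_nat_eq_real_of_nat by (intro ennreal_leI) simp
          also have "\<dots> = epowr (Nm (Suc (max m0 k)) x) \<sigma>"
            using m0 top by (simp add: Nm_def ennreal_of_nat_eq_real_of_nat epowr_ennreal[symmetric] del: of_nat_Suc)
          also have "\<dots> \<le> (SUP m. epowr (Nm m x) \<sigma>)" by (rule SUP_upper) simp
          finally show ?thesis .
        qed
        then have "(SUP m. epowr (Nm m x) \<sigma>) = \<top>" by (rule ennreal_eq_topI)
        then show ?thesis by (simp only: top_greatest)
      qed
    qed
    then have "(\<integral>\<^sup>+x. epowr (N x) \<sigma> \<partial>lborel) \<le> (\<integral>\<^sup>+x. (SUP m. epowr (Nm m x) \<sigma>) \<partial>lborel)"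
      by (rule nn_integral_mono)
    also have "\<dots> = (SUP m. \<integral>\<^sup>+x. epowr (Nm m x) \<sigma> \<partial>lborel)"
      by (rule nn_integral_monotone_convergence_SUP[OF inc]) measurable
    also have "\<dots> \<le> ennreal (2 * A) * ?IR" by (rule SUP_least) (rule bound)
    finally show ?thesis by (simp add: N_def R_def)
  qed
  then show thesis using A by (intro that[of "2 * A"]) auto
qed


section \<open>Sequence norms and pointwise interpolation between them\<close>

lemma lq_norm_finite: "q \<noteq> \<infinity> \<Longrightarrow> lq_norm q c = epowr (\<Sum>j. epowr (c j) (enn2real q)) (1 / enn2real q)"
  by (simp add: lq_norm_def)

lemma borel_measurable_lq_norm [measurable]:
  assumes [measurable]: "\<And>j. c j \<in> borel_measurable M"
  shows "(\<lambda>x. lq_norm q (\<lambda>j. c j x)) \<in> borel_measurable M"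
  unfolding lq_norm_def by measurable

lemma le_lq_norm:
  assumes "0 < q" shows "c j \<le> lq_norm q c"
proof (cases "q = \<infinity>")
  case True
  then show ?thesis by (auto simp: lq_norm_def intro: SUP_upper)
next
  case False
  then have q: "enn2real q > 0" using assms by (simp add: enn2real_positive_iff less_top)
  have "c j = epowr (epowr (c j) (enn2real q)) (1 / enn2real q)" using q by (simp add: epowr_epowr)
  also have "\<dots> \<le> epowr (\<Sum>j. epowr (c j) (enn2real q)) (1 / enn2real q)"
    using q sum_le_suminf[of "\<lambda>j. epowr (c j) (enn2real q)" "{j}"] by (intro epowr_mono) auto
  finally show ?thesis using False by (simp add: lq_norm_def)
qed

text \<open>t = B / A balances the two terms. If exactly one of \<open>A\<close> and
  \<open>B\<close> vanishes there is no optimal t, but for D > 0 some t makes the right side D / 2,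
  a contradiction.\<close>

lemma le_geometric_mean:
  fixes A B D \<theta> :: real
  assumes \<theta>: "0 < \<theta>" "\<theta> < 1" and A: "A \<ge> 0" and B: "B \<ge> 0"
    and D: "\<And>t. t > 0 \<Longrightarrow> D \<le> t powr \<theta> * A + t powr (\<theta> - 1) * B"
  shows "D \<le> 2 * (A powr (1 - \<theta>) * B powr \<theta>)"
proof (cases "A = 0 \<or> B = 0")
  case False
  then have p: "A > 0" "B > 0" using A B by auto
  have "(B / A) powr \<theta> * A = A powr (1 - \<theta>) * B powr \<theta>"
    using p by (simp add: powr_divide powr_diff)
  moreover have "(B / A) powr (\<theta> - 1) * B = A powr (1 - \<theta>) * B powr \<theta>"
    using p by (simp add: powr_divide powr_diff)
  ultimately show ?thesis using D[of "B / A"] p by (simp add: mult.commute)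
next
  case True
  have "D \<le> 0"
  proof (rule ccontr)
    assume D0: "\<not> D \<le> 0"
    show False
    proof (cases "B = 0")
      case B0: True
      show False
      proof (cases "A = 0")
        case True
        then show False using D[of 1] B0 D0 by simp
      next
        case False
        then have A0: "A > 0" using A by simp
        have "((D / (2 * A)) powr (1 / \<theta>)) powr \<theta> * A = D / 2"
          using D0 A0 \<theta> by (simp add: powr_powr)
        then show False using D[of "(D / (2 * A)) powr (1 / \<theta>)"] D0 A0 B0 by simp
      qed
    next
      case False
      then have B0: "B > 0" and A0: "A = 0" using B True by auto
      have "((D / (2 * B)) powr (1 / (\<theta> - 1))) powr (\<theta> - 1) * B = D / 2"
        using D0 B0 \<theta> by (simp add: powr_powr)
      then show False using D[of "(D / (2 * B)) powr (1 / (\<theta> - 1))"] D0 A0 B0 by simp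
    qed
  qed
  then show ?thesis using A B by (smt (verit) mult_nonneg_nonneg powr_ge_zero)
qed

text \<open>Real interpolation by hand. Optimising t for each j separately bounds \<open>D j\<close>
  by a geometric mean of \<open>A\<close> and \<open>B j\<close>; its Q-th power is A^(Q-P) times
  the P-th power of \<open>B j\<close> up to a constant, so the sum over j meets only P-th
  powers.\<close>

lemma epowr_sum_interpolate:
  fixes D B :: "nat \<Rightarrow> ennreal" and A :: ennreal and P Q :: real
  assumes P: "0 < P" "P < Q"
    and D: "\<And>j t. t > 0 \<Longrightarrow> D j \<le> ennreal (t powr (P / Q)) * A + ennreal (t powr (P / Q - 1)) * B j"
  shows "epowr (\<Sum>j. epowr (D j) Q) (P / Q) \<le> ennreal (2 powr P) * (epowr A P + (\<Sum>j. epowr (B j) P))"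
proof (cases "A = \<top> \<or> (\<exists>j. B j = \<top>)")
  case True
  have *: "epowr A P + (\<Sum>j. epowr (B j) P) = \<top>"
  proof (cases "A = \<top>")
    case False
    with True obtain j where j: "B j = \<top>" by blast
    have "epowr (B j) P \<le> (\<Sum>j. epowr (B j) P)" using sum_le_suminf[of "\<lambda>j. epowr (B j) P" "{j}"] by simp
    then show ?thesis using j by (simp add: top_unique)
  qed simp
  show ?thesis unfolding * by (simp add: ennreal_mult_top)
next
  case False
  define \<theta> where "\<theta> = P / Q"
  have \<theta>: "0 < \<theta>" "\<theta> < 1" "\<theta> * Q = P" "(1 - \<theta>) * Q = Q - P" using P by (auto simp: \<theta>_def field_simps)
  from False obtain a where a: "A = ennreal a" "a \<ge> 0" by (cases A) auto
  have "epowr (D j) Q \<le> (ennreal (2 powr Q) * epowr A (Q - P)) * epowr (B j) P" for j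
  proof -
    from False obtain b where b: "B j = ennreal b" "b \<ge> 0" by (cases "B j") auto
    have "D j \<le> ennreal (1 powr \<theta>) * A + ennreal (1 powr (\<theta> - 1)) * B j" unfolding \<theta>_def by (rule D) simp
    then have "D j < \<top>" using a b by (auto simp: ennreal_plus[symmetric] le_less_trans simp del: ennreal_plus)
    then obtain d where d: "D j = ennreal d" "d \<ge> 0" by (cases "D j") auto
    have "d \<le> 2 * (a powr (1 - \<theta>) * b powr \<theta>)"
    proof (rule le_geometric_mean)
      fix t :: real assume t: "t > 0"
      have "ennreal d \<le> ennreal (t powr \<theta> * a + t powr (\<theta> - 1) * b)"
        using D[OF t, of j] a b d by (simp add: \<theta>_def ennreal_mult'[symmetric] ennreal_plus[symmetric] del: ennreal_plus)
      then show "d \<le> t powr \<theta> * a + t powr (\<theta> - 1) * b" using a b by (subst (asm) ennreal_le_iff) auto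
    qed (use \<theta> a b in auto)
    then have "d powr Q \<le> (2 * (a powr (1 - \<theta>) * b powr \<theta>)) powr Q"
      using d P by (intro powr_mono2) auto
    also have "\<dots> = 2 powr Q * (a powr (Q - P) * b powr P)"
      using a b by (simp add: powr_mult powr_powr \<theta>)
    finally show ?thesis
      using a b d by (simp add: epowr_ennreal ennreal_mult'[symmetric] ennreal_leI mult.assoc)
  qed
  then have "(\<Sum>j. epowr (D j) Q) \<le> (\<Sum>j. (ennreal (2 powr Q) * epowr A (Q - P)) * epowr (B j) P)"
    by (intro suminf_le summableI)
  also have "\<dots> = (ennreal (2 powr Q) * epowr A (Q - P)) * (\<Sum>j. epowr (B j) P)" by simp
  finally have "epowr (\<Sum>j. epowr (D j) Q) \<theta> \<le> epowr ((ennreal (2 powr Q) * epowr A (Q - P)) * (\<Sum>j. epowr (B j) P)) \<theta>"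
    using \<theta> by (intro epowr_mono) auto
  also have "\<dots> = ennreal (2 powr P) * (epowr (epowr A P) (1 - \<theta>) * epowr (\<Sum>j. epowr (B j) P) \<theta>)"
  proof -
    have "(Q - P) * \<theta> = P * (1 - \<theta>)" using \<theta>(3) by (simp add: algebra_simps)
    then show ?thesis using \<theta> by (simp add: epowr_mult epowr_epowr epowr_ennreal powr_powr mult_ac)
  qed
  also have "\<dots> \<le> ennreal (2 powr P) * (epowr A P + (\<Sum>j. epowr (B j) P))"
    by (intro mult_left_mono epowr_interpolate \<theta>) auto
  finally show ?thesis by (simp add: \<theta>_def)
qed

text \<open>
  For \<open>Q < P\<close> Jensen's inequality reduces the claim to the sum of averages; for \<open>P < Q\<close> each \<open>F j\<close> is split
  between the norm of the sequence, handled by the maximal function, and a multiple of \<open>F j\<close> to the power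
  \<open>Q / P\<close>, handled term by term.
\<close>

theorem avg_vector_valued:
  assumes b: "0 < b" and P: "P > 1" and Q: "ennreal 1 < Q"
  obtains C where "C > 0" "\<And>F :: nat \<Rightarrow> 'a::euclidean_space \<Rightarrow> ennreal. (\<And>j. F j \<in> borel_measurable borel) \<Longrightarrow>
     (\<integral>\<^sup>+x. epowr (lq_norm Q (\<lambda>j. avg b j (F j) x)) P \<partial>lborel) \<le> ennreal C * (\<integral>\<^sup>+x. epowr (lq_norm Q (\<lambda>j. F j x)) P \<partial>lborel)"
proof -
  obtain D where D: "D > 0" "\<And>F :: 'a \<Rightarrow> ennreal. F \<in> borel_measurable borel \<Longrightarrow>
     (\<integral>\<^sup>+x. epowr (maxavg b F x) P \<partial>lborel) \<le> ennreal D * (\<integral>\<^sup>+x. epowr (F x) P \<partial>lborel)"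
    using maxavg_strong[OF b P, where 'a='a] by blast
  define m where "m = kern_mass TYPE('a) b"
  have m: "m \<ge> 0" using kern_mass_nonneg[OF b, where 'a='a] by (simp add: m_def)
  let ?goal = "\<lambda>C. \<forall>F :: nat \<Rightarrow> 'a \<Rightarrow> ennreal. (\<forall>j. F j \<in> borel_measurable borel) \<longrightarrow>
     (\<integral>\<^sup>+x. epowr (lq_norm Q (\<lambda>j. avg b j (F j) x)) P \<partial>lborel) \<le> ennreal C * (\<integral>\<^sup>+x. epowr (lq_norm Q (\<lambda>j. F j x)) P \<partial>lborel)"
  have "\<exists>C>0. ?goal C"
  proof (cases "Q = \<infinity>")
    case True
    have "?goal D"
    proof (intro allI impI)
      fix F :: "nat \<Rightarrow> 'a \<Rightarrow> ennreal" assume "\<forall>j. F j \<in> borel_measurable borel"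
      then have Fm[measurable]: "\<And>j. F j \<in> borel_measurable borel" by blast
      let ?S = "\<lambda>x. SUP j. F j x"
      have "(\<integral>\<^sup>+x. epowr (lq_norm Q (\<lambda>j. avg b j (F j) x)) P \<partial>lborel) \<le> (\<integral>\<^sup>+x. epowr (maxavg b ?S x) P \<partial>lborel)"
      proof (intro nn_integral_mono epowr_mono)
        fix x
        have "avg b j (F j) x \<le> maxavg b ?S x" for j
          by (rule order_trans[OF avg_mono avg_le_maxavg]) (rule SUP_upper, simp)
        then show "lq_norm Q (\<lambda>j. avg b j (F j) x) \<le> maxavg b ?S x"
          using True by (auto simp: lq_norm_def intro: SUP_least)
      qed (use P in simp)
      also have "\<dots> \<le> ennreal D * (\<integral>\<^sup>+x. epowr (?S x) P \<partial>lborel)" by (intro D) measurable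
      finally show "(\<integral>\<^sup>+x. epowr (lq_norm Q (\<lambda>j. avg b j (F j) x)) P \<partial>lborel) \<le> ennreal D * (\<integral>\<^sup>+x. epowr (lq_norm Q (\<lambda>j. F j x)) P \<partial>lborel)"
        using True by (simp add: lq_norm_def)
    qed
    with D show ?thesis by blast
  next
    case False
    define k where "k = enn2real Q"
    have Qk: "Q = ennreal k" "k > 1"
    proof -
      show "Q = ennreal k" using False by (simp add: k_def less_top)
      with Q show "k > 1" by (simp add: ennreal_less_iff)
    qed
    have lq: "epowr (lq_norm Q c) P = epowr (\<Sum>j. epowr (c j) k) (P / k)" for c
      using False by (simp add: lq_norm_finite k_def epowr_epowr)
    consider "k < P" | "k = P" | "P < k" by linarith
    then show ?thesis
    proof cases
      case 1
      then have s: "P / k > 1" using Qk by simp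
      obtain C where C: "C > 0" "\<And>X :: nat \<Rightarrow> 'a \<Rightarrow> ennreal. (\<And>j. X j \<in> borel_measurable borel) \<Longrightarrow>
        (\<integral>\<^sup>+x. epowr (\<Sum>j. avg b j (X j) x) (P / k) \<partial>lborel) \<le> ennreal C * (\<integral>\<^sup>+x. epowr (\<Sum>j. X j x) (P / k) \<partial>lborel)"
        using avg_sum_strong[OF b s, where 'a='a] by blast
      define B where "B = ((m + 1) powr k) powr (P / k)"
      have B: "B > 0" using m by (simp add: B_def)
      have "?goal (B * C)"
      proof (intro allI impI)
        fix F :: "nat \<Rightarrow> 'a \<Rightarrow> ennreal" assume "\<forall>j. F j \<in> borel_measurable borel"
        then have Fm[measurable]: "\<And>j. F j \<in> borel_measurable borel" by blast
        have "(\<integral>\<^sup>+x. epowr (lq_norm Q (\<lambda>j. avg b j (F j) x)) P \<partial>lborel)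
          \<le> (\<integral>\<^sup>+x. ennreal B * epowr (\<Sum>j. avg b j (\<lambda>y. epowr (F j y) k) x) (P / k) \<partial>lborel)"
        proof (rule nn_integral_mono)
          fix x
          have "(\<Sum>j. epowr (avg b j (F j) x) k) \<le> (\<Sum>j. ennreal ((m + 1) powr k) * avg b j (\<lambda>y. epowr (F j y) k) x)"
            unfolding m_def using Qk by (intro suminf_le summableI avg_jensen b Fm) auto
          also have "\<dots> = ennreal ((m + 1) powr k) * (\<Sum>j. avg b j (\<lambda>y. epowr (F j y) k) x)" by simp
          finally have "epowr (\<Sum>j. epowr (avg b j (F j) x) k) (P / k) \<le> epowr (ennreal ((m + 1) powr k) * (\<Sum>j. avg b j (\<lambda>y. epowr (F j y) k) x)) (P / k)"
            using P Qk by (intro epowr_mono) auto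
          then show "epowr (lq_norm Q (\<lambda>j. avg b j (F j) x)) P \<le> ennreal B * epowr (\<Sum>j. avg b j (\<lambda>y. epowr (F j y) k) x) (P / k)"
            unfolding lq B_def using P Qk by (subst (asm) epowr_cmult) auto
        qed
        also have "\<dots> = ennreal B * (\<integral>\<^sup>+x. epowr (\<Sum>j. avg b j (\<lambda>y. epowr (F j y) k) x) (P / k) \<partial>lborel)"
          by (rule nn_integral_cmult) measurable
        also have "\<dots> \<le> ennreal B * (ennreal C * (\<integral>\<^sup>+x. epowr (\<Sum>j. epowr (F j x) k) (P / k) \<partial>lborel))"
          by (intro mult_left_mono C) auto
        finally show "(\<integral>\<^sup>+x. epowr (lq_norm Q (\<lambda>j. avg b j (F j) x)) P \<partial>lborel) \<le> ennreal (B * C) * (\<integral>\<^sup>+x. epowr (lq_norm Q (\<lambda>j. F j x)) P \<partial>lborel)"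
          using B by (simp add: lq ennreal_mult' mult.assoc)
      qed
      with B C show ?thesis by (intro exI[of _ "B * C"]) auto
    next
      case 2
      define B where "B = (m + 1) powr P * m"
      have B: "B \<ge> 0" using m by (simp add: B_def)
      have "?goal (B + 1)"
      proof (intro allI impI)
        fix F :: "nat \<Rightarrow> 'a \<Rightarrow> ennreal" assume "\<forall>j. F j \<in> borel_measurable borel"
        then have Fm[measurable]: "\<And>j. F j \<in> borel_measurable borel" by blast
        have "(\<integral>\<^sup>+x. epowr (lq_norm Q (\<lambda>j. avg b j (F j) x)) P \<partial>lborel) = (\<Sum>j. \<integral>\<^sup>+x. epowr (avg b j (F j) x) P \<partial>lborel)"
          unfolding lq using 2 P by (simp add: nn_integral_suminf)
        also have "\<dots> \<le> (\<Sum>j. ennreal B * (\<integral>\<^sup>+x. epowr (F j x) P \<partial>lborel))"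
          unfolding B_def m_def using P by (intro suminf_le summableI nn_integral_avg_epowr_le b Fm) auto
        also have "\<dots> = ennreal B * (\<Sum>j. \<integral>\<^sup>+x. epowr (F j x) P \<partial>lborel)" by simp
        also have "(\<Sum>j. \<integral>\<^sup>+x. epowr (F j x) P \<partial>lborel) = (\<integral>\<^sup>+x. epowr (lq_norm Q (\<lambda>j. F j x)) P \<partial>lborel)"
          unfolding lq using 2 P by (simp add: nn_integral_suminf)
        also have "ennreal B * (\<integral>\<^sup>+x. epowr (lq_norm Q (\<lambda>j. F j x)) P \<partial>lborel) \<le> ennreal (B + 1) * (\<integral>\<^sup>+x. epowr (lq_norm Q (\<lambda>j. F j x)) P \<partial>lborel)"
          by (intro mult_right_mono ennreal_leI) auto
        finally show "(\<integral>\<^sup>+x. epowr (lq_norm Q (\<lambda>j. avg b j (F j) x)) P \<partial>lborel) \<le> ennreal (B + 1) * (\<integral>\<^sup>+x. epowr (lq_norm Q (\<lambda>j. F j x)) P \<partial>lborel)" .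
      qed
      with B show ?thesis by (intro exI[of _ "B + 1"]) auto
    next
      case 3
      define \<theta> where "\<theta> = P / k"
      have \<theta>: "0 < \<theta>" "\<theta> < 1" "1 / \<theta> * P = k" using 3 P by (auto simp: \<theta>_def)
      define B where "B = (m + 1) powr P * m"
      have B: "B \<ge> 0" using m by (simp add: B_def)
      define A where "A = 2 powr P * (D + B)"
      have A: "A > 0" using D B by (simp add: A_def add_pos_nonneg)
      have "?goal A"
      proof (intro allI impI)
        fix F :: "nat \<Rightarrow> 'a \<Rightarrow> ennreal" assume "\<forall>j. F j \<in> borel_measurable borel"
        then have Fm[measurable]: "\<And>j. F j \<in> borel_measurable borel" by blast
        define N where "N x = lq_norm Q (\<lambda>j. F j x)" for x
        have Nm[measurable]: "N \<in> borel_measurable borel" unfolding N_def[abs_def] by measurable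
        \<comment> \<open>This is N (F_j / N)^(k/P). The normalisation by the pointwise norm
          \<open>N\<close> is chosen so that the P-th powers of the \<open>X j\<close> sum to N^P,
          which is \<open>k2\<close>.\<close>
        define X where "X j x = (if N x = 0 \<or> N x = \<top> then 0 else ennreal (enn2real (N x) powr (1 - 1 / \<theta>)) * epowr (F j x) (1 / \<theta>))" for j x
        have Xm[measurable]: "X j \<in> borel_measurable borel" for j unfolding X_def[abs_def] by measurable
        have FN: "F j x \<le> N x" for j x
          unfolding N_def using Qk by (intro le_lq_norm) auto
        have k1: "F j x \<le> ennreal (t powr \<theta>) * N x + ennreal (t powr (\<theta> - 1)) * X j x" if t: "t > 0" for j x t
        proof (cases "N x = 0 \<or> N x = \<top>")
          case True
          then show ?thesis using FN[of j x] t by (auto simp: ennreal_mult_top)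
        next
          case False
          then obtain n where n: "N x = ennreal n" "n > 0" by (cases "N x") (auto simp: less_le)
          define l where "l = t powr \<theta> * n"
          have l: "l > 0" using t n by (simp add: l_def)
          have "F j x \<le> ennreal l + ennreal (l powr (1 - 1 / \<theta>)) * epowr (F j x) (1 / \<theta>)"
            using \<theta> l by (intro ennreal_le_lambda_powr) auto
          also have "l powr (1 - 1 / \<theta>) = t powr (\<theta> - 1) * n powr (1 - 1 / \<theta>)"
            using t n \<theta> by (simp add: l_def powr_mult powr_powr right_diff_distrib)
          also have "ennreal l = ennreal (t powr \<theta>) * N x" unfolding l_def n(1) by (rule ennreal_mult') simp
          also have "ennreal (t powr (\<theta> - 1) * n powr (1 - 1 / \<theta>)) * epowr (F j x) (1 / \<theta>) = ennreal (t powr (\<theta> - 1)) * X j x"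
            using False n by (simp add: X_def ennreal_mult' mult.assoc)
          finally show ?thesis .
        qed
        have k2: "(\<Sum>j. epowr (X j x) P) \<le> epowr (N x) P" for x
        proof (cases "N x = 0 \<or> N x = \<top>")
          case True
          then show ?thesis by (auto simp: X_def)
        next
          case False
          then obtain n where n: "N x = ennreal n" "n > 0" by (cases "N x") (auto simp: less_le)
          have Nk: "(\<Sum>j. epowr (F j x) k) = epowr (N x) k"
            using False Qk unfolding N_def by (simp add: lq_norm_finite epowr_epowr)
          have "epowr (X j x) P = ennreal (n powr (P - k)) * epowr (F j x) k" for j
            using False n P \<theta> by (simp add: X_def epowr_mult epowr_epowr epowr_ennreal powr_powr left_diff_distrib)
          then have "(\<Sum>j. epowr (X j x) P) = ennreal (n powr (P - k)) * (\<Sum>j. epowr (F j x) k)" by simp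
          also have "\<dots> = epowr (N x) P"
            unfolding Nk using n by (simp add: epowr_ennreal ennreal_mult'[symmetric] powr_add[symmetric])
          finally show ?thesis by simp
        qed
        have k3: "avg b j (F j) x \<le> ennreal (t powr (P / k)) * maxavg b N x + ennreal (t powr (P / k - 1)) * avg b j (X j) x" if t: "t > 0" for j x t
        proof -
          have "avg b j (F j) x \<le> avg b j (\<lambda>y. ennreal (t powr \<theta>) * N y + ennreal (t powr (\<theta> - 1)) * X j y) x"
            by (intro avg_mono k1 t)
          also have "\<dots> = ennreal (t powr \<theta>) * avg b j N x + ennreal (t powr (\<theta> - 1)) * avg b j (X j) x"
            by (subst avg_add) (auto simp: avg_cmult)
          also have "\<dots> \<le> ennreal (t powr \<theta>) * maxavg b N x + ennreal (t powr (\<theta> - 1)) * avg b j (X j) x"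
            by (intro add_right_mono mult_left_mono avg_le_maxavg) simp
          finally show ?thesis by (simp add: \<theta>_def)
        qed
        have "(\<integral>\<^sup>+x. epowr (lq_norm Q (\<lambda>j. avg b j (F j) x)) P \<partial>lborel)
           \<le> (\<integral>\<^sup>+x. ennreal (2 powr P) * (epowr (maxavg b N x) P + (\<Sum>j. epowr (avg b j (X j) x) P)) \<partial>lborel)"
          unfolding lq using P 3 by (intro nn_integral_mono epowr_sum_interpolate k3) auto
        also have "\<dots> = ennreal (2 powr P) * ((\<integral>\<^sup>+x. epowr (maxavg b N x) P \<partial>lborel) + (\<Sum>j. \<integral>\<^sup>+x. epowr (avg b j (X j) x) P \<partial>lborel))"
          by (simp add: nn_integral_cmult nn_integral_add nn_integral_suminf)
        also have "\<dots> \<le> ennreal (2 powr P) * (ennreal D * (\<integral>\<^sup>+x. epowr (N x) P \<partial>lborel) + (\<Sum>j. ennreal B * (\<integral>\<^sup>+x. epowr (X j x) P \<partial>lborel)))"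
          unfolding B_def m_def using P by (intro mult_left_mono add_mono D suminf_le summableI nn_integral_avg_epowr_le b Xm Nm) auto
        also have "(\<Sum>j. ennreal B * (\<integral>\<^sup>+x. epowr (X j x) P \<partial>lborel)) = ennreal B * (\<integral>\<^sup>+x. (\<Sum>j. epowr (X j x) P) \<partial>lborel)"
          by (simp add: nn_integral_suminf)
        also have "\<dots> \<le> ennreal B * (\<integral>\<^sup>+x. epowr (N x) P \<partial>lborel)"
          by (intro mult_left_mono nn_integral_mono k2) simp
        finally have "(\<integral>\<^sup>+x. epowr (lq_norm Q (\<lambda>j. avg b j (F j) x)) P \<partial>lborel)
           \<le> ennreal (2 powr P) * (ennreal D * (\<integral>\<^sup>+x. epowr (N x) P \<partial>lborel) + ennreal B * (\<integral>\<^sup>+x. epowr (N x) P \<partial>lborel))"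
          by (simp add: add_left_mono mult_left_mono)
        also have "\<dots> = ennreal A * (\<integral>\<^sup>+x. epowr (N x) P \<partial>lborel)"
          using D B by (simp add: A_def ennreal_mult' distrib_right[symmetric] mult.assoc)
        finally show "(\<integral>\<^sup>+x. epowr (lq_norm Q (\<lambda>j. avg b j (F j) x)) P \<partial>lborel) \<le> ennreal A * (\<integral>\<^sup>+x. epowr (lq_norm Q (\<lambda>j. F j x)) P \<partial>lborel)"
          by (simp add: N_def)
      qed
      with A show ?thesis by blast
    qed
  qed
  then show thesis using that by blast
qed

subsection \<open>Peetre's maximal inequality\<close>

definition wt :: "nat \<Rightarrow> 'a::euclidean_space \<Rightarrow> 'a \<Rightarrow> real" where
  "wt j x y = 1 + 2 ^ j * norm (x - y)"

lemma wt_ge_1: "1 \<le> wt j x y"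
  by (simp add: wt_def)

lemma wt_pos: "0 < wt j x y"
  using wt_ge_1[of j x y] by linarith

lemma wt_triangle: "wt j x y \<le> wt j x z * wt j z y"
proof -
  have "norm (x - y) \<le> norm (x - z) + norm (z - y)" using norm_triangle_ineq[of "x - z" "z - y"] by simp
  from mult_left_mono[OF this, of "2 ^ j"]
  have "2 ^ j * norm (x - y) \<le> 2 ^ j * norm (x - z) + 2 ^ j * norm (z - y)" by (simp add: distrib_left)
  moreover have "0 \<le> (2 ^ j * norm (x - z)) * (2 ^ j * norm (z - y))" by (intro mult_nonneg_nonneg) auto
  ultimately show ?thesis unfolding wt_def distrib_left distrib_right by linarith
qed

lemma wt_Suc_le: "wt (Suc j) x z \<le> 2 * wt j x z" "wt j x z \<le> wt (Suc j) x z"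
  by (auto simp: wt_def intro!: mult_right_mono)

lemma wt_mono: "j \<le> k \<Longrightarrow> wt j x z \<le> wt k x z"
  unfolding wt_def by (intro add_left_mono mult_right_mono power_increasing) auto

lemma borel_measurable_wt [measurable]: "(\<lambda>y. wt j x y) \<in> borel_measurable borel"
  unfolding wt_def by measurable

text \<open>The dictionary between weights and averages: the weight to the power -r is, up to
  normalisation, the averaging kernel with excess decay r - n.\<close>

lemma kern_wt: "kern (r - real DIM('a)) j (x - y) = 2 ^ (j * DIM('a)) * wt j x (y::'a::euclidean_space) powr (- r)"
  by (simp add: kern_def wt_def)

lemma kern_wt_le:
  fixes x y z :: "'a::euclidean_space"
  assumes "r \<ge> 0"
  shows "kern (r - real DIM('a)) j (z - y) \<le> wt j x z powr r * kern (r - real DIM('a)) j (x - y)"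
proof -
  have "wt j z y powr (- r) \<le> (wt j x y / wt j x z) powr (- r)"
    using wt_triangle[of j x y z] wt_pos[of j x z] wt_pos[of j x y] assms
    by (intro powr_mono2') (auto simp: field_simps)
  also have "\<dots> = wt j x z powr r * wt j x y powr (- r)"
    using wt_pos[of j x z] wt_pos[of j x y] by (simp add: powr_divide powr_minus divide_simps)
  finally show ?thesis unfolding kern_wt by (simp add: mult.left_commute)
qed

text \<open>Moving the centre of an average costs a power of the weight between the two centres,
  because the weight is submultiplicative.\<close>

lemma avg_wt_le:
  fixes F :: "'a::euclidean_space \<Rightarrow> ennreal"
  assumes "r \<ge> 0" and [measurable]: "F \<in> borel_measurable borel"
  shows "avg (r - real DIM('a)) j F z \<le> ennreal (wt j x z powr r) * avg (r - real DIM('a)) j F x"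
proof -
  have "avg (r - real DIM('a)) j F z \<le> (\<integral>\<^sup>+y. ennreal (wt j x z powr r) * (ennreal (kern (r - real DIM('a)) j (x - y)) * F y) \<partial>lborel)"
    unfolding avg_def
  proof (rule nn_integral_mono)
    fix y
    have "ennreal (kern (r - real DIM('a)) j (z - y)) \<le> ennreal (wt j x z powr r * kern (r - real DIM('a)) j (x - y))"
      by (intro ennreal_leI kern_wt_le assms)
    also have "\<dots> = ennreal (wt j x z powr r) * ennreal (kern (r - real DIM('a)) j (x - y))" by (rule ennreal_mult') simp
    finally show "ennreal (kern (r - real DIM('a)) j (z - y)) * F y \<le> ennreal (wt j x z powr r) * (ennreal (kern (r - real DIM('a)) j (x - y)) * F y)"
      unfolding mult.assoc[symmetric] by (rule mult_right_mono) simp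
  qed
  also have "\<dots> = ennreal (wt j x z powr r) * avg (r - real DIM('a)) j F x"
    unfolding avg_def by (rule nn_integral_cmult) measurable
  finally show ?thesis .
qed

text \<open>|h| is the product of its powers \<open>\<eta>\<close> and 1 - \<open>\<eta>\<close>.
  The second is bounded through \<open>A\<close>; the weight that remains has exponent -a \<eta> and
  is the averaging kernel for the first.\<close>

lemma peetre_split:
  fixes h :: "'a::euclidean_space \<Rightarrow> complex"
  assumes a: "0 < a" and \<eta>: "0 < \<eta>" "\<eta> \<le> 1" and hm[measurable]: "h \<in> borel_measurable borel"
    and A: "A \<ge> 0" "\<And>y. norm (h y) \<le> A * wt j x y powr a" and B: "B \<ge> 0"
    and g: "\<And>y. g y \<ge> 0" "\<And>y. g y \<le> B * 2 ^ (j * DIM('a)) * wt j x y powr (- a)"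
  shows "(\<integral>\<^sup>+y. ennreal (g y * norm (h y)) \<partial>lborel)
     \<le> ennreal (B * A powr (1 - \<eta>)) * avg (a * \<eta> - real DIM('a)) j (\<lambda>y. ennreal (norm (h y) powr \<eta>)) x"
proof -
  have "(\<integral>\<^sup>+y. ennreal (g y * norm (h y)) \<partial>lborel)
      \<le> (\<integral>\<^sup>+y. ennreal (B * A powr (1 - \<eta>)) * (ennreal (kern (a * \<eta> - real DIM('a)) j (x - y)) * ennreal (norm (h y) powr \<eta>)) \<partial>lborel)"
  proof (rule nn_integral_mono)
    fix y
    let ?w = "wt j x y"
    have "norm (h y) = norm (h y) powr \<eta> * norm (h y) powr (1 - \<eta>)"
      using \<eta> by (simp add: powr_add[symmetric])
    also have "\<dots> \<le> norm (h y) powr \<eta> * (A * ?w powr a) powr (1 - \<eta>)"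
      using A \<eta> by (intro mult_left_mono powr_mono2) auto
    finally have "norm (h y) \<le> norm (h y) powr \<eta> * (A powr (1 - \<eta>) * ?w powr (a * (1 - \<eta>)))"
      using A wt_pos[of j x y] by (simp add: powr_mult powr_powr)
    then have "g y * norm (h y) \<le> (B * 2 ^ (j * DIM('a)) * ?w powr (- a)) * (norm (h y) powr \<eta> * (A powr (1 - \<eta>) * ?w powr (a * (1 - \<eta>))))"
      using g[of y] B by (intro mult_mono) auto
    also have "\<dots> = B * A powr (1 - \<eta>) * (kern (a * \<eta> - real DIM('a)) j (x - y) * norm (h y) powr \<eta>)"
    proof -
      have "?w powr (- a) * ?w powr (a * (1 - \<eta>)) = ?w powr (- (a * \<eta>))"
        by (simp add: powr_add[symmetric] algebra_simps)
      then have "?w powr (- (a * \<eta>)) = ?w powr (- a) * ?w powr (a * (1 - \<eta>))" by simp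
      then show ?thesis unfolding kern_wt by (simp only: mult_ac)
    qed
    finally have "ennreal (g y * norm (h y)) \<le> ennreal (B * A powr (1 - \<eta>) * (kern (a * \<eta> - real DIM('a)) j (x - y) * norm (h y) powr \<eta>))"
      by (rule ennreal_leI)
    also have "\<dots> = ennreal (B * A powr (1 - \<eta>)) * (ennreal (kern (a * \<eta> - real DIM('a)) j (x - y)) * ennreal (norm (h y) powr \<eta>))"
      using B by (simp add: ennreal_mult' kern_nonneg)
    finally show "ennreal (g y * norm (h y)) \<le> ennreal (B * A powr (1 - \<eta>)) * (ennreal (kern (a * \<eta> - real DIM('a)) j (x - y)) * ennreal (norm (h y) powr \<eta>))" .
  qed
  also have "\<dots> = ennreal (B * A powr (1 - \<eta>)) * avg (a * \<eta> - real DIM('a)) j (\<lambda>y. ennreal (norm (h y) powr \<eta>)) x"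
    unfolding avg_def by (rule nn_integral_cmult) measurable
  finally show ?thesis .
qed

text \<open>For the supremum S of |h| divided by the weight, the splitting gives S \<le> B
  S^(1-\<eta>) W. The growth hypothesis makes S finite, so that a power of it may be cancelled:
  S^\<eta> \<le> B W.\<close>

lemma peetre_bounded:
  fixes h :: "'a::euclidean_space \<Rightarrow> complex"
  assumes a: "0 < a" and \<eta>: "0 < \<eta>" "\<eta> \<le> 1" and hm[measurable]: "h \<in> borel_measurable borel" and B: "0 < B"
    and A: "\<And>z. norm (h z) \<le> A * wt j x z powr a"
    and rep: "\<And>z. ennreal (norm (h z)) \<le> (\<integral>\<^sup>+y. ennreal (B * 2 ^ (j * DIM('a)) * wt j z y powr (- a) * norm (h y)) \<partial>lborel)"
  shows "ennreal (norm (h z) powr \<eta>) \<le> ennreal (B * wt j x z powr (a * \<eta>)) *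
     avg (a * \<eta> - real DIM('a)) j (\<lambda>y. ennreal (norm (h y) powr \<eta>)) x"
proof -
  let ?W = "avg (a * \<eta> - real DIM('a)) j (\<lambda>y. ennreal (norm (h y) powr \<eta>)) x"
  show ?thesis
  proof (cases "?W = \<top>")
    case True
    then show ?thesis using B wt_pos[of j x z] by (simp add: ennreal_mult_top)
  next
    case False
    then obtain W where W: "?W = ennreal W" "W \<ge> 0" by (cases ?W) auto
    let ?q = "\<lambda>z. norm (h z) / wt j x z powr a"
    define S where "S = (SUP z. ?q z)"
    have q: "?q z \<le> A" for z using A[of z] wt_pos[of j x z] by (simp add: divide_le_eq)
    then have bdd: "bdd_above (range ?q)" by (intro bdd_aboveI2)
    have qS: "?q z \<le> S" for z unfolding S_def by (rule cSUP_upper[OF UNIV_I bdd])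
    have S0: "0 \<le> S" using qS[of x] by (rule order_trans[rotated]) simp
    have hS: "norm (h z) \<le> S * wt j x z powr a" for z
      using qS[of z] wt_pos[of j x z] by (simp add: divide_le_eq)
    have "?q z \<le> B * S powr (1 - \<eta>) * W" for z
    proof -
      have p: "0 < wt j x z powr a" using wt_pos[of j x z] by simp
      have "ennreal (norm (h z)) \<le> (\<integral>\<^sup>+y. ennreal (B * 2 ^ (j * DIM('a)) * wt j z y powr (- a) * norm (h y)) \<partial>lborel)"
        by (rule rep)
      also have "\<dots> \<le> ennreal ((wt j x z powr a * B) * S powr (1 - \<eta>)) * ?W"
      proof (rule peetre_split[OF a \<eta> hm S0 hS])
        show "0 \<le> wt j x z powr a * B" using B by simp
        fix y
        show "0 \<le> B * 2 ^ (j * DIM('a)) * wt j z y powr (- a)" using B by simp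
        have "kern (a - real DIM('a)) j (z - y) \<le> wt j x z powr a * kern (a - real DIM('a)) j (x - y)"
          using a by (intro kern_wt_le) simp
        from mult_left_mono[OF this less_imp_le[OF B]]
        show "B * 2 ^ (j * DIM('a)) * wt j z y powr (- a) \<le> wt j x z powr a * B * 2 ^ (j * DIM('a)) * wt j x y powr (- a)"
          unfolding kern_wt by (simp only: mult_ac)
      qed
      also have "\<dots> = ennreal (wt j x z powr a * B * S powr (1 - \<eta>) * W)"
        unfolding W(1) using B by (intro ennreal_mult'[symmetric]) simp
      finally have "norm (h z) \<le> wt j x z powr a * B * S powr (1 - \<eta>) * W"
        using B W(2) by (subst (asm) ennreal_le_iff) auto
      then show ?thesis using p by (simp add: divide_le_eq mult_ac)
    qed
    then have le: "S \<le> B * S powr (1 - \<eta>) * W" unfolding S_def by (intro cSUP_least) auto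
    have S\<eta>: "S powr \<eta> \<le> B * W"
    proof (cases "S = 0")
      case True
      then show ?thesis using B W by simp
    next
      case False
      with S0 have Sp: "S > 0" by simp
      have "S powr \<eta> * S powr (1 - \<eta>) \<le> (B * W) * S powr (1 - \<eta>)"
        using le Sp by (simp add: powr_add[symmetric] mult_ac)
      then show ?thesis using Sp by (simp add: mult_le_cancel_right)
    qed
    have "norm (h z) powr \<eta> \<le> (S * wt j x z powr a) powr \<eta>"
      using hS[of z] \<eta> by (intro powr_mono2) auto
    also have "\<dots> = S powr \<eta> * wt j x z powr (a * \<eta>)"
      using S0 by (simp add: powr_mult powr_powr)
    also have "\<dots> \<le> (B * W) * wt j x z powr (a * \<eta>)"
      by (intro mult_right_mono S\<eta>) simp
    finally have "ennreal (norm (h z) powr \<eta>) \<le> ennreal (B * wt j x z powr (a * \<eta>) * W)"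
      by (intro ennreal_leI) (simp add: mult_ac)
    also have "\<dots> = ennreal (B * wt j x z powr (a * \<eta>)) * ?W"
      unfolding W(1) using B by (intro ennreal_mult') simp
    finally show ?thesis .
  qed
qed

text \<open>
  The Peetre maximal function is only known to be finite for large \<open>a\<close>. The bound for such an \<open>a'\<close> yields
  the growth needed to rerun the argument with \<open>a\<close> itself.
\<close>

lemma peetre_poly_growth:
  fixes h :: "'a::euclidean_space \<Rightarrow> complex" and Bf :: "real \<Rightarrow> real"
  assumes a: "0 < a" and \<eta>: "0 < \<eta>" "\<eta> \<le> 1" and hm[measurable]: "h \<in> borel_measurable borel"
    and B: "\<And>a. a > 0 \<Longrightarrow> 0 < Bf a"
    and growth: "\<And>z. norm (h z) \<le> C * (1 + norm z) ^ m"
    and rep: "\<And>a z. a > 0 \<Longrightarrow> ennreal (norm (h z)) \<le> (\<integral>\<^sup>+y. ennreal (Bf a * 2 ^ (j * DIM('a)) * wt j z y powr (- a) * norm (h y)) \<partial>lborel)"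
  shows "ennreal (norm (h z) powr \<eta>) \<le> ennreal (Bf a * wt j x z powr (a * \<eta>)) *
     avg (a * \<eta> - real DIM('a)) j (\<lambda>y. ennreal (norm (h y) powr \<eta>)) x"
proof -
  let ?F = "\<lambda>y. ennreal (norm (h y) powr \<eta>)"
  let ?W = "avg (a * \<eta> - real DIM('a)) j ?F x"
  show ?thesis
  proof (cases "?W = \<top>")
    case True
    then show ?thesis using B[OF a] wt_pos[of j x z] by (simp add: ennreal_mult_top)
  next
    case False
    then obtain W where W: "?W = ennreal W" "W \<ge> 0" by (cases ?W) auto
    define a' where "a' = max a (real m)"
    have a': "a' > 0" "a \<le> a'" using a by (auto simp: a'_def)
    have C0: "C \<ge> 0" using order_trans[OF norm_ge_zero growth[of 0]] by simp
    have far: "norm (h y) \<le> (C * (1 + norm z) ^ m) * wt j z y powr a'" for y z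
    proof -
      have "1 + norm (y - z) \<le> wt j z y"
        unfolding wt_def norm_minus_commute[of z y] using mult_right_mono[of 1 "2 ^ j" "norm (y - z)"] by simp
      then have "(1 + norm (y - z)) ^ m \<le> wt j z y ^ m" by (intro power_mono) auto
      also have "\<dots> = wt j z y powr real m" using wt_pos[of j z y] by (simp add: powr_realpow)
      also have "\<dots> \<le> wt j z y powr a'" using wt_ge_1[of j z y] by (intro powr_mono) (auto simp: a'_def)
      finally have *: "(1 + norm (y - z)) ^ m \<le> wt j z y powr a'" .
      have "norm (h y) \<le> C * (1 + norm y) ^ m" by (rule growth)
      also have "\<dots> \<le> C * ((1 + norm z) ^ m * (1 + norm (y - z)) ^ m)"
        using C0 by (intro mult_left_mono one_plus_norm_power_triangle)
      also have "\<dots> \<le> C * ((1 + norm z) ^ m * wt j z y powr a')"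
        using C0 * by (intro mult_left_mono) auto
      finally show ?thesis by (simp only: mult.assoc)
    qed
    have "norm (h z) \<le> (Bf a' * W) powr (1 / \<eta>) * wt j x z powr a" for z
    proof -
      have "ennreal (norm (h z) powr \<eta>) \<le> ennreal (Bf a' * wt j z z powr (a' * \<eta>)) * avg (a' * \<eta> - real DIM('a)) j ?F z"
        by (rule peetre_bounded[OF a'(1) \<eta> hm B[OF a'(1)] far rep[OF a'(1)]])
      \<comment> \<open>The bound for \<open>a'\<close> is used with its centre at \<open>z\<close>
        itself, where the weight is 1. Only then is the kernel replaced by the larger one for
        \<open>a\<close> and the centre moved to \<open>x\<close>.\<close>
      also have "Bf a' * wt j z z powr (a' * \<eta>) = Bf a'" by (simp add: wt_def)
      also have "avg (a' * \<eta> - real DIM('a)) j ?F z \<le> avg (a * \<eta> - real DIM('a)) j ?F z"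
        unfolding avg_def
      proof (intro nn_integral_mono mult_right_mono ennreal_leI)
        fix y
        show "kern (a' * \<eta> - real DIM('a)) j (z - y) \<le> kern (a * \<eta> - real DIM('a)) j (z - y)"
          unfolding kern_wt using a' \<eta> wt_ge_1[of j z y] by (intro mult_left_mono powr_mono) auto
      qed simp
      also have "avg (a * \<eta> - real DIM('a)) j ?F z \<le> ennreal (wt j x z powr (a * \<eta>)) * ?W"
        using a \<eta> by (intro avg_wt_le) auto
      also have "ennreal (Bf a') * (ennreal (wt j x z powr (a * \<eta>)) * ?W) = ennreal (Bf a' * W * wt j x z powr (a * \<eta>))"
        unfolding W(1) using B[OF a'(1)] W(2) by (simp add: ennreal_mult'[symmetric] mult_ac)
      finally have "ennreal (norm (h z) powr \<eta>) \<le> ennreal (Bf a' * W * wt j x z powr (a * \<eta>))"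
        by (simp add: mult_left_mono)
      then have le: "norm (h z) powr \<eta> \<le> Bf a' * W * wt j x z powr (a * \<eta>)"
        using B[OF a'(1)] W(2) by (subst (asm) ennreal_le_iff) auto
      have "norm (h z) = (norm (h z) powr \<eta>) powr (1 / \<eta>)" using \<eta> by (simp add: powr_powr)
      also have "\<dots> \<le> (Bf a' * W * wt j x z powr (a * \<eta>)) powr (1 / \<eta>)"
        using le \<eta> by (intro powr_mono2) auto
      also have "\<dots> = (Bf a' * W) powr (1 / \<eta>) * wt j x z powr a"
        using B[OF a'(1)] W(2) \<eta> by (simp add: powr_mult powr_powr)
      finally show ?thesis .
    qed
    then show ?thesis by (rule peetre_bounded[OF a \<eta> hm B[OF a] _ rep[OF a]])
  qed
qed

subsection \<open>Sequence norms\<close>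

lemma suminf_ennreal_swap:
  fixes f :: "nat \<Rightarrow> nat \<Rightarrow> ennreal"
  shows "(\<Sum>k. \<Sum>j. f k j) = (\<Sum>j. \<Sum>k. f k j)"
proof -
  have "(\<Sum>k. \<Sum>j. f k j) = (\<integral>\<^sup>+k. (\<Sum>j. f k j) \<partial>count_space UNIV)"
    by (simp add: nn_integral_count_space_nat)
  also have "\<dots> = (\<Sum>j. \<integral>\<^sup>+k. f k j \<partial>count_space UNIV)" by (rule nn_integral_suminf) simp
  finally show ?thesis by (simp add: nn_integral_count_space_nat)
qed

lemma suminf_ennreal_le_of_inj:
  fixes g :: "nat \<Rightarrow> ennreal"
  assumes "inj_on \<pi> {j. R j}"
  shows "(\<Sum>j. if R j then g (\<pi> j) else 0) \<le> (\<Sum>i. g i)"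
proof -
  have "(\<Sum>j<m. if R j then g (\<pi> j) else 0) \<le> (\<Sum>i. g i)" for m
  proof -
    have "(\<Sum>j<m. if R j then g (\<pi> j) else 0) = (\<Sum>j\<in>{j. j < m \<and> R j}. g (\<pi> j))"
      by (rule sum.mono_neutral_cong_right) auto
    also have "\<dots> = sum g (\<pi> ` {j. j < m \<and> R j})"
      using assms by (subst sum.reindex) (auto intro: inj_on_subset)
    also have "\<dots> \<le> (\<Sum>i. g i)" by (rule sum_le_suminf) auto
    finally show ?thesis .
  qed
  then show ?thesis by (auto simp: suminf_eq_SUP intro: SUP_least)
qed

lemma suminf_geometric_ennreal:
  assumes "0 \<le> \<theta>" "\<theta> < 1"
  shows "(\<Sum>i. ennreal (\<theta> ^ i)) = ennreal (1 / (1 - \<theta>))"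
proof -
  have "(\<Sum>i. ennreal (\<theta> ^ i)) = ennreal (\<Sum>i. \<theta> ^ i)"
    using assms by (intro suminf_ennreal2 summable_geometric) auto
  then show ?thesis using assms by (simp add: suminf_geometric)
qed

lemma lq_norm_mono:
  assumes "\<And>j. c j \<le> d j" shows "lq_norm q c \<le> lq_norm q d"
  unfolding lq_norm_def using assms by (auto intro!: SUP_mono epowr_mono suminf_le)

lemma lq_norm_cmult:
  assumes q: "0 < q" shows "lq_norm q (\<lambda>j. a * c j) = a * lq_norm q c"
proof (cases "q = \<infinity>")
  case True
  then show ?thesis by (simp add: lq_norm_def SUP_mult_left_ennreal)
next
  case False
  then have q': "enn2real q > 0" using q by (simp add: enn2real_positive_iff less_top)
  then show ?thesis using False by (simp add: lq_norm_def epowr_mult epowr_epowr)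
qed

text \<open>A quasi-triangle inequality with a constant that covers q < 1 as well.\<close>

lemma lq_norm_add_le:
  assumes q: "0 < q"
  obtains K where "K > 0" "\<And>c d. lq_norm q (\<lambda>j. c j + d j) \<le> ennreal K * (lq_norm q c + lq_norm q d)"
proof (cases "q = \<infinity>")
  case True
  have "lq_norm q (\<lambda>j. c j + d j) \<le> ennreal 1 * (lq_norm q c + lq_norm q d)" for c d
    using True by (auto simp: lq_norm_def intro!: SUP_least add_mono SUP_upper)
  then show thesis by (intro that[of 1]) auto
next
  case False
  define k where "k = enn2real q"
  have k: "k > 0" using False q by (simp add: k_def enn2real_positive_iff less_top)
  have "lq_norm q (\<lambda>j. c j + d j) \<le> ennreal (2 * 2 powr (1 / k)) * (lq_norm q c + lq_norm q d)" for c d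
  proof -
    have "(\<Sum>j. epowr (c j + d j) k) \<le> (\<Sum>j. ennreal (2 powr k) * (epowr (c j) k + epowr (d j) k))"
      using k by (intro suminf_le summableI epowr_add_le)
    also have "\<dots> = ennreal (2 powr k) * ((\<Sum>j. epowr (c j) k) + (\<Sum>j. epowr (d j) k))"
      by (simp add: suminf_add[symmetric])
    finally have "epowr (\<Sum>j. epowr (c j + d j) k) (1 / k)
        \<le> epowr (ennreal (2 powr k) * ((\<Sum>j. epowr (c j) k) + (\<Sum>j. epowr (d j) k))) (1 / k)"
      using k by (intro epowr_mono) auto
    also have "\<dots> = ennreal 2 * epowr ((\<Sum>j. epowr (c j) k) + (\<Sum>j. epowr (d j) k)) (1 / k)"
      using k by (subst epowr_cmult) (auto simp: powr_powr)
    also have "\<dots> \<le> ennreal 2 * (ennreal (2 powr (1 / k)) * (epowr (\<Sum>j. epowr (c j) k) (1 / k) + epowr (\<Sum>j. epowr (d j) k) (1 / k)))"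
      using k by (intro mult_left_mono epowr_add_le) auto
    also have "\<dots> = ennreal (2 * 2 powr (1 / k)) * (lq_norm q c + lq_norm q d)"
    proof -
      have "ennreal (2 * 2 powr (1 / k)) = ennreal 2 * ennreal (2 powr (1 / k))" by (rule ennreal_mult') simp
      then show ?thesis by (simp only: lq_norm_finite[OF False] k_def mult.assoc)
    qed
    finally show ?thesis using False by (simp add: lq_norm_finite k_def)
  qed
  then show thesis by (intro that[of "2 * 2 powr (1 / k)"]) auto
qed

text \<open>The exponent q / \<eta>, with \<infinity> preserved. Peetre's inequality bounds
  \<eta>-th powers, and these live in the sequence space of this exponent.\<close>

definition q_div :: "ennreal \<Rightarrow> real \<Rightarrow> ennreal" where
  "q_div q \<eta> = (if q = \<infinity> then \<infinity> else ennreal (enn2real q / \<eta>))"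

lemma epowr_SUP:
  assumes "0 < \<eta>" shows "(SUP j. epowr (c j) \<eta>) = epowr (SUP j. c j) \<eta>"
proof (rule antisym)
  show "(SUP j. epowr (c j) \<eta>) \<le> epowr (SUP j. c j) \<eta>"
    using assms by (intro SUP_least epowr_mono SUP_upper) auto
  have "c j \<le> epowr (SUP j. epowr (c j) \<eta>) (1 / \<eta>)" for j
  proof -
    have "c j = epowr (epowr (c j) \<eta>) (1 / \<eta>)" using assms by (simp add: epowr_epowr)
    also have "\<dots> \<le> epowr (SUP j. epowr (c j) \<eta>) (1 / \<eta>)"
      using assms by (intro epowr_mono SUP_upper) auto
    finally show ?thesis .
  qed
  then have "epowr (SUP j. c j) \<eta> \<le> epowr (epowr (SUP j. epowr (c j) \<eta>) (1 / \<eta>)) \<eta>"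
    using assms by (intro epowr_mono SUP_least) auto
  then show "epowr (SUP j. c j) \<eta> \<le> (SUP j. epowr (c j) \<eta>)" using assms by (simp add: epowr_epowr)
qed

lemma lq_norm_epowr:
  assumes "0 < \<eta>" "0 < q"
  shows "lq_norm (q_div q \<eta>) (\<lambda>j. epowr (c j) \<eta>) = epowr (lq_norm q c) \<eta>"
proof (cases "q = \<infinity>")
  case True
  then show ?thesis using assms by (simp add: lq_norm_def q_div_def epowr_SUP)
next
  case False
  define k where "k = enn2real q"
  have k: "k > 0" using False assms by (simp add: k_def enn2real_positive_iff less_top)
  have Q: "q_div q \<eta> \<noteq> \<infinity>" "enn2real (q_div q \<eta>) = k / \<eta>"
    using False k assms by (auto simp: q_div_def k_def)
  show ?thesis unfolding lq_norm_finite[OF Q(1)] lq_norm_finite[OF False] Q(2)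
    using k assms by (simp add: epowr_epowr k_def[symmetric])
qed

lemma suminf_le_mult_SUP:
  fixes g Y :: "nat \<Rightarrow> ennreal"
  shows "(\<Sum>j. g j * Y j) \<le> (\<Sum>j. g j) * (SUP j. Y j)"
proof -
  have "(\<Sum>j. g j * Y j) \<le> (\<Sum>j. g j * (SUP j. Y j))"
    by (intro suminf_le summableI mult_left_mono SUP_upper) auto
  then show ?thesis by simp
qed

text \<open>A Schur-type bound that covers q < 1. The geometric factor is split into two square
  roots: one is summed over j against a supremum, the q-th power of the other is summed over k. The
  shift 3 is the frequency overlap of the product pieces.\<close>

lemma lq_norm_upper_triangular:
  assumes q: "0 < q" and \<theta>: "0 < \<theta>" "\<theta> < 1"
  obtains C where "C > 0" "\<And>Y. lq_norm q (\<lambda>k. \<Sum>j. if k \<le> j + 3 then ennreal (\<theta> ^ (j + 3 - k)) * Y j else 0) \<le> ennreal C * lq_norm q Y"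
proof -
  define s where "s = sqrt \<theta>"
  have s: "0 < s" "s < 1" "s * s = \<theta>" using \<theta> by (auto simp: s_def real_sqrt_lt_1_iff)
  define A where "A = 1 / (1 - s)"
  have A: "A > 0" using s by (simp add: A_def)
  let ?t = "\<lambda>k j. if k \<le> j + 3 then ennreal (s ^ (j + 3 - k)) else 0"
  have sum_j: "(\<Sum>j. ?t k j) \<le> ennreal A" for k
  proof -
    have "(\<Sum>j. ?t k j) \<le> (\<Sum>i. ennreal (s ^ i))"
      by (rule suminf_ennreal_le_of_inj[where g="\<lambda>i. ennreal (s ^ i)" and \<pi>="\<lambda>j. j + 3 - k"]) (auto simp: inj_on_def)
    also have "(\<Sum>i. ennreal (s ^ i)) = ennreal A"
      unfolding A_def using s by (intro suminf_geometric_ennreal) auto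
    finally show ?thesis .
  qed
  have pt: "(\<Sum>j. if k \<le> j + 3 then ennreal (\<theta> ^ (j + 3 - k)) * Y j else 0) \<le> ennreal A * (SUP j. ?t k j * Y j)" for k Y
  proof -
    have "(\<Sum>j. if k \<le> j + 3 then ennreal (\<theta> ^ (j + 3 - k)) * Y j else 0) = (\<Sum>j. ?t k j * (?t k j * Y j))"
      using s by (intro arg_cong[where f=suminf] ext)
        (simp add: s(3)[symmetric] power_mult_distrib ennreal_mult' mult.assoc)
    also have "\<dots> \<le> (\<Sum>j. ?t k j) * (SUP j. ?t k j * Y j)" by (rule suminf_le_mult_SUP)
    also have "\<dots> \<le> ennreal A * (SUP j. ?t k j * Y j)" by (intro mult_right_mono sum_j) simp
    finally show ?thesis .
  qed
  show thesis
  proof (cases "q = \<infinity>")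
    case True
    have "lq_norm q (\<lambda>k. \<Sum>j. if k \<le> j + 3 then ennreal (\<theta> ^ (j + 3 - k)) * Y j else 0) \<le> ennreal A * lq_norm q Y" for Y
    proof -
      have "(\<Sum>j. if k \<le> j + 3 then ennreal (\<theta> ^ (j + 3 - k)) * Y j else 0) \<le> ennreal A * (SUP j. Y j)" for k
      proof (rule order_trans[OF pt], intro mult_left_mono SUP_mono)
        fix j
        have "?t k j * Y j \<le> 1 * Y j"
          using s by (intro mult_right_mono) (auto simp: power_le_one)
        then show "\<exists>m\<in>UNIV. ?t k j * Y j \<le> Y m" by auto
      qed simp
      then show ?thesis using True by (auto simp: lq_norm_def intro: SUP_least)
    qed
    with A show ?thesis by (rule that)
  next
    case False
    define m where "m = enn2real q"
    have m: "m > 0" using False q by (simp add: m_def enn2real_positive_iff less_top)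
    define z where "z = s powr m"
    have z: "0 < z" "z < 1" using s m by (auto simp: z_def powr01_less_one)
    define B where "B = 1 / (1 - z)"
    have B: "B > 0" using z by (simp add: B_def)
    let ?z = "\<lambda>k j. if k \<le> j + 3 then ennreal (z ^ (j + 3 - k)) else 0"
    have tz: "epowr (?t k j) m = ?z k j" for k j
      using s m by (auto simp: epowr_ennreal z_def powr_power powr_powr powr_realpow[symmetric] mult.commute)
    have sum_k: "(\<Sum>k. ?z k j) \<le> ennreal B" for j
    proof -
      have "(\<Sum>k. ?z k j) \<le> (\<Sum>i. ennreal (z ^ i))"
        by (rule suminf_ennreal_le_of_inj[where g="\<lambda>i. ennreal (z ^ i)" and \<pi>="\<lambda>k. j + 3 - k"]) (auto simp: inj_on_def)
      also have "(\<Sum>i. ennreal (z ^ i)) = ennreal B"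
      unfolding B_def using z by (intro suminf_geometric_ennreal) auto
    finally show ?thesis .
    qed
    define C where "C = (A powr m * B) powr (1 / m)"
    have C: "C > 0" using A B by (simp add: C_def)
    have "lq_norm q (\<lambda>k. \<Sum>j. if k \<le> j + 3 then ennreal (\<theta> ^ (j + 3 - k)) * Y j else 0) \<le> ennreal C * lq_norm q Y" for Y
    proof -
      have "(\<Sum>k. epowr (\<Sum>j. if k \<le> j + 3 then ennreal (\<theta> ^ (j + 3 - k)) * Y j else 0) m)
         \<le> (\<Sum>k. ennreal (A powr m) * (\<Sum>j. ?z k j * epowr (Y j) m))"
      proof (intro suminf_le summableI)
        fix k
        have "epowr (\<Sum>j. if k \<le> j + 3 then ennreal (\<theta> ^ (j + 3 - k)) * Y j else 0) m \<le> epowr (ennreal A * (SUP j. ?t k j * Y j)) m"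
          using m by (intro epowr_mono pt) simp
        also have "\<dots> = ennreal (A powr m) * epowr (SUP j. ?t k j * Y j) m"
          using A m by (subst epowr_cmult) auto
        also have "epowr (SUP j. ?t k j * Y j) m = (SUP j. ?z k j * epowr (Y j) m)"
          using m by (simp only: epowr_SUP[symmetric] epowr_mult tz)
        also have "\<dots> \<le> (\<Sum>j. ?z k j * epowr (Y j) m)"
        proof (rule SUP_least)
          fix j
          show "?z k j * epowr (Y j) m \<le> (\<Sum>j. ?z k j * epowr (Y j) m)"
            using sum_le_suminf[of "\<lambda>j. ?z k j * epowr (Y j) m" "{j}"] by (simp only: summableI finite.intros sum.insert sum.empty) simp
        qed
        finally show "epowr (\<Sum>j. if k \<le> j + 3 then ennreal (\<theta> ^ (j + 3 - k)) * Y j else 0) m \<le> ennreal (A powr m) * (\<Sum>j. ?z k j * epowr (Y j) m)"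
          by (simp add: mult_left_mono)
      qed
      also have "\<dots> = ennreal (A powr m) * (\<Sum>j. (\<Sum>k. ?z k j) * epowr (Y j) m)"
        by (simp only: ennreal_suminf_cmult suminf_ennreal_swap[of "\<lambda>k j. ?z k j * epowr (Y j) m"] ennreal_suminf_multc)
      also have "\<dots> \<le> ennreal (A powr m) * (\<Sum>j. ennreal B * epowr (Y j) m)"
        by (intro mult_left_mono suminf_le summableI mult_right_mono sum_k) auto
      also have "\<dots> = ennreal (A powr m * B) * (\<Sum>j. epowr (Y j) m)"
        by (simp add: ennreal_mult' mult.assoc)
      finally have "epowr (\<Sum>k. epowr (\<Sum>j. if k \<le> j + 3 then ennreal (\<theta> ^ (j + 3 - k)) * Y j else 0) m) (1 / m)
         \<le> epowr (ennreal (A powr m * B) * (\<Sum>j. epowr (Y j) m)) (1 / m)"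
        using m by (intro epowr_mono) auto
      also have "\<dots> = ennreal C * epowr (\<Sum>j. epowr (Y j) m) (1 / m)"
        unfolding C_def using A B m by (intro epowr_cmult) auto
      finally show ?thesis using False by (simp add: lq_norm_finite m_def)
    qed
    with C show ?thesis by (rule that)
  qed
qed

text \<open>For p \<ge> 1 this is the power mean inequality and the source of the exponent 1/r'. For
  p < 1 it is the embedding of l^p into l^1, and the exponent of 1 + J is 0.\<close>

lemma sum_le_power_mean:
  fixes a :: "nat \<Rightarrow> real"
  assumes p: "p > 0" and a: "\<And>k. a k \<ge> 0" and A: "(\<Sum>k\<le>J. a k powr p) \<le> A"
  shows "(\<Sum>k\<le>J. a k) \<le> 2 * (1 + real J) powr (1 - 1 / max 1 p) * A powr (1 / p)"
proof (cases "A = 0")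
  case True
  then have "(\<Sum>k\<le>J. a k powr p) = 0" using A by (intro antisym sum_nonneg) auto
  then have "\<forall>k\<in>{..J}. a k powr p = 0" by (subst (asm) sum_nonneg_eq_0_iff) auto
  then show ?thesis using True by simp
next
  case False
  have "0 \<le> (\<Sum>k\<le>J. a k powr p)" by (intro sum_nonneg) auto
  with A False have A0: "A > 0" by linarith
  show ?thesis
  proof (cases "p \<ge> 1")
    case True
    \<comment> \<open>At this level the two contributions (1 + J) l and l^(1-p) A coincide.\<close>
    define l where "l = (A / (1 + real J)) powr (1 / p)"
    have l: "l > 0" using A0 by (simp add: l_def)
    have "a k \<le> l + l powr (1 - p) * a k powr p" for k
      using ennreal_le_lambda_powr[OF l True, of "ennreal (a k)"] a[of k] l
      by (simp add: epowr_ennreal ennreal_mult'[symmetric] ennreal_plus[symmetric] ennreal_le_iff del: ennreal_plus)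
    then have "(\<Sum>k\<le>J. a k) \<le> (\<Sum>k\<le>J. l + l powr (1 - p) * a k powr p)" by (rule sum_mono)
    also have "\<dots> = (1 + real J) * l + l powr (1 - p) * (\<Sum>k\<le>J. a k powr p)"
      by (simp add: sum.distrib sum_distrib_left)
    also have "\<dots> \<le> (1 + real J) * l + l powr (1 - p) * A" by (intro add_left_mono mult_left_mono A) simp
    also have "(1 + real J) * l = (1 + real J) powr (1 - 1 / p) * A powr (1 / p)"
      using A0 by (simp add: l_def powr_divide powr_diff)
    also have "l powr (1 - p) * A = (1 + real J) powr (1 - 1 / p) * A powr (1 / p)"
    proof -
      have "l powr (1 - p) = (A / (1 + real J)) powr (1 / p - 1)"
        using True by (simp add: l_def powr_powr right_diff_distrib diff_divide_distrib)
      also have "\<dots> = A powr (1 / p - 1) * (1 + real J) powr (1 - 1 / p)"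
      proof -
        have "(A / (1 + real J)) powr (1 / p - 1) = A powr (1 / p - 1) * (1 + real J) powr (- (1 / p - 1))"
        proof -
          have 1: "(A / (1 + real J)) powr (1 / p - 1) = A powr (1 / p - 1) / (1 + real J) powr (1 / p - 1)"
            by (rule powr_divide)
          have 2: "(1 + real J) powr (- (1 / p - 1)) = inverse ((1 + real J) powr (1 / p - 1))" by (rule powr_minus)
          show ?thesis unfolding 1 2 by (rule divide_inverse)
        qed
        then show ?thesis by (simp only: minus_diff_eq)
      qed
      finally show ?thesis using A0 powr_add[of A "1 / p - 1" 1] by simp
    qed
    finally show ?thesis using True by (simp add: max_def mult_ac)
  next
    case False
    have "a k \<le> A powr ((1 - p) / p) * a k powr p" if k: "k \<le> J" for k
    proof -
      have "a k powr p \<le> A"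
        using member_le_sum[of k "{..J}" "\<lambda>k. a k powr p"] k A by force
      then have "(a k powr p) powr ((1 - p) / p) \<le> A powr ((1 - p) / p)"
        using False p by (intro powr_mono2) auto
      then have "a k powr (1 - p) \<le> A powr ((1 - p) / p)" using p by (simp add: powr_powr)
      then have "a k powr (1 - p) * a k powr p \<le> A powr ((1 - p) / p) * a k powr p" by (rule mult_right_mono) simp
      then show ?thesis using a[of k] by (simp add: powr_add[symmetric])
    qed
    then have "(\<Sum>k\<le>J. a k) \<le> (\<Sum>k\<le>J. A powr ((1 - p) / p) * a k powr p)" by (intro sum_mono) auto
    also have "\<dots> \<le> A powr ((1 - p) / p) * A"
      unfolding sum_distrib_left[symmetric] by (intro mult_left_mono A) simp
    also have "\<dots> = A powr (1 / p)" using A0 p powr_add[of A "(1 - p) / p" 1] by (simp add: diff_divide_distrib)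
    also have "\<dots> \<le> 2 * A powr (1 / p)" using powr_ge_zero[of A "1 / p"] by linarith
    finally show ?thesis using False by (simp add: max_def)
  qed
qed

lemma q_div_greater_1:
  assumes "0 < \<eta>" "ennreal \<eta> < q" shows "ennreal 1 < q_div q \<eta>"
proof (cases "q = \<infinity>")
  case False
  then have "\<eta> < enn2real q" using assms by (cases q) (auto simp: ennreal_less_iff)
  then show ?thesis using False assms by (simp add: q_div_def ennreal_less_iff field_simps)
qed (simp add: q_div_def)

subsection \<open>Polynomial growth and dyadic weights\<close>

definition poly_growth :: "('a::euclidean_space \<Rightarrow> complex) \<Rightarrow> bool" where
  "poly_growth h \<longleftrightarrow> (\<exists>C m. \<forall>z. norm (h z) \<le> C * (1 + norm z) ^ m)"

lemma poly_growth_smear: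
  assumes "tempered u" "K \<in> schwartz" shows "poly_growth (smear u K)"
proof -
  obtain C m where C: "C > 0" "\<And>y. norm (smear u K y) \<le> C * (1 + norm y) ^ m"
    using smear_growth[OF assms] by blast
  show ?thesis unfolding poly_growth_def by (rule exI[of _ C], rule exI[of _ m], rule allI, rule C(2))
qed

lemma poly_growth_mult:
  assumes "poly_growth f" "poly_growth g" shows "poly_growth (\<lambda>x. f x * g x)"
proof -
  obtain C m where C: "\<And>z. norm (f z) \<le> C * (1 + norm z) ^ m" using assms(1) unfolding poly_growth_def by blast
  obtain D k where D: "\<And>z. norm (g z) \<le> D * (1 + norm z) ^ k" using assms(2) unfolding poly_growth_def by blast
  have "norm (f z * g z) \<le> (C * D) * (1 + norm z) ^ (m + k)" for z
    using mult_mono[OF C[of z] D[of z]] order_trans[OF norm_ge_zero C[of z]]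
    by (simp add: norm_mult power_add mult_ac)
  then show ?thesis unfolding poly_growth_def by blast
qed

lemma poly_growth_diff:
  assumes "poly_growth f" "poly_growth g" shows "poly_growth (\<lambda>x. f x - g x)"
proof -
  obtain C m where C: "\<And>z. norm (f z) \<le> C * (1 + norm z) ^ m" using assms(1) unfolding poly_growth_def by blast
  obtain D k where D: "\<And>z. norm (g z) \<le> D * (1 + norm z) ^ k" using assms(2) unfolding poly_growth_def by blast
  have up: "r \<le> \<bar>A\<bar> * (1 + norm z) ^ (m + k)" if "r \<le> A * (1 + norm z) ^ i" "i \<le> m + k" for r A i and z :: 'a
  proof -
    have "r \<le> \<bar>A\<bar> * (1 + norm z) ^ i"
      using order_trans[OF that(1) mult_right_mono[OF abs_ge_self[of A], of "(1 + norm z) ^ i"]] by simp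
    also have "\<dots> \<le> \<bar>A\<bar> * (1 + norm z) ^ (m + k)" using that(2) by (intro mult_left_mono power_increasing) auto
    finally show ?thesis .
  qed
  have "norm (f z - g z) \<le> (\<bar>C\<bar> + \<bar>D\<bar>) * (1 + norm z) ^ (m + k)" for z
    using norm_triangle_ineq4[of "f z" "g z"] up[OF C[of z]] up[OF D[of z]] unfolding distrib_right by simp
  then show ?thesis unfolding poly_growth_def by blast
qed

lemma rapid_mult_poly_growth_integrable:
  fixes \<psi> :: "'a::euclidean_space \<Rightarrow> complex"
  assumes "\<psi> \<in> schwartz" "poly_growth h" "h \<in> borel_measurable borel"
  shows "integrable lborel (\<lambda>y. \<psi> y * h y)"
proof -
  obtain C m where C: "\<And>z. norm (h z) \<le> C * (1 + norm z) ^ m" using assms(2) unfolding poly_growth_def by blast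
  show ?thesis by (rule rapid_integrable_weight(1)[OF schwartzD(1)[OF assms(1)] schwartz_measurable[OF assms(1)] assms(3) C])
qed

text \<open>The annulus at radius 2^-k has at least half the volume of its ball, because 2^-n \<le>
  1/2. So \<open>V\<close>, which is at least 2^(kn) t_k there, has integral at least a fixed
  multiple of t_k over it, and the annuli are disjoint.\<close>

lemma dyadic_annuli_sum:
  fixes V :: "'a::euclidean_space \<Rightarrow> ennreal"
  assumes [measurable]: "V \<in> borel_measurable borel"
    and le: "\<And>k y. norm (y - x) \<le> 1 / 2 ^ k \<Longrightarrow> ennreal (2 ^ (k * DIM('a))) * t k \<le> V y"
  shows "(\<Sum>k. t k) \<le> ennreal (2 / unit_ball_vol DIM('a)) * (\<integral>\<^sup>+y. V y \<partial>lborel)"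
proof -
  let ?n = "DIM('a)"
  let ?v = "unit_ball_vol (real ?n)"
  have v: "?v > 0" by simp
  define E where "E k = cball x (1 / 2 ^ k) - cball x (1 / 2 ^ Suc k)" for k
  have Es: "E k \<in> sets lborel" for k by (simp add: E_def)
  have "disjoint_family E"
  proof -
    have "E m \<inter> E k = {}" if "m < k" for m k
    proof -
      have "(1::real) / 2 ^ k \<le> 1 / 2 ^ Suc m"
        using that by (intro divide_left_mono power_increasing) auto
      then have "cball x (1 / 2 ^ k) \<subseteq> cball x (1 / 2 ^ Suc m)" by (rule subset_cball)
      then show ?thesis unfolding E_def by blast
    qed
    then show ?thesis unfolding disjoint_family_on_def by (metis Int_commute nat_neq_iff)
  qed
  have meas: "ennreal (?v / 2) \<le> ennreal (2 ^ (k * ?n)) * emeasure lborel (E k)" for k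
  proof -
    have sub: "cball x (1 / 2 ^ Suc k) \<subseteq> cball x (1 / 2 ^ k)" by (intro subset_cball) (simp add: field_simps)
    have "emeasure lborel (E k) = emeasure lborel (cball x (1 / 2 ^ k)) - emeasure lborel (cball x (1 / 2 ^ Suc k))"
      unfolding E_def using emeasure_lborel_cball_finite[of x "1 / 2 ^ Suc k"] by (intro emeasure_Diff sub) auto
    also have "\<dots> = ennreal (?v * (1 / 2 ^ k) ^ ?n) - ennreal (?v * (1 / 2 ^ Suc k) ^ ?n)"
      by (simp only: emeasure_cball[of "1 / 2 ^ k"] emeasure_cball[of "1 / 2 ^ Suc k"] zero_le_divide_1_iff zero_le_power zero_le_numeral)
    also have "\<dots> = ennreal (?v * (1 / 2 ^ k) ^ ?n - ?v * (1 / 2 ^ Suc k) ^ ?n)"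
      using v by (intro ennreal_minus) simp
    finally have 1: "emeasure lborel (E k) = ennreal (?v * (1 / 2 ^ k) ^ ?n - ?v * (1 / 2 ^ Suc k) ^ ?n)" .
    have 2: "(1 / 2 ^ Suc k :: real) ^ ?n \<le> 1 / 2 * (1 / 2 ^ k) ^ ?n"
    proof -
      have "(1 / 2 ^ Suc k :: real) ^ ?n = (1 / 2) ^ ?n * (1 / 2 ^ k) ^ ?n" unfolding power_mult_distrib[symmetric] by simp
      also have "\<dots> \<le> (1 / 2) ^ 1 * (1 / 2 ^ k) ^ ?n"
        using DIM_positive[where 'a='a] by (intro mult_right_mono power_decreasing) auto
      finally show ?thesis by simp
    qed
    have 3: "2 ^ (k * ?n) * (1 / 2 ^ k :: real) ^ ?n = 1" by (simp add: power_mult power_one_over)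
    have "?v / 2 = 2 ^ (k * ?n) * (?v * (1 / 2 ^ k) ^ ?n - ?v * (1 / 2 * (1 / 2 ^ k) ^ ?n))"
      using 3 by (simp add: right_diff_distrib mult.left_commute[of _ ?v])
    also have "\<dots> \<le> 2 ^ (k * ?n) * (?v * (1 / 2 ^ k) ^ ?n - ?v * (1 / 2 ^ Suc k) ^ ?n)"
      using v 2 by (intro mult_left_mono diff_left_mono) auto
    finally have "ennreal (?v / 2) \<le> ennreal (2 ^ (k * ?n) * (?v * (1 / 2 ^ k) ^ ?n - ?v * (1 / 2 ^ Suc k) ^ ?n))"
      by (rule ennreal_leI)
    then show ?thesis unfolding 1 by (simp add: ennreal_mult')
  qed
  have "ennreal (?v / 2) * (\<Sum>k. t k) = (\<Sum>k. ennreal (?v / 2) * t k)" by simp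
  also have "\<dots> \<le> (\<Sum>k. \<integral>\<^sup>+y. V y * indicator (E k) y \<partial>lborel)"
  proof (intro suminf_le summableI)
    fix k
    have "ennreal (?v / 2) * t k \<le> (ennreal (2 ^ (k * ?n)) * t k) * emeasure lborel (E k)"
      using mult_right_mono[OF meas[of k], of "t k"] by (simp add: mult_ac)
    also have "\<dots> = (\<integral>\<^sup>+y. (ennreal (2 ^ (k * ?n)) * t k) * indicator (E k) y \<partial>lborel)"
      using Es by (intro nn_integral_cmult_indicator[symmetric]) simp
    also have "\<dots> \<le> (\<integral>\<^sup>+y. V y * indicator (E k) y \<partial>lborel)"
    proof (rule nn_integral_mono)
      fix y
      show "(ennreal (2 ^ (k * ?n)) * t k) * indicator (E k) y \<le> V y * indicator (E k) y"
      proof (cases "y \<in> E k")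
        case True
        then have "norm (y - x) \<le> 1 / 2 ^ k" by (simp add: E_def dist_norm norm_minus_commute)
        then show ?thesis by (intro mult_right_mono le) auto
      qed simp
    qed
    finally show "ennreal (?v / 2) * t k \<le> (\<integral>\<^sup>+y. V y * indicator (E k) y \<partial>lborel)" .
  qed
  also have "\<dots> = (\<integral>\<^sup>+y. (\<Sum>k. V y * indicator (E k) y) \<partial>lborel)"
    using Es by (intro nn_integral_suminf[symmetric] borel_measurable_times_ennreal borel_measurable_indicator) auto
  also have "\<dots> \<le> (\<integral>\<^sup>+y. V y \<partial>lborel)"
  proof (rule nn_integral_mono)
    fix y
    have "(\<Sum>k. V y * indicator (E k) y) = V y * (\<Sum>k. indicator (E k) y)" by simp
    also have "\<dots> = V y * indicator (\<Union>k. E k) y"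
      using suminf_indicator[OF \<open>disjoint_family E\<close>, of y] by simp
    also have "\<dots> \<le> V y * 1" by (intro mult_left_mono) (auto simp: indicator_def)
    finally show "(\<Sum>k. V y * indicator (E k) y) \<le> V y" by simp
  qed
  finally have "ennreal (2 / ?v) * (ennreal (?v / 2) * (\<Sum>k. t k)) \<le> ennreal (2 / ?v) * (\<integral>\<^sup>+y. V y \<partial>lborel)"
    by (rule mult_left_mono) simp
  then show ?thesis using v by (simp add: mult.assoc[symmetric] ennreal_mult'[symmetric])
qed

text \<open>Integrability of the (2 + p)-th power thereby dominates the function and its square, up
  to a bounded term.\<close>

lemma le_one_plus_powr:
  assumes "r \<ge> 0" "p \<ge> 0" shows "r \<le> 1 + r powr (2 + p)" "r\<^sup>2 \<le> 1 + r powr (2 + (p::real))"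
proof -
  have 1: "r \<le> 1 + r powr (2 + p) \<and> r\<^sup>2 \<le> 1 + r powr (2 + p)"
  proof (cases "r \<le> 1")
    case True
    then have "r\<^sup>2 \<le> 1" using assms by (simp add: power_le_one)
    then show ?thesis using True powr_ge_zero[of r "2 + p"] by linarith
  next
    case False
    then have r1: "1 \<le> r" by simp
    have "r powr 1 \<le> r powr (2 + p)" by (rule powr_mono) (use r1 assms in auto)
    moreover have "r powr 2 \<le> r powr (2 + p)" by (rule powr_mono) (use r1 assms in auto)
    moreover have "r powr 1 = r" "r powr 2 = r\<^sup>2" using assms by (simp_all add: powr_numeral)
    ultimately show ?thesis by linarith
  qed
  then show "r \<le> 1 + r powr (2 + p)" "r\<^sup>2 \<le> 1 + r powr (2 + p)" by auto
qed

text \<open>The weight of the theorem at t = 2^-j, where \<open>log_plus (1 / t)\<close> is j ln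
  2.\<close>

definition dyadic_weight :: "real \<Rightarrow> nat \<Rightarrow> real" where
  "dyadic_weight e j = (1 + real j * ln 2) powr e"

lemma log_plus_dyadic: "(1 + log_plus (1 / 2 powr (- real j))) powr e = dyadic_weight e j"
proof -
  have "1 / 2 powr (- real j) = (2::real) powr real j" by (simp add: powr_minus divide_inverse)
  then have "log_plus (1 / 2 powr (- real j)) = real j * ln 2" by (simp add: log_plus_def ln_powr)
  then show ?thesis by (simp add: dyadic_weight_def)
qed

lemma dyadic_weight_ge_1: "0 \<le> e \<Longrightarrow> 1 \<le> dyadic_weight e j"
  unfolding dyadic_weight_def by (intro ge_one_powr_ge_zero) auto

lemma dyadic_weight_lower:
  assumes "0 \<le> e" "e \<le> 1" shows "(1 + real j) powr e \<le> 2 * dyadic_weight e j"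
proof -
  have "ln (1 / 2) \<le> 1 / 2 - (1::real)" by (rule ln_le_minus_one) simp
  then have ln2_ge_half: "1 / 2 \<le> ln (2::real)" by (simp add: ln_div)
  have "1 + real j \<le> 2 * (1 + real j * ln 2)"
    using mult_left_mono[OF ln2_ge_half, of "real j"] by simp
  then have "(1 + real j) powr e \<le> (2 * (1 + real j * ln 2)) powr e"
    using assms by (intro powr_mono2) auto
  also have "\<dots> = 2 powr e * dyadic_weight e j" unfolding dyadic_weight_def by (rule powr_mult)
  also have "2 powr e \<le> (2::real) powr 1" using assms by (intro powr_mono) auto
  finally show ?thesis using dyadic_weight_ge_1[OF assms(1), of j] by (simp add: mult_right_mono)
qed

text \<open>Passing to a scale finer by i steps raises the weight at most by a factor linear in i,
  which any geometric decay can absorb.\<close>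

lemma dyadic_weight_shift:
  assumes e: "0 \<le> e" "e \<le> 1" and j: "j \<le> i + k"
  shows "dyadic_weight e j \<le> (1 + real i) * dyadic_weight e k"
proof -
  have l: "ln 2 \<le> (1::real)" using ln_le_minus_one[of "2::real"] by simp
  have "1 + real j * ln 2 \<le> 1 + (real i + real k) * ln 2"
    using j by (intro add_left_mono mult_right_mono) auto
  also have "\<dots> \<le> 1 + real i + real k * ln 2"
    using mult_left_mono[OF l, of "real i"] by (simp add: distrib_right)
  also have "\<dots> \<le> (1 + real i) * (1 + real k * ln 2)" by (simp add: algebra_simps)
  finally have "(1 + real j * ln 2) powr e \<le> ((1 + real i) * (1 + real k * ln 2)) powr e"
    using e by (intro powr_mono2) auto
  also have "\<dots> = (1 + real i) powr e * dyadic_weight e k" by (simp add: dyadic_weight_def powr_mult)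
  also have "(1 + real i) powr e \<le> (1 + real i) powr 1" using e by (intro powr_mono) auto
  finally show ?thesis
    unfolding dyadic_weight_def[of e j] using dyadic_weight_ge_1[OF e(1), of k] by (simp add: mult_right_mono)
qed

text \<open>Bernoulli's inequality. An arbitrarily small part of the geometric decay pays for the
  linear loss in the weights.\<close>

lemma linear_le_geometric:
  assumes t: "1 < (t::real)"
  shows "1 + real i \<le> (1 + 1 / (t - 1)) * t ^ i"
proof -
  have B: "1 + real i * (t - 1) \<le> t ^ i" using Bernoulli_inequality[of "t - 1" i] t by simp
  then have "real i \<le> t ^ i / (t - 1)" using t by (simp add: field_simps)
  moreover have "1 \<le> t ^ i" using t by (intro one_le_power) simp
  ultimately show ?thesis by (simp add: distrib_right)
qed

subsection \<open>Littlewood-Paley pieces\<close>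

definition low_symbol :: "('a::euclidean_space \<Rightarrow> real) \<Rightarrow> nat \<Rightarrow> 'a \<Rightarrow> complex" where
  "low_symbol \<phi> J \<xi> = complex_of_real (\<phi> ((1 / 2 ^ J) *\<^sub>R \<xi>))"

definition low_kernel :: "('a::euclidean_space \<Rightarrow> real) \<Rightarrow> nat \<Rightarrow> 'a \<Rightarrow> complex" where
  "low_kernel \<phi> J = inv_fourier (low_symbol \<phi> J)"

definition lp_kernel :: "('a::euclidean_space \<Rightarrow> real) \<Rightarrow> nat \<Rightarrow> 'a \<Rightarrow> complex" where
  "lp_kernel \<phi> j = inv_fourier (lp_symbol \<phi> j)"

lemma lp_symbol_0: "lp_symbol \<phi> 0 = low_symbol \<phi> 0"
  by (simp add: lp_symbol_def low_symbol_def fun_eq_iff)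

lemma lp_symbol_Suc: "lp_symbol \<phi> (Suc j) = (\<lambda>\<xi>. low_symbol \<phi> (Suc j) \<xi> - low_symbol \<phi> j \<xi>)"
  by (simp add: lp_symbol_def low_symbol_def fun_eq_iff Let_def)

context
  fixes \<phi> :: "'a::euclidean_space \<Rightarrow> real"
  assumes \<phi>: "lp_generator \<phi>"
begin

lemma low_symbol_schwartz: "low_symbol \<phi> J \<in> schwartz"
proof -
  have "(\<lambda>\<xi>. complex_of_real (\<phi> \<xi>)) \<in> schwartz" using \<phi> by (simp add: lp_generator_def)
  from schwartz_affine[OF this, of "1 / 2 ^ J" 0] show ?thesis by (simp add: low_symbol_def[abs_def])
qed

lemma lp_symbol_schwartz: "lp_symbol \<phi> j \<in> schwartz"
  by (cases j) (simp_all add: lp_symbol_0 lp_symbol_Suc low_symbol_schwartz schwartz_diff)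

lemma low_kernel_schwartz: "low_kernel \<phi> J \<in> schwartz"
  unfolding low_kernel_def by (intro inv_fourier_schwartz low_symbol_schwartz)

lemma lp_kernel_schwartz: "lp_kernel \<phi> J \<in> schwartz"
  unfolding lp_kernel_def by (intro inv_fourier_schwartz lp_symbol_schwartz)

lemma lp_kernel_0: "lp_kernel \<phi> 0 = low_kernel \<phi> 0"
  by (simp add: lp_kernel_def low_kernel_def lp_symbol_0)

lemma lp_kernel_Suc: "lp_kernel \<phi> (Suc j) = (\<lambda>x. low_kernel \<phi> (Suc j) x - low_kernel \<phi> j x)"
  unfolding lp_kernel_def low_kernel_def lp_symbol_Suc by (intro inv_fourier_diff low_symbol_schwartz)

text \<open>All low-pass kernels are dilates of the one at level 0, whose decay therefore yields
  bounds uniform in \<open>J\<close>.\<close>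

lemma low_kernel_scale: "low_kernel \<phi> J z = 2 ^ (J * DIM('a)) * low_kernel \<phi> 0 (2 ^ J *\<^sub>R z)"
proof -
  have [measurable]: "low_symbol \<phi> J \<in> borel_measurable borel" for J by (intro schwartz_measurable low_symbol_schwartz)
  let ?c = "complex_of_real ((2 * pi) ^ DIM('a))"
  have "ift (low_symbol \<phi> J) z = \<bar>2 ^ J\<bar> ^ DIM('a) *\<^sub>R (LINT \<xi>|lborel. low_symbol \<phi> J (0 + 2 ^ J *\<^sub>R \<xi>) * expi (z \<bullet> (0 + 2 ^ J *\<^sub>R \<xi>)))"
    unfolding ift_def by (rule has_bochner_integral_lborel_affine(2)) (auto intro!: borel_measurable_times borel_measurable_exp)
  also have "(LINT \<xi>|lborel. low_symbol \<phi> J (0 + 2 ^ J *\<^sub>R \<xi>) * expi (z \<bullet> (0 + 2 ^ J *\<^sub>R \<xi>))) = ift (low_symbol \<phi> 0) (2 ^ J *\<^sub>R z)"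
    unfolding ift_def by (intro Bochner_Integration.integral_cong refl) (simp add: low_symbol_def)
  finally have "ift (low_symbol \<phi> J) z = 2 ^ (J * DIM('a)) * ift (low_symbol \<phi> 0) (2 ^ J *\<^sub>R z)"
    by (simp add: scaleR_conv_of_real power_mult)
  then show ?thesis unfolding low_kernel_def inv_fourier_ift by (simp only: mult.left_commute)
qed

lemma low_kernel_decay:
  obtains B where "B > 0" "\<And>J z x. norm (low_kernel \<phi> J (x - z)) \<le> B * 2 ^ (J * DIM('a)) * wt J x z powr (- a)"
proof -
  define N where "N = nat \<lceil>a\<rceil>"
  have N: "a \<le> real N" by (simp add: N_def real_nat_ceiling_ge)
  obtain B where B: "B > 0" "\<And>x. (1 + norm x) ^ N * norm (low_kernel \<phi> 0 x) \<le> B"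
    using rapidE[OF schwartzD(1)[OF low_kernel_schwartz[of 0]], of N] by blast
  have "norm (low_kernel \<phi> J (x - z)) \<le> B * 2 ^ (J * DIM('a)) * wt J x z powr (- a)" for J z x
  proof -
    have w: "1 + norm (2 ^ J *\<^sub>R (x - z)) = wt J x z" by (simp add: wt_def)
    have p: "wt J x z powr real N = wt J x z ^ N" using wt_pos[of J x z] by (simp add: powr_realpow)
    have "norm (low_kernel \<phi> 0 (2 ^ J *\<^sub>R (x - z))) \<le> B / wt J x z powr real N"
      using B(2)[of "2 ^ J *\<^sub>R (x - z)"] wt_pos[of J x z] unfolding w p by (simp add: pos_le_divide_eq mult.commute)
    also have "\<dots> = B * wt J x z powr (- real N)" by (simp add: powr_minus divide_inverse)
    also have "\<dots> \<le> B * wt J x z powr (- a)"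
      using B(1) N wt_ge_1[of J x z] by (intro mult_left_mono powr_mono) auto
    finally have "2 ^ (J * DIM('a)) * norm (low_kernel \<phi> 0 (2 ^ J *\<^sub>R (x - z))) \<le> 2 ^ (J * DIM('a)) * (B * wt J x z powr (- a))"
      by (rule mult_left_mono) simp
    then show ?thesis unfolding low_kernel_scale[of J] by (simp add: norm_mult norm_power mult_ac)
  qed
  with B(1) show thesis by (rule that)
qed

text \<open>A difference of low-pass kernels at consecutive levels; the two weights differ at most
  by a factor 2, which costs 2^a.\<close>

lemma lp_kernel_decay:
  assumes a: "a \<ge> 0"
  obtains B where "B > 0" "\<And>j z x. norm (lp_kernel \<phi> j (x - z)) \<le> B * 2 ^ (j * DIM('a)) * wt j x z powr (- a)"
proof -
  obtain B where B: "B > 0" "\<And>J z x. norm (low_kernel \<phi> J (x - z)) \<le> B * 2 ^ (J * DIM('a)) * wt J x z powr (- a)"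
    using low_kernel_decay by blast
  define B' where "B' = B * (1 + 2 powr a)"
  have B': "B' > 0" "B \<le> B'" using B by (auto simp: B'_def add_pos_nonneg intro!: mult_pos_pos)
  have "norm (lp_kernel \<phi> j (x - z)) \<le> B' * 2 ^ (j * DIM('a)) * wt j x z powr (- a)" for j z x
  proof (cases j)
    case 0
    have "norm (lp_kernel \<phi> 0 (x - z)) \<le> B * 2 ^ (0 * DIM('a)) * wt 0 x z powr (- a)"
      unfolding lp_kernel_0 by (rule B(2))
    also have "\<dots> \<le> B' * 2 ^ (0 * DIM('a)) * wt 0 x z powr (- a)"
      using B'(2) by (intro mult_right_mono) auto
    finally show ?thesis using 0 by simp
  next
    case (Suc k)
    have "wt k x z powr (- a) \<le> (wt (Suc k) x z / 2) powr (- a)"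
      using wt_Suc_le(1)[of k x z] a wt_pos[of "Suc k" x z] by (intro powr_mono2') auto
    also have "\<dots> = 2 powr a * wt (Suc k) x z powr (- a)"
      using wt_pos[of "Suc k" x z] by (simp add: powr_divide powr_minus divide_simps)
    finally have "B * 2 ^ (k * DIM('a)) * wt k x z powr (- a) \<le> B * 2 ^ (Suc k * DIM('a)) * (2 powr a * wt (Suc k) x z powr (- a))"
      using B(1) by (intro mult_mono power_increasing) auto
    with B(2)[of k x z] have "norm (low_kernel \<phi> k (x - z)) \<le> B * 2 ^ (Suc k * DIM('a)) * (2 powr a * wt (Suc k) x z powr (- a))"
      by linarith
    with B(2)[of "Suc k" x z] norm_triangle_ineq4[of "low_kernel \<phi> (Suc k) (x - z)" "low_kernel \<phi> k (x - z)"]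
    have "norm (lp_kernel \<phi> (Suc k) (x - z)) \<le> B * 2 ^ (Suc k * DIM('a)) * wt (Suc k) x z powr (- a)
        + B * 2 ^ (Suc k * DIM('a)) * (2 powr a * wt (Suc k) x z powr (- a))"
      unfolding lp_kernel_Suc by linarith
    also have "\<dots> = B' * 2 ^ (Suc k * DIM('a)) * wt (Suc k) x z powr (- a)"
      unfolding B'_def by (simp only: distrib_left distrib_right mult_ac mult_1_left)
    finally show ?thesis using Suc by simp
  qed
  with B'(1) show thesis by (rule that)
qed

lemma low_symbol_eq_1: "norm \<xi> \<le> 2 ^ J \<Longrightarrow> low_symbol \<phi> J \<xi> = 1"
  using \<phi> by (simp add: low_symbol_def lp_generator_def divide_le_eq)

lemma low_symbol_eq_0: "norm \<xi> > 3 / 2 * 2 ^ J \<Longrightarrow> low_symbol \<phi> J \<xi> = 0"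
proof -
  assume "norm \<xi> > 3 / 2 * 2 ^ J"
  then have "norm ((1 / 2 ^ J) *\<^sub>R \<xi>) > 3 / 2" by (simp add: field_simps)
  then have "(1 / 2 ^ J) *\<^sub>R \<xi> \<notin> closure {\<xi>. \<phi> \<xi> \<noteq> 0}" using \<phi> by (auto simp: lp_generator_def)
  then show ?thesis using closure_subset[of "{\<xi>. \<phi> \<xi> \<noteq> 0}"] by (auto simp: low_symbol_def)
qed

lemma lp_symbol_eq_0_high: "norm \<xi> > 3 / 2 * 2 ^ j \<Longrightarrow> lp_symbol \<phi> j \<xi> = 0"
proof (cases j)
  case (Suc k)
  assume *: "norm \<xi> > 3 / 2 * 2 ^ j"
  then have "norm \<xi> > 3 / 2 * 2 ^ k" using Suc zero_less_power[of "2::real" k] by (simp, linarith)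
  with * Suc show ?thesis by (simp add: lp_symbol_Suc low_symbol_eq_0 del: power_Suc)
qed (simp add: lp_symbol_0 low_symbol_eq_0)

lemma lp_symbol_eq_0_low:
  assumes "norm \<xi> \<le> 2 ^ k" shows "lp_symbol \<phi> (Suc k) \<xi> = 0"
proof -
  have "norm \<xi> \<le> 2 ^ Suc k" using assms zero_le_power[of "2::real" k] unfolding power_Suc by linarith
  with assms show ?thesis by (simp add: lp_symbol_Suc low_symbol_eq_1 del: power_Suc)
qed

text \<open>Two frequencies of size at most (3/2) 2^j add up to at most 3 * 2^j < 2^(j+2), where the
  symbol of level J + 2 equals 1.\<close>

lemma low_symbol_reproduce:
  assumes "j \<le> J"
  shows "low_symbol \<phi> (J + 2) (\<xi> + \<eta>) * (low_symbol \<phi> j \<xi> * low_symbol \<phi> j \<eta>) = 1 * (low_symbol \<phi> j \<xi> * low_symbol \<phi> j \<eta>)"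
proof (cases "low_symbol \<phi> j \<xi> = 0 \<or> low_symbol \<phi> j \<eta> = 0")
  case False
  then have "norm \<xi> \<le> 3 / 2 * 2 ^ j" "norm \<eta> \<le> 3 / 2 * 2 ^ j" using low_symbol_eq_0 by (meson not_less)+
  then have "norm (\<xi> + \<eta>) \<le> 3 * 2 ^ j" using norm_triangle_ineq[of \<xi> \<eta>] by linarith
  also have "\<dots> \<le> 2 ^ (J + 2)" using power_increasing[OF assms, of "2::real"] zero_le_power[of "2::real" j] by (simp add: power_add, linarith)
  finally show ?thesis by (simp only: low_symbol_eq_1)
qed auto

text \<open>The sum of the two frequencies stays below 2^(j+2) \<le> 2^(k-1), the inner radius of
  the k-th annulus. This is the origin of the offset 3 in everything that follows.\<close>

lemma lp_symbol_product_vanish: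
  assumes "j + 3 \<le> k"
  shows "lp_symbol \<phi> k (\<xi> + \<eta>) * (low_symbol \<phi> j \<xi> * low_symbol \<phi> j \<eta>) = 0 * (low_symbol \<phi> j \<xi> * low_symbol \<phi> j \<eta>)"
proof (cases "low_symbol \<phi> j \<xi> = 0 \<or> low_symbol \<phi> j \<eta> = 0")
  case False
  then have "norm \<xi> \<le> 3 / 2 * 2 ^ j" "norm \<eta> \<le> 3 / 2 * 2 ^ j" using low_symbol_eq_0 by (meson not_less)+
  then have "norm (\<xi> + \<eta>) \<le> 3 * 2 ^ j" using norm_triangle_ineq[of \<xi> \<eta>] by linarith
  also have "\<dots> \<le> 2 ^ (j + 2)" by (simp add: power_add)
  also have "\<dots> \<le> 2 ^ (k - 1)" using assms by (intro power_increasing) auto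
  finally have "lp_symbol \<phi> (Suc (k - 1)) (\<xi> + \<eta>) = 0" by (rule lp_symbol_eq_0_low)
  then show ?thesis using assms by simp
qed auto

lemma lp_symbol_reproduce: "low_symbol \<phi> (j + 2) \<xi> * lp_symbol \<phi> j \<xi> = 1 * lp_symbol \<phi> j \<xi>"
proof (cases "lp_symbol \<phi> j \<xi> = 0")
  case False
  then have "norm \<xi> \<le> 3 / 2 * 2 ^ j" using lp_symbol_eq_0_high by (meson not_less)
  also have "\<dots> \<le> 2 ^ (j + 2)" by (simp add: power_add)
  finally show ?thesis by (simp only: low_symbol_eq_1)
qed simp

text \<open>
  Reproduction by a low-pass kernel replaces the condition that the spectrum lies in a ball of radius \<open>2^(j + 2)\<close>.
\<close>

definition band :: "nat \<Rightarrow> ('a \<Rightarrow> complex) \<Rightarrow> bool" where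
  "band j h \<longleftrightarrow> h \<in> borel_measurable borel \<and> (\<exists>C m. \<forall>z. norm (h z) \<le> C * (1 + norm z) ^ m) \<and>
     (\<forall>x. h x = (LINT y|lborel. low_kernel \<phi> (j + 2) (x - y) * h y))"

text \<open>The reproducing kernel has level j + 2 but is dominated by a weight of level j, at the
  cost of 2^(2n). Decay constants are chosen for all exponents simultaneously, since
  \<open>peetre_poly_growth\<close> varies the exponent.\<close>

lemma band_peetre:
  assumes a: "0 < a" and \<eta>: "0 < \<eta>" "\<eta> \<le> 1"
  obtains B where "B > 0" "\<And>j h x z. band j h \<Longrightarrow> ennreal (norm (h z) powr \<eta>) \<le> ennreal (B * wt j x z powr (a * \<eta>)) *
     avg (a * \<eta> - real DIM('a)) j (\<lambda>y. ennreal (norm (h y) powr \<eta>)) x"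
proof -
  have "\<exists>B. B > 0 \<and> (\<forall>J z x. norm (low_kernel \<phi> J (x - z)) \<le> B * 2 ^ (J * DIM('a)) * wt J x z powr (- a))" for a
    by (rule low_kernel_decay[of a]) blast
  then have "\<forall>a. \<exists>B. B > 0 \<and> (\<forall>J z x. norm (low_kernel \<phi> J (x - z)) \<le> B * 2 ^ (J * DIM('a)) * wt J x z powr (- a))"
    by (rule allI)
  from choice[OF this] obtain B where
    B0: "\<forall>a. B a > 0 \<and> (\<forall>J z x. norm (low_kernel \<phi> J (x - z)) \<le> B a * 2 ^ (J * DIM('a)) * wt J x z powr (- a))"
    by (rule exE)
  note B = B0[THEN spec, THEN conjunct1] B0[THEN spec, THEN conjunct2, rule_format]
  define Bf where "Bf a = B a * 2 ^ (2 * DIM('a))" for a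
  have Bf: "Bf a > 0" for a using B(1) by (simp add: Bf_def)
  have "ennreal (norm (h z) powr \<eta>) \<le> ennreal (Bf a * wt j x z powr (a * \<eta>)) *
     avg (a * \<eta> - real DIM('a)) j (\<lambda>y. ennreal (norm (h y) powr \<eta>)) x" if h: "band j h" for j h x z
  proof -
    from h obtain C m where C: "\<And>z. norm (h z) \<le> C * (1 + norm z) ^ m" unfolding band_def by blast
    have hm: "h \<in> borel_measurable borel" using h by (simp add: band_def)
    have rep: "ennreal (norm (h z)) \<le> (\<integral>\<^sup>+y. ennreal (Bf a * 2 ^ (j * DIM('a)) * wt j z y powr (- a) * norm (h y)) \<partial>lborel)" if a: "a > 0" for a z
    proof -
      have "h z = (LINT y|lborel. low_kernel \<phi> (j + 2) (z - y) * h y)" using h unfolding band_def by blast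
      then have "ennreal (norm (h z)) = ennreal (norm (LINT y|lborel. low_kernel \<phi> (j + 2) (z - y) * h y))"
        by (rule arg_cong)
      \<comment> \<open>If the integrand is not integrable, the Bochner integral is 0 and the bound
        is trivial.\<close>
      also have "\<dots> \<le> (\<integral>\<^sup>+y. ennreal (norm (low_kernel \<phi> (j + 2) (z - y) * h y)) \<partial>lborel)"
        by (cases "integrable lborel (\<lambda>y. low_kernel \<phi> (j + 2) (z - y) * h y)")
           (auto simp: integral_norm_bound_ennreal not_integrable_integral_eq)
      also have "\<dots> \<le> (\<integral>\<^sup>+y. ennreal (Bf a * 2 ^ (j * DIM('a)) * wt j z y powr (- a) * norm (h y)) \<partial>lborel)"
      proof (intro nn_integral_mono ennreal_leI)
        fix y
        have "norm (low_kernel \<phi> (j + 2) (z - y)) \<le> B a * 2 ^ ((j + 2) * DIM('a)) * wt (j + 2) z y powr (- a)"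
          by (rule B(2))
        also have "\<dots> \<le> B a * 2 ^ ((j + 2) * DIM('a)) * wt j z y powr (- a)"
          using B(1)[of a] a wt_mono[of j "j + 2" z y] wt_pos[of j z y] by (intro mult_left_mono powr_mono2') auto
        also have "\<dots> = Bf a * 2 ^ (j * DIM('a)) * wt j z y powr (- a)"
        proof -
          have "(2::real) ^ ((j + 2) * DIM('a)) = 2 ^ (2 * DIM('a)) * 2 ^ (j * DIM('a))"
            unfolding power_add[symmetric] by (simp only: add_mult_distrib add.commute)
          then show ?thesis unfolding Bf_def by (simp only: mult.assoc)
        qed
        finally show "norm (low_kernel \<phi> (j + 2) (z - y) * h y) \<le> Bf a * 2 ^ (j * DIM('a)) * wt j z y powr (- a) * norm (h y)"
          unfolding norm_mult by (rule mult_right_mono) simp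
      qed
      finally show ?thesis .
    qed
    show ?thesis by (rule peetre_poly_growth[OF a \<eta> hm Bf C rep])
  qed
  with Bf show thesis by (intro that[of "Bf a"])
qed

text \<open>The kernel of scale k is expressed through weights of scale j: replacing one weight by
  the other costs 2^((j+3-k) a), and passing from the normalisation 2^(kn) to 2^(jn) gains 2^((j-k)
  n). Together this is 2^((j-k)(a-n)) and a constant 2^(3a).\<close>

lemma band_convolve:
  assumes a: "0 < a" and \<eta>: "0 < \<eta>" "\<eta> \<le> 1"
  obtains C where "C > 0" "\<And>j k h x. band j h \<Longrightarrow> k \<le> j + 3 \<Longrightarrow>
     ennreal (norm (LINT y|lborel. lp_kernel \<phi> k (x - y) * h y))
       \<le> ennreal (C * 2 powr ((real j - real k) * (a - real DIM('a)))) *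
          epowr (avg (a * \<eta> - real DIM('a)) j (\<lambda>y. ennreal (norm (h y) powr \<eta>)) x) (1 / \<eta>)"
proof -
  let ?n = "real DIM('a)"
  obtain B where B: "B > 0" "\<And>j h x z. band j h \<Longrightarrow> ennreal (norm (h z) powr \<eta>) \<le> ennreal (B * wt j x z powr (a * \<eta>)) *
     avg (a * \<eta> - ?n) j (\<lambda>y. ennreal (norm (h y) powr \<eta>)) x"
    using band_peetre[OF a \<eta>] by blast
  obtain D where D: "D > 0" "\<And>j z x. norm (lp_kernel \<phi> j (x - z)) \<le> D * 2 ^ (j * DIM('a)) * wt j x z powr (- a)"
    using lp_kernel_decay[of a] a by auto
  define C where "C = D * 2 powr (3 * a) * B powr (1 / \<eta> - 1)"
  have C: "C > 0" using B D by (simp add: C_def)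
  have "ennreal (norm (LINT y|lborel. lp_kernel \<phi> k (x - y) * h y))
       \<le> ennreal (C * 2 powr ((real j - real k) * (a - ?n))) *
          epowr (avg (a * \<eta> - ?n) j (\<lambda>y. ennreal (norm (h y) powr \<eta>)) x) (1 / \<eta>)"
    if h: "band j h" and jk: "k \<le> j + 3" for j k h x
  proof -
    let ?W = "avg (a * \<eta> - ?n) j (\<lambda>y. ennreal (norm (h y) powr \<eta>)) x"
    have hm[measurable]: "h \<in> borel_measurable borel" using h by (simp add: band_def)
    show ?thesis
    proof (cases "?W = \<top>")
      case True
      then show ?thesis using C by (simp add: ennreal_mult_top)
    next
      case False
      then obtain W where W: "?W = ennreal W" "W \<ge> 0" by (cases ?W) auto
      define A where "A = (B * W) powr (1 / \<eta>)"
      have hA: "norm (h z) \<le> A * wt j x z powr a" for z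
      proof -
        have "ennreal (norm (h z) powr \<eta>) \<le> ennreal (B * wt j x z powr (a * \<eta>) * W)"
          using B(2)[OF h, of z x] unfolding W(1) using B(1) W(2) by (simp add: ennreal_mult'[symmetric])
        then have le: "norm (h z) powr \<eta> \<le> B * wt j x z powr (a * \<eta>) * W"
          using B(1) W(2) by (subst (asm) ennreal_le_iff) auto
        have "norm (h z) = (norm (h z) powr \<eta>) powr (1 / \<eta>)" using \<eta> by (simp add: powr_powr)
        also have "\<dots> \<le> (B * wt j x z powr (a * \<eta>) * W) powr (1 / \<eta>)"
          using le \<eta> by (intro powr_mono2) auto
        also have "\<dots> = A * wt j x z powr a"
          using B(1) W(2) \<eta> by (simp add: A_def powr_mult powr_powr)
        finally show ?thesis .
      qed
      define E where "E = D * 2 powr (3 * a) * 2 powr ((real j - real k) * (a - ?n))"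
      have E: "E > 0" using D by (simp add: E_def)
      have "ennreal (norm (LINT y|lborel. lp_kernel \<phi> k (x - y) * h y)) \<le> (\<integral>\<^sup>+y. ennreal (norm (lp_kernel \<phi> k (x - y) * h y)) \<partial>lborel)"
        by (cases "integrable lborel (\<lambda>y. lp_kernel \<phi> k (x - y) * h y)")
           (auto simp: integral_norm_bound_ennreal not_integrable_integral_eq)
      also have "\<dots> = (\<integral>\<^sup>+y. ennreal (norm (lp_kernel \<phi> k (x - y)) * norm (h y)) \<partial>lborel)"
        by (simp only: norm_mult)
      also have "\<dots> \<le> ennreal (E * A powr (1 - \<eta>)) * ?W"
      proof (rule peetre_split[OF a \<eta> hm _ hA])
        show "0 \<le> A" "0 \<le> E" using E by (auto simp: A_def)
        fix y
        show "0 \<le> norm (lp_kernel \<phi> k (x - y))" by simp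
        have "wt j x y \<le> wt (k + (j + 3 - k)) x y" using jk by (intro wt_mono) simp
        also have "\<dots> \<le> 2 ^ (j + 3 - k) * wt k x y" by (simp add: wt_def power_add distrib_left mult_ac)
        finally have "wt j x y / 2 ^ (j + 3 - k) \<le> wt k x y" by (simp add: divide_le_eq mult.commute)
        then have "wt k x y powr (- a) \<le> (wt j x y / 2 ^ (j + 3 - k)) powr (- a)"
          using a wt_pos[of j x y] by (intro powr_mono2') auto
        also have "\<dots> = 2 powr (real (j + 3 - k) * a) * wt j x y powr (- a)"
          using wt_pos[of j x y] by (simp add: powr_divide powr_minus powr_realpow[symmetric] powr_powr divide_simps)
        finally have "D * 2 ^ (k * DIM('a)) * wt k x y powr (- a) \<le> D * 2 ^ (k * DIM('a)) * (2 powr (real (j + 3 - k) * a) * wt j x y powr (- a))"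
          using D(1) by (intro mult_left_mono) auto
        also have "\<dots> = E * 2 ^ (j * DIM('a)) * wt j x y powr (- a)"
        proof -
          have "(2::real) ^ (k * DIM('a)) * 2 powr (real (j + 3 - k) * a) = 2 powr (real k * ?n + real (j + 3 - k) * a)"
            by (simp add: powr_add powr_realpow[symmetric])
          also have "real k * ?n + real (j + 3 - k) * a = 3 * a + (real j - real k) * (a - ?n) + real j * ?n"
            using jk by (simp add: of_nat_diff algebra_simps)
          also have "2 powr \<dots> = 2 powr (3 * a) * 2 powr ((real j - real k) * (a - ?n)) * 2 ^ (j * DIM('a))"
            by (simp add: powr_add powr_realpow[symmetric])
          finally have "(2::real) ^ (k * DIM('a)) * 2 powr (real (j + 3 - k) * a) = 2 powr (3 * a) * 2 powr ((real j - real k) * (a - ?n)) * 2 ^ (j * DIM('a))" .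
          then show ?thesis unfolding E_def by (metis (no_types, lifting) mult.assoc)
        qed
        finally show "norm (lp_kernel \<phi> k (x - y)) \<le> E * 2 ^ (j * DIM('a)) * wt j x y powr (- a)"
          using D(2)[of k x y] by linarith
      qed
      also have "\<dots> = ennreal (E * A powr (1 - \<eta>) * W)"
        unfolding W(1) using E by (intro ennreal_mult'[symmetric]) simp
      also have "E * A powr (1 - \<eta>) * W = C * 2 powr ((real j - real k) * (a - ?n)) * W powr (1 / \<eta>)"
      proof -
        have "A powr (1 - \<eta>) = (B * W) powr (1 / \<eta> - 1)"
          using \<eta> by (simp add: A_def powr_powr right_diff_distrib left_diff_distrib diff_divide_distrib)
        also have "\<dots> = B powr (1 / \<eta> - 1) * W powr (1 / \<eta> - 1)" using B(1) W(2) by (simp add: powr_mult)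
        finally have 1: "A powr (1 - \<eta>) = B powr (1 / \<eta> - 1) * W powr (1 / \<eta> - 1)" .
        have 2: "W powr (1 / \<eta>) = W powr (1 / \<eta> - 1) * W"
        proof (cases "W = 0")
          case False
          then show ?thesis using W(2) powr_add[of W "1 / \<eta> - 1" 1] by simp
        qed simp
        show ?thesis unfolding 1 2 E_def C_def by (simp only: mult_ac)
      qed
      also have "ennreal (C * 2 powr ((real j - real k) * (a - ?n)) * W powr (1 / \<eta>)) = ennreal (C * 2 powr ((real j - real k) * (a - ?n))) * epowr ?W (1 / \<eta>)"
        unfolding W(1) using W(2) C by (simp add: epowr_ennreal ennreal_mult')
      finally show ?thesis .
    qed
  qed
  with C show thesis by (rule that)
qed

subsection \<open>Convergence of the Littlewood-Paley expansion\<close>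

text \<open>By dilation the first moment has size 2^-J, and the polynomial factor only decreases
  under contraction. This is the rate of convergence of the truncations.\<close>

lemma low_kernel_moment:
  "(LINT y|lborel. norm (low_kernel \<phi> J y) * ((1 + 2 * norm y) ^ N * norm y))
     \<le> (1 / 2 ^ J) * (LINT y|lborel. norm (low_kernel \<phi> 0 y) * ((1 + 2 * norm y) ^ N * norm y))"
proof -
  note [measurable] = schwartz_measurable[OF low_kernel_schwartz]
  let ?g = "\<lambda>J y::'a. norm (low_kernel \<phi> J y) * ((1 + 2 * norm y) ^ N * norm y)"
  have int: "integrable lborel (?g J)" for J
  proof -
    have "integrable lborel (\<lambda>y. norm (low_kernel \<phi> J y) * norm (complex_of_real ((1 + 2 * norm y) ^ N * norm y)))"
    proof (rule rapid_integrable_weight(2)[OF schwartzD(1)[OF low_kernel_schwartz]])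
      fix y :: 'a
      have "(1 + 2 * norm y) ^ N * norm y \<le> (2 * (1 + norm y)) ^ N * (1 + norm y)"
        by (intro mult_mono power_mono) auto
      also have "\<dots> = 2 ^ N * (1 + norm y) ^ (N + 1)"
        unfolding power_mult_distrib power_add power_one_right by (simp only: mult_ac)
      finally show "norm (complex_of_real ((1 + 2 * norm y) ^ N * norm y)) \<le> 2 ^ N * (1 + norm y) ^ (N + 1)"
        unfolding norm_of_real by (simp only: abs_mult power_abs abs_of_nonneg add_nonneg_nonneg norm_ge_zero mult_nonneg_nonneg zero_le_one zero_le_numeral zero_le_power)
    qed measurable
    then show ?thesis unfolding norm_of_real by (simp add: abs_mult power_abs)
  qed
  let ?c = "1 / 2 ^ J :: real"
  have gm: "(\<lambda>y. complex_of_real (?g J y)) \<in> borel_measurable borel" by measurable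
  have "complex_of_real (LINT y|lborel. ?g J y) = (LINT y|lborel. complex_of_real (?g J y))"
    by (rule integral_complex_of_real[symmetric])
  also have "\<dots> = (\<bar>?c\<bar> ^ DIM('a)) *\<^sub>R (LINT y|lborel. complex_of_real (?g J (0 + ?c *\<^sub>R y)))"
    by (rule has_bochner_integral_lborel_affine(2)[OF gm]) simp
  also have "\<dots> = complex_of_real ((\<bar>?c\<bar> ^ DIM('a)) * (LINT y|lborel. ?g J (0 + ?c *\<^sub>R y)))"
    by (subst integral_complex_of_real) (simp only: scaleR_conv_of_real of_real_mult)
  finally have eq: "(LINT y|lborel. ?g J y) = (\<bar>?c\<bar> ^ DIM('a)) * (LINT y|lborel. ?g J (0 + ?c *\<^sub>R y))"
    by (simp only: of_real_eq_iff)
  have ic: "integrable lborel (\<lambda>y. ?g J (0 + ?c *\<^sub>R y))"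
  proof -
    have "integrable lborel (\<lambda>y. complex_of_real (?g J (0 + ?c *\<^sub>R y)))"
      using has_bochner_integral_lborel_affine(1)[OF gm, of ?c 0] int[of J] by (simp only: complex_of_real_integrable_eq) simp
    then show ?thesis by (simp only: complex_of_real_integrable_eq)
  qed
  have pt: "(\<bar>?c\<bar> ^ DIM('a)) * ?g J (0 + ?c *\<^sub>R y) \<le> ?c * ?g 0 y" for y
  proof -
    have k: "norm (low_kernel \<phi> J (0 + ?c *\<^sub>R y)) = 2 ^ (J * DIM('a)) * norm (low_kernel \<phi> 0 y)"
      unfolding low_kernel_scale[of J] by (simp add: norm_mult norm_power)
    have "\<bar>?c\<bar> ^ DIM('a) * 2 ^ (J * DIM('a)) = 1" by (simp add: power_mult power_divide)
    then have "(\<bar>?c\<bar> ^ DIM('a)) * ?g J (0 + ?c *\<^sub>R y) = norm (low_kernel \<phi> 0 y) * ((1 + 2 * norm (?c *\<^sub>R y)) ^ N * norm (?c *\<^sub>R y))"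
      unfolding k by (metis (no_types, lifting) add_0 mult.assoc mult_1)
    also have "\<dots> \<le> norm (low_kernel \<phi> 0 y) * ((1 + 2 * norm y) ^ N * (?c * norm y))"
      by (intro mult_left_mono mult_mono power_mono) (auto simp: divide_le_eq mult_le_cancel_left1)
    finally show ?thesis by (simp only: mult_ac)
  qed
  have "(LINT y|lborel. ?g J y) = (LINT y|lborel. (\<bar>?c\<bar> ^ DIM('a)) * ?g J (0 + ?c *\<^sub>R y))"
    unfolding eq by (rule integral_mult_right_zero[symmetric])
  also have "\<dots> \<le> (LINT y|lborel. ?c * ?g 0 y)"
    by (intro integral_mono integrable_mult_right ic int pt)
  finally show ?thesis by (simp only: integral_mult_right_zero)
qed

text \<open>The total mass of a kernel is its symbol at frequency 0.\<close>

lemma low_kernel_integral: "(LINT y|lborel. low_kernel \<phi> J y) = 1"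
proof -
  have "(LINT y|lborel. low_kernel \<phi> J y) = fourier (low_kernel \<phi> J) 0" by (simp add: fourier_def)
  also have "\<dots> = low_symbol \<phi> J 0"
    unfolding low_kernel_def by (rule fourier_inversion[OF low_symbol_schwartz])
  finally show ?thesis using low_symbol_eq_1[of 0 J] by simp
qed

text \<open>Testing the truncation against \<open>\<psi>\<close> means testing \<open>u\<close>
  against a mollified \<open>\<psi>\<close>, a superposition with the map \<open>uminus\<close>.
  With the constant map 0 one recovers \<open>\<psi>\<close> itself, as the kernel has mass 1; the
  difference is controlled by the weighted first moment.\<close>

lemma low_pass_tendsto:
  fixes \<psi> :: "'a \<Rightarrow> complex"
  assumes u: "tempered u" and \<psi>: "\<psi> \<in> schwartz"
  shows "(\<lambda>J. LINT x|lborel. \<psi> x * smear u (low_kernel \<phi> J) x) \<longlonglongrightarrow> u \<psi>"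
proof -
  note KS = low_kernel_schwartz
  note [measurable] = schwartz_measurable[OF KS] schwartz_measurable[OF \<psi>]
  define \<psi>' where "\<psi>' t = \<psi> (0 - t)" for t
  have \<psi>'S: "\<psi>' \<in> schwartz" unfolding \<psi>'_def[abs_def] by (rule schwartz_reflect[OF \<psi>])
  have adm: "admissible (low_kernel \<phi> J) uminus" "admissible (low_kernel \<phi> J) (\<lambda>_. 0)" for J
    using schwartzD(1)[OF KS] by (auto simp: admissible_def)
  have eq1: "(LINT x|lborel. \<psi> x * smear u (low_kernel \<phi> J) x) = u (superpos (low_kernel \<phi> J) uminus \<psi>')" for J
  proof -
    have "(LINT x|lborel. \<psi> x * smear u (low_kernel \<phi> J) x) = u (\<lambda>s. LINT x|lborel. \<psi> x * low_kernel \<phi> J (x - s))"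
      by (rule smear_exchange(1)[OF u KS schwartzD(1)[OF \<psi>] schwartz_measurable[OF \<psi>], symmetric])
    also have "(\<lambda>s. LINT x|lborel. \<psi> x * low_kernel \<phi> J (x - s)) = superpos (low_kernel \<phi> J) uminus \<psi>'"
    proof
      fix s
      have "(LINT x|lborel. \<psi> x * low_kernel \<phi> J (x - s)) = (LINT x|lborel. \<psi> (s + 1 *\<^sub>R x) * low_kernel \<phi> J ((s + 1 *\<^sub>R x) - s))"
        using has_bochner_integral_lborel_affine(2)[of "\<lambda>x. \<psi> x * low_kernel \<phi> J (x - s)" 1 s] by simp
      then show "(LINT x|lborel. \<psi> x * low_kernel \<phi> J (x - s)) = superpos (low_kernel \<phi> J) uminus \<psi>' s"
        by (simp add: superpos_def \<psi>'_def mult.commute add.commute)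
    qed
    finally show ?thesis .
  qed
  have eq2: "superpos (low_kernel \<phi> J) (\<lambda>_. 0) \<psi>' = \<psi>" for J
    by (rule ext) (simp add: superpos_def \<psi>'_def low_kernel_integral)
  obtain N C where C: "C > 0" "\<And>f. f \<in> schwartz \<Longrightarrow> norm (u f) \<le> C * schwartz_norm N f"
    using tempered_bound[OF u] by blast
  obtain B where B: "B > 0" "\<And>\<psi> F G. admissible \<psi> F \<Longrightarrow> admissible \<psi> G \<Longrightarrow>
     schwartz_norm N (\<lambda>s. superpos \<psi> F \<psi>' s - superpos \<psi> G \<psi>' s)
       \<le> B * (LINT y|lborel. norm (\<psi> y) * ((1 + 2 * norm y) ^ N * norm (F y - G y)))"
    using superpos_diff_bound[OF \<psi>'S, of N] by blast
  define I where "I = (LINT y|lborel. norm (low_kernel \<phi> 0 y) * ((1 + 2 * norm y) ^ N * norm y))"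
  have bd: "norm ((LINT x|lborel. \<psi> x * smear u (low_kernel \<phi> J) x) - u \<psi>) \<le> (C * B * I) * (1 / 2) ^ J" for J
  proof -
    note S = superpos_schwartz[OF adm(1) \<psi>'S, of J] superpos_schwartz[OF adm(2) \<psi>'S, of J]
    have "norm ((LINT x|lborel. \<psi> x * smear u (low_kernel \<phi> J) x) - u \<psi>)
       = norm (u (\<lambda>s. superpos (low_kernel \<phi> J) uminus \<psi>' s - superpos (low_kernel \<phi> J) (\<lambda>_. 0) \<psi>' s))"
      unfolding eq1 using temperedD(3)[OF u S] by (simp only: eq2)
    also have "\<dots> \<le> C * schwartz_norm N (\<lambda>s. superpos (low_kernel \<phi> J) uminus \<psi>' s - superpos (low_kernel \<phi> J) (\<lambda>_. 0) \<psi>' s)"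
      by (rule C(2)[OF schwartz_diff[OF S]])
    also have "\<dots> \<le> C * (B * (LINT y|lborel. norm (low_kernel \<phi> J y) * ((1 + 2 * norm y) ^ N * norm (- y - 0))))"
      using C(1) by (intro mult_left_mono B(2) adm) auto
    also have "\<dots> \<le> C * (B * ((1 / 2 ^ J) * I))"
      using C(1) B(1) low_kernel_moment[of J N] by (intro mult_left_mono) (auto simp: I_def)
    finally show ?thesis by (simp add: power_one_over mult_ac)
  qed
  have "(\<lambda>J. (C * B * I) * (1 / 2) ^ J) \<longlonglongrightarrow> 0"
    by (intro tendsto_mult_right_zero LIMSEQ_power_zero) simp
  then have "(\<lambda>J. (LINT x|lborel. \<psi> x * smear u (low_kernel \<phi> J) x) - u \<psi>) \<longlonglongrightarrow> 0"
    by (rule Lim_null_comparison[rotated]) (intro always_eventually allI bd)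
  then show ?thesis by (rule LIM_zero_cancel)
qed

subsection \<open>Pointwise bounds at the critical smoothness\<close>

definition low :: "nat \<Rightarrow> 'a distribution \<Rightarrow> 'a \<Rightarrow> complex" where
  "low J u = smear u (low_kernel \<phi> J)"

definition piece :: "nat \<Rightarrow> 'a distribution \<Rightarrow> 'a \<Rightarrow> complex" where
  "piece j u = smear u (lp_kernel \<phi> j)"

lemma low_measurable [measurable (raw)]: "tempered u \<Longrightarrow> low J u \<in> borel_measurable borel"
  unfolding low_def by (intro smear_measurable low_kernel_schwartz)

lemma piece_measurable [measurable (raw)]: "tempered u \<Longrightarrow> piece J u \<in> borel_measurable borel"
  unfolding piece_def by (intro smear_measurable lp_kernel_schwartz)

lemma low_growth: "tempered u \<Longrightarrow> poly_growth (low J u)"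
  unfolding low_def by (intro poly_growth_smear low_kernel_schwartz)

lemma piece_0: "piece 0 u = low 0 u"
  by (simp add: piece_def low_def lp_kernel_0)

lemma piece_Suc: "tempered u \<Longrightarrow> piece (Suc j) u x = low (Suc j) u x - low j u x"
  unfolding piece_def low_def lp_kernel_Suc smear_def
  by (intro temperedD(3) schwartz_reflect low_kernel_schwartz)

lemma low_eq_sum: "tempered u \<Longrightarrow> low J u x = (\<Sum>k\<le>J. piece k u x)"
  by (induction J) (simp_all add: piece_0 piece_Suc)

lemma multiplier_fun_piece: "tempered u \<Longrightarrow> multiplier_fun (lp_symbol \<phi> j) u = piece j u"
  unfolding piece_def lp_kernel_def by (rule multiplier_fun_eq[OF \<phi> _ lp_symbol_schwartz])

lemma piece_band:
  assumes u: "tempered u" shows "band j (piece j u)"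
proof -
  have "piece j u x = (LINT y|lborel. low_kernel \<phi> (j + 2) (x - y) * piece j u y)" for x
    using convolve_smear[OF u lp_symbol_schwartz low_symbol_schwartz lp_symbol_reproduce, where x=x]
    by (simp add: piece_def low_kernel_def lp_kernel_def)
  moreover have "poly_growth (piece j u)"
    unfolding piece_def by (intro poly_growth_smear u lp_kernel_schwartz)
  ultimately show ?thesis
    unfolding band_def poly_growth_def using piece_measurable[OF u] by blast
qed

definition coef :: "real \<Rightarrow> 'a distribution \<Rightarrow> nat \<Rightarrow> 'a \<Rightarrow> ennreal" where
  "coef s u j x = ennreal (2 powr (real j * s) * norm (piece j u x))"

text \<open>The p-th power of the norm at smoothness n/p, kept without the root so that estimates
  can be integrated and added.\<close>

definition energy :: "real \<Rightarrow> ennreal \<Rightarrow> 'a distribution \<Rightarrow> ennreal" where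
  "energy p q u = (\<integral>\<^sup>+x. epowr (lq_norm q (\<lambda>j. coef (real DIM('a) / p) u j x)) p \<partial>lborel)"

lemma coef_measurable [measurable (raw)]: "tempered u \<Longrightarrow> coef s u j \<in> borel_measurable borel"
  unfolding coef_def[abs_def] by measurable

lemma epowr_coef:
  "epowr (coef s u j x) r = ennreal (2 powr (real j * s * r)) * ennreal (norm (piece j u x) powr r)"
proof -
  have "epowr (coef s u j x) r = ennreal ((2 powr (real j * s) * norm (piece j u x)) powr r)"
    unfolding coef_def by (rule epowr_ennreal) simp
  also have "(2 powr (real j * s) * norm (piece j u x)) powr r = 2 powr (real j * s * r) * norm (piece j u x) powr r"
    by (simp add: powr_mult powr_powr)
  also have "ennreal \<dots> = ennreal (2 powr (real j * s * r)) * ennreal (norm (piece j u x) powr r)"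
    by (rule ennreal_mult') simp
  finally show ?thesis .
qed

lemma F_norm_energy:
  assumes "tempered u"
  shows "F_norm \<phi> (real DIM('a) / p) (\<lambda>t. 1) p q u = epowr (energy p q u) (1 / p)"
  unfolding F_norm_def Lp_norm_def energy_def coef_def multiplier_fun_piece[OF assms] by simp

text \<open>
  On the annulus \<open>norm (y - x) \<approx> 2^(-k)\<close>, of volume \<open>2^(-kn)\<close>, Peetre's inequality bounds \<open>piece k u x\<close> by a
  maximal function at \<open>y\<close>. The annuli are disjoint, so the sum over \<open>k\<close> costs one integral of its \<open>p\<close>-th power.
\<close>

lemma critical_pointwise_sum:
  assumes p: "0 < p" and q: "0 < q"
  obtains C where "C > 0" "\<And>u x. tempered u \<Longrightarrow> (\<Sum>k. ennreal (norm (piece k u x) powr p)) \<le> ennreal C * energy p q u"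
proof -
  let ?n = "real DIM('a)"
  \<comment> \<open>Here \<open>\<eta>\<close> only has to be at most 1 and below p, because the
    maximal inequality is applied to a single function.\<close>
  define \<eta> where "\<eta> = min 1 (p / 2)"
  have \<eta>: "0 < \<eta>" "\<eta> \<le> 1" "\<eta> < p" using p by (auto simp: \<eta>_def min_def)
  define P where "P = p / \<eta>"
  have P: "P > 1" "\<eta> * P = p" using \<eta> by (auto simp: P_def)
  define a where "a = 2 * ?n / \<eta>"
  have a: "a > 0" using \<eta> by (simp add: a_def)
  define b where "b = a * \<eta> - ?n"
  have b: "b > 0" using \<eta> by (simp add: b_def a_def)
  obtain B where B: "B > 0" "\<And>j h x z. band j h \<Longrightarrow> ennreal (norm (h z) powr \<eta>) \<le> ennreal (B * wt j x z powr (a * \<eta>)) *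
     avg b j (\<lambda>y. ennreal (norm (h y) powr \<eta>)) x"
    using band_peetre[OF a \<eta>(1,2)] unfolding b_def by blast
  obtain D where D: "D > 0" "\<And>F :: 'a \<Rightarrow> ennreal. F \<in> borel_measurable borel \<Longrightarrow>
     (\<integral>\<^sup>+x. epowr (maxavg b F x) P \<partial>lborel) \<le> ennreal D * (\<integral>\<^sup>+x. epowr (F x) P \<partial>lborel)"
    using maxavg_strong[OF b P(1), where 'a='a] by blast
  define K where "K = (B * 2 powr (a * \<eta>)) powr P"
  have K: "K > 0" using B by (simp add: K_def)
  define C where "C = 2 / unit_ball_vol DIM('a) * (K * D)"
  have C: "C > 0" using K D by (simp add: C_def)
  have "(\<Sum>k. ennreal (norm (piece k u x) powr p)) \<le> ennreal C * energy p q u" if u: "tempered u" for u x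
  proof -
    \<comment> \<open>One function above all rescaled pieces. The supremum over k lies below every
      l^q norm, so a scalar maximal inequality is enough.\<close>
    define G where "G y = (SUP k. coef (?n / p) u k y)" for y
    note [measurable] = coef_measurable[OF u]
    have Gm[measurable]: "G \<in> borel_measurable borel" unfolding G_def[abs_def] by measurable
    define V where "V y = ennreal K * epowr (maxavg b (\<lambda>y. epowr (G y) \<eta>) y) P" for y
    have Vm: "V \<in> borel_measurable borel" unfolding V_def[abs_def] by measurable
    have "(\<Sum>k. ennreal (norm (piece k u x) powr p)) \<le> ennreal (2 / unit_ball_vol DIM('a)) * (\<integral>\<^sup>+y. V y \<partial>lborel)"
    proof (rule dyadic_annuli_sum[OF Vm])
      fix k y assume y: "norm (y - x) \<le> 1 / 2 ^ k"
      let ?f = "piece k u"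
      have wt: "wt k y x \<le> 2" using y by (simp add: wt_def field_simps)
      have s: "ennreal (2 powr (real k * (?n / p) * \<eta>)) * ennreal (norm (?f z) powr \<eta>) = epowr (coef (?n / p) u k z) \<eta>" for z
        by (simp only: epowr_coef)
      have "ennreal (norm (?f x) powr \<eta>) \<le> ennreal (B * 2 powr (a * \<eta>)) * avg b k (\<lambda>y. ennreal (norm (?f y) powr \<eta>)) y"
      proof (rule order_trans[OF B(2)[OF piece_band[OF u], where z=x and x=y]], intro mult_right_mono ennreal_leI mult_left_mono powr_mono2)
        show "wt k y x \<le> 2" by (rule wt)
      qed (use a \<eta> B wt_pos[of k y x] in auto)
      then have "ennreal (2 powr (real k * (?n / p) * \<eta>)) * ennreal (norm (?f x) powr \<eta>)
          \<le> ennreal (2 powr (real k * (?n / p) * \<eta>)) * (ennreal (B * 2 powr (a * \<eta>)) * avg b k (\<lambda>y. ennreal (norm (?f y) powr \<eta>)) y)"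
        by (rule mult_left_mono) simp
      also have "\<dots> = ennreal (B * 2 powr (a * \<eta>)) * avg b k (\<lambda>y. ennreal (2 powr (real k * (?n / p) * \<eta>)) * ennreal (norm (?f y) powr \<eta>)) y"
        using piece_measurable[OF u] by (subst avg_cmult) (auto simp: mult.left_commute)
      also have "\<dots> \<le> ennreal (B * 2 powr (a * \<eta>)) * maxavg b (\<lambda>y. epowr (G y) \<eta>) y"
      proof (intro mult_left_mono)
        have "coef (?n / p) u k y \<le> G y" for y unfolding G_def by (rule SUP_upper) simp
        then have "avg b k (\<lambda>y. epowr (coef (?n / p) u k y) \<eta>) y \<le> avg b k (\<lambda>y. epowr (G y) \<eta>) y"
          using \<eta> by (intro avg_mono epowr_mono) auto
        also have "\<dots> \<le> maxavg b (\<lambda>y. epowr (G y) \<eta>) y" by (rule avg_le_maxavg)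
        finally show "avg b k (\<lambda>y. ennreal (2 powr (real k * (?n / p) * \<eta>)) * ennreal (norm (?f y) powr \<eta>)) y \<le> maxavg b (\<lambda>y. epowr (G y) \<eta>) y"
          unfolding s .
      qed simp
      finally have "epowr (epowr (coef (?n / p) u k x) \<eta>) P \<le> epowr (ennreal (B * 2 powr (a * \<eta>)) * maxavg b (\<lambda>y. epowr (G y) \<eta>) y) P"
        unfolding s using P by (intro epowr_mono) auto
      also have "\<dots> = V y" unfolding V_def K_def using B P by (intro epowr_cmult) auto
      also have "epowr (epowr (coef (?n / p) u k x) \<eta>) P = ennreal (2 ^ (k * DIM('a))) * ennreal (norm (?f x) powr p)"
      proof -
        \<comment> \<open>Critical smoothness: the p-th power of 2^(k n/p) is 2^(kn), the reciprocal
          of the volume scale of the annulus.\<close>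
        have "real k * (?n / p) * p = real (k * DIM('a))" using p by simp
        then have 1: "2 powr (real k * (?n / p) * p) = (2::real) ^ (k * DIM('a))"
          by (simp only: powr_realpow zero_less_numeral)
        have 2: "epowr (epowr (coef (?n / p) u k x) \<eta>) P = epowr (coef (?n / p) u k x) p"
          by (simp only: epowr_epowr P(2))
        show ?thesis unfolding 2 unfolding epowr_coef 1 ..
      qed
      finally show "ennreal (2 ^ (k * DIM('a))) * ennreal (norm (?f x) powr p) \<le> V y" .
    qed
    also have "(\<integral>\<^sup>+y. V y \<partial>lborel) = ennreal K * (\<integral>\<^sup>+y. epowr (maxavg b (\<lambda>y. epowr (G y) \<eta>) y) P \<partial>lborel)"
      unfolding V_def by (rule nn_integral_cmult) measurable
    also have "ennreal (2 / unit_ball_vol DIM('a)) * \<dots> \<le> ennreal (2 / unit_ball_vol DIM('a)) * (ennreal K * (ennreal D * energy p q u))"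
    proof (intro mult_left_mono)
      have "(\<integral>\<^sup>+y. epowr (maxavg b (\<lambda>y. epowr (G y) \<eta>) y) P \<partial>lborel)
          \<le> ennreal D * (\<integral>\<^sup>+y. epowr (epowr (G y) \<eta>) P \<partial>lborel)"
        by (rule D(2)) measurable
      also have "(\<integral>\<^sup>+y. epowr (epowr (G y) \<eta>) P \<partial>lborel) = (\<integral>\<^sup>+y. epowr (G y) p \<partial>lborel)"
        by (simp only: epowr_epowr P(2))
      also have "ennreal D * \<dots> \<le> ennreal D * energy p q u"
      proof (rule mult_left_mono)
        show "(\<integral>\<^sup>+y. epowr (G y) p \<partial>lborel) \<le> energy p q u"
          unfolding energy_def
        proof (rule nn_integral_mono)
          fix y
          have "G y \<le> lq_norm q (\<lambda>j. coef (?n / p) u j y)"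
            unfolding G_def by (rule SUP_least) (rule le_lq_norm[OF q])
          then show "epowr (G y) p \<le> epowr (lq_norm q (\<lambda>j. coef (?n / p) u j y)) p"
            using p by (intro epowr_mono) auto
        qed
      qed simp
      finally show "(\<integral>\<^sup>+y. epowr (maxavg b (\<lambda>y. epowr (G y) \<eta>) y) P \<partial>lborel) \<le> ennreal D * energy p q u" .
    qed auto
    also have "\<dots> = ennreal C * energy p q u"
    proof -
      have "ennreal C = ennreal (2 / unit_ball_vol DIM('a)) * (ennreal K * ennreal D)"
        unfolding C_def using K by (subst ennreal_mult') (auto simp: ennreal_mult')
      then show ?thesis by (simp only: mult.assoc)
    qed
    finally show ?thesis .
  qed
  with C show thesis by (rule that)
qed

text \<open>The pointwise l^p bound on the pieces, read for a single index and, through the power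
  mean inequality, for the first J + 1 indices. \<open>N\<close> stands for the norm of
  \<open>u\<close>.\<close>

lemma critical_bounds:
  assumes p: "0 < p" and q: "0 < q"
  obtains C where "C > 0"
    "\<And>u x j N. tempered u \<Longrightarrow> N \<ge> 0 \<Longrightarrow> energy p q u = ennreal (N powr p) \<Longrightarrow> norm (piece j u x) \<le> C * N"
    "\<And>u x J N. tempered u \<Longrightarrow> N \<ge> 0 \<Longrightarrow> energy p q u = ennreal (N powr p) \<Longrightarrow>
        norm (low J u x) \<le> C * (1 + real J) powr (1 - 1 / max 1 p) * N"
proof -
  obtain C where C: "C > 0" "\<And>u x. tempered u \<Longrightarrow> (\<Sum>k. ennreal (norm (piece k u x) powr p)) \<le> ennreal C * energy p q u"
    using critical_pointwise_sum[OF p q] by blast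
  define D where "D = 2 * C powr (1 / p)"
  have D: "D > 0" using C by (simp add: D_def)
  have fin: "(\<Sum>k\<in>A. norm (piece k u x) powr p) \<le> C * N powr p"
    if u: "tempered u" "N \<ge> 0" "energy p q u = ennreal (N powr p)" "finite A" for u x N A
  proof -
    have "ennreal (\<Sum>k\<in>A. norm (piece k u x) powr p) = (\<Sum>k\<in>A. ennreal (norm (piece k u x) powr p))"
      by (intro sum_ennreal[symmetric]) simp
    also have "\<dots> \<le> (\<Sum>k. ennreal (norm (piece k u x) powr p))"
      using u(4) by (intro sum_le_suminf) auto
    also have "\<dots> \<le> ennreal C * energy p q u" by (rule C(2)[OF u(1)])
    also have "\<dots> = ennreal (C * N powr p)" unfolding u(3) using C by (intro ennreal_mult'[symmetric]) simp
    finally show ?thesis using C by (subst (asm) ennreal_le_iff) auto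
  qed
  have root: "(C * N powr p) powr (1 / p) = C powr (1 / p) * N" if "N \<ge> 0" for N
    using C p that by (simp add: powr_mult powr_powr)
  have "norm (piece j u x) \<le> D * N" if u: "tempered u" "N \<ge> 0" "energy p q u = ennreal (N powr p)" for u x j N
  proof -
    have "norm (piece j u x) = (norm (piece j u x) powr p) powr (1 / p)" using p by (simp add: powr_powr)
    also have "\<dots> \<le> (C * N powr p) powr (1 / p)"
      using fin[OF u, of "{j}" x] p by (intro powr_mono2) auto
    also have "\<dots> = C powr (1 / p) * N" by (rule root[OF u(2)])
    also have "\<dots> \<le> D * N" unfolding D_def using u(2) by (intro mult_right_mono) auto
    finally show ?thesis .
  qed
  moreover have "norm (low J u x) \<le> D * (1 + real J) powr (1 - 1 / max 1 p) * N"
    if u: "tempered u" "N \<ge> 0" "energy p q u = ennreal (N powr p)" for u x J N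
  proof -
    have "norm (low J u x) \<le> (\<Sum>k\<le>J. norm (piece k u x))"
      unfolding low_eq_sum[OF u(1)] by (rule norm_sum)
    also have "\<dots> \<le> 2 * (1 + real J) powr (1 - 1 / max 1 p) * (C * N powr p) powr (1 / p)"
      using fin[OF u, of "{..J}" x] by (intro sum_le_power_mean p) auto
    finally show ?thesis unfolding root[OF u(2)] D_def by (simp add: mult_ac)
  qed
  ultimately show thesis using D by (rule that[rotated])
qed

subsection \<open>The pointwise product\<close>

text \<open>A single term lies below the l^q norm, and at smoothness n/p its p-th power carries the
  factor 2^(jn).\<close>

lemma piece_power_integral:
  assumes u: "tempered u" and p: "0 < p" and q: "0 < q"
  shows "(\<integral>\<^sup>+x. ennreal (norm (piece j u x) powr p) \<partial>lborel) \<le> ennreal ((1 / 2 ^ DIM('a)) ^ j) * energy p q u"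
proof -
  note pm[measurable] = piece_measurable[OF u]
  have "ennreal (2 ^ (j * DIM('a))) * (\<integral>\<^sup>+x. ennreal (norm (piece j u x) powr p) \<partial>lborel)
     = (\<integral>\<^sup>+x. ennreal (2 ^ (j * DIM('a))) * ennreal (norm (piece j u x) powr p) \<partial>lborel)"
    by (rule nn_integral_cmult[symmetric]) measurable
  also have "\<dots> \<le> energy p q u"
    unfolding energy_def
  proof (rule nn_integral_mono)
    fix x
    have "real j * (real DIM('a) / p) * p = real (j * DIM('a))" using p by simp
    then have "2 powr (real j * (real DIM('a) / p) * p) = (2::real) ^ (j * DIM('a))" by (simp only: powr_realpow zero_less_numeral)
    then have "ennreal (2 ^ (j * DIM('a))) * ennreal (norm (piece j u x) powr p) = epowr (coef (real DIM('a) / p) u j x) p"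
      unfolding epowr_coef by (simp only:)
    also have "\<dots> \<le> epowr (lq_norm q (\<lambda>j. coef (real DIM('a) / p) u j x)) p"
      using p by (intro epowr_mono le_lq_norm q) auto
    finally show "ennreal (2 ^ (j * DIM('a))) * ennreal (norm (piece j u x) powr p) \<le> epowr (lq_norm q (\<lambda>j. coef (real DIM('a) / p) u j x)) p" .
  qed
  finally have "ennreal ((1 / 2 ^ DIM('a)) ^ j) * (ennreal (2 ^ (j * DIM('a))) * (\<integral>\<^sup>+x. ennreal (norm (piece j u x) powr p) \<partial>lborel))
      \<le> ennreal ((1 / 2 ^ DIM('a)) ^ j) * energy p q u"
    by (rule mult_left_mono) simp
  moreover have "ennreal ((1 / 2 ^ DIM('a)) ^ j) * ennreal (2 ^ (j * DIM('a))) = 1"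
  proof -
    have "(1 / 2 ^ DIM('a)) ^ j * (2::real) ^ (j * DIM('a)) = 1"
      by (simp add: power_one_over power_mult[symmetric] mult.commute)
    moreover have "ennreal ((1 / 2 ^ DIM('a)) ^ j) * ennreal (2 ^ (j * DIM('a))) = ennreal ((1 / 2 ^ DIM('a)) ^ j * 2 ^ (j * DIM('a)))"
      by (rule ennreal_mult'[symmetric]) simp
    ultimately show ?thesis by simp
  qed
  ultimately show ?thesis by (simp only: mult.assoc[symmetric] mult_1)
qed

definition abs_sum :: "'a distribution \<Rightarrow> 'a \<Rightarrow> ennreal" where
  "abs_sum u x = (\<Sum>j. ennreal (norm (piece j u x)))"

lemma abs_sum_measurable [measurable (raw)]: "tempered u \<Longrightarrow> abs_sum u \<in> borel_measurable borel"
  unfolding abs_sum_def[abs_def] using piece_measurable[of u] by measurable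

text \<open>
  The pieces are bounded and decay geometrically in \<open>L\<^sup>p\<close>, so any exponent above \<open>p\<close> would do; one that is at
  least 2 makes products of two such functions locally integrable.
\<close>

lemma abs_sum_integral:
  assumes u: "tempered u" and p: "0 < p" and q: "0 < q" and fin: "energy p q u = ennreal (N powr p)" and N: "N \<ge> 0"
  shows "(\<integral>\<^sup>+x. epowr (abs_sum u x) (2 + p) \<partial>lborel) < \<top>"
proof -
  note pm[measurable] = piece_measurable[OF u]
  let ?P = "2 + p"
  let ?n = "real DIM('a)"
  \<comment> \<open>Half of the available decay: 2^(j e (2+p)) = 2^(jn/2), to be set against the
    2^(-jn) of \<open>piece_power_integral\<close>.\<close>
  define e where "e = ?n / (2 * ?P)"
  have e: "e > 0" using p by (simp add: e_def)
  define \<theta> :: real where "\<theta> = 2 powr (- e)"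
  have \<theta>: "0 < \<theta>" "\<theta> < 1" using e by (auto simp: \<theta>_def powr_less_one)
  obtain C where C: "C > 0" "\<And>j x. norm (piece j u x) \<le> C * N"
    using critical_bounds[OF p q] u N fin by metis
  define A where "A = 1 / (1 - \<theta>)"
  have A: "A > 0" using \<theta> by (simp add: A_def)
  have pt: "epowr (abs_sum u x) ?P \<le> (\<Sum>j. ennreal (A powr ?P * (C * N)\<^sup>2 * (2 powr (?n / 2)) ^ j) * ennreal (norm (piece j u x) powr p))" for x
  proof -
    let ?g = "\<lambda>j. ennreal (2 powr (real j * e) * norm (piece j u x))"
    have "abs_sum u x = (\<Sum>j. ennreal (\<theta> ^ j) * ?g j)"
      unfolding abs_sum_def
    proof (intro arg_cong[where f=suminf] ext)
      fix j
      have "\<theta> ^ j * 2 powr (real j * e) = 1"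
        by (simp add: \<theta>_def powr_power powr_add[symmetric])
      then have *: "norm (piece j u x) = \<theta> ^ j * (2 powr (real j * e) * norm (piece j u x))"
        by (simp only: mult.assoc[symmetric] mult_1)
      have "ennreal (norm (piece j u x)) = ennreal (\<theta> ^ j * (2 powr (real j * e) * norm (piece j u x)))"
        by (rule arg_cong[OF *])
      also have "\<dots> = ennreal (\<theta> ^ j) * ?g j" using \<theta> by (intro ennreal_mult) auto
      finally show "ennreal (norm (piece j u x)) = ennreal (\<theta> ^ j) * ?g j" .
    qed
    also have "\<dots> \<le> (\<Sum>j. ennreal (\<theta> ^ j)) * (SUP j. ?g j)" by (rule suminf_le_mult_SUP)
    also have "(\<Sum>j. ennreal (\<theta> ^ j)) = ennreal A"
      unfolding A_def using \<theta> by (intro suminf_geometric_ennreal) auto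
    finally have "epowr (abs_sum u x) ?P \<le> epowr (ennreal A * (SUP j. ?g j)) ?P"
      using p by (intro epowr_mono) auto
    also have "\<dots> = ennreal (A powr ?P) * (SUP j. epowr (?g j) ?P)"
      using A p by (subst epowr_cmult) (auto simp: epowr_SUP)
    also have "\<dots> \<le> ennreal (A powr ?P) * (\<Sum>j. epowr (?g j) ?P)"
    proof (intro mult_left_mono SUP_least)
      show "epowr (?g j) ?P \<le> (\<Sum>j. epowr (?g j) ?P)" for j
        using sum_le_suminf[of "\<lambda>j. epowr (?g j) ?P" "{j}"] by simp
    qed simp
    also have "\<dots> = (\<Sum>j. ennreal (A powr ?P) * epowr (?g j) ?P)" by simp
    also have "\<dots> \<le> (\<Sum>j. ennreal (A powr ?P * (C * N)\<^sup>2 * (2 powr (?n / 2)) ^ j) * ennreal (norm (piece j u x) powr p))"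
    proof (intro suminf_le summableI)
      fix j
      let ?f = "norm (piece j u x)"
      have "epowr (?g j) ?P = ennreal ((2 powr (real j * e) * ?f) powr ?P)" by (rule epowr_ennreal) simp
      also have "(2 powr (real j * e) * ?f) powr ?P = (2 powr (?n / 2)) ^ j * (?f powr 2 * ?f powr p)"
      proof -
        have "real j * e * ?P = real j * (?n / 2)" using p by (simp add: e_def field_simps)
        moreover have "(2 powr (real j * e) * ?f) powr ?P = 2 powr (real j * e * ?P) * ?f powr ?P"
          by (simp add: powr_mult powr_powr)
        ultimately have "(2 powr (real j * e) * ?f) powr ?P = 2 powr (real j * (?n / 2)) * ?f powr ?P" by (simp only:)
        then show ?thesis by (simp add: powr_add powr_power mult_ac)
      qed
      \<comment> \<open>Two of the 2 + p powers are spent on the uniform bound; the remaining p are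
        what the energy controls.\<close>
      also have "\<dots> \<le> (2 powr (?n / 2)) ^ j * ((C * N)\<^sup>2 * ?f powr p)"
      proof (intro mult_left_mono mult_right_mono)
        have "?f powr 2 \<le> (C * N) powr 2" using C(2)[of j x] by (intro powr_mono2) auto
        then show "?f powr 2 \<le> (C * N)\<^sup>2" using C(1) N by (simp add: powr_numeral)
      qed auto
      finally have "epowr (?g j) ?P \<le> ennreal ((2 powr (?n / 2)) ^ j * ((C * N)\<^sup>2 * ?f powr p))" by (simp add: ennreal_leI)
      then have "ennreal (A powr ?P) * epowr (?g j) ?P \<le> ennreal (A powr ?P) * ennreal ((2 powr (?n / 2)) ^ j * ((C * N)\<^sup>2 * ?f powr p))"
        by (rule mult_left_mono) simp
      also have "\<dots> = ennreal (A powr ?P * ((2 powr (?n / 2)) ^ j * ((C * N)\<^sup>2 * ?f powr p)))"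
        by (rule ennreal_mult'[symmetric]) simp
      also have "A powr ?P * ((2 powr (?n / 2)) ^ j * ((C * N)\<^sup>2 * ?f powr p)) = A powr ?P * (C * N)\<^sup>2 * (2 powr (?n / 2)) ^ j * ?f powr p"
        by (simp only: mult_ac)
      also have "ennreal \<dots> = ennreal (A powr ?P * (C * N)\<^sup>2 * (2 powr (?n / 2)) ^ j) * ennreal (?f powr p)"
        by (rule ennreal_mult') simp
      finally show "ennreal (A powr ?P) * epowr (?g j) ?P \<le> ennreal (A powr ?P * (C * N)\<^sup>2 * (2 powr (?n / 2)) ^ j) * ennreal (?f powr p)" .
    qed
    finally show ?thesis .
  qed
  define z :: real where "z = 2 powr (- (?n / 2))"
  have z: "0 < z" "z < 1" by (auto simp: z_def powr_less_one)
  have zz: "(2 powr (?n / 2)) ^ j * (1 / 2 ^ DIM('a)) ^ j = z ^ j" for j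
  proof -
    have "2 powr (?n / 2) * (1 / 2 ^ DIM('a)) = z"
    proof -
      have "2 powr (?n / 2) * 2 powr (?n / 2) = (2::real) ^ DIM('a)"
        by (simp add: powr_add[symmetric] powr_realpow)
      then show ?thesis unfolding z_def powr_minus by (simp add: divide_simps)
    qed
    then show ?thesis by (simp only: power_mult_distrib[symmetric])
  qed
  define B where "B = A powr ?P * (C * N)\<^sup>2"
  have B: "B \<ge> 0" by (simp add: B_def)
  have "(\<integral>\<^sup>+x. epowr (abs_sum u x) ?P \<partial>lborel) \<le> (\<integral>\<^sup>+x. (\<Sum>j. ennreal (B * (2 powr (?n / 2)) ^ j) * ennreal (norm (piece j u x) powr p)) \<partial>lborel)"
    unfolding B_def by (rule nn_integral_mono) (rule pt)
  also have "\<dots> = (\<Sum>j. \<integral>\<^sup>+x. ennreal (B * (2 powr (?n / 2)) ^ j) * ennreal (norm (piece j u x) powr p) \<partial>lborel)"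
    by (rule nn_integral_suminf) measurable
  also have "\<dots> \<le> (\<Sum>j. ennreal (B * N powr p) * ennreal (z ^ j))"
  proof (intro suminf_le summableI)
    fix j
    have "(\<integral>\<^sup>+x. ennreal (B * (2 powr (?n / 2)) ^ j) * ennreal (norm (piece j u x) powr p) \<partial>lborel)
       = ennreal (B * (2 powr (?n / 2)) ^ j) * (\<integral>\<^sup>+x. ennreal (norm (piece j u x) powr p) \<partial>lborel)"
      by (rule nn_integral_cmult) measurable
    also have "\<dots> \<le> ennreal (B * (2 powr (?n / 2)) ^ j) * (ennreal ((1 / 2 ^ DIM('a)) ^ j) * ennreal (N powr p))"
      using piece_power_integral[OF u p q, of j] unfolding fin by (intro mult_left_mono) auto
    also have "\<dots> = ennreal (B * (2 powr (?n / 2)) ^ j * ((1 / 2 ^ DIM('a)) ^ j * N powr p))"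
      using B by (simp only: ennreal_mult'[symmetric] zero_le_power mult_nonneg_nonneg powr_ge_zero zero_le_divide_1_iff zero_le_numeral)
    also have "B * (2 powr (?n / 2)) ^ j * ((1 / 2 ^ DIM('a)) ^ j * N powr p) = B * N powr p * z ^ j"
      unfolding zz[symmetric] by (simp only: mult_ac)
    also have "ennreal \<dots> = ennreal (B * N powr p) * ennreal (z ^ j)" using B by (intro ennreal_mult') simp
    finally show "(\<integral>\<^sup>+x. ennreal (B * (2 powr (?n / 2)) ^ j) * ennreal (norm (piece j u x) powr p) \<partial>lborel) \<le> ennreal (B * N powr p) * ennreal (z ^ j)" .
  qed
  also have "\<dots> = ennreal (B * N powr p) * (\<Sum>j. ennreal (z ^ j))" by (rule ennreal_suminf_cmult)
  also have "(\<Sum>j. ennreal (z ^ j)) = ennreal (1 / (1 - z))"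
    using z by (intro suminf_geometric_ennreal) auto
  also have "ennreal (B * N powr p) * ennreal (1 / (1 - z)) < \<top>" by (simp add: ennreal_mult_less_top)
  finally show ?thesis .
qed

section \<open>The function represented by a distribution of finite energy\<close>

definition limit_fun :: "'a distribution \<Rightarrow> 'a \<Rightarrow> complex" where
  "limit_fun u x = lim (\<lambda>J. low J u x)"

text \<open>\<open>enn2real\<close> sends \<infinity> to 0. This is harmless, because for finite
  energy \<open>abs_sum\<close> is finite almost everywhere.\<close>

definition majorant :: "'a distribution \<Rightarrow> 'a \<Rightarrow> real" where
  "majorant u x = enn2real (abs_sum u x)"

lemma limit_fun_measurable: "tempered u \<Longrightarrow> limit_fun u \<in> borel_measurable borel"
  unfolding limit_fun_def[abs_def] by (intro borel_measurable_lim_metric low_measurable)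

lemma majorant_facts:
  assumes u: "tempered u" and p: "0 < p" and q: "0 < q" and fin: "energy p q u = ennreal (N powr p)" and N: "N \<ge> 0"
  shows "integrable lborel (\<lambda>x. majorant u x powr (2 + p))"
    and "AE x in lborel. (\<lambda>J. low J u x) \<longlonglongrightarrow> limit_fun u x"
    and "AE x in lborel. \<forall>J. norm (low J u x) \<le> majorant u x"
proof -
  note am[measurable] = abs_sum_measurable[OF u]
  note bd = abs_sum_integral[OF u p q fin N]
  show "integrable lborel (\<lambda>x. majorant u x powr (2 + p))"
  proof (rule integrableI_nonneg)
    have "(\<integral>\<^sup>+x. ennreal (majorant u x powr (2 + p)) \<partial>lborel) \<le> (\<integral>\<^sup>+x. epowr (abs_sum u x) (2 + p) \<partial>lborel)"
      by (intro nn_integral_mono) (auto simp: majorant_def epowr_def)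
    with bd show "(\<integral>\<^sup>+x. ennreal (majorant u x powr (2 + p)) \<partial>lborel) < \<infinity>" by (simp add: le_less_trans)
  qed (auto simp: majorant_def[abs_def])
  have "AE x in lborel. epowr (abs_sum u x) (2 + p) \<noteq> \<infinity>"
    using bd by (intro nn_integral_PInf_AE) auto
  then have ae: "AE x in lborel. abs_sum u x < \<top>"
    by eventually_elim (metis epowr_less_top_iff infinity_ennreal_def less_top)
  from ae show "AE x in lborel. (\<lambda>J. low J u x) \<longlonglongrightarrow> limit_fun u x"
  proof eventually_elim
    case (elim x)
    then have "summable (\<lambda>k. norm (piece k u x))"
      unfolding abs_sum_def by (intro summable_suminf_not_top) auto
    then have "summable (\<lambda>k. piece k u x)" by (rule summable_norm_cancel)
    then have "(\<lambda>J. \<Sum>k\<le>J. piece k u x) \<longlonglongrightarrow> (\<Sum>k. piece k u x)" by (rule summable_LIMSEQ')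
    then have "(\<lambda>J. low J u x) \<longlonglongrightarrow> (\<Sum>k. piece k u x)" by (simp add: low_eq_sum[OF u])
    then show ?case unfolding limit_fun_def by (simp add: limI)
  qed
  from ae show "AE x in lborel. \<forall>J. norm (low J u x) \<le> majorant u x"
  proof eventually_elim
    case (elim x)
    show ?case
    proof
      fix J
      have "norm (low J u x) \<le> (\<Sum>k\<le>J. norm (piece k u x))"
        unfolding low_eq_sum[OF u] by (rule norm_sum)
      then have "ennreal (norm (low J u x)) \<le> (\<Sum>k\<le>J. ennreal (norm (piece k u x)))"
        by (subst sum_ennreal) (auto intro: ennreal_leI)
      also have "\<dots> \<le> abs_sum u x" unfolding abs_sum_def by (intro sum_le_suminf) auto
      also have "\<dots> = ennreal (majorant u x)" using elim by (simp add: majorant_def)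
      finally show "norm (low J u x) \<le> majorant u x"
        by (subst (asm) ennreal_le_iff) (auto simp: majorant_def)
    qed
  qed
qed

text \<open>The pairings of the truncations with a Schwartz function converge to the distribution by
  \<open>low_pass_tendsto\<close> and to the integral of the pointwise limit by dominated
  convergence.\<close>

lemma is_function_limit_fun:
  assumes u: "tempered u" and p: "0 < p" and q: "0 < q" and fin: "energy p q u = ennreal (N powr p)" and N: "N \<ge> 0"
  shows "is_function u (limit_fun u)"
proof -
  note M = majorant_facts[OF u p q fin N]
  note lm[measurable] = limit_fun_measurable[OF u] low_measurable[OF u]
  have *: "integrable lborel (\<lambda>x. limit_fun u x * \<psi> x) \<and> u \<psi> = (LINT x|lborel. limit_fun u x * \<psi> x)" if \<psi>: "\<psi> \<in> schwartz" for \<psi>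
  proof -
    note \<psi>m[measurable] = schwartz_measurable[OF \<psi>]
    obtain D where D: "D > 0" "\<And>x. norm (\<psi> x) \<le> D" using rapidE[OF schwartzD(1)[OF \<psi>], of 0] by auto
    let ?w = "\<lambda>x. norm (\<psi> x) + D * majorant u x powr (2 + p)"
    have wi: "integrable lborel ?w"
      using schwartz_integrable[OF \<psi>] M(1) by (intro Bochner_Integration.integrable_add integrable_norm integrable_mult_right)
    have bnd: "AE x in lborel. norm (\<psi> x * low J u x) \<le> ?w x" for J
      using M(3)
    proof eventually_elim
      case (elim x)
      then have "norm (low J u x) \<le> majorant u x" by blast
      also have "\<dots> \<le> 1 + majorant u x powr (2 + p)" using p by (intro le_one_plus_powr) (auto simp: majorant_def)
      finally have "norm (\<psi> x) * norm (low J u x) \<le> norm (\<psi> x) * (1 + majorant u x powr (2 + p))"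
        by (intro mult_left_mono) auto
      also have "\<dots> \<le> ?w x" using mult_right_mono[OF D(2)[of x], of "majorant u x powr (2 + p)"] by (simp add: distrib_left)
      finally show ?case by (simp add: norm_mult)
    qed
    have lim: "AE x in lborel. (\<lambda>J. \<psi> x * low J u x) \<longlonglongrightarrow> \<psi> x * limit_fun u x"
      using M(2) by eventually_elim (intro tendsto_mult tendsto_const)
    have ms: "(\<lambda>x. \<psi> x * limit_fun u x) \<in> borel_measurable lborel" "(\<lambda>x. \<psi> x * low J u x) \<in> borel_measurable lborel" for J
      by measurable
    have "(\<lambda>J. LINT x|lborel. \<psi> x * low J u x) \<longlonglongrightarrow> (LINT x|lborel. \<psi> x * limit_fun u x)"
      by (rule integral_dominated_convergence[OF ms wi lim bnd])
    moreover have "integrable lborel (\<lambda>x. \<psi> x * limit_fun u x)"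
      by (rule integrable_dominated_convergence[OF ms wi lim bnd])
    moreover have "(\<lambda>J. LINT x|lborel. \<psi> x * low J u x) \<longlonglongrightarrow> u \<psi>"
      using low_pass_tendsto[OF u \<psi>] by (simp add: low_def)
    ultimately show ?thesis using LIMSEQ_unique by (auto simp: mult.commute)
  qed
  then show ?thesis unfolding is_function_def using u lm(1) by blast
qed

section \<open>Telescoping pieces of the product and their spectral localisation\<close>

text \<open>
  Telescoping differences instead of a paraproduct decomposition: one family of pieces, all with low-frequency
  spectrum, suffices because positive smoothness lets the sum over \<open>j \<ge> k - 3\<close> converge.
\<close>

definition prod_piece :: "'a distribution \<Rightarrow> 'a distribution \<Rightarrow> nat \<Rightarrow> 'a \<Rightarrow> complex" where
  "prod_piece u v j x = (case j of 0 \<Rightarrow> low 0 u x * low 0 v x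
     | Suc i \<Rightarrow> low (Suc i) u x * low (Suc i) v x - low i u x * low i v x)"

lemma prod_piece_0: "prod_piece u v 0 = (\<lambda>x. low 0 u x * low 0 v x)"
  and prod_piece_Suc: "prod_piece u v (Suc i) = (\<lambda>x. low (Suc i) u x * low (Suc i) v x - low i u x * low i v x)"
  by (simp_all add: prod_piece_def fun_eq_iff)

lemma sum_prod_piece: "(\<Sum>j\<le>J. prod_piece u v j x) = low J u x * low J v x"
  by (induction J) (simp_all add: prod_piece_0 prod_piece_Suc)

lemma low_product_growth:
  assumes "tempered u" "tempered v"
  shows "poly_growth (\<lambda>x. low J u x * low J v x)"
  by (intro poly_growth_mult low_growth assms)

lemma prod_piece_growth:
  assumes "tempered u" "tempered v"
  shows "poly_growth (prod_piece u v j)"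
  by (cases j) (simp_all add: prod_piece_0 prod_piece_Suc low_product_growth[OF assms] poly_growth_diff)

lemma prod_piece_measurable:
  assumes "tempered u" "tempered v"
  shows "prod_piece u v j \<in> borel_measurable borel"
  by (cases j) (simp_all add: prod_piece_0 prod_piece_Suc low_measurable[OF assms(1)] low_measurable[OF assms(2)]
      borel_measurable_times borel_measurable_diff)

lemma convolve_low_product:
  assumes u: "tempered u" and v: "tempered v" and K: "K \<in> schwartz"
  shows "integrable lborel (\<lambda>y. K (x - y) * (low J u y * low J v y))"
    "integrable lborel (\<lambda>y. K (x - y) * prod_piece u v j y)"
  using rapid_mult_poly_growth_integrable[OF schwartz_reflect[OF K] low_product_growth[OF u v]]
    rapid_mult_poly_growth_integrable[OF schwartz_reflect[OF K] prod_piece_growth[OF u v] prod_piece_measurable[OF u v]]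
    low_measurable[OF u] low_measurable[OF v] borel_measurable_times
  by blast+

text \<open>l = 1 expresses reproduction and l = 0 vanishing. The hypothesis ranges over all levels
  up to j since a telescoping difference involves two of them.\<close>

lemma convolve_prod_piece:
  assumes u: "tempered u" and v: "tempered v" and c: "c \<in> schwartz"
    and l: "\<And>i \<xi> \<eta>. i \<le> j \<Longrightarrow> c (\<xi> + \<eta>) * (low_symbol \<phi> i \<xi> * low_symbol \<phi> i \<eta>) = l * (low_symbol \<phi> i \<xi> * low_symbol \<phi> i \<eta>)"
  shows "(LINT y|lborel. inv_fourier c (x - y) * prod_piece u v j y) = l * prod_piece u v j x"
proof -
  have low: "(LINT y|lborel. inv_fourier c (x - y) * (low i u y * low i v y)) = l * (low i u x * low i v x)" if "i \<le> j" for i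
    unfolding low_def low_kernel_def
    by (rule convolve_smear_product(1)[OF u v low_symbol_schwartz low_symbol_schwartz c l[OF that]])
  show ?thesis
  proof (cases j)
    case 0
    then show ?thesis using low[of 0] by (simp add: prod_piece_0)
  next
    case (Suc i)
    have "(LINT y|lborel. inv_fourier c (x - y) * prod_piece u v j y)
       = (LINT y|lborel. inv_fourier c (x - y) * (low (Suc i) u y * low (Suc i) v y))
        - (LINT y|lborel. inv_fourier c (x - y) * (low i u y * low i v y))"
      unfolding Suc prod_piece_Suc right_diff_distrib
      by (intro Bochner_Integration.integral_diff convolve_low_product(1) u v inv_fourier_schwartz c)
    then show ?thesis using low[of "Suc i"] low[of i] Suc by (simp add: prod_piece_Suc right_diff_distrib)
  qed
qed

lemma prod_piece_band:
  assumes u: "tempered u" and v: "tempered v"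
  shows "band j (prod_piece u v j)"
proof -
  have "prod_piece u v j x = (LINT y|lborel. low_kernel \<phi> (j + 2) (x - y) * prod_piece u v j y)" for x
    unfolding low_kernel_def
    using convolve_prod_piece[OF u v low_symbol_schwartz low_symbol_reproduce, of j j x] by simp
  then show ?thesis
    unfolding band_def using prod_piece_growth[OF u v] prod_piece_measurable[OF u v] unfolding poly_growth_def by blast
qed

lemma prod_piece_vanish:
  assumes u: "tempered u" and v: "tempered v" and jk: "j + 3 \<le> k"
  shows "(LINT y|lborel. lp_kernel \<phi> k (x - y) * prod_piece u v j y) = 0"
  unfolding lp_kernel_def
  using convolve_prod_piece[OF u v lp_symbol_schwartz, of j k 0 x] lp_symbol_product_vanish jk by simp

text \<open>The discrete Leibniz rule: each term consists of one piece and one truncation, and only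
  the truncation carries the growth in j.\<close>

lemma prod_piece_bound:
  assumes u: "tempered u" and v: "tempered v"
    and lu: "\<And>J. norm (low J u x) \<le> C * (1 + real J) powr e * M" and lv: "\<And>J. norm (low J v x) \<le> C * (1 + real J) powr e * N"
    and nn: "e \<ge> 0" "C \<ge> 0" "M \<ge> 0" "N \<ge> 0"
  shows "norm (prod_piece u v j x) \<le> C * (1 + real j) powr e * (N * norm (piece j u x) + M * norm (piece j v x))"
proof (cases j)
  case 0
  have "norm (prod_piece u v j x) = norm (piece j u x) * norm (low 0 v x)"
    unfolding 0 prod_piece_0 piece_0 norm_mult ..
  also have "\<dots> \<le> norm (piece j u x) * (C * (1 + real j) powr e * N)"
    unfolding 0 by (intro mult_left_mono lv) auto
  also have "\<dots> \<le> C * (1 + real j) powr e * (N * norm (piece j u x) + M * norm (piece j v x))"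
    using nn by (simp add: distrib_left mult_ac)
  finally show ?thesis .
next
  case (Suc i)
  have "prod_piece u v j x = piece j u x * low j v x + low i u x * piece j v x"
    unfolding Suc prod_piece_Suc piece_Suc[OF u] piece_Suc[OF v] by (simp add: algebra_simps)
  then have "norm (prod_piece u v j x) \<le> norm (piece j u x) * norm (low j v x) + norm (low i u x) * norm (piece j v x)"
    using norm_triangle_ineq[of "piece j u x * low j v x" "low i u x * piece j v x"] by (simp add: norm_mult)
  also have "\<dots> \<le> norm (piece j u x) * (C * (1 + real j) powr e * N) + (C * (1 + real j) powr e * M) * norm (piece j v x)"
  proof (intro add_mono mult_left_mono mult_right_mono lv)
    have "C * (1 + real i) powr e * M \<le> C * (1 + real j) powr e * M"
      using nn Suc by (intro mult_right_mono mult_left_mono powr_mono2) auto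
    with lu[of i] show "norm (low i u x) \<le> C * (1 + real j) powr e * M" by linarith
  qed auto
  also have "\<dots> = C * (1 + real j) powr e * (N * norm (piece j u x) + M * norm (piece j v x))"
    by (simp add: distrib_left mult_ac)
  finally show ?thesis .
qed

text \<open>Products of truncations converge almost everywhere below the common majorant 2 +
  \<open>?R\<close>. Hence the product of the two limit functions defines a tempered distribution,
  and its pieces are limits of the telescoping sums convolved term by term.\<close>

lemma pointwise_product_exists:
  assumes u: "tempered u" and v: "tempered v" and p: "0 < p" and q: "0 < q"
    and fu: "energy p q u = ennreal (M powr p)" "M \<ge> 0" and fv: "energy p q v = ennreal (N powr p)" "N \<ge> 0"
  obtains h where "is_pointwise_product u v h" "tempered h"
    "\<And>k x. ennreal (norm (piece k h x)) \<le> (\<Sum>j. if k \<le> j + 3 then ennreal (norm (LINT y|lborel. lp_kernel \<phi> k (x - y) * prod_piece u v j y)) else 0)"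
proof -
  note Mu = majorant_facts[OF u p q fu]
  note Mv = majorant_facts[OF v p q fv]
  let ?F = "limit_fun u" and ?G = "limit_fun v"
  note lm[measurable] = limit_fun_measurable[OF u] limit_fun_measurable[OF v] low_measurable[OF u] low_measurable[OF v]
  let ?R = "\<lambda>x. majorant u x powr (2 + p) + majorant v x powr (2 + p)"
  have Ri: "integrable lborel ?R" using Mu(1) Mv(1) by (rule Bochner_Integration.integrable_add)
  have R: "norm (low J u x * low J v x) \<le> 2 + ?R x"
    if "\<forall>J. norm (low J u x) \<le> majorant u x" "\<forall>J. norm (low J v x) \<le> majorant v x" for J x
  proof -
    have "norm (low J u x * low J v x) \<le> majorant u x * majorant v x"
      unfolding norm_mult using that by (intro mult_mono) (auto simp: majorant_def)
    also have "\<dots> \<le> (majorant u x)\<^sup>2 + (majorant v x)\<^sup>2"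
    proof -
      have "2 * (majorant u x * majorant v x) \<le> (majorant u x)\<^sup>2 + (majorant v x)\<^sup>2"
        using sum_squares_bound[of "majorant u x" "majorant v x"] by (simp add: mult.assoc)
      moreover have "0 \<le> majorant u x * majorant v x" by (simp add: majorant_def)
      ultimately show ?thesis by linarith
    qed
    also have "\<dots> \<le> 2 + ?R x"
      using le_one_plus_powr(2)[of "majorant u x" p] le_one_plus_powr(2)[of "majorant v x" p] p by (simp add: majorant_def)
    finally show ?thesis .
  qed
  have bndFG: "AE x in lborel. norm (?F x * ?G x) \<le> 2 + ?R x"
    using Mu(2,3) Mv(2,3)
  proof eventually_elim
    case (elim x)
    have "(\<lambda>J. norm (low J u x * low J v x)) \<longlonglongrightarrow> norm (?F x * ?G x)"
      using elim by (intro tendsto_norm tendsto_mult)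
    then show ?case by (rule LIMSEQ_le_const2) (use R elim in blast)
  qed
  define h :: "'a distribution" where "h \<psi> = (LINT x|lborel. (?F x * ?G x) * \<psi> x)" for \<psi>
  have hf: "is_function h (\<lambda>x. ?F x * ?G x)"
  proof (rule is_functionI[where N="DIM('a) + 1"])
    show "integrable lborel (\<lambda>x. norm (?F x * ?G x) / (1 + norm x) ^ (DIM('a) + 1))"
    proof (rule Bochner_Integration.integrable_bound)
      show "integrable lborel (\<lambda>x. 2 * (1 / (1 + norm x) ^ (DIM('a) + 1)) + ?R x)"
        by (intro Bochner_Integration.integrable_add integrable_mult_right integrable_inverse_power Ri)
      show "(\<lambda>x. norm (?F x * ?G x) / (1 + norm x) ^ (DIM('a) + 1)) \<in> borel_measurable lborel" by measurable
      show "AE x in lborel. norm (norm (?F x * ?G x) / (1 + norm x) ^ (DIM('a) + 1)) \<le> norm (2 * (1 / (1 + norm x) ^ (DIM('a) + 1)) + ?R x)"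
        using bndFG
      proof eventually_elim
        case (elim x)
        have p1: "1 \<le> (1 + norm x) ^ (DIM('a) + 1)" by (rule one_le_power) simp
        have R0: "0 \<le> ?R x" by (intro add_nonneg_nonneg powr_ge_zero)
        have "norm (?F x * ?G x) / (1 + norm x) ^ (DIM('a) + 1) \<le> (2 + ?R x) / (1 + norm x) ^ (DIM('a) + 1)"
          using elim p1 by (intro divide_right_mono) auto
        also have "\<dots> = 2 * (1 / (1 + norm x) ^ (DIM('a) + 1)) + ?R x / (1 + norm x) ^ (DIM('a) + 1)"
          by (simp add: add_divide_distrib)
        also have "?R x / (1 + norm x) ^ (DIM('a) + 1) \<le> ?R x / 1"
          using p1 R0 by (intro divide_left_mono) auto
        finally have "norm (?F x * ?G x) / (1 + norm x) ^ (DIM('a) + 1) \<le> 2 * (1 / (1 + norm x) ^ (DIM('a) + 1)) + ?R x" by simp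
        moreover have "0 \<le> norm (?F x * ?G x) / (1 + norm x) ^ (DIM('a) + 1)" by simp
        ultimately show ?case unfolding real_norm_def by linarith
      qed
    qed
  qed (auto simp: h_def)
  have ht: "tempered h" using hf by (simp add: is_function_def)
  have pp: "is_pointwise_product u v h"
    unfolding is_pointwise_product_def
    using is_function_limit_fun[OF u p q fu] is_function_limit_fun[OF v p q fv] hf by blast
  have "ennreal (norm (piece k h x)) \<le> (\<Sum>j. if k \<le> j + 3 then ennreal (norm (LINT y|lborel. lp_kernel \<phi> k (x - y) * prod_piece u v j y)) else 0)" for k x
  proof -
    define \<psi> where "\<psi> y = lp_kernel \<phi> k (x - y)" for y
    have \<psi>S: "\<psi> \<in> schwartz" unfolding \<psi>_def[abs_def] by (rule schwartz_reflect[OF lp_kernel_schwartz])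
    note \<psi>m[measurable] = schwartz_measurable[OF \<psi>S]
    obtain D where D: "D > 0" "\<And>x. norm (\<psi> x) \<le> D" using rapidE[OF schwartzD(1)[OF \<psi>S], of 0] by auto
    let ?t = "\<lambda>j. LINT y|lborel. \<psi> y * prod_piece u v j y"
    have pk: "piece k h x = (LINT y|lborel. \<psi> y * (?F y * ?G y))"
      by (simp add: piece_def smear_def h_def \<psi>_def mult.commute)
    have "(\<lambda>J. LINT y|lborel. \<psi> y * (low J u y * low J v y)) \<longlonglongrightarrow> (LINT y|lborel. \<psi> y * (?F y * ?G y))"
    proof (rule integral_dominated_convergence)
      show "integrable lborel (\<lambda>y. 2 * norm (\<psi> y) + D * ?R y)"
        by (intro Bochner_Integration.integrable_add integrable_mult_right integrable_norm schwartz_integrable[OF \<psi>S] Ri)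
      show "AE y in lborel. (\<lambda>J. \<psi> y * (low J u y * low J v y)) \<longlonglongrightarrow> \<psi> y * (?F y * ?G y)"
        using Mu(2) Mv(2) by eventually_elim (intro tendsto_mult tendsto_const)
      show "AE y in lborel. norm (\<psi> y * (low J u y * low J v y)) \<le> 2 * norm (\<psi> y) + D * ?R y" for J
        using Mu(3) Mv(3)
      proof eventually_elim
        case (elim y)
        have R0: "0 \<le> ?R y" by (intro add_nonneg_nonneg powr_ge_zero)
        have "norm (\<psi> y * (low J u y * low J v y)) \<le> norm (\<psi> y) * (2 + ?R y)"
          unfolding norm_mult[of "\<psi> y"] using R[OF elim, of J] by (intro mult_left_mono) auto
        also have "\<dots> \<le> 2 * norm (\<psi> y) + D * ?R y"
          using mult_right_mono[OF D(2)[of y] R0] by (simp only: distrib_left mult.commute[of _ 2])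
        finally show ?case .
      qed
    qed measurable
    moreover have "(LINT y|lborel. \<psi> y * (low J u y * low J v y)) = (\<Sum>j\<le>J. ?t j)" for J
    proof -
      have "(LINT y|lborel. \<psi> y * (low J u y * low J v y)) = (LINT y|lborel. (\<Sum>j\<le>J. \<psi> y * prod_piece u v j y))"
        by (simp only: sum_prod_piece[symmetric] sum_distrib_left)
      also have "\<dots> = (\<Sum>j\<le>J. ?t j)"
        unfolding \<psi>_def by (intro Bochner_Integration.integral_sum convolve_low_product(2) u v lp_kernel_schwartz)
      finally show ?thesis .
    qed
    ultimately have "(\<lambda>J. \<Sum>j\<le>J. ?t j) \<longlonglongrightarrow> piece k h x" unfolding pk by simp
    then have lim: "(\<lambda>J. ennreal (norm (\<Sum>j\<le>J. ?t j))) \<longlonglongrightarrow> ennreal (norm (piece k h x))"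
      by (intro tendsto_ennrealI tendsto_norm)
    have "ennreal (norm (\<Sum>j\<le>J. ?t j)) \<le> (\<Sum>j. if k \<le> j + 3 then ennreal (norm (?t j)) else 0)" for J
    proof -
      have "norm (\<Sum>j\<le>J. ?t j) \<le> (\<Sum>j\<le>J. norm (?t j))" by (rule norm_sum)
      then have "ennreal (norm (\<Sum>j\<le>J. ?t j)) \<le> (\<Sum>j\<le>J. ennreal (norm (?t j)))"
        by (subst sum_ennreal) (auto intro: ennreal_leI)
      \<comment> \<open>The terms dropped have j + 3 < k, and there the convolution
        vanishes.\<close>
      also have "\<dots> = (\<Sum>j\<le>J. if k \<le> j + 3 then ennreal (norm (?t j)) else 0)"
        using prod_piece_vanish[OF u v, of _ k x] by (intro sum.cong) (auto simp: \<psi>_def)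
      also have "\<dots> \<le> (\<Sum>j. if k \<le> j + 3 then ennreal (norm (?t j)) else 0)"
        by (intro sum_le_suminf) auto
      finally show ?thesis .
    qed
    then show ?thesis using LIMSEQ_le_const2[OF lim] unfolding \<psi>_def by blast
  qed
  with pp ht show thesis by (rule that)
qed

subsection \<open>The product estimate\<close>

text \<open>\<open>h\<close> enters only through the bound on its pieces. Dividing by the weight at
  index j cancels the growth of the truncations in the product pieces, so that after the
  vector-valued inequality only the energies of \<open>u\<close> and \<open>v\<close>
  remain.\<close>

lemma product_estimate:
  assumes p: "0 < p" and \<eta>: "p / (p + 1) < \<eta>" "\<eta> \<le> 1" "\<eta> < p" "ennreal \<eta> < q"
    and e: "e = 1 - 1 / max 1 p"
  obtains C where "C > 0"
    "\<And>u v h M N. tempered u \<Longrightarrow> tempered v \<Longrightarrow> energy p q u = ennreal (M powr p) \<Longrightarrow> M \<ge> 0 \<Longrightarrow>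
       energy p q v = ennreal (N powr p) \<Longrightarrow> N \<ge> 0 \<Longrightarrow>
       (\<And>k x. ennreal (norm (piece k h x)) \<le>
          (\<Sum>j. if k \<le> j + 3 then ennreal (norm (LINT y|lborel. lp_kernel \<phi> k (x - y) * prod_piece u v j y)) else 0)) \<Longrightarrow>
       (\<integral>\<^sup>+x. epowr (lq_norm q (\<lambda>k. ennreal (2 powr (real k * (real DIM('a) / p)) / dyadic_weight e k * norm (piece k h x)))) p \<partial>lborel)
         \<le> ennreal (C * (M * N) powr p)"
proof -
  let ?n = "real DIM('a)"
  let ?W = "dyadic_weight e"
  define s where "s = ?n / p"
  have e01: "0 \<le> e" "e \<le> 1" unfolding e by (auto simp: divide_simps)
  note W1 = dyadic_weight_ge_1[OF e01(1)]
  have W0: "0 < ?W j" for j using W1[of j] by linarith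
  have "0 < p / (p + 1)" using p by simp
  then have \<eta>0: "0 < \<eta>" using \<eta>(1) by linarith
  have q: "0 < q" using \<eta>(4) by (meson le_less_trans zero_le)
  define P where "P = p / \<eta>"
  have P: "P > 1" "\<eta> * P = p" using \<eta>(3) \<eta>0 by (auto simp: P_def)
  let ?Q = "q_div q \<eta>"
  \<comment> \<open>A Peetre exponent \<open>a > n / \<eta>\<close> with \<open>a - n < n / p\<close> exists exactly because \<open>\<eta> > p / (p + 1)\<close>.\<close>
  have "1 / \<eta> < (p + 1) / p" using \<eta>(1) \<eta>0 p by (simp add: field_simps)
  then have "?n * (1 / \<eta>) < ?n * ((p + 1) / p)" by (intro mult_strict_left_mono) auto
  then have "?n / \<eta> < ?n + s" using p by (simp add: s_def field_simps)
  then obtain a where a: "?n / \<eta> < a" "a < ?n + s" using dense by blast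
  have "0 < ?n / \<eta>" using \<eta>0 by simp
  then have a0: "0 < a" using a(1) by linarith
  define b where "b = a * \<eta> - ?n"
  have b: "0 < b" using a(1) \<eta>0 by (simp add: b_def field_simps)
  \<comment> \<open>What smoothness leaves after paying the convolution loss a - n. Half of it,
    through \<open>\<theta>\<close>, drives the sum over j; the other half, through
    \<open>t\<close>, absorbs the linear factor from the logarithmic weights.\<close>
  define \<delta> where "\<delta> = s - (a - ?n)"
  have \<delta>: "0 < \<delta>" using a(2) by (simp add: \<delta>_def)
  define \<theta> :: real where "\<theta> = 2 powr (- (\<delta> / 2))"
  have \<theta>: "0 < \<theta>" "\<theta> < 1" using \<delta> by (auto simp: \<theta>_def powr_less_one)
  define t :: real where "t = 2 powr (\<delta> / 2)"
  have t: "1 < t" using \<delta> by (simp add: t_def)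
  define C3 where "C3 = 1 + 1 / (t - 1)"
  have C3: "0 < C3" using t by (simp add: C3_def add_pos_nonneg)
  obtain B where B: "B > 0" "\<And>j k h x. band j h \<Longrightarrow> k \<le> j + 3 \<Longrightarrow>
     ennreal (norm (LINT y|lborel. lp_kernel \<phi> k (x - y) * h y))
       \<le> ennreal (B * 2 powr ((real j - real k) * (a - ?n))) *
          epowr (avg b j (\<lambda>y. ennreal (norm (h y) powr \<eta>)) x) (1 / \<eta>)"
    using band_convolve[OF a0 \<eta>0 \<eta>(2)] unfolding b_def by blast
  obtain D where D: "D > 0" "\<And>Y. lq_norm q (\<lambda>k. \<Sum>j. if k \<le> j + 3 then ennreal (\<theta> ^ (j + 3 - k)) * Y j else 0) \<le> ennreal D * lq_norm q Y"
    using lq_norm_upper_triangular[OF q \<theta>] by blast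
  obtain A where A: "A > 0" "\<And>F :: nat \<Rightarrow> 'a \<Rightarrow> ennreal. (\<And>j. F j \<in> borel_measurable borel) \<Longrightarrow>
     (\<integral>\<^sup>+x. epowr (lq_norm ?Q (\<lambda>j. avg b j (F j) x)) P \<partial>lborel) \<le> ennreal A * (\<integral>\<^sup>+x. epowr (lq_norm ?Q (\<lambda>j. F j x)) P \<partial>lborel)"
    using avg_vector_valued[OF b P(1) q_div_greater_1[OF \<eta>0 \<eta>(4)], where 'a='a] by blast
  obtain K where K: "K > 0" "\<And>c d. lq_norm q (\<lambda>j. c j + d j) \<le> ennreal K * (lq_norm q c + lq_norm q d)"
    using lq_norm_add_le[OF q] by blast
  obtain L where L: "L > 0"
    "\<And>u x J N. tempered u \<Longrightarrow> N \<ge> 0 \<Longrightarrow> energy p q u = ennreal (N powr p) \<Longrightarrow> norm (low J u x) \<le> L * (1 + real J) powr e * N"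
    using critical_bounds[OF p q] unfolding e by metis
  \<comment> \<open>The factor 2^(3\<delta>) accounts for counting the decay from j + 3 - k, which
    is a natural number, instead of j - k.\<close>
  define E where "E = B * 2 powr (3 * \<delta>) * C3"
  have E: "0 < E" using B C3 by (simp add: E_def)
  define C where "C = (E * D) powr p * (A * ((2 * K) powr p * (2 * (2 * L) powr p)))"
  have C: "0 < C" using A E D K L by (simp add: C_def)
  have factor: "2 powr (real k * s) / ?W k * (B * 2 powr ((real j - real k) * (a - ?n)))
      \<le> E * \<theta> ^ (j + 3 - k) * (2 powr (real j * s) / ?W j)" if jk: "k \<le> j + 3" for j k
  proof -
    define i where "i = j + 3 - k"
    have i: "real i = real j + 3 - real k" "j \<le> i + k" using jk by (auto simp: i_def)
    have "1 / ?W k \<le> (1 + real i) / ?W j"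
      using dyadic_weight_shift[OF e01 i(2)] W0[of j] W0[of k] by (simp add: field_simps)
    also have "\<dots> \<le> C3 * t ^ i / ?W j"
      unfolding C3_def using W0[of j] by (intro divide_right_mono linear_le_geometric t) simp
    finally have 1: "1 / ?W k \<le> C3 * t ^ i / ?W j" .
    have 2: "2 powr (real k * s) * 2 powr ((real j - real k) * (a - ?n)) = 2 powr (real j * s) * (2 powr (3 * \<delta>) * (2::real) powr (- (real i * \<delta>)))"
      unfolding powr_add[symmetric] i(1) \<delta>_def by (simp add: algebra_simps)
    have "t ^ i * 2 powr (- (real i * \<delta>)) = 2 powr (real i * (\<delta> / 2) + - (real i * \<delta>))"
      unfolding powr_add by (simp add: t_def powr_power mult_ac)
    also have "real i * (\<delta> / 2) + - (real i * \<delta>) = - (real i * \<delta> / 2)" by simp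
    also have "(2::real) powr (- (real i * \<delta> / 2)) = \<theta> ^ i" by (simp add: \<theta>_def powr_power mult_ac)
    finally have 3: "t ^ i * 2 powr (- (real i * \<delta>)) = \<theta> ^ i" .
    have "2 powr (real k * s) / ?W k * (B * 2 powr ((real j - real k) * (a - ?n)))
       = B * (2 powr (real k * s) * 2 powr ((real j - real k) * (a - ?n))) * (1 / ?W k)" by simp
    also have "\<dots> \<le> B * (2 powr (real k * s) * 2 powr ((real j - real k) * (a - ?n))) * (C3 * t ^ i / ?W j)"
      using B(1) by (intro mult_left_mono 1) simp
    also have "\<dots> = B * (2 powr (real j * s) * (2 powr (3 * \<delta>) * 2 powr (- (real i * \<delta>)))) * (C3 * t ^ i / ?W j)"
      by (simp only: 2)
    also have "\<dots> = E * (t ^ i * 2 powr (- (real i * \<delta>))) * (2 powr (real j * s) / ?W j)"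
      by (simp add: E_def)
    finally show ?thesis unfolding 3 unfolding i_def .
  qed
  have main: "(\<integral>\<^sup>+x. epowr (lq_norm q (\<lambda>k. ennreal (2 powr (real k * s) / ?W k * norm (piece k h x)))) p \<partial>lborel)
         \<le> ennreal (C * (M * N) powr p)"
    if u: "tempered u" and v: "tempered v" and fu: "energy p q u = ennreal (M powr p)" "M \<ge> 0"
      and fv: "energy p q v = ennreal (N powr p)" "N \<ge> 0"
      and h: "\<And>k x. ennreal (norm (piece k h x)) \<le>
          (\<Sum>j. if k \<le> j + 3 then ennreal (norm (LINT y|lborel. lp_kernel \<phi> k (x - y) * prod_piece u v j y)) else 0)"
    for u v h M N
  proof -
    note [measurable] = prod_piece_measurable[OF u v] coef_measurable[OF u] coef_measurable[OF v]
    define c where "c j = 2 powr (real j * s) / ?W j" for j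
    have c: "0 \<le> c j" for j using W0[of j] by (simp add: c_def)
    define H where "H j x = ennreal (c j * norm (prod_piece u v j x))" for j x
    have Hm[measurable]: "H j \<in> borel_measurable borel" for j unfolding H_def[abs_def] by measurable
    have H_le: "H j x \<le> ennreal (2 * L * N) * coef s u j x + ennreal (2 * L * M) * coef s v j x" for j x
    proof -
      let ?U = "norm (piece j u x)" and ?V = "norm (piece j v x)"
      have "norm (prod_piece u v j x) \<le> L * (1 + real j) powr e * (N * ?U + M * ?V)"
        by (rule prod_piece_bound[OF u v]) (use L u v fu fv e01 in auto)
      also have "\<dots> \<le> L * (2 * ?W j) * (N * ?U + M * ?V)"
        using L fu fv by (intro mult_right_mono mult_left_mono dyadic_weight_lower e01) auto
      finally have "c j * norm (prod_piece u v j x) \<le> c j * (L * (2 * ?W j) * (N * ?U + M * ?V))"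
        by (rule mult_left_mono) (rule c)
      also have "\<dots> = 2 * L * N * (2 powr (real j * s) * ?U) + 2 * L * M * (2 powr (real j * s) * ?V)"
        using W0[of j] by (simp add: c_def field_simps)
      finally have "H j x \<le> ennreal (2 * L * N * (2 powr (real j * s) * ?U) + 2 * L * M * (2 powr (real j * s) * ?V))"
        unfolding H_def by (rule ennreal_leI)
      also have "\<dots> = ennreal (2 * L * N) * coef s u j x + ennreal (2 * L * M) * coef s v j x"
        using L fu fv by (simp add: coef_def ennreal_mult)
      finally show ?thesis .
    qed
    \<comment> \<open>Written as an \<eta>-th root so that its l^q norm becomes an l^(q/\<eta>) norm
      of averages, to which the vector-valued inequality applies.\<close>
    define Y where "Y j x = epowr (avg b j (\<lambda>y. epowr (H j y) \<eta>) x) (1 / \<eta>)" for j x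
    have Y: "Y j x = ennreal (c j) * epowr (avg b j (\<lambda>y. ennreal (norm (prod_piece u v j y) powr \<eta>)) x) (1 / \<eta>)" for j x
    proof -
      have 1: "epowr (H j y) \<eta> = ennreal (c j powr \<eta>) * ennreal (norm (prod_piece u v j y) powr \<eta>)" for y
        unfolding H_def using c[of j] by (subst epowr_ennreal) (auto simp: powr_mult ennreal_mult)
      show ?thesis
        unfolding Y_def 1 using \<eta>0 c[of j] by (subst avg_cmult) (auto simp: epowr_cmult powr_powr)
    qed
    have d_le: "ennreal (c k * norm (piece k h x)) \<le> ennreal E * (\<Sum>j. if k \<le> j + 3 then ennreal (\<theta> ^ (j + 3 - k)) * Y j x else 0)" for k x
    proof -
      let ?I = "\<lambda>j. norm (LINT y|lborel. lp_kernel \<phi> k (x - y) * prod_piece u v j y)"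
      have "ennreal (c k * norm (piece k h x)) = ennreal (c k) * ennreal (norm (piece k h x))"
        using c[of k] by (intro ennreal_mult) auto
      also have "\<dots> \<le> ennreal (c k) * (\<Sum>j. if k \<le> j + 3 then ennreal (?I j) else 0)"
        by (intro mult_left_mono h) simp
      also have "\<dots> = (\<Sum>j. ennreal (c k) * (if k \<le> j + 3 then ennreal (?I j) else 0))"
        by (rule ennreal_suminf_cmult[symmetric])
      also have "\<dots> \<le> (\<Sum>j. ennreal E * (if k \<le> j + 3 then ennreal (\<theta> ^ (j + 3 - k)) * Y j x else 0))"
      proof (intro suminf_le summableI)
        fix j
        show "ennreal (c k) * (if k \<le> j + 3 then ennreal (?I j) else 0) \<le> ennreal E * (if k \<le> j + 3 then ennreal (\<theta> ^ (j + 3 - k)) * Y j x else 0)"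
        proof (cases "k \<le> j + 3")
          case True
          let ?A = "epowr (avg b j (\<lambda>y. ennreal (norm (prod_piece u v j y) powr \<eta>)) x) (1 / \<eta>)"
          have "ennreal (c k) * ennreal (?I j) \<le> ennreal (c k) * (ennreal (B * 2 powr ((real j - real k) * (a - ?n))) * ?A)"
            by (intro mult_left_mono B(2) True prod_piece_band u v) simp
          also have "\<dots> = ennreal (c k * (B * 2 powr ((real j - real k) * (a - ?n)))) * ?A"
            using c[of k] B(1) by (simp add: ennreal_mult mult.assoc)
          also have "\<dots> \<le> ennreal (E * \<theta> ^ (j + 3 - k) * c j) * ?A"
            using factor[OF True] by (intro mult_right_mono ennreal_leI) (auto simp: c_def)
          also have "\<dots> = ennreal E * (ennreal (\<theta> ^ (j + 3 - k)) * Y j x)"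
            unfolding Y using c[of j] E \<theta> by (simp add: ennreal_mult mult.assoc)
          finally show ?thesis using True by simp
        qed simp
      qed
      also have "\<dots> = ennreal E * (\<Sum>j. if k \<le> j + 3 then ennreal (\<theta> ^ (j + 3 - k)) * Y j x else 0)"
        by (rule ennreal_suminf_cmult)
      finally show ?thesis .
    qed
    have Y_lq: "epowr (lq_norm q (\<lambda>j. Y j x)) p = epowr (lq_norm ?Q (\<lambda>j. avg b j (\<lambda>y. epowr (H j y) \<eta>) x)) P" for x
    proof -
      have "epowr (Y j x) \<eta> = avg b j (\<lambda>y. epowr (H j y) \<eta>) x" for j
        using \<eta>0 by (simp add: Y_def epowr_epowr)
      then have "lq_norm ?Q (\<lambda>j. avg b j (\<lambda>y. epowr (H j y) \<eta>) x) = epowr (lq_norm q (\<lambda>j. Y j x)) \<eta>"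
        using lq_norm_epowr[OF \<eta>0 q, of "\<lambda>j. Y j x"] by simp
      then show ?thesis by (simp only: epowr_epowr P(2))
    qed
    have H_lq: "epowr (lq_norm ?Q (\<lambda>j. epowr (H j x) \<eta>)) P = epowr (lq_norm q (\<lambda>j. H j x)) p" for x
      by (simp only: lq_norm_epowr[OF \<eta>0 q] epowr_epowr P(2))
    let ?U = "\<lambda>x. lq_norm q (\<lambda>j. coef s u j x)" and ?V = "\<lambda>x. lq_norm q (\<lambda>j. coef s v j x)"
    have H_int: "epowr (lq_norm q (\<lambda>j. H j x)) p \<le>
        ennreal ((2 * K) powr p) * (ennreal ((2 * L * N) powr p) * epowr (?U x) p + ennreal ((2 * L * M) powr p) * epowr (?V x) p)" for x
    proof -
      have "lq_norm q (\<lambda>j. H j x) \<le> lq_norm q (\<lambda>j. ennreal (2 * L * N) * coef s u j x + ennreal (2 * L * M) * coef s v j x)"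
        by (rule lq_norm_mono) (rule H_le)
      also have "\<dots> \<le> ennreal K * (ennreal (2 * L * N) * ?U x + ennreal (2 * L * M) * ?V x)"
        using K(2)[of "\<lambda>j. ennreal (2 * L * N) * coef s u j x" "\<lambda>j. ennreal (2 * L * M) * coef s v j x"]
        by (simp only: lq_norm_cmult[OF q])
      finally have "epowr (lq_norm q (\<lambda>j. H j x)) p \<le> epowr (ennreal K * (ennreal (2 * L * N) * ?U x + ennreal (2 * L * M) * ?V x)) p"
        using p by (intro epowr_mono) auto
      also have "\<dots> = ennreal (K powr p) * epowr (ennreal (2 * L * N) * ?U x + ennreal (2 * L * M) * ?V x) p"
        using K p by (intro epowr_cmult) auto
      also have "\<dots> \<le> ennreal (K powr p) * (ennreal (2 powr p) * (epowr (ennreal (2 * L * N) * ?U x) p + epowr (ennreal (2 * L * M) * ?V x) p))"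
        by (intro mult_left_mono epowr_add_le p) simp
      also have "epowr (ennreal (2 * L * N) * ?U x) p = ennreal ((2 * L * N) powr p) * epowr (?U x) p"
        using L fv p by (intro epowr_cmult) auto
      also have "epowr (ennreal (2 * L * M) * ?V x) p = ennreal ((2 * L * M) powr p) * epowr (?V x) p"
        using L fu p by (intro epowr_cmult) auto
      also have "ennreal (K powr p) * (ennreal (2 powr p) * (ennreal ((2 * L * N) powr p) * epowr (?U x) p + ennreal ((2 * L * M) powr p) * epowr (?V x) p))
         = ennreal ((2 * K) powr p) * (ennreal ((2 * L * N) powr p) * epowr (?U x) p + ennreal ((2 * L * M) powr p) * epowr (?V x) p)"
        unfolding mult.assoc[symmetric, of "ennreal (K powr p)"] using K by (simp add: ennreal_mult[symmetric] powr_mult mult.commute)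
      finally show ?thesis .
    qed
    have Um: "(\<lambda>x. epowr (?U x) p) \<in> borel_measurable borel" "(\<lambda>x. epowr (?V x) p) \<in> borel_measurable borel" by measurable
    have "(\<integral>\<^sup>+x. epowr (lq_norm q (\<lambda>k. ennreal (c k * norm (piece k h x)))) p \<partial>lborel)
        \<le> (\<integral>\<^sup>+x. ennreal ((E * D) powr p) * epowr (lq_norm ?Q (\<lambda>j. avg b j (\<lambda>y. epowr (H j y) \<eta>) x)) P \<partial>lborel)"
    proof (rule nn_integral_mono)
      fix x
      have "lq_norm q (\<lambda>k. ennreal (c k * norm (piece k h x)))
          \<le> lq_norm q (\<lambda>k. ennreal E * (\<Sum>j. if k \<le> j + 3 then ennreal (\<theta> ^ (j + 3 - k)) * Y j x else 0))"
        by (rule lq_norm_mono) (rule d_le)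
      also have "\<dots> \<le> ennreal E * (ennreal D * lq_norm q (\<lambda>j. Y j x))"
        unfolding lq_norm_cmult[OF q] by (intro mult_left_mono D(2)) simp
      also have "\<dots> = ennreal (E * D) * lq_norm q (\<lambda>j. Y j x)" using E D by (simp add: ennreal_mult mult.assoc)
      finally have "epowr (lq_norm q (\<lambda>k. ennreal (c k * norm (piece k h x)))) p \<le> epowr (ennreal (E * D) * lq_norm q (\<lambda>j. Y j x)) p"
        using p by (intro epowr_mono) auto
      also have "\<dots> = ennreal ((E * D) powr p) * epowr (lq_norm q (\<lambda>j. Y j x)) p"
        using E D p by (intro epowr_cmult) auto
      finally show "epowr (lq_norm q (\<lambda>k. ennreal (c k * norm (piece k h x)))) p
          \<le> ennreal ((E * D) powr p) * epowr (lq_norm ?Q (\<lambda>j. avg b j (\<lambda>y. epowr (H j y) \<eta>) x)) P"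
        unfolding Y_lq .
    qed
    also have "\<dots> = ennreal ((E * D) powr p) * (\<integral>\<^sup>+x. epowr (lq_norm ?Q (\<lambda>j. avg b j (\<lambda>y. epowr (H j y) \<eta>) x)) P \<partial>lborel)"
      by (rule nn_integral_cmult) measurable
    also have "\<dots> \<le> ennreal ((E * D) powr p) * (ennreal A * (\<integral>\<^sup>+x. epowr (lq_norm ?Q (\<lambda>j. epowr (H j x) \<eta>)) P \<partial>lborel))"
      by (intro mult_left_mono A(2)) auto
    also have "(\<integral>\<^sup>+x. epowr (lq_norm ?Q (\<lambda>j. epowr (H j x) \<eta>)) P \<partial>lborel)
        \<le> (\<integral>\<^sup>+x. ennreal ((2 * K) powr p) * (ennreal ((2 * L * N) powr p) * epowr (?U x) p + ennreal ((2 * L * M) powr p) * epowr (?V x) p) \<partial>lborel)"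
      unfolding H_lq by (rule nn_integral_mono) (rule H_int)
    also have "\<dots> = ennreal ((2 * K) powr p) * (ennreal ((2 * L * N) powr p) * energy p q u + ennreal ((2 * L * M) powr p) * energy p q v)"
      using Um by (simp add: nn_integral_cmult nn_integral_add energy_def s_def)
    \<comment> \<open>Both terms scale in the same way: N^p times the energy of \<open>u\<close> and
      M^p times that of \<open>v\<close> equal (M N)^p.\<close>
    also have "\<dots> = ennreal ((2 * K) powr p * (2 * (2 * L) powr p) * (M * N) powr p)"
    proof -
      have "(2 * L * N) powr p * M powr p = (2 * L) powr p * (M * N) powr p"
        "(2 * L * M) powr p * N powr p = (2 * L) powr p * (M * N) powr p"
        using L fu fv by (simp_all add: powr_mult)
      then show ?thesis unfolding fu(1) fv(1)
        by (simp add: ennreal_mult[symmetric] ennreal_plus[symmetric] mult_ac del: ennreal_plus)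
    qed
    also have "ennreal ((E * D) powr p) * (ennreal A * ennreal ((2 * K) powr p * (2 * (2 * L) powr p) * (M * N) powr p)) = ennreal (C * (M * N) powr p)"
      unfolding C_def using A by (simp add: ennreal_mult[symmetric] mult_ac)
    finally show ?thesis unfolding c_def by (simp add: mult_left_mono)
  qed
  show thesis by (rule that[OF C main[unfolded s_def]])
qed

end

section \<open>From energies back to the norms of the statement\<close>

lemma energy_F_space:
  fixes \<phi> :: "'a::euclidean_space \<Rightarrow> real"
  assumes \<phi>: "lp_generator \<phi>" and p: "0 < p" and u: "u \<in> F_space \<phi> (DIM('a) / p) (\<lambda>t. 1) p q"
  shows "energy \<phi> p q u = ennreal (enn2real (F_norm \<phi> (DIM('a) / p) (\<lambda>t. 1) p q u) powr p)"
proof -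
  let ?F = "F_norm \<phi> (DIM('a) / p) (\<lambda>t. 1) p q u"
  have t: "tempered u" and fin: "?F < \<infinity>" using u by (auto simp: F_space_def)
  have "energy \<phi> p q u = epowr ?F p"
    unfolding F_norm_energy[OF \<phi> t] epowr_epowr using p by simp
  with fin show ?thesis by (simp add: epowr_def)
qed

theorem corollary4p4:
  fixes \<phi> :: "'a::euclidean_space \<Rightarrow> real"
    and p r :: real and q :: ennreal and w :: "real \<Rightarrow> real"
  assumes "lp_generator \<phi>"
    and "0 < p" and "0 < q"
    and "min 1 (min (ennreal p) q) > ennreal (p / (p + 1))"
    and "r = max 1 p"
    and "w = (\<lambda>t. (1 + log_plus (1 / t)) powr (1 - 1 / r))"
  shows "\<exists>C>0. \<forall>f \<in> F_space \<phi> (DIM('a) / p) (\<lambda>t. 1) p q. \<forall>g \<in> F_space \<phi> (DIM('a) / p) (\<lambda>t. 1) p q.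
           \<exists>fg. is_pointwise_product f g fg \<and>
             F_norm \<phi> (DIM('a) / p) (\<lambda>t. 1 / w t) p q fg
               \<le> ennreal C * F_norm \<phi> (DIM('a) / p) (\<lambda>t. 1) p q f * F_norm \<phi> (DIM('a) / p) (\<lambda>t. 1) p q g"
proof -
  note \<phi> = assms(1) and p = assms(2) and q = assms(3)
  let ?s = "real DIM('a) / p"
  let ?N = "F_norm \<phi> ?s (\<lambda>t. 1) p q"
  \<comment> \<open>The strict inequality leaves a gap; any number in it, made real, serves as
    \<eta>, below 1, p and q and above p/(p+1).\<close>
  obtain y where y: "ennreal (p / (p + 1)) < y" "y < min 1 (min (ennreal p) q)" using dense[OF assms(4)] by blast
  define \<eta> where "\<eta> = enn2real y"
  have "y < 1" using y(2) by simp
  then have "y < \<top>" using ennreal_one_less_top by (rule less_trans)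
  then have \<eta>y: "y = ennreal \<eta>" "0 \<le> \<eta>" by (auto simp: \<eta>_def)
  have \<eta>: "p / (p + 1) < \<eta>" "\<eta> \<le> 1" "\<eta> < p" "ennreal \<eta> < q"
    using y p \<eta>y(2) unfolding \<eta>y(1) by (auto simp: ennreal_less_iff ennreal_less_one_iff)
  define e where "e = 1 - 1 / max 1 p"
  obtain C where C: "C > 0"
    "\<And>u v h M N. tempered u \<Longrightarrow> tempered v \<Longrightarrow> energy \<phi> p q u = ennreal (M powr p) \<Longrightarrow> M \<ge> 0 \<Longrightarrow>
       energy \<phi> p q v = ennreal (N powr p) \<Longrightarrow> N \<ge> 0 \<Longrightarrow>
       (\<And>k x. ennreal (norm (piece \<phi> k h x)) \<le>
          (\<Sum>j. if k \<le> j + 3 then ennreal (norm (LINT y|lborel. lp_kernel \<phi> k (x - y) * prod_piece \<phi> u v j y)) else 0)) \<Longrightarrow>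
       (\<integral>\<^sup>+x. epowr (lq_norm q (\<lambda>k. ennreal (2 powr (real k * ?s) / dyadic_weight e k * norm (piece \<phi> k h x)))) p \<partial>lborel)
         \<le> ennreal (C * (M * N) powr p)"
    using product_estimate[OF \<phi> p \<eta> e_def] by blast
  have "\<exists>h. is_pointwise_product u v h \<and> F_norm \<phi> ?s (\<lambda>t. 1 / w t) p q h \<le> ennreal (C powr (1 / p)) * ?N u * ?N v"
    if uS: "u \<in> F_space \<phi> ?s (\<lambda>t. 1) p q" and vS: "v \<in> F_space \<phi> ?s (\<lambda>t. 1) p q" for u v
  proof -
    have u: "tempered u" "?N u < \<infinity>" and v: "tempered v" "?N v < \<infinity>" using uS vS by (auto simp: F_space_def)
    define M where "M = enn2real (?N u)"
    define N where "N = enn2real (?N v)"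
    have MN: "0 \<le> M" "0 \<le> N" "?N u = ennreal M" "?N v = ennreal N" using u v by (auto simp: M_def N_def)
    have Eu: "energy \<phi> p q u = ennreal (M powr p)" and Ev: "energy \<phi> p q v = ennreal (N powr p)"
      unfolding M_def N_def by (rule energy_F_space[OF \<phi> p uS], rule energy_F_space[OF \<phi> p vS])
    obtain h where h: "is_pointwise_product u v h" "tempered h"
      "\<And>k x. ennreal (norm (piece \<phi> k h x)) \<le> (\<Sum>j. if k \<le> j + 3 then ennreal (norm (LINT y|lborel. lp_kernel \<phi> k (x - y) * prod_piece \<phi> u v j y)) else 0)"
      using pointwise_product_exists[OF \<phi> u(1) v(1) p q Eu MN(1) Ev MN(2)] by blast
    have "F_norm \<phi> ?s (\<lambda>t. 1 / w t) p q h
        = epowr (\<integral>\<^sup>+x. epowr (lq_norm q (\<lambda>k. ennreal (2 powr (real k * ?s) / dyadic_weight e k * norm (piece \<phi> k h x)))) p \<partial>lborel) (1 / p)"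
      unfolding F_norm_def Lp_norm_def multiplier_fun_piece[OF \<phi> h(2)] assms(5,6) log_plus_dyadic e_def by simp
    also have "\<dots> \<le> epowr (ennreal (C * (M * N) powr p)) (1 / p)"
      using p by (intro epowr_mono C(2)[OF u(1) v(1) Eu MN(1) Ev MN(2) h(3)]) auto
    also have "\<dots> = ennreal ((C * (M * N) powr p) powr (1 / p))" using C(1) by (intro epowr_ennreal) simp
    also have "(C * (M * N) powr p) powr (1 / p) = C powr (1 / p) * M * N"
      using C(1) p MN(1,2) by (simp add: powr_mult powr_powr)
    also have "ennreal \<dots> = ennreal (C powr (1 / p)) * ?N u * ?N v"
      unfolding MN(3,4) using MN(1,2) by (simp add: ennreal_mult)
    finally show ?thesis using h(1) by blast
  qed
  moreover have "0 < C powr (1 / p)" using C(1) by simp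
  ultimately show ?thesis by blast
qed

end
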